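(* Let $X_1,\dots,X_m$ be linearly independent smooth vector fields on $\mathbb{R}^N$ ($N\ge3$) satisfying assumptions (I) and (II) stated in the context, and let $\mathcal{L}=\sum_{j=1}^mX_j^2$. Then: (1) An open set $\Omega\subseteq\mathbb{R}^N$ is a maximum principle set for $\mathcal{L}$ if and only if its complement $\mathbb{R}^N\setminus\Omega$ is $\mathcal{L}$-large at infinity. (2) If $\Omega\subseteq\mathbb{R}^N$ is an open set such that $\mathbb{R}^N\setminus\Omega$ is $p_{\mathcal{L}}$-unbounded for some $p>1$, then $\Omega$ is a maximum principle set for $\mathcal{L}$. (3) If $\Omega\subseteq\mathbb{R}^N$ is an open set such that $\mathbb{R}^N\setminus\Omega$ contains a $\Gamma$-cone, then $\Omega$ is a maximum principle set for $\mathcal{L}$.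
   Context: Vector fields ("linearly independent" means in the real vector space of smooth vector fields on $\mathbb{R}^N$): (I) each $X_j$ is $\delta_\lambda$-homogeneous of degree $1$, i.e. $X_j(\varphi\circ\delta_\lambda)=\lambda\,(X_j\varphi)\circ\delta_\lambda$ for all $\varphi\in C^\infty(\mathbb{R}^N)$ and $\lambda>0$, where $\delta_\lambda(x)=(\lambda^{\sigma_1}x_1,\dots,\lambda^{\sigma_N}x_N)$ and $1=\sigma_1\le\dots\le\sigma_N$ are positive integers; (II) (Hörmander rank condition) $\dim\{X(x):X\in\mathrm{Lie}\{X_1,\dots,X_m\}\}=N$ for every $x\in\mathbb{R}^N$. Fundamental solution: $\Gamma$ denotes the global fundamental solution of $\mathcal{L}$, i.e. the (known to exist) function $\Gamma:\{(x,y)\in\mathbb{R}^N\times\mathbb{R}^N:x\neq y\}\to(0,\infty)$ which is $C^\infty$, symmetric, has $\Gamma(x;\cdot)\in L^1_{\mathrm{loc}}(\mathbb{R}^N)$, satisfies $\int_{\mathbb{R}^N}\Gamma(x;y)\mathcal{L}\varphi(y)\,dy=-\varphi(x)$ for all $\varphi\in C_0^\infty(\mathbb{R}^N)$ and $x\in\mathbb{R}^N$, $\lim_{y\to x}\Gamma(x;y)=\infty$, $\lim_{\|y\|\to\infty}\Gamma(x;y)=0$, and $\Gamma(\delta_\lambda(x);\delta_\lambda(y))=\lambda^{2-Q}\Gamma(x;y)$ with $Q=\sum_{j=1}^N\sigma_j$. Set $\gamma(x,y)=1/\Gamma(x;y)$ for $x\ne y$, $\gamma(x,x)=0$, and $\Omega(x,r)=\{y:\gamma(x,y)<r\}$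 ($\Gamma$-ball), $r>0$. Potential theory: a function is $\mathcal{L}$-harmonic in an open set if it is a smooth solution of $\mathcal{L}u=0$ there. For $\Omega\subseteq\mathbb{R}^N$ open, an upper semicontinuous function $u:\Omega\to[-\infty,\infty)$ is $\mathcal{L}$-subharmonic in $\Omega$ if (i) $\{x\in\Omega:u(x)>-\infty\}$ is dense in $\Omega$; (ii) for every bounded open set $W$ with $\overline W\subseteq\Omega$ and every $h$ that is $\mathcal{L}$-harmonic in $W$, continuous up to $\partial W$ and satisfies $u\le h$ on $\partial W$, one has $u\le h$ in $W$. $\underline{\mathcal{L}}_b(\Omega)$ denotes the set of $\mathcal{L}$-subharmonic functions in $\Omega$ that are bounded above. Maximum principle set: an open set $\Omega\subseteq\mathbb{R}^N$ is a maximum principle set for $\mathcal{L}$ if every $u\in\underline{\mathcal{L}}_b(\Omega)$ such that $\limsup_{x\to\xi}u(x)\le 0$ for every $\xi\in\partial\Omega$ satisfies $u\le 0$ in $\Omega$. Thin/large sets: an unbounded set $F\subseteq\mathbb{R}^N$ is $\mathcal{L}$-thin at infinity if there is $u\in\underline{\mathcal{L}}_b(\mathbb{R}^N)$ with $\limsup_{x\to\infty,\,x\in F}u(x)<\limsup_{x\to\infty}u(x)$. A bounded set $F$ (possibly empty) is $\mathcal{L}$-thin at infinity if there is $u\in\underline{\mathcal{L}}_b(\mathbb{R}^N)$ with $\sup_F u<\sup_{\mathbb{R}^N}u$ (where $\sup_\varnothing u=-\infty$). $F$ is $\mathcal{L}$-large at infinity if it is not $\mathcal{L}$-thin at infinity.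 $p_{\mathcal{L}}$-boundedness: for $p\in(1,\infty)$, $F\subseteq\mathbb{R}^N$ is $p_{\mathcal{L}}$-bounded if there is a countable family $\{\Omega(x_n,r_n)\}_{n\in J}$ of $\Gamma$-balls such that $F\subseteq\bigcup_{n\in J}\Omega(x_n,r_n)$ and $\sum_{n\in J}\big(r_n/\gamma(0,x_n)\big)^p<\infty$ (a term with $x_n=0$ counts as $+\infty$). $F$ is $p_{\mathcal{L}}$-unbounded if it is not $p_{\mathcal{L}}$-bounded. $\Gamma$-cone: a set $K\subseteq\mathbb{R}^N$ is a $\Gamma$-cone if there is a sequence of $\Gamma$-balls $\{\Omega(z_j,R_j)\}_{j\in\mathbb{N}}$, all contained in $K$, such that $\|z_j\|\to\infty$ as $j\to\infty$ and $\liminf_{j\to\infty}R_j/\gamma(0,z_j)>0$. *)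

theory Defs
  imports "HOL-Analysis.Analysis"
begin

section \<open>Smooth functions\<close>

text \<open>Intended for open \<open>S\<close> only: \<open>f\<close> has continuous iterated partial derivatives
  up to order \<open>k\<close> on \<open>S\<close>.\<close>

primrec Ck_on :: "nat \<Rightarrow> 'a::euclidean_space set \<Rightarrow> ('a \<Rightarrow> 'b::real_normed_vector) \<Rightarrow> bool" where
  "Ck_on 0 S f \<longleftrightarrow> continuous_on S f"
| "Ck_on (Suc k) S f \<longleftrightarrow> f differentiable_on S \<and>
     (\<forall>b\<in>Basis. Ck_on k S (\<lambda>x. frechet_derivative f (at x) b))"

definition smooth_on :: "'a::euclidean_space set \<Rightarrow> ('a \<Rightarrow> 'b::real_normed_vector) \<Rightarrow> bool" where
  "smooth_on S f \<longleftrightarrow> (\<forall>k. Ck_on k S f)"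

definition test_function :: "('a::euclidean_space \<Rightarrow> real) \<Rightarrow> bool" where
  "test_function \<phi> \<longleftrightarrow> smooth_on UNIV \<phi> \<and> compact (closure {x. \<phi> x \<noteq> 0})"


section \<open>Vector fields\<close>

text \<open>A vector field \<open>\<Sum>i. a i (x) \<partial>i\<close> is encoded by its coefficient map \<open>x \<mapsto> (a i (x))\<close>; its
  action on functions is the directional derivative. A family \<open>X 1, \<dots>, X m\<close> of vector fields
  is a function on \<open>nat\<close>, of which only the values on \<open>{1..m}\<close> matter.\<close>

definition vf_apply :: "('a::euclidean_space \<Rightarrow> 'a) \<Rightarrow> ('a \<Rightarrow> real) \<Rightarrow> 'a \<Rightarrow> real" where
  "vf_apply X \<phi> x = frechet_derivative \<phi> (at x) (X x)"

definition vf_independent :: "nat \<Rightarrow> (nat \<Rightarrow> 'a::euclidean_space \<Rightarrow> 'a) \<Rightarrow> bool" where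
  "vf_independent m X \<longleftrightarrow>
     (\<forall>c::nat \<Rightarrow> real. (\<forall>x. (\<Sum>j=1..m. c j *\<^sub>R X j x) = 0) \<longrightarrow> (\<forall>j\<in>{1..m}. c j = 0))"

text \<open>Coefficients of \<open>\<phi> \<mapsto> X (Y \<phi>) - Y (X \<phi>)\<close>.\<close>

definition lie_bracket :: "('a::euclidean_space \<Rightarrow> 'a) \<Rightarrow> ('a \<Rightarrow> 'a) \<Rightarrow> 'a \<Rightarrow> 'a" where
  "lie_bracket X Y x = frechet_derivative Y (at x) (X x) - frechet_derivative X (at x) (Y x)"

inductive_set Lie_generated :: "('a::euclidean_space \<Rightarrow> 'a) set \<Rightarrow> ('a \<Rightarrow> 'a) set"
  for V :: "('a \<Rightarrow> 'a) set" where
  generator: "Z \<in> V \<Longrightarrow> Z \<in> Lie_generated V"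
| zero: "(\<lambda>x. 0) \<in> Lie_generated V"
| add: "Y \<in> Lie_generated V \<Longrightarrow> Z \<in> Lie_generated V \<Longrightarrow> (\<lambda>x. Y x + Z x) \<in> Lie_generated V"
| scale: "Z \<in> Lie_generated V \<Longrightarrow> (\<lambda>x. c *\<^sub>R Z x) \<in> Lie_generated V"
| bracket: "Y \<in> Lie_generated V \<Longrightarrow> Z \<in> Lie_generated V \<Longrightarrow> lie_bracket Y Z \<in> Lie_generated V"

definition hormander_condition :: "nat \<Rightarrow> (nat \<Rightarrow> real^'n \<Rightarrow> real^'n) \<Rightarrow> bool" where
  "hormander_condition m X \<longleftrightarrow>
     (\<forall>x. dim ((\<lambda>Z. Z x) ` Lie_generated (X ` {1..m})) = CARD('n))"

definition dilation :: "('n \<Rightarrow> nat) \<Rightarrow> real \<Rightarrow> real^'n \<Rightarrow> real^'n" where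
  "dilation \<sigma> t x = (\<chi> i. t ^ \<sigma> i * x $ i)"

text \<open>\<open>1 = \<sigma> 1 \<le> \<dots> \<le> \<sigma> N\<close>, the coordinates being indexed by a finite linearly ordered type.\<close>

definition dilation_exponents :: "('n::{finite,linorder} \<Rightarrow> nat) \<Rightarrow> bool" where
  "dilation_exponents \<sigma> \<longleftrightarrow> mono \<sigma> \<and> \<sigma> (Min UNIV) = 1"

definition vf_homogeneous_1 :: "('n \<Rightarrow> nat) \<Rightarrow> (real^'n \<Rightarrow> real^'n) \<Rightarrow> bool" where
  "vf_homogeneous_1 \<sigma> X \<longleftrightarrow>
     (\<forall>\<phi> t x. smooth_on UNIV \<phi> \<longrightarrow> t > 0 \<longrightarrow>
        vf_apply X (\<phi> \<circ> dilation \<sigma> t) x = t * vf_apply X \<phi> (dilation \<sigma> t x))"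

definition sum_of_squares ::
  "nat \<Rightarrow> (nat \<Rightarrow> 'a::euclidean_space \<Rightarrow> 'a) \<Rightarrow> ('a \<Rightarrow> real) \<Rightarrow> 'a \<Rightarrow> real" where
  "sum_of_squares m X u x = (\<Sum>j=1..m. vf_apply (X j) (vf_apply (X j) u) x)"


section \<open>The fundamental solution and its balls\<close>

text \<open>The values of \<open>\<Gamma>\<close> on the diagonal are irrelevant.\<close>

definition fundamental_solution ::
  "('n \<Rightarrow> nat) \<Rightarrow> ((real^'n \<Rightarrow> real) \<Rightarrow> real^'n \<Rightarrow> real) \<Rightarrow> (real^'n \<Rightarrow> real^'n \<Rightarrow> real) \<Rightarrow> bool" where
  "fundamental_solution \<sigma> L \<Gamma> \<longleftrightarrow>
     (\<forall>x y. x \<noteq> y \<longrightarrow> \<Gamma> x y > 0) \<and>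
     smooth_on {(x, y). x \<noteq> y} (\<lambda>(x, y). \<Gamma> x y) \<and>
     (\<forall>x y. x \<noteq> y \<longrightarrow> \<Gamma> x y = \<Gamma> y x) \<and>
     (\<forall>x K. compact K \<longrightarrow> set_integrable lborel K (\<Gamma> x)) \<and>
     (\<forall>\<phi> x. test_function \<phi> \<longrightarrow> (LINT y|lborel. \<Gamma> x y * L \<phi> y) = - \<phi> x) \<and>
     (\<forall>x. filterlim (\<Gamma> x) at_top (at x)) \<and>
     (\<forall>x. (\<Gamma> x \<longlongrightarrow> 0) at_infinity) \<and>
     (\<forall>x y t. x \<noteq> y \<longrightarrow> t > 0 \<longrightarrow>
        \<Gamma> (dilation \<sigma> t x) (dilation \<sigma> t y) = t powi (2 - int (\<Sum>i\<in>UNIV. \<sigma> i)) * \<Gamma> x y)"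

definition quasi_dist :: "('a \<Rightarrow> 'a \<Rightarrow> real) \<Rightarrow> 'a \<Rightarrow> 'a \<Rightarrow> real" where
  "quasi_dist \<Gamma> x y = (if x = y then 0 else 1 / \<Gamma> x y)"

definition Gamma_ball :: "('a \<Rightarrow> 'a \<Rightarrow> real) \<Rightarrow> 'a \<Rightarrow> real \<Rightarrow> 'a set" where
  "Gamma_ball \<Gamma> x r = {y. quasi_dist \<Gamma> x y < r}"


section \<open>Potential theory\<close>

definition harmonic_on ::
  "(('a::euclidean_space \<Rightarrow> real) \<Rightarrow> 'a \<Rightarrow> real) \<Rightarrow> 'a set \<Rightarrow> ('a \<Rightarrow> real) \<Rightarrow> bool" where
  "harmonic_on L W h \<longleftrightarrow> smooth_on W h \<and> (\<forall>x\<in>W. L h x = 0)"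

definition upper_semicontinuous_on :: "'a::topological_space set \<Rightarrow> ('a \<Rightarrow> ereal) \<Rightarrow> bool" where
  "upper_semicontinuous_on S u \<longleftrightarrow> (\<forall>c. openin (top_of_set S) {x\<in>S. u x < c})"

definition subharmonic_on ::
  "(('a::euclidean_space \<Rightarrow> real) \<Rightarrow> 'a \<Rightarrow> real) \<Rightarrow> 'a set \<Rightarrow> ('a \<Rightarrow> ereal) \<Rightarrow> bool" where
  "subharmonic_on L \<Omega> u \<longleftrightarrow>
     (\<forall>x\<in>\<Omega>. u x < \<infinity>) \<and>
     upper_semicontinuous_on \<Omega> u \<and>
     \<Omega> \<subseteq> closure {x\<in>\<Omega>. u x > -\<infinity>} \<and>
     (\<forall>W h. open W \<and> bounded W \<and> closure W \<subseteq> \<Omega> \<and> harmonic_on L W h \<and>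
        continuous_on (closure W) h \<and> (\<forall>x\<in>frontier W. u x \<le> ereal (h x)) \<longrightarrow>
        (\<forall>x\<in>W. u x \<le> ereal (h x)))"

definition subharmonic_bdd_above ::
  "(('a::euclidean_space \<Rightarrow> real) \<Rightarrow> 'a \<Rightarrow> real) \<Rightarrow> 'a set \<Rightarrow> ('a \<Rightarrow> ereal) set" where
  "subharmonic_bdd_above L \<Omega> =
     {u. subharmonic_on L \<Omega> u \<and> (\<exists>M::real. \<forall>x\<in>\<Omega>. u x \<le> ereal M)}"

definition maximum_principle_set ::
  "(('a::euclidean_space \<Rightarrow> real) \<Rightarrow> 'a \<Rightarrow> real) \<Rightarrow> 'a set \<Rightarrow> bool" where
  "maximum_principle_set L \<Omega> \<longleftrightarrow> open \<Omega> \<and>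
     (\<forall>u\<in>subharmonic_bdd_above L \<Omega>.
        (\<forall>\<xi>\<in>frontier \<Omega>. Limsup (at \<xi> within \<Omega>) u \<le> 0) \<longrightarrow> (\<forall>x\<in>\<Omega>. u x \<le> 0))"

definition thin_at_infinity ::
  "(('a::euclidean_space \<Rightarrow> real) \<Rightarrow> 'a \<Rightarrow> real) \<Rightarrow> 'a set \<Rightarrow> bool" where
  "thin_at_infinity L F \<longleftrightarrow>
     (if bounded F
      then \<exists>u\<in>subharmonic_bdd_above L UNIV. (SUP x\<in>F. u x) < (SUP x. u x)
      else \<exists>u\<in>subharmonic_bdd_above L UNIV.
             Limsup (inf at_infinity (principal F)) u < Limsup at_infinity u)"

definition large_at_infinity ::
  "(('a::euclidean_space \<Rightarrow> real) \<Rightarrow> 'a \<Rightarrow> real) \<Rightarrow> 'a set \<Rightarrow> bool" where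
  "large_at_infinity L F \<longleftrightarrow> \<not> thin_at_infinity L F"

text \<open>The condition \<open>x n \<noteq> 0\<close> renders the convention that a term with \<open>x n = 0\<close> is \<open>+\<infinity>\<close>.\<close>

definition p_bounded :: "('a::euclidean_space \<Rightarrow> 'a \<Rightarrow> real) \<Rightarrow> real \<Rightarrow> 'a set \<Rightarrow> bool" where
  "p_bounded \<Gamma> p F \<longleftrightarrow>
     (\<exists>(J::nat set) x r. (\<forall>n\<in>J. r n > 0 \<and> x n \<noteq> 0) \<and>
        F \<subseteq> (\<Union>n\<in>J. Gamma_ball \<Gamma> (x n) (r n)) \<and>
        (\<lambda>n. (r n / quasi_dist \<Gamma> 0 (x n)) powr p) summable_on J)"

definition Gamma_cone :: "('a::euclidean_space \<Rightarrow> 'a \<Rightarrow> real) \<Rightarrow> 'a set \<Rightarrow> bool" where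
  "Gamma_cone \<Gamma> K \<longleftrightarrow>
     (\<exists>(z::nat \<Rightarrow> 'a) R. (\<forall>j. R j > 0 \<and> Gamma_ball \<Gamma> (z j) (R j) \<subseteq> K) \<and>
        filterlim (\<lambda>j. norm (z j)) at_top sequentially \<and>
        liminf (\<lambda>j. ereal (R j / quasi_dist \<Gamma> 0 (z j))) > 0)"

end

theory Submission imports Defs begin

text \<open>Homogeneity forces the coefficients of the fields to be polynomials, so \<open>L\<close> is formally
 self-adjoint and a weak maximum principle holds. If the maximum principle fails on \<open>\<Omega>\<close>, then the
 positive part of a counterexample, extended by 0, is a bounded subharmonic function \<open>v\<close> on the whole space that
 vanishes off \<open>\<Omega>\<close> and has supremum \<open>S > 0\<close>; subtracting multiples of \<open>\<Gamma>\<close> gives the equivalence with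
 thinness. If the complement contains balls of radius \<open>R\<close> around \<open>z\<close>, then \<open>v \<le> S (1 - R \<Gamma> z / 2)\<close>, which for
 the balls of a cone is a fixed proportion of \<open>S\<close>.

 For coverings, rescale the dyadic annuli of the complement to one compact annulus. By a minimax argument, each
 piece either is covered by balls at cost \<open>C \<kappa>\<close> or carries finite measures of mass \<open>\<kappa>\<close> whose potentials are
 bounded outside arbitrarily small neighbourhoods of their supports. Comparing \<open>v\<close> with the sums of these potentials
 shows that the masses are summable, hence so are the costs. The covering step needs only that a ball is
 almost unchanged when its boundary moves by a power of its radius, which follows from an a priori gradient
 bound with polynomial loss; the latter is Kohn's commutator argument carried out with convolutions alone.\<close>

text \<open>Every comparison function is a constant plus a finite combination of functions
  \<open>Ga p\<close>, so harmonicity off the poles and the behaviour at infinity are explicit. The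
  difficulty is that a discrete measure has an unbounded potential at its own atoms: a bound can
  hold only where each kernel stays below a threshold. That threshold must be so high that the
  excluded zone lies where \<open>v\<close> is already small, which semicontinuity provides for each
  annulus without any rate. Hence the constants of the covering alternative must not depend on the
  threshold. What makes this possible is \<open>p > 1\<close>. With \<open>p = 1 + 2 eta\<close>, a
  dyadic radius \<open>r\<close> needs about \<open>r powr (- 1 - eta)\<close> balls times a
  logarithm, each at cost \<open>r powr p\<close>, and the remaining factor
  \<open>r powr eta\<close> sums over all scales. The logarithm is the price of a greedy hitting set
  for a net of polynomially many points. This is why it is enough to control the balls under
  displacements by a power of the radius, and why the regularity estimates may lose any power of the
  radius.\<close>

lemmas intb_add = Bochner_Integration.integrable_add and intb_diff = Bochner_Integration.integrable_diff
 and intb_sum = Bochner_Integration.integrable_sum and int_add = Bochner_Integration.integral_add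
 and int_diff = Bochner_Integration.integral_diff and int_sum = Bochner_Integration.integral_sum
 and int_mult0 = Bochner_Integration.integral_mult_right_zero and int_nonneg = Bochner_Integration.integral_nonneg
 and int_cong = Bochner_Integration.integral_cong and int_norm_bound = Bochner_Integration.integral_norm_bound_integral

section \<open>Smooth functions\<close>

definition pd :: "'a::euclidean_space => ('a => 'b::real_normed_vector) => 'a => 'b" where
 "pd b f x = frechet_derivative f (at x) b"

lemma frechet_derivative_cong_open:
 assumes "open S" "x : S" "!!y. y : S ==> f y = g y"
 shows "frechet_derivative f (at x) = frechet_derivative g (at x)"
proof -
 have "(f has_derivative D) (at x) \<longleftrightarrow> (g has_derivative D) (at x)" for D
  using has_derivative_transform_within_open[OF _ assms(1,2)] assms(3) by metis
 thus ?thesis unfolding frechet_derivative_def by simp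
qed

lemma differentiable_on_cong_open:
 assumes "open S" "!!y. y : S ==> f y = g y" "f differentiable_on S"
 shows "g differentiable_on S"
 unfolding differentiable_on_def
proof
 fix x assume x: "x : S"
 hence "f differentiable (at x within S)" using assms(3) by (simp add: differentiable_on_def)
 thus "g differentiable (at x within S)"
  by (rule differentiable_transform_within[where d = 1]) (use x assms(2) in auto)
qed

lemma Ck_on_cong:
 assumes "open S" "!!y. y : S ==> f y = g y" "Ck_on k S f"
 shows "Ck_on k S g"
 using assms(2,3)
proof (induction k arbitrary: f g)
 case 0 thus ?case by (simp add: continuous_on_eq)
next
 case (Suc k)
 have d: "g differentiable_on S"
  using differentiable_on_cong_open[OF assms(1)] Suc.prems by (metis Ck_on.simps(2))
 have "Ck_on k S (%x. frechet_derivative g (at x) b)" if "b : Basis" for b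
 proof (rule Suc.IH)
  show "frechet_derivative f (at y) b = frechet_derivative g (at y) b" if "y : S" for y
   using frechet_derivative_cong_open[OF assms(1) that] Suc.prems(1) by metis
  show "Ck_on k S (%x. frechet_derivative f (at x) b)" using Suc.prems that by simp
 qed
 with d show ?case by simp
qed

lemma Ck_on_Suc_pd:
 "Ck_on (Suc k) S f \<longleftrightarrow> f differentiable_on S & (ALL b:Basis. Ck_on k S (pd b f))"
 by (simp add: pd_def[abs_def])

lemma Ck_on_Suc_imp: "Ck_on (Suc k) S f ==> Ck_on k S f"
proof (induction k arbitrary: f)
 case 0 thus ?case by (simp add: differentiable_imp_continuous_on)
next
 case (Suc k) thus ?case by (metis Ck_on.simps(2))
qed

lemma Ck_on_subset: "Ck_on k S f ==> T <= S ==> Ck_on k T f"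
 by (induction k arbitrary: f) (auto intro: continuous_on_subset differentiable_on_subset)

lemma smooth_on_subset: "smooth_on S f ==> T <= S ==> smooth_on T f"
 unfolding smooth_on_def using Ck_on_subset by blast

lemma smooth_on_cong:
 "open S ==> (!!y. y : S ==> f y = g y) ==> smooth_on S f ==> smooth_on S g"
 unfolding smooth_on_def using Ck_on_cong by metis

lemma smooth_on_differentiable: "smooth_on S f ==> f differentiable_on S"
 unfolding smooth_on_def by (metis Ck_on.simps(2))

lemma smooth_on_pd: "smooth_on S f ==> b : Basis ==> smooth_on S (pd b f)"
 unfolding smooth_on_def by (metis Ck_on_Suc_pd)

lemma smooth_on_continuous: "smooth_on S f ==> continuous_on S f"
 unfolding smooth_on_def by (metis Ck_on.simps(1))

lemma has_derivative_frechet: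
 assumes "smooth_on S f" "open S" "x : S"
 shows "(f has_derivative frechet_derivative f (at x)) (at x)"
 using smooth_on_differentiable[OF assms(1)] assms(2,3)
 by (metis at_within_open differentiable_on_def frechet_derivative_works)

lemma has_derivative_frechet':
 "f differentiable_on S ==> open S ==> x : S ==> (f has_derivative frechet_derivative f (at x)) (at x)"
 by (metis at_within_open differentiable_on_def frechet_derivative_works)

lemma frechet_derivative_eq: "(f has_derivative D) (at x) ==> frechet_derivative f (at x) = D"
 by (metis frechet_derivative_at)

lemma pd_eq: "(f has_derivative D) (at x) ==> pd b f x = D b"
 by (simp add: pd_def frechet_derivative_eq)

lemma pd_cong_open:
 "open S ==> x : S ==> (!!y. y : S ==> f y = g y) ==> pd b f x = pd b g x"
 unfolding pd_def by (metis frechet_derivative_cong_open)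

lemma frechet_derivative_pd:
 assumes "f differentiable (at x)"
 shows "frechet_derivative f (at x) v = (SUM b:Basis. (v \<bullet> b) *\<^sub>R pd b f x)"
proof -
 interpret bounded_linear "frechet_derivative f (at x)"
  using assms by (meson frechet_derivative_works has_derivative_bounded_linear)
 have "frechet_derivative f (at x) v = frechet_derivative f (at x) (SUM b:Basis. (v \<bullet> b) *\<^sub>R b)"
  by (simp add: euclidean_representation)
 also have "... = (SUM b:Basis. (v \<bullet> b) *\<^sub>R frechet_derivative f (at x) b)"
  by (simp add: sum scaleR)
 finally show ?thesis by (simp add: pd_def)
qed

lemma differentiable_on_openI:
 assumes "open S" "!!x. x : S ==> (f has_derivative D x) (at x)"
 shows "f differentiable_on S"
 using assms by (meson differentiable_at_withinI differentiable_def differentiable_on_def)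

text \<open>Any explicit derivative \<open>D\<close> may replace \<open>frechet_derivative\<close>,
  so each closure rule below reduces to a derivative rule and its induction hypothesis.\<close>

lemma Ck_on_SucI:
 assumes "open S" "!!x. x : S ==> (f has_derivative D x) (at x)"
  and "!!b. b : Basis ==> Ck_on k S (%x. D x b)"
 shows "Ck_on (Suc k) S f"
 unfolding Ck_on_Suc_pd
proof (intro conjI ballI)
 show "f differentiable_on S" using differentiable_on_openI assms by blast
 fix b :: 'a assume "b : Basis"
 thus "Ck_on k S (pd b f)"
  using Ck_on_cong[OF assms(1) _ assms(3)] assms(2) pd_eq by metis
qed

lemma smooth_on_imp_Ck_deriv:
 assumes "Ck_on (Suc k) S f" "open S"
 shows "!!x. x : S ==> (f has_derivative frechet_derivative f (at x)) (at x)"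
  "!!b. b : Basis ==> Ck_on k S (%x. frechet_derivative f (at x) b)"
 using assms has_derivative_frechet' by (auto simp del: )

lemma Ck_on_const: "Ck_on k S (%x. c)"
proof (induction k arbitrary: c)
 case (Suc k)
 have "frechet_derivative (%x. c) (at x) b = 0" for x b :: 'a
  by (simp add: frechet_derivative_const)
 with Suc show ?case by simp
qed simp

lemma Ck_on_add:
 assumes "open S" "Ck_on k S f" "Ck_on k S g" shows "Ck_on k S (%x. f x+g x)"
 using assms(2,3)
proof (induction k arbitrary: f g)
 case 0 thus ?case by (simp add: continuous_on_add)
next
 case (Suc k)
 note F = smooth_on_imp_Ck_deriv[OF Suc.prems(1) assms(1)]
 note G = smooth_on_imp_Ck_deriv[OF Suc.prems(2) assms(1)]
 show ?case
  by (rule Ck_on_SucI[OF assms(1) has_derivative_add[OF F(1) G(1)] Suc.IH[OF F(2) G(2)]])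
qed

lemma Ck_on_sum:
 assumes "open S" "!!i. i : I ==> Ck_on k S (f i)" shows "Ck_on k S (%x. SUM i:I. f i x)"
 using assms(2) by (induction I rule: infinite_finite_induct) (auto intro: Ck_on_const Ck_on_add[OF assms(1)])

lemma Ck_on_bounded_linear:
 assumes "open S" "bounded_linear T" "Ck_on k S f" shows "Ck_on k S (%x. T (f x))"
 using assms(3)
proof (induction k arbitrary: f)
 case 0 thus ?case using assms(2) by (simp add: bounded_linear.continuous_on)
next
 case (Suc k)
 note F = smooth_on_imp_Ck_deriv[OF Suc.prems(1) assms(1)]
 show ?case
  by (rule Ck_on_SucI[OF assms(1) bounded_linear.has_derivative[OF assms(2) F(1)] Suc.IH[OF F(2)]])
qed

lemma Ck_on_mult:
 fixes f g :: "'a::euclidean_space => real"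
 assumes "open S" "Ck_on k S f" "Ck_on k S g" shows "Ck_on k S (%x. f x*g x)"
 using assms(2,3)
proof (induction k arbitrary: f g)
 case 0 thus ?case by (simp add: continuous_on_mult)
next
 case (Suc k)
 note F = smooth_on_imp_Ck_deriv[OF Suc.prems(1) assms(1)]
 note G = smooth_on_imp_Ck_deriv[OF Suc.prems(2) assms(1)]
 show ?case
 proof (rule Ck_on_SucI[OF assms(1) has_derivative_mult[OF F(1) G(1)]])
  fix b :: 'a assume b: "b : Basis"
  show "Ck_on k S (%x. f x*frechet_derivative g (at x) b+frechet_derivative f (at x) b*g x)"
   using Suc.IH[OF Ck_on_Suc_imp[OF Suc.prems(1)] G(2)[OF b]]
    Suc.IH[OF F(2)[OF b] Ck_on_Suc_imp[OF Suc.prems(2)]]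
   by (rule Ck_on_add[OF assms(1)])
 qed
qed

lemma Ck_on_linear:
 fixes T :: "'a::euclidean_space => 'b::real_normed_vector"
 assumes "open S" "bounded_linear T" shows "Ck_on k S T"
proof (cases k)
 case 0 thus ?thesis using assms by (simp add: linear_continuous_on)
next
 case (Suc j)
 show ?thesis unfolding Suc
  by (rule Ck_on_SucI[OF assms(1) bounded_linear_imp_has_derivative[OF assms(2)] Ck_on_const])
qed

lemma Ck_on_comp:
 fixes f :: "'a::euclidean_space => real" and Ph :: "real => real"
 assumes "open S" "open T" "f ` S <= T" "Ck_on k T Ph" "Ck_on k S f"
 shows "Ck_on k S (%x. Ph (f x))"
 using assms(4,5)
proof (induction k arbitrary: Ph)
 case 0 thus ?case using assms(3) by (auto intro: continuous_on_compose2)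
next
 case (Suc k)
 note F = smooth_on_imp_Ck_deriv[OF Suc.prems(2) assms(1)]
 note P = smooth_on_imp_Ck_deriv[OF Suc.prems(1) assms(2)]
 have D: "((%x. Ph (f x)) has_derivative
   (%v. pd 1 Ph (f x)*frechet_derivative f (at x) v)) (at x)" if "x : S" for x
 proof -
  have fx: "f x : T" using that assms(3) by auto
  have "frechet_derivative Ph (at (f x)) v = pd 1 Ph (f x) * v" for v
   using P(1)[OF fx] frechet_derivative_pd[of Ph "f x" v] by (simp add: differentiableI mult.commute)
  thus ?thesis using has_derivative_compose[OF F(1)[OF that] P(1)[OF fx]] by simp
 qed
 show ?case
 proof (rule Ck_on_SucI[OF assms(1) D])
  fix b :: 'a assume b: "b : Basis"
  have "Ck_on k S (%x. pd 1 Ph (f x))"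
   using Suc.IH[of "pd 1 Ph"] P(2)[of 1] Ck_on_Suc_imp[OF Suc.prems(2)] by (simp add: pd_def[abs_def])
  thus "Ck_on k S (%x. pd 1 Ph (f x)*frechet_derivative f (at x) b)"
   using F(2)[OF b] assms(1) Ck_on_mult by blast
 qed
qed

lemma Ck_on_affine:
 fixes f :: "'b::euclidean_space => 'c::real_normed_vector" and g :: "'a::euclidean_space => 'b"
 assumes "open S" "open T" "g ` S <= T" "!!x. (g has_derivative A) (at x)" "Ck_on k T f"
 shows "Ck_on k S (%x. f (g x))"
 using assms(5)
proof (induction k arbitrary: f)
 case 0
 have "continuous_on S g" using assms(4) by (meson continuous_at_imp_continuous_on has_derivative_continuous)
 with 0 show ?case using assms(3) by (auto intro: continuous_on_compose2)
next
 case (Suc k)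
 note F = smooth_on_imp_Ck_deriv[OF Suc.prems(1) assms(2)]
 have D: "((%x. f (g x)) has_derivative (%v. SUM c:Basis. (A v \<bullet> c) *\<^sub>R pd c f (g x))) (at x)"
  if "x : S" for x
 proof -
  have gx: "g x : T" using that assms(3) by auto
  have "frechet_derivative f (at (g x)) (A v) = (SUM c:Basis. (A v \<bullet> c) *\<^sub>R pd c f (g x))" for v
   using F(1)[OF gx] by (intro frechet_derivative_pd) (simp add: differentiableI)
  thus ?thesis using has_derivative_compose[OF assms(4) F(1)[OF gx]] by simp
 qed
 show ?case
 proof (rule Ck_on_SucI[OF assms(1) D])
  fix b :: 'a assume b: "b : Basis"
  show "Ck_on k S (%x. SUM c:Basis. (A b \<bullet> c) *\<^sub>R pd c f (g x))"
  proof (rule Ck_on_sum[OF assms(1)])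
   fix c :: 'b assume c: "c : Basis"
   have "Ck_on k T (pd c f)" using F(2)[OF c] by (simp add: pd_def[abs_def])
   from Ck_on_bounded_linear[OF assms(1) bounded_linear_scaleR_right Suc.IH[OF this]]
   show "Ck_on k S (%x. (A b \<bullet> c) *\<^sub>R pd c f (g x))" .
  qed
 qed
qed

lemma smooth_on_const [simp]: "smooth_on S (%x. c)"
 by (simp add: smooth_on_def Ck_on_const)

lemma smooth_on_add: "open S ==> smooth_on S f ==> smooth_on S g ==> smooth_on S (%x. f x+g x)"
 by (simp add: smooth_on_def Ck_on_add)

lemma smooth_on_sum: "open S ==> (!!i. i : I ==> smooth_on S (f i)) ==> smooth_on S (%x. SUM i:I. f i x)"
 by (simp add: smooth_on_def Ck_on_sum)

lemma smooth_on_mult: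
 fixes f g :: "'a::euclidean_space => real"
 shows "open S ==> smooth_on S f ==> smooth_on S g ==> smooth_on S (%x. f x*g x)"
 by (simp add: smooth_on_def Ck_on_mult)

lemma smooth_on_bounded_linear:
 "open S ==> bounded_linear T ==> smooth_on S f ==> smooth_on S (%x. T (f x))"
 by (simp add: smooth_on_def Ck_on_bounded_linear)

lemma smooth_on_linear: "open S ==> bounded_linear T ==> smooth_on S T"
 by (simp add: smooth_on_def Ck_on_linear)

lemma smooth_on_minus:
 fixes f :: "'a::euclidean_space => 'b::real_normed_vector"
 shows "open S ==> smooth_on S f ==> smooth_on S (%x. - f x)"
 by (rule smooth_on_bounded_linear) (auto intro: bounded_linear_minus bounded_linear_ident)

lemma smooth_on_diff:
 fixes f g :: "'a::euclidean_space => 'b::real_normed_vector"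
 shows "open S ==> smooth_on S f ==> smooth_on S g ==> smooth_on S (%x. f x - g x)"
 using smooth_on_add[OF _ _ smooth_on_minus, of S f g] by simp

lemma smooth_on_power:
 fixes f :: "'a::euclidean_space => real"
 shows "open S ==> smooth_on S f ==> smooth_on S (%x. f x^n)"
 by (induction n) (auto intro: smooth_on_mult)

lemma smooth_on_comp:
 fixes f :: "'a::euclidean_space => real" and Ph :: "real => real"
 shows "open S ==> open T ==> f ` S <= T ==> smooth_on T Ph ==> smooth_on S f ==> smooth_on S (%x. Ph (f x))"
 by (simp add: smooth_on_def Ck_on_comp)

lemma smooth_on_affine:
 fixes f :: "'b::euclidean_space => 'c::real_normed_vector" and g :: "'a::euclidean_space => 'b"
 shows "open S ==> open T ==> g ` S <= T ==> (!!x. (g has_derivative A) (at x)) ==> smooth_on T f ==>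
  smooth_on S (%x. f (g x))"
 unfolding smooth_on_def by (rule allI, rule Ck_on_affine) auto

text \<open>Serves functions given by cases, such as a cutoff times a singular function, where a
  different formula is smooth near each point.\<close>

lemma smooth_on_UN_local:
 assumes "open S" "!!x. x : S ==> EX T. open T & x : T & smooth_on T f"
 shows "smooth_on S f"
 unfolding smooth_on_def
proof
 fix k
 have "!!x. x : S ==> EX T. open T & x : T & Ck_on k T f" using assms(2) smooth_on_def by blast
 thus "Ck_on k S f"
 proof (induction k arbitrary: f)
  case 0 thus ?case
   by (metis Ck_on.simps(1) continuous_at_imp_continuous_on continuous_on_eq_continuous_at)
 next
  case (Suc k)
  have "f differentiable_on S"
  proof (rule differentiable_on_openI[OF assms(1)])
   fix x assume "x : S"
   then obtain T where "open T" "x : T" "Ck_on (Suc k) T f" using Suc.prems by blast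
   thus "(f has_derivative frechet_derivative f (at x)) (at x)"
    using smooth_on_imp_Ck_deriv(1) by blast
  qed
  moreover have "Ck_on k S (%x. frechet_derivative f (at x) b)" if "b : Basis" for b
   using Suc.IH Suc.prems that by (metis Ck_on.simps(2))
  ultimately show ?case by simp
 qed
qed

section \<open>Bump and step functions on the line\<close>

definition expb :: "nat => real => real" where
 "expb n t = (if t > 0 then (1/t)^n*exp (-(1/t)) else 0)"

lemma expb_nonneg: "expb n t >= 0" by (simp add: expb_def)
lemma expb_pos: "t > 0 ==> expb n t > 0" by (simp add: expb_def)
lemma expb_0: "t <= 0 ==> expb n t = 0" by (simp add: expb_def)

lemma expb_tendsto_0: "((%t. expb n t) \<longlongrightarrow> 0) (at 0)"
proof -
 have "((%s::real. s^n/exp s) \<longlongrightarrow> 0) at_top" by (rule tendsto_power_div_exp_0)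
 moreover have "filterlim (%t::real. inverse t) at_top (at_right 0)"
  by (rule filterlim_inverse_at_top_right)
 ultimately have "((%t::real. (inverse t)^n/exp (inverse t)) \<longlongrightarrow> 0) (at_right 0)"
  by (rule filterlim_compose)
 hence 1: "((%t. expb n t) \<longlongrightarrow> 0) (at_right 0)"
  by (rule Lim_transform_eventually)
   (auto simp: eventually_at_right_field expb_def exp_minus field_simps intro!: exI[of _ 1])
 have 2: "((%t. expb n t) \<longlongrightarrow> 0) (at_left 0)"
  by (rule Lim_transform_eventually[OF tendsto_const])
   (auto simp: eventually_at_left_field expb_def intro!: exI[of _ "-1"])
 show ?thesis using 1 2 by (simp add: filterlim_at_split)
qed

text \<open>The powers of \<open>1/t\<close> in \<open>expb\<close> are there for this:
  differentiation maps the family into itself, and smoothness becomes one induction for all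
  \<open>n\<close> at once.\<close>

lemma expb_DERIV: "(expb n has_real_derivative (expb (n+2) t - n*expb (n+1) t)) (at t)"
proof (cases t "0::real" rule: linorder_cases)
 case less
 have "((%t. 0::real) has_real_derivative 0) (at t)" by simp
 hence "(expb n has_real_derivative 0) (at t)"
  by (rule has_field_derivative_transform_within_open[of _ _ _ "{..<0}"]) (use less in "auto simp: expb_def")
 thus ?thesis using less by (simp add: expb_def)
next
 case equal
 \<comment> \<open>At 0 the difference quotient of \<open>expb n\<close> is again a member of the
   family, \<open>expb (Suc n)\<close>.\<close>
 have "((%h. (expb n (0+h) - expb n 0)/h) \<longlongrightarrow> 0) (at 0)"
  by (rule Lim_transform_eventually[OF expb_tendsto_0[of "Suc n"]])
   (auto simp: expb_def eventually_at intro!: exI[of _ 1])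
 thus ?thesis using equal by (simp add: DERIV_def expb_def)
next
 case greater
 have "((%t. (1/t)^n*exp (-(1/t))) has_real_derivative (expb (n+2) t - n*expb (n+1) t)) (at t)"
 proof (cases n)
  case 0
  show ?thesis unfolding 0 using greater
   by (auto intro!: derivative_eq_intros simp: expb_def power2_eq_square)
 next
  case (Suc k)
  have i: "((%t. 1/t) has_real_derivative - (1/t)*(1/t)) (at t)"
   using greater by (auto intro!: derivative_eq_intros simp: power2_eq_square)
  have p: "((%t. (1/t)^Suc k) has_real_derivative (1+real k)*((1/t)^k*(- (1/t)*(1/t)))) (at t)"
   using DERIV_power_Suc[OF i, of k] by (simp add: mult.assoc mult.commute)
  have e: "((%t. exp (-(1/t))) has_real_derivative exp (-(1/t))*((1/t)*(1/t))) (at t)"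
   using DERIV_fun_exp[OF DERIV_minus[OF i]] by simp
  show ?thesis unfolding Suc using greater
   by (intro DERIV_cong[OF DERIV_mult[OF p e]]) (simp add: expb_def algebra_simps)
 qed
 thus ?thesis
  by (rule has_field_derivative_transform_within_open[of _ _ _ "{0<..}"]) (use greater in "auto simp: expb_def")
qed

lemma Ck_on_real_SucI:
 fixes f f' :: "real => real"
 assumes "open S" "!!x. x : S ==> (f has_real_derivative f' x) (at x)" "Ck_on k S f'"
 shows "Ck_on (Suc k) S f"
proof (rule Ck_on_SucI[OF assms(1), where D = "%x v. f' x * v"])
 show "(f has_derivative (*) (f' x)) (at x)" if "x : S" for x
  using assms(2)[OF that] by (simp add: has_field_derivative_def)
qed (use assms(3) in simp)

lemma Ck_on_expb: "Ck_on k UNIV (expb n)"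
proof (induction k arbitrary: n)
 case 0
 thus ?case
  using DERIV_isCont[OF expb_DERIV] by (simp add: continuous_at_imp_continuous_on)
next
 case (Suc k)
 have "Ck_on k UNIV (%t. expb (n+2) t+(- real n)*expb (n+1) t)"
  by (rule Ck_on_add[OF open_UNIV Suc Ck_on_mult[OF open_UNIV Ck_on_const Suc]])
 thus ?case
  by (intro Ck_on_real_SucI[OF open_UNIV expb_DERIV]) simp
qed

lemma smooth_on_expb: "smooth_on UNIV (expb n)"
 by (simp add: smooth_on_def Ck_on_expb)

definition wbump :: "real => real" where "wbump t = expb 0 t*expb 0 (1 - t)"

lemma smooth_on_wbump: "smooth_on UNIV wbump"
proof -
 have "smooth_on UNIV (%t. expb 0 (1 - t))"
  by (rule smooth_on_affine[OF open_UNIV open_UNIV _ _ smooth_on_expb, where A = "%v. - v"])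
   (auto intro!: derivative_eq_intros)
 thus ?thesis
  using smooth_on_mult[OF open_UNIV smooth_on_expb] by (auto simp: wbump_def[abs_def])
qed

lemma wbump_nonneg: "wbump t >= 0" by (simp add: wbump_def expb_nonneg)
lemma wbump_pos: "0 < t ==> t < 1 ==> wbump t > 0" by (simp add: wbump_def expb_pos)
lemma wbump_0: "t <= 0 | t >= 1 ==> wbump t = 0" by (auto simp: wbump_def expb_0)
text \<open>Because \<open>w\<close> vanishes for \<open>t <= 0\<close>, integration from -1 already
  gives a primitive on the whole line.\<close>

lemma smooth_antiderivative:
 fixes w :: "real => real"
 assumes "smooth_on UNIV w" "!!t. t <= 0 ==> w t = 0"
 obtains W where "!!t. (W has_real_derivative w t) (at t)" "smooth_on UNIV W" "!!t. t <= 0 ==> W t = 0"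
proof -
 define W where "W t = integral {-1..t} w" for t
 have cont: "continuous_on A w" for A
  using smooth_on_continuous[OF assms(1)] continuous_on_subset by blast
 have W0: "W t = 0" if "t <= 0" for t
 proof -
  have "integral {-1..t} w = integral {-1..t} (%x. 0)"
   by (rule integral_cong) (use that assms(2) in auto)
  thus ?thesis by (simp add: W_def)
 qed
 have D: "(W has_real_derivative w t) (at t)" for t
 proof (cases "t < 0")
  case True
  have "((%t. 0::real) has_real_derivative 0) (at t)" by simp
  hence "(W has_real_derivative 0) (at t)"
   by (rule has_field_derivative_transform_within_open[of _ _ _ "{..<0}"]) (use True W0 in auto)
  thus ?thesis using True assms(2) by simp
 next
  case False
  have "(W has_real_derivative w t) (at t within {-1..t+1})"
   unfolding W_def by (rule integral_has_real_derivative[OF cont]) (use False in auto)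
  thus ?thesis using False
   by (metis (no_types, lifting) at_within_Icc_at less_add_one not_less order_less_le_trans neg_less_0_iff_less zero_less_one)
 qed
 have "smooth_on UNIV W"
  unfolding smooth_on_def
 proof
  fix k show "Ck_on k UNIV W"
   using Ck_on_real_SucI[OF open_UNIV D, of k] assms(1) Ck_on_Suc_imp smooth_on_def by blast
 qed
 with D W0 show ?thesis using that by blast
qed

text \<open>The derivative is exported as \<open>- w\<close> with \<open>w >= 0\<close>; this sign
  is later the concavity of the truncation in \<open>trunc_exists\<close>.\<close>

lemma smooth_step_exists:
 obtains s w :: "real => real"
 where "smooth_on UNIV s" "!!t. t <= 1 ==> s t = 1" "!!t. t >= 2 ==> s t = 0"
  "!!t. 0 <= s t" "!!t. s t <= 1" "!!t. (s has_real_derivative - w t) (at t)" "!!t. w t >= 0"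
  "smooth_on UNIV w"
proof -
 obtain W where W: "!!t. (W has_real_derivative wbump t) (at t)" "smooth_on UNIV W" "!!t. t <= 0 ==> W t = 0"
  using smooth_antiderivative[OF smooth_on_wbump] wbump_0 by blast
 have mono: "W a <= W b" if "a <= b" for a b
  using DERIV_nonneg_imp_nondecreasing[OF that, of W] W(1) wbump_nonneg by blast
 have W1: "W 1 > 0"
 proof -
  have "W 0 < W 1"
  proof (rule DERIV_pos_imp_increasing_open[of 0 1 W])
   show "EX y. (W has_real_derivative y) (at x) & 0 < y" if "0 < x" "x < 1" for x
    using W(1) wbump_pos that by blast
   show "continuous_on {0..1} W"
    using DERIV_isCont[OF W(1)] by (simp add: continuous_at_imp_continuous_on)
  qed simp
  thus ?thesis using W(3)[of 0] by simp
 qed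
 have Wge: "W t = W 1" if "t >= 1" for t
 proof (rule antisym)
  show "W t <= W 1"
   using DERIV_nonpos_imp_nonincreasing[OF that, of W] W(1) wbump_0 by (metis order_refl)
 qed (rule mono[OF that])
 define s where "s t = 1 - W (t - 1)/W 1" for t
 define w where "w t = wbump (t - 1)/W 1" for t
 have sm1: "smooth_on UNIV (%t. f (t - 1))" if "smooth_on UNIV f" for f :: "real => real"
  by (rule smooth_on_affine[OF open_UNIV open_UNIV _ _ that, where A = "%v. v"])
   (auto intro!: derivative_eq_intros)
 have smw: "smooth_on UNIV w"
  using smooth_on_mult[OF open_UNIV smooth_on_const[of UNIV "1/W 1"] sm1[OF smooth_on_wbump]]
  by (simp add: w_def[abs_def])
 have sms: "smooth_on UNIV s"
  using smooth_on_diff[OF open_UNIV smooth_on_const[of UNIV 1] smooth_on_mult[OF open_UNIV smooth_on_const[of UNIV "1/W 1"] sm1[OF W(2)]]]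
  by (simp add: s_def[abs_def])
 have D: "(s has_real_derivative - w t) (at t)" for t
  unfolding s_def w_def using W1
  by (auto intro!: derivative_eq_intros DERIV_chain2[OF W(1)])
 have le: "0 <= W t" "W t <= W 1" for t
  using mono[of "min t 0" t] W(3)[of "min t 0"] mono[of t "max t 1"] Wge[of "max t 1"] by auto
 show ?thesis
 proof (rule that[of s w, OF sms _ _ _ _ D _ smw])
  show "s t = 1" if "t <= 1" for t using W(3)[of "t - 1"] that by (simp add: s_def)
  show "s t = 0" if "t >= 2" for t using Wge[of "t - 1"] W1 that by (simp add: s_def)
  show "0 <= s t" "s t <= 1" for t using le[of "t - 1"] W1 by (simp_all add: s_def)
  show "w t >= 0" for t using wbump_nonneg W1 by (simp add: w_def)
 qed
qed

section \<open>Compactly supported smooth functions and their integrals\<close>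

definition csm :: "('a::euclidean_space => real) => bool" where
 "csm f \<longleftrightarrow> smooth_on UNIV f & (EX R. ALL x. norm x >= R --> f x = 0)"

lemma csm_smooth: "csm f ==> smooth_on UNIV f" by (simp add: csm_def)

lemma csm_test_function: "csm f ==> test_function f"
proof -
 assume "csm f"
 then obtain R where R: "!!x. norm x >= R ==> f x = 0" and s: "smooth_on UNIV f" by (auto simp: csm_def)
 have "{x. f x ~= 0} <= cball 0 R" using R by (force simp: not_le)
 hence "bounded {x. f x ~= 0}" using bounded_cball bounded_subset by blast
 thus ?thesis using s by (simp add: test_function_def compact_closure)
qed

lemma pd_zero_open:
 assumes "open S" "x : S" "!!y. y : S ==> f y = 0" shows "pd b f x = 0"
 using pd_cong_open[OF assms(1,2), of f "%_. 0"] assms(3) by (simp add: pd_def frechet_derivative_const)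

lemma open_norm_gt: "open {x::'a::real_normed_vector. norm x > R}"
 by (simp add: open_Collect_less continuous_on_norm)

lemma csm_pd: assumes "csm f" "b : Basis" shows "csm (pd b f)"
proof -
 obtain R where R: "!!x. norm x >= R ==> f x = 0" and s: "smooth_on UNIV f" using assms by (auto simp: csm_def)
 have "pd b f x = 0" if "norm x >= R+1" for x
  by (rule pd_zero_open[OF open_norm_gt[of R]]) (use that R in auto)
 thus ?thesis using smooth_on_pd[OF s assms(2)] by (auto simp: csm_def)
qed

lemma csm_mult_left: "smooth_on UNIV g ==> csm f ==> csm (%x. g x*f x)"
 unfolding csm_def by (metis smooth_on_mult open_UNIV mult_zero_right)

lemma csm_mult_right: "csm f ==> smooth_on UNIV g ==> csm (%x. f x*g x)"
 unfolding csm_def by (metis smooth_on_mult open_UNIV mult_zero_left)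

lemma csm_add: assumes "csm f" "csm g" shows "csm (%x. f x+g x)"
proof -
 obtain R R' where "!!x. norm x >= R ==> f x = 0" "!!x. norm x >= R' ==> g x = 0"
  using assms by (auto simp: csm_def)
 thus ?thesis using assms unfolding csm_def
  by (intro conjI exI[of _ "max R R'"]) (auto intro: smooth_on_add)
qed

lemma csm_zero [simp]: "csm (%x. 0)" by (simp add: csm_def)

lemma csm_sum: "(!!i. i : I ==> csm (f i)) ==> csm (%x. SUM i:I. f i x)"
 by (induction I rule: infinite_finite_induct) (auto intro: csm_add)

lemma csm_continuous: "csm f ==> continuous_on A f"
 using csm_smooth smooth_on_continuous continuous_on_subset by blast

lemma integrable_cont_supp:
 fixes f :: "'a::euclidean_space => real"
 assumes "continuous_on UNIV f" "!!x. norm x >= R ==> f x = 0"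
 shows "integrable lborel f"
proof -
 have "integrable lborel (%x. indicator (cball 0 R) x *\<^sub>R f x)"
  by (rule borel_integrable_compact) (use continuous_on_subset[OF assms(1)] in auto)
 moreover have "(%x. indicator (cball 0 R) x *\<^sub>R f x) = f"
  using assms(2) by (force simp: indicator_def)
 ultimately show ?thesis by simp
qed

lemma csm_integrable: "csm f ==> integrable lborel f"
 using integrable_cont_supp[OF csm_continuous] by (auto simp: csm_def)

lemma csm_bounded: assumes "csm f" obtains B where "B > 0" "!!x. abs (f x) <= B"
proof -
 obtain R where R: "!!x. norm x >= R ==> f x = 0" using assms by (auto simp: csm_def)
 have "bounded (f ` cball 0 R)"
  by (intro compact_imp_bounded compact_continuous_image csm_continuous assms compact_cball)
 then obtain B where B: "!!x. x : cball 0 R ==> \<bar>f x\<bar> <= B" by (force simp: bounded_iff)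
 have "abs (f x) <= max B 1" for x
  using R[of x] B[of x] by (cases "norm x <= R") auto
 thus ?thesis using that[of "max B 1"] by auto
qed

lemma lborel_integral_translate:
 fixes f :: "'a::euclidean_space => real"
 assumes "f : borel_measurable borel"
 shows "(LINT x|lborel. f (c+x)) = (LINT x|lborel. f x)"
proof -
 have "(LINT x|distr lborel borel ((+) c). f x) = (LINT x|lborel. f (c+x))"
  by (rule integral_distr) (use assms in auto)
 thus ?thesis by (simp add: lborel_distr_plus)
qed

lemma integrable_translate:
 fixes f :: "'a::euclidean_space => real"
 assumes "integrable lborel f"
 shows "integrable lborel (%x. f (c+x))"
proof -
 have "integrable (distr lborel borel ((+) c)) f" using assms by (simp add: lborel_distr_plus)
 thus ?thesis by (subst (asm) integrable_distr_eq) (use assms in auto)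
qed

text \<open>Translation invariance makes the integral of every difference quotient vanish. The mean
  value theorem bounds the quotients uniformly, so dominated convergence passes to the
  derivative.\<close>

lemma integral_pd_zero:
 fixes f :: "'a::euclidean_space => real"
 assumes "csm f" "b : Basis"
 shows "(LINT x|lborel. pd b f x) = 0"
proof -
 obtain R where R: "!!x. norm x >= R ==> f x = 0" using assms by (auto simp: csm_def)
 obtain B where B: "!!x. abs (pd b f x) <= B" using csm_bounded[OF csm_pd[OF assms]] by metis
 have B0: "B >= 0" using B[of 0] by linarith
 define t where "t n = 1/(real n+1)" for n :: nat
 have t: "t n > 0" "t n <= 1" for n by (auto simp: t_def)
 have tn: "t n ~= 0" for n using t(1)[of n] by simp
 have t0: "t \<longlonglongrightarrow> 0" unfolding t_def using LIMSEQ_inverse_real_of_nat by (simp add: inverse_eq_divide add.commute)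
 define q where "q n x = (f (t n *\<^sub>R b+x) - f x) / t n" for n x
 have line: "((%s. f (s *\<^sub>R b+x)) has_real_derivative pd b f (s *\<^sub>R b+x)) (at s)" for s x
 proof -
  have "(f has_derivative frechet_derivative f (at (s *\<^sub>R b+x))) (at (s *\<^sub>R b+x))"
   by (rule has_derivative_frechet[OF csm_smooth[OF assms(1)]]) auto
  moreover have "((%s. s *\<^sub>R b+x) has_derivative (%h. h *\<^sub>R b)) (at s)"
   by (auto intro!: derivative_eq_intros)
  ultimately have "((%s. f (s *\<^sub>R b+x)) has_derivative (%h. frechet_derivative f (at (s *\<^sub>R b+x)) (h *\<^sub>R b))) (at s)"
   by (rule has_derivative_compose[rotated])
  moreover have "frechet_derivative f (at (s *\<^sub>R b+x)) (h *\<^sub>R b) = pd b f (s *\<^sub>R b+x)*h" for h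
  proof -
   have "linear (frechet_derivative f (at (s *\<^sub>R b+x)))"
    by (meson calculation(1) has_derivative_frechet[OF csm_smooth[OF assms(1)] open_UNIV UNIV_I] has_derivative_linear)
   thus ?thesis by (simp add: pd_def linear_scale mult.commute)
  qed
  ultimately show ?thesis by (simp add: has_field_derivative_def)
 qed
 have bound: "abs (q n x) <= B*indicator (cball 0 (R+1)) x" for n x
 proof (cases "x : cball 0 (R+1)")
  case True
  obtain z where "0 < z" "z < t n" "f (t n *\<^sub>R b+x) - f (0 *\<^sub>R b+x) = (t n - 0) * pd b f (z *\<^sub>R b+x)"
   using MVT2[of 0 "t n" "%s. f (s *\<^sub>R b+x)" "%s. pd b f (s *\<^sub>R b+x)"] t[of n] line by blast
  hence "q n x = pd b f (z *\<^sub>R b+x)" using t[of n] by (simp add: q_def)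
  thus ?thesis using B True by simp
 next
  case False
  hence x: "norm x > R+1" by simp
  have "norm x <= norm (t n *\<^sub>R b+x)+norm (t n *\<^sub>R b)"
   using norm_triangle_ineq4[of "t n *\<^sub>R b+x" "t n *\<^sub>R b"] by simp
  moreover have "norm (t n *\<^sub>R b) <= 1" using t[of n] assms(2) by simp
  ultimately have "f (t n *\<^sub>R b+x) = 0" "f x = 0" using R x by auto
  thus ?thesis using False by (simp add: q_def)
 qed
 have lim: "(%n. LINT x|lborel. q n x) \<longlonglongrightarrow> (LINT x|lborel. pd b f x)"
 proof (rule integral_dominated_convergence[where w = "%x. B*indicator (cball 0 (R+1)) x"])
  have fm: "f : borel_measurable borel"
   using csm_continuous[OF assms(1)] by (rule borel_measurable_continuous_onI)
  thus "q n : borel_measurable lborel" for n unfolding q_def by measurable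
  show "pd b f : borel_measurable lborel"
   using csm_continuous[OF csm_pd[OF assms]] by (simp add: borel_measurable_continuous_onI)
  show "integrable lborel (%x. B*indicator (cball (0::'a) (R+1)) x)"
   by (intro integrable_mult_right integrable_real_indicator) (auto intro: emeasure_bounded_finite[unfolded infinity_ennreal_def])
  show "AE x in lborel. norm (q n x) <= B*indicator (cball 0 (R+1)) x" for n
   by (rule AE_I2) (simp only: real_norm_def bound)
  show "AE x in lborel. (%n. q n x) \<longlonglongrightarrow> pd b f x"
  proof (rule AE_I2)
   fix x
   have "((%h. (f (h *\<^sub>R b+x) - f x)/h) \<longlongrightarrow> pd b f x) (at 0)"
    using line[of x 0] by (simp add: DERIV_def)
   moreover have "filterlim t (at 0) sequentially"
    by (rule filterlim_atI[OF t0]) (simp add: tn)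
   ultimately show "(%n. q n x) \<longlonglongrightarrow> pd b f x"
    unfolding q_def by (rule filterlim_compose)
  qed
 qed
 have "(LINT x|lborel. q n x) = 0" for n
 proof -
  have fi: "integrable lborel f" by (rule csm_integrable[OF assms(1)])
  have "(LINT x|lborel. f (t n *\<^sub>R b+x) - f x) = 0"
   using fi integrable_translate[OF fi] lborel_integral_translate[of f] by simp
  thus ?thesis by (simp add: q_def)
 qed
 thus ?thesis using lim by (simp add: LIMSEQ_const_iff)
qed

section \<open>Polynomial vector fields\<close>

abbreviation pdi :: "'n::finite => (real^'n => real) => real^'n => real" where
 "pdi i \<equiv> pd (axis i 1)"

definition svf :: "(real^'n::finite => real^'n) => bool" where
 "svf Z \<longleftrightarrow> (ALL i. smooth_on UNIV (%x. Z x $ i))"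

definition divergence :: "(real^'n::finite => real^'n) => real^'n => real" where
 "divergence Z x = (SUM i:UNIV. pdi i (%y. Z y $ i) x)"

lemma axis_Basis [simp]: "axis i (1::real) : Basis" by simp

lemma sum_Basis_axis: "(SUM b:(Basis::(real^'n::finite) set). f b) = (SUM i:UNIV. f (axis i 1))"
proof -
 have 1: "(Basis::(real^'n) set) = range (%i. axis i 1)" by (auto simp: Basis_vec_def)
 have 2: "inj_on (%i::'n. axis i (1::real)) UNIV" by (auto simp: inj_on_def axis_eq_axis)
 show ?thesis unfolding 1 sum.reindex[OF 2] o_def ..
qed

lemma smooth_on_differentiable_at:
 "smooth_on S f ==> open S ==> x : S ==> f differentiable (at x)"
 using has_derivative_frechet differentiableI by blast

lemma vf_apply_pd:
 assumes "f differentiable (at x)"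
 shows "vf_apply Z f x = (SUM i:UNIV. Z x $ i * pdi i f x)"
 unfolding vf_apply_def frechet_derivative_pd[OF assms] sum_Basis_axis
 by (simp add: inner_axis)

lemma vf_apply_cong_open:
 "open S ==> x : S ==> (!!y. y : S ==> f y = g y) ==> vf_apply Z f x = vf_apply Z g x"
 unfolding vf_apply_def by (metis frechet_derivative_cong_open)

lemma smooth_vf_apply:
 assumes "svf Z" "open S" "smooth_on S f" shows "smooth_on S (vf_apply Z f)"
proof -
 have "smooth_on S (%x. SUM i:UNIV. Z x $ i * pdi i f x)"
  by (intro smooth_on_sum smooth_on_mult assms(2) smooth_on_pd assms(3) axis_Basis)
   (use assms(1) smooth_on_subset[OF _ subset_UNIV] in "auto simp: svf_def")
 thus ?thesis
  by (rule smooth_on_cong[OF assms(2), rotated])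
   (simp add: vf_apply_pd smooth_on_differentiable_at[OF assms(3,2)])
qed

lemma pd_add: "f differentiable (at x) ==> g differentiable (at x) ==> pd b (%x. f x+g x) x = pd b f x + pd b g x"
 unfolding frechet_derivative_works by (drule (1) has_derivative_add, drule pd_eq[of _ _ _ b]) (simp add: pd_def)

lemma pd_mult:
 fixes f g :: "'a::euclidean_space => real"
 shows "f differentiable (at x) ==> g differentiable (at x) ==>
  pd b (%x. f x*g x) x = f x * pd b g x + pd b f x*g x"
 unfolding frechet_derivative_works by (drule (1) has_derivative_mult, drule pd_eq[of _ _ _ b]) (simp add: pd_def)

lemma pd_const [simp]: "pd b (%x. c) x = 0"
 by (simp add: pd_def frechet_derivative_const)

lemma pd_sum:
 "(!!i. i : I ==> f i differentiable (at x)) ==> pd b (%x. SUM i:I. f i x) x = (SUM i:I. pd b (f i) x)"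
 by (induction I rule: infinite_finite_induct) (auto simp: pd_add)

lemma pd_cmult:
 fixes f :: "'a::euclidean_space => real"
 shows "f differentiable (at x) ==> pd b (%x. c*f x) x = c * pd b f x"
 using pd_mult[of "%_. c" x f b] by simp

lemma vf_apply_add:
 "f differentiable (at x) ==> g differentiable (at x) ==> vf_apply Z (%x. f x+g x) x = vf_apply Z f x + vf_apply Z g x"
 unfolding frechet_derivative_works vf_apply_def by (drule (1) has_derivative_add, drule frechet_derivative_eq) simp

lemma vf_apply_mult:
 "f differentiable (at x) ==> g differentiable (at x) ==>
  vf_apply Z (%x. f x*g x) x = f x * vf_apply Z g x + vf_apply Z f x*g x"
 unfolding frechet_derivative_works vf_apply_def by (drule (1) has_derivative_mult, drule frechet_derivative_eq) simp

lemma vf_apply_const [simp]: "vf_apply Z (%x. c) x = 0"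
 by (simp add: vf_apply_def frechet_derivative_const)

lemma vf_apply_cmult:
 "f differentiable (at x) ==> vf_apply Z (%x. c*f x) x = c * vf_apply Z f x"
 using vf_apply_mult[of "%_. c" x f] by simp

lemma vf_apply_sum:
 "(!!i. i : I ==> f i differentiable (at x)) ==> vf_apply Z (%x. SUM i:I. f i x) x = (SUM i:I. vf_apply Z (f i) x)"
 by (induction I rule: infinite_finite_induct) (auto simp: vf_apply_add)

lemma vf_apply_diff:
 "f differentiable (at x) ==> g differentiable (at x) ==> vf_apply Z (%x. f x - g x) x = vf_apply Z f x - vf_apply Z g x"
 using vf_apply_add[of f x "%x. - 1*g x" Z] vf_apply_cmult[of g x Z "-1"] by simp

lemma vf_apply_zero_open:
 assumes "open S" "x : S" "!!y. y : S ==> f y = 0" shows "vf_apply Z f x = 0"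
 using vf_apply_cong_open[OF assms(1,2), of f "%_. 0"] assms(3) by simp

lemma csm_vf_apply: assumes "svf Z" "csm f" shows "csm (vf_apply Z f)"
proof -
 obtain R where R: "!!x. norm x >= R ==> f x = 0" using assms by (auto simp: csm_def)
 have "vf_apply Z f x = 0" if "norm x >= R+1" for x
  by (rule vf_apply_zero_open[OF open_norm_gt[of R]]) (use that R in auto)
 thus ?thesis using smooth_vf_apply[OF assms(1) open_UNIV csm_smooth[OF assms(2)]] by (auto simp: csm_def)
qed

text \<open>For a field without divergence, \<open>Z (f g)\<close> is the divergence of the
  compactly supported field \<open>f g Z\<close> and has integral zero; the product rule does the
  rest.\<close>

lemma vf_by_parts:
 assumes Z: "svf Z" "!!x. divergence Z x = 0" and f: "smooth_on UNIV f" and g: "csm g"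
 shows "(LINT x|lborel. vf_apply Z f x*g x) = - (LINT x|lborel. f x * vf_apply Z g x)"
proof -
 note sg = csm_smooth[OF g]
 have Zi: "smooth_on UNIV (%x. Z x $ i)" for i using Z(1) by (simp add: svf_def)
 have d: "f differentiable (at x)" "g differentiable (at x)" "(%x. Z x $ i) differentiable (at x)" for x i
  using smooth_on_differentiable_at[OF _ open_UNIV] f sg Zi by auto
 have df: "(%x. f x*g x) differentiable (at x)" for x
  using d by (intro differentiable_mult)
 have c: "csm (%x. Z x $ i*(f x*g x))" for i
  by (intro csm_mult_left Zi f g)
 have "vf_apply Z f x*g x+f x * vf_apply Z g x = (SUM i:UNIV. pdi i (%x. Z x $ i*(f x*g x)) x)" for x
 proof -
  have "(SUM i:UNIV. pdi i (%x. Z x $ i*(f x*g x)) x) =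
   (SUM i:UNIV. Z x $ i * pdi i (%x. f x*g x) x)+divergence Z x*(f x*g x)"
   by (simp only: pd_mult[OF d(3) df] sum.distrib divergence_def sum_distrib_right)
  also have "... = vf_apply Z (%x. f x*g x) x" by (simp add: Z(2) vf_apply_pd[OF df])
  finally show ?thesis by (simp add: vf_apply_mult[OF d(1,2)])
 qed
 hence "(LINT x|lborel. vf_apply Z f x*g x+f x * vf_apply Z g x) =
   (SUM i:UNIV. LINT x|lborel. pdi i (%x. Z x $ i*(f x*g x)) x)"
  by (simp add: int_sum csm_integrable csm_pd c)
 also have "... = 0" by (simp add: integral_pd_zero c)
 finally have "(LINT x|lborel. vf_apply Z f x*g x+f x * vf_apply Z g x) = 0" .
 moreover have "integrable lborel (%x. vf_apply Z f x*g x)" "integrable lborel (%x. f x * vf_apply Z g x)"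
  by (intro csm_integrable csm_mult_left smooth_vf_apply csm_vf_apply Z f g open_UNIV)+
 ultimately show ?thesis by simp
qed

section \<open>Smooth homogeneous functions are polynomials\<close>

inductive_set polyf :: "(real^'n::finite => real) set" where
 polyf_const: "(%x. c) : polyf"
| polyf_coord: "(%x. x $ i) : polyf"
| polyf_add: "f : polyf ==> g : polyf ==> (%x. f x+g x) : polyf"
| polyf_mult: "f : polyf ==> g : polyf ==> (%x. f x*g x) : polyf"

lemma polyf_sum: "(!!i. i : I ==> f i : polyf) ==> (%x. SUM i:I. f i x) : polyf"
 by (induction I rule: infinite_finite_induct) (auto intro: polyf.intros)

lemma smooth_coord: "smooth_on UNIV (%x::real^'n::finite. x $ i)"
 by (rule smooth_on_linear) (auto intro: bounded_linear_vec_nth)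

lemma polyf_smooth: "f : polyf ==> smooth_on UNIV f"
 by (induction rule: polyf.induct) (auto intro: smooth_coord smooth_on_add smooth_on_mult)

lemma pdi_coord: "pdi k (%x. x $ i) x = (if k = i then 1 else 0)"
 using pd_eq[OF bounded_linear_imp_has_derivative[OF bounded_linear_vec_nth[of i]], of "axis k 1" x]
 by (simp add: axis_def)

lemma polyf_pd: "f : polyf ==> pdi k f : polyf"
proof (induction rule: polyf.induct)
 case (polyf_const c) thus ?case using polyf.polyf_const[of 0] by simp
next
 case (polyf_coord i)
 have "pdi k (%x. x $ i) = (%x. if k = i then 1 else 0)" by (auto simp: pdi_coord)
 thus ?case by (simp add: polyf.polyf_const)
next
 case (polyf_add f g)
 have "pdi k (%x. f x+g x) = (%x. pdi k f x + pdi k g x)"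
  using polyf_add.hyps polyf_smooth smooth_on_differentiable_at[OF _ open_UNIV] by (auto intro!: pd_add)
 thus ?case using polyf_add by (simp add: polyf.polyf_add)
next
 case (polyf_mult f g)
 have "pdi k (%x. f x*g x) = (%x. f x * pdi k g x + pdi k f x*g x)"
  using polyf_mult.hyps polyf_smooth smooth_on_differentiable_at[OF _ open_UNIV] by (auto intro!: pd_mult)
 thus ?case using polyf_mult by (simp add: polyf.polyf_add polyf.polyf_mult)
qed

definition homog :: "('n::finite => nat) => nat => (real^'n => real) => bool" where
 "homog sg d f \<longleftrightarrow> (ALL t>0. ALL x. f (dilation sg t x) = t^d*f x)"

lemma dilation_nth [simp]: "dilation sg t x $ i = t ^ sg i*x $ i" by (simp add: dilation_def)

lemma dilation_1 [simp]: "dilation sg 1 x = x" by (simp add: vec_eq_iff)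

lemma dilation_dilation: "dilation sg s (dilation sg t x) = dilation sg (s * t) x"
 by (simp add: vec_eq_iff power_mult_distrib mult.assoc)

lemma dilation_zero [simp]: "dilation sg t 0 = 0" by (simp add: vec_eq_iff)

lemma bounded_linear_dilation: "bounded_linear (dilation sg t :: real^'n::finite => real^'n)"
 unfolding linear_conv_bounded_linear[symmetric] by (rule linearI) (simp_all add: vec_eq_iff algebra_simps)

text \<open>The scaling of a derivative, left multiplied out because \<open>d\<close> may be smaller
  than \<open>sg k\<close>.\<close>

lemma homog_pd_scale:
 assumes f: "smooth_on UNIV f" "homog sg d f" and t: "t > 0"
 shows "t ^ sg k * pdi k f (dilation sg t x) = t^d * pdi k f x"
proof -
 have D: "(f has_derivative frechet_derivative f (at y)) (at y)" for y
  by (rule has_derivative_frechet[OF f(1)]) auto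
 have "((%x. f (dilation sg t x)) has_derivative (%v. frechet_derivative f (at (dilation sg t x)) (dilation sg t v))) (at x)"
  by (rule has_derivative_compose[OF bounded_linear_imp_has_derivative[OF bounded_linear_dilation] D])
 moreover have "(%x. f (dilation sg t x)) = (%x. t^d*f x)" using f(2) t by (auto simp: homog_def)
 ultimately have "pdi k (%x. t^d*f x) x = frechet_derivative f (at (dilation sg t x)) (dilation sg t (axis k 1))"
  using pd_eq by metis
 moreover have "dilation sg t (axis k 1) = t ^ sg k *\<^sub>R axis k 1" by (simp add: vec_eq_iff axis_def)
 moreover have "linear (frechet_derivative f (at y))" for y using D has_derivative_linear by blast
 ultimately show ?thesis
  using pd_cmult[of f x "axis k 1" "t^d"] smooth_on_differentiable_at[OF f(1)] by (simp add: pd_def linear_scale)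
qed

lemma homog_pd:
 assumes f: "smooth_on UNIV f" "homog sg d f" and "sg k <= d"
 shows "homog sg (d - sg k) (pdi k f)"
 unfolding homog_def
proof (intro allI impI)
 fix t x assume t: "(t::real) > 0"
 have "t ^ sg k * pdi k f (dilation sg t x) = t ^ sg k*(t^(d - sg k) * pdi k f x)"
  unfolding homog_pd_scale[OF f t] mult.assoc[symmetric] power_add[symmetric] using assms(3) by simp
 thus "pdi k f (dilation sg t x) = t^(d - sg k) * pdi k f x" using t by simp
qed

lemma dilation_tendsto_0:
 assumes "!!i. sg i >= 1"
 shows "((%t. dilation sg t x) \<longlongrightarrow> 0) (at_right 0)"
proof (rule vec_tendstoI)
 fix i
 have "((%t. t ^ sg i*x $ i) \<longlongrightarrow> 0 ^ sg i*x $ i) (at_right 0)" by (intro tendsto_intros)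
 moreover have "(0::real) ^ sg i = 0" using assms[of i] by simp
 ultimately show "((%t. dilation sg t x $ i) \<longlongrightarrow> 0 $ i) (at_right 0)" by simp
qed

text \<open>The derivative would have negative degree: \<open>pdi k f x\<close> equals a positive
  power of \<open>t\<close> times the value of \<open>pdi k f\<close> at the dilated point, and this
  tends to 0 with \<open>t\<close>.\<close>

lemma homog_pd_zero:
 assumes f: "smooth_on UNIV f" "homog sg d f" and "sg k > d" and sg: "!!i. sg i >= 1"
 shows "pdi k f x = 0"
proof -
 have c: "isCont (pdi k f) 0"
  using smooth_on_continuous[OF smooth_on_pd[OF f(1) axis_Basis]] continuous_on_eq_continuous_at open_UNIV by blast
 have "((%t. t^(sg k - d) * pdi k f (dilation sg t x)) \<longlongrightarrow> 0^(sg k - d) * pdi k f 0) (at_right 0)"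
  by (intro tendsto_intros isCont_tendsto_compose[OF c] dilation_tendsto_0 sg)
 moreover have "\<forall>\<^sub>F t in at_right 0. t^(sg k - d) * pdi k f (dilation sg t x) = pdi k f x"
  unfolding eventually_at_right_field
 proof (intro exI[of _ 1] conjI allI impI)
  fix t :: real assume t: "0 < t" "t < 1"
  have "t^d*(t^(sg k - d) * pdi k f (dilation sg t x)) = t^d * pdi k f x"
   unfolding homog_pd_scale[OF f t(1), of k x, symmetric] mult.assoc[symmetric] power_add[symmetric]
   using assms(3) by simp
  thus "t^(sg k - d) * pdi k f (dilation sg t x) = pdi k f x" using t by simp
 qed simp
 ultimately have "((%t::real. pdi k f x) \<longlongrightarrow> 0^(sg k - d) * pdi k f 0) (at_right 0)"
  by (rule Lim_transform_eventually)
 hence "pdi k f x = 0^(sg k - d) * pdi k f 0"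
  using tendsto_unique[OF _ tendsto_const] trivial_limit_at_right_real by metis
 thus ?thesis using assms(3) by simp
qed

text \<open>Euler's identity with weights: differentiate
  \<open>f (dilation sg t x) = t^d * f x\<close> at \<open>t = 1\<close>.\<close>

lemma homog_euler:
 fixes sg :: "'n::finite => nat"
 assumes f: "smooth_on UNIV f" "homog sg d f"
 shows "(SUM k:UNIV. real (sg k)*(x $ k * pdi k f x)) = d*f x"
proof -
 have Df: "(f has_derivative frechet_derivative f (at x)) (at x)"
  by (rule has_derivative_frechet[OF f(1)]) auto
 have "((%t. dilation sg t x) has_derivative (%h. h *\<^sub>R (\<chi> k. real (sg k)*x $ k))) (at 1)"
 proof (rule has_derivative_componentwise_within[THEN iffD2], rule ballI)
  fix b :: "real^'n" assume "b : Basis"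
  then obtain i where b: "b = axis i 1" by (auto simp: Basis_vec_def)
  have "((%t. t ^ sg i*x $ i) has_derivative (%h. h*(real (sg i)*x $ i))) (at 1)"
   by (auto intro!: derivative_eq_intros)
  thus "((%t. dilation sg t x \<bullet> b) has_derivative (%h. (h *\<^sub>R (\<chi> k. real (sg k)*x $ k)) \<bullet> b)) (at 1)"
   by (simp add: b inner_axis)
 qed
 hence "((%t. f (dilation sg t x)) has_derivative (%h. frechet_derivative f (at x) (h *\<^sub>R (\<chi> k. real (sg k)*x $ k)))) (at 1)"
  using has_derivative_compose[of "%t. dilation sg t x" _ 1 UNIV f] Df by simp
 moreover have "((%t. f (dilation sg t x)) has_derivative (%h. h*(d*f x))) (at 1)"
 proof (rule has_derivative_transform_within_open[of _ _ _ _ "{0<..}"])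
  show "((%t. t^d*f x) has_derivative (%h. h*(d*f x))) (at 1)"
   by (auto intro!: derivative_eq_intros)
 qed (use f(2) in "auto simp: homog_def")
 ultimately have "(%h. frechet_derivative f (at x) (h *\<^sub>R (\<chi> k. real (sg k)*x $ k))) = (%h. h*(d*f x))"
  by (rule has_derivative_unique)
 hence "frechet_derivative f (at x) (1 *\<^sub>R (\<chi> k. real (sg k)*x $ k)) = 1*(d*f x)" by metis
 thus ?thesis
  using frechet_derivative_pd[OF differentiableI[OF Df]]
  by (simp add: sum_Basis_axis inner_axis mult.assoc)
qed

text \<open>Induction on the degree. The partial derivatives have smaller degree or vanish, and
  Euler's identity recovers \<open>f\<close> from them; in degree 0 letting \<open>t\<close> tend to
  0 shows that \<open>f\<close> is constant.\<close>

lemma homog_polyf: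
 assumes sg: "!!i. sg i >= 1"
 shows "smooth_on UNIV f ==> homog sg d f ==> f : polyf"
proof (induction d arbitrary: f rule: less_induct)
 case (less d)
 show ?case
 proof (cases "d = 0")
  case True
  have "f x = f 0" for x
  proof -
   have "isCont f 0" using smooth_on_continuous[OF less.prems(1)] continuous_on_eq_continuous_at open_UNIV by blast
   hence "((%t. f (dilation sg t x)) \<longlongrightarrow> f 0) (at_right 0)"
    by (rule isCont_tendsto_compose) (rule dilation_tendsto_0[OF sg])
   moreover have "\<forall>\<^sub>F t in at_right 0. f (dilation sg t x) = f x"
    unfolding eventually_at_right_field using less.prems(2) True by (auto simp: homog_def intro!: exI[of _ 1])
   ultimately have "((%t::real. f x) \<longlongrightarrow> f 0) (at_right 0)" by (rule Lim_transform_eventually)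
   thus ?thesis using tendsto_unique[OF _ tendsto_const] trivial_limit_at_right_real by metis
  qed
  hence "f = (%x. f 0)" by auto
  thus ?thesis using polyf_const by metis
 next
  case False
  have p: "pdi k f : polyf" for k
  proof (cases "sg k <= d")
   case True
   thus ?thesis
    using less.IH[of "d - sg k" "pdi k f"] sg[of k] False smooth_on_pd[OF less.prems(1) axis_Basis]
    homog_pd[OF less.prems True] by auto
  next
   case False
   hence "pdi k f = (%x. 0)" using homog_pd_zero[OF less.prems _ sg] by fastforce
   thus ?thesis using polyf_const[of 0] by simp
  qed
  have "f = (%x. (1/d)*(SUM k:UNIV. real (sg k)*(x $ k * pdi k f x)))"
   using homog_euler[OF less.prems] False by auto
  also have "... : polyf" by (intro polyf_mult polyf_const polyf_sum polyf_coord p)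
  finally show ?thesis .
 qed
qed

section \<open>Cutoff functions\<close>

lemma cut0_exists:
 "EX c::'a::euclidean_space => real. csm c & (ALL x. 0 <= c x & c x <= 1) &
  (ALL x. norm x <= 1 --> c x = 1) & (ALL x. norm x >= 3/2 --> c x = 0)"
proof -
 obtain s w :: "real => real" where s: "smooth_on UNIV s" "!!t. t <= 1 ==> s t = 1" "!!t. t >= 2 ==> s t = 0"
  "!!t. 0 <= s t" "!!t. s t <= 1" by (rule smooth_step_exists) blast
 define c :: "'a => real" where "c x = s (SUM b:Basis. (x \<bullet> b)*(x \<bullet> b))" for x
 have nn: "(SUM b:Basis. (x \<bullet> b)*(x \<bullet> b)) = (norm x)^2" for x :: 'a
  by (simp add: euclidean_inner[symmetric] power2_norm_eq_inner)
 have "smooth_on UNIV (%x::'a. SUM b:Basis. (x \<bullet> b)*(x \<bullet> b))"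
  by (intro smooth_on_sum smooth_on_mult smooth_on_linear open_UNIV bounded_linear_inner_left)
 hence sm: "smooth_on UNIV c"
  unfolding c_def by (rule smooth_on_comp[OF open_UNIV open_UNIV _ s(1), rotated]) auto
 have 0: "c x = 0" if "norm x >= 3/2" for x
 proof -
  \<comment> \<open>The step is applied to the squared norm and ends at 2; the radius 3/2 suffices
    since 9/4 exceeds 2.\<close>
  have "(3/2)^2 <= (norm x)^2" using that by (intro power_mono) auto
  thus ?thesis unfolding c_def nn by (intro s(3)) (simp add: power2_eq_square)
 qed
 have 1: "c x = 1" if "norm x <= 1" for x
 proof -
  have "(norm x)^2 <= 1^2" using that by (intro power_mono) auto
  thus ?thesis unfolding c_def nn by (intro s(2)) simp
 qed
 show ?thesis
  by (intro exI[of _ c] conjI allI impI csm_def[THEN iffD2] sm exI[of _ "3/2"])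
   (use 0 1 s(4,5) in "auto simp: c_def")
qed

definition cut0 :: "'a::euclidean_space => real" where
 "cut0 = (SOME c. csm c & (ALL x. 0 <= c x & c x <= 1) &
  (ALL x. norm x <= 1 --> c x = 1) & (ALL x. norm x >= 3/2 --> c x = 0))"

lemma cut0:
 fixes x :: "'a::euclidean_space"
 shows "csm (cut0 :: 'a::euclidean_space => real)" "0 <= cut0 x" "cut0 x <= 1"
 "norm x <= 1 ==> cut0 x = 1" "norm x >= 3/2 ==> cut0 x = 0"
 using someI_ex[OF cut0_exists[where 'a='a]] unfolding cut0_def[symmetric] by auto

text \<open>All cutoffs are rescalings of one function, so bounds for their derivatives of order
  \<open>k\<close> are \<open>r^-k\<close> times constants independent of centre and radius.\<close>

definition cutoff :: "'a::euclidean_space => real => 'a => real" where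
 "cutoff y r x = cut0 ((1/r) *\<^sub>R (x - y))"

lemma cutoff:
 assumes "r > 0"
 shows "0 <= cutoff y r x" "cutoff y r x <= 1"
  "dist y x <= r ==> cutoff y r x = 1" "dist y x >= 3/2*r ==> cutoff y r x = 0"
proof -
 have n: "norm ((1/r) *\<^sub>R (x - y)) = dist y x/r" using assms by (simp add: dist_norm norm_minus_commute)
 show "0 <= cutoff y r x" "cutoff y r x <= 1" by (simp_all add: cutoff_def cut0)
 show "dist y x <= r ==> cutoff y r x = 1"
  unfolding cutoff_def by (rule cut0(4)) (simp only: n, use assms in simp)
 show "dist y x >= 3/2*r ==> cutoff y r x = 0"
  unfolding cutoff_def by (rule cut0(5)) (simp only: n, use assms in \<open>simp add: field_simps\<close>)
qed

lemma has_derivative_scale_shift: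
 "((%x. c *\<^sub>R (x - y)) has_derivative (%v. c *\<^sub>R v)) (at x)"
 by (auto intro!: derivative_eq_intros)

lemma csm_cutoff: assumes "r > 0" shows "csm (cutoff y r :: 'a::euclidean_space => real)"
proof -
 have "smooth_on UNIV (cutoff y r)"
  unfolding cutoff_def
  by (rule smooth_on_affine[OF open_UNIV open_UNIV _ has_derivative_scale_shift csm_smooth[OF cut0(1)]]) auto
 moreover have "cutoff y r x = 0" if "norm x >= norm y+3/2*r" for x
  using that norm_triangle_ineq2[of x y] by (intro cutoff(4)[OF assms]) (simp add: dist_norm norm_minus_commute)
 ultimately show ?thesis unfolding csm_def by blast
qed

lemma pd_scale_shift:
 assumes "smooth_on UNIV f"
 shows "pd b (%x. f (c *\<^sub>R (x - y))) x = c *\<^sub>R pd b f (c *\<^sub>R (x - y))"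
proof -
 let ?D = "frechet_derivative f (at (c *\<^sub>R (x - y)))"
 have D: "(f has_derivative ?D) (at (c *\<^sub>R (x - y)))"
  by (rule has_derivative_frechet[OF assms]) auto
 have "linear ?D" using D has_derivative_linear by blast
 thus ?thesis
  using pd_eq[OF has_derivative_compose[OF has_derivative_scale_shift D], of b]
  by (simp add: pd_def linear_scale)
qed

lemma pd_cutoff: "pd b (cutoff y r) x = (1/r) * pd b cut0 ((1/r) *\<^sub>R (x - y))"
 using pd_scale_shift[OF csm_smooth[OF cut0(1)], of b "1/r" y x] by (simp add: cutoff_def[abs_def])

lemma pd_pd_cutoff:
 assumes "b : Basis"
 shows "pd c (pd b (cutoff y r)) x = (1/r)^2 * pd c (pd b cut0) ((1/r) *\<^sub>R (x - y))"
proof -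
 have s: "smooth_on UNIV (pd b (cut0 :: 'a => real))"
  using assms smooth_on_pd csm_smooth[OF cut0(1)] by blast
 have s2: "smooth_on UNIV (%x. pd b (cut0 :: 'a => real) ((1/r) *\<^sub>R (x - y)))"
  by (rule smooth_on_affine[OF open_UNIV open_UNIV _ has_derivative_scale_shift s]) auto
 have "pd b (cutoff y r) = (%x. (1/r) * pd b cut0 ((1/r) *\<^sub>R (x - y)))" by (auto simp: pd_cutoff)
 hence "pd c (pd b (cutoff y r)) x = (1/r) * pd c (%x. pd b cut0 ((1/r) *\<^sub>R (x - y))) x"
  by (simp only:) (rule pd_cmult, rule differentiableI, rule has_derivative_frechet[OF s2], auto)
 thus ?thesis by (simp add: pd_scale_shift[OF s] power2_eq_square)
qed

lemma smooth_on_cut_mult: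
 fixes f g :: "'a::euclidean_space => real"
 assumes "smooth_on UNIV g" "open S" "smooth_on S f" "closed K" "K <= S" "!!x. x ~: K ==> g x = 0"
 shows "smooth_on UNIV (%x. g x*f x)"
proof (rule smooth_on_UN_local[OF open_UNIV])
 fix x
 show "EX T. open T & x : T & smooth_on T (%x. g x*f x)"
 proof (cases "x : K")
  case True
  thus ?thesis using assms
   by (intro exI[of _ S]) (auto intro: smooth_on_mult smooth_on_subset)
 next
  case False
  have "smooth_on (-K) (%x. g x*f x)"
   by (rule smooth_on_cong[where f = "%x. 0"]) (use assms in auto)
  thus ?thesis using False assms(4) by (intro exI[of _ "-K"]) auto
 qed
qed

section \<open>Positive integrals and interior maxima\<close>

lemma integral_pos_cont:
 fixes g :: "'a::euclidean_space => real"
 assumes "continuous_on UNIV g" "integrable lborel g" "!!x. g x >= 0" "g y > 0"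
 shows "(LINT x|lborel. g x) > 0"
proof -
 have "isCont g y" using assms(1) by (simp add: continuous_on_eq_continuous_at)
 then obtain d where d: "d > 0" "!!x. dist x y < d ==> dist (g x) (g y) < g y/2"
  using assms(4) unfolding continuous_at_eps_delta by (metis half_gt_zero)
 have "g y/2*indicator (ball y d) x <= g x" for x
 proof (cases "x : ball y d")
  case True
  hence "dist (g x) (g y) < g y/2" using d(2) by (simp add: dist_commute)
  hence "abs (g x - g y) < g y/2" by (simp add: dist_real_def)
  hence "g y/2 <= g x" by arith
  thus ?thesis using True by simp
 qed (use assms(3) in auto)
 hence "(LINT x|lborel. g y/2*indicator (ball y d) x) <= (LINT x|lborel. g x)"
  by (intro integral_mono assms(2) integrable_mult_right integrable_real_indicator)
   (auto intro: emeasure_bounded_finite[unfolded infinity_ennreal_def])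
 moreover have "measure lborel (ball y d) > 0"
  using content_ball_pos[OF d(1), of y] by (simp add: measure_completion)
 hence "g y*measure lborel (ball y d) > 0" using assms(4) by (rule mult_pos_pos[rotated])
 ultimately show ?thesis by simp
qed

text \<open>The differential of \<open>f\<close> vanishes at the maximum, so replacing
  \<open>Z\<close> by the constant field \<open>Z x\<close> does not change \<open>Z (Z f)\<close>
  at \<open>x\<close>. The result is a second derivative along a line; were it positive,
  \<open>f\<close> would exceed \<open>f x\<close> on that line.\<close>

lemma vf_interior_max:
 fixes Z :: "real^'n::finite => real^'n"
 assumes Z: "svf Z" and W: "open W" "x : W" and f: "smooth_on W f" and mx: "!!y. y : W ==> f y <= f x"
 shows "vf_apply Z (vf_apply Z f) x <= 0"
proof (rule ccontr)
 assume neg: "~ ?thesis"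
 define v where "v = Z x"
 define psi where "psi = vf_apply (%_. v) f"
 have cs: "svf (%_::real^'n. v)" by (simp add: svf_def)
 have fd: "f differentiable (at y)" if "y : W" for y using smooth_on_differentiable_at[OF f W(1) that] .
 have D0: "frechet_derivative f (at x) = (%h. 0)"
  using differential_zero_maxmin[of x W f] W mx has_derivative_frechet[OF f W] by blast
 have spsi: "smooth_on W psi" unfolding psi_def by (rule smooth_vf_apply[OF cs W(1) f])
 have pf: "smooth_on W (pdi i f)" for i by (rule smooth_on_pd[OF f axis_Basis])
 have sZ: "smooth_on W (%y. Z y $ i+(- v $ i))" for i
  by (intro smooth_on_add W(1) smooth_on_const) (use Z smooth_on_subset[OF _ subset_UNIV] in "auto simp: svf_def")
 let ?R = "%y. SUM i:UNIV. (Z y $ i+(- v $ i)) * pdi i f y"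
 have eq: "vf_apply Z f y = psi y+?R y" if "y : W" for y
  by (simp add: psi_def vf_apply_pd[OF fd[OF that]] algebra_simps sum_subtractf sum.distrib[symmetric])
 have sR: "smooth_on W (%y. (Z y $ i+(- v $ i)) * pdi i f y)" for i
  by (intro smooth_on_mult W(1) sZ pf)
 have "vf_apply Z ?R x = (SUM i:UNIV. vf_apply Z (%y. (Z y $ i+(- v $ i)) * pdi i f y) x)"
  by (rule vf_apply_sum) (rule smooth_on_differentiable_at[OF sR W])
 also have "... = 0"
 proof (rule sum.neutral, rule ballI)
  fix i
  have "pdi i f x = 0" by (simp add: pd_def D0)
  thus "vf_apply Z (%y. (Z y $ i+(- v $ i)) * pdi i f y) x = 0"
   by (subst vf_apply_mult[OF smooth_on_differentiable_at[OF sZ W] smooth_on_differentiable_at[OF pf W]])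
    (simp add: v_def)
 qed
 finally have R0: "vf_apply Z ?R x = 0" .
 have "vf_apply Z (vf_apply Z f) x = vf_apply Z (%y. psi y+?R y) x"
  by (rule vf_apply_cong_open[OF W eq])
 also have "... = vf_apply Z psi x"
  using R0 smooth_on_differentiable_at[OF spsi W] smooth_on_differentiable_at[OF smooth_on_sum[OF W(1) sR] W]
  by (subst vf_apply_add) auto
 finally have pos: "frechet_derivative psi (at x) v > 0" using neg by (simp add: vf_apply_def v_def)
 obtain e where e: "e > 0" "ball x e <= W" using W openE by blast
 have vne: "v ~= 0"
 proof
  assume "v = 0"
  hence "frechet_derivative psi (at x) v = 0"
   using has_derivative_frechet[OF spsi W] has_derivative_linear linear_0 by metis
  thus False using pos by simp
 qed
 define T where "T = e/norm v"
 have T: "T > 0" using e vne by (simp add: T_def)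
 have inW: "x + t *\<^sub>R v : W" if "abs t < T" for t
 proof -
  have "norm (t *\<^sub>R v) < e" using that vne by (simp add: T_def field_simps)
  thus ?thesis using e(2) by (auto simp: subset_iff dist_norm)
 qed
 have line: "((%t. h (x + t *\<^sub>R v)) has_real_derivative frechet_derivative h (at (x + t *\<^sub>R v)) v) (at t)"
  if h: "smooth_on W h" and t: "abs t < T" for h :: "real^'n => real" and t
 proof -
  have Dh: "(h has_derivative frechet_derivative h (at (x + t *\<^sub>R v))) (at (x + t *\<^sub>R v))"
   by (rule has_derivative_frechet[OF h W(1) inW[OF t]])
  have "((%t. x + t *\<^sub>R v) has_derivative (%s. s *\<^sub>R v)) (at t)" by (auto intro!: derivative_eq_intros)
  from has_derivative_compose[OF this Dh]
  have "((%t. h (x + t *\<^sub>R v)) has_derivative (%s. frechet_derivative h (at (x + t *\<^sub>R v)) (s *\<^sub>R v))) (at t)" .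
  moreover have "linear (frechet_derivative h (at (x + t *\<^sub>R v)))" using Dh has_derivative_linear by blast
  ultimately show ?thesis by (simp add: has_field_derivative_def linear_scale mult_commute_abs)
 qed
 have g1: "((%t. f (x + t *\<^sub>R v)) has_real_derivative psi (x + t *\<^sub>R v)) (at t)" if "abs t < T" for t
  using line[OF f that] by (simp add: psi_def vf_apply_def)
 have "((%t. psi (x + t *\<^sub>R v)) has_real_derivative frechet_derivative psi (at x) v) (at 0)"
  using line[OF spsi, of 0] T by simp
 then obtain d where d: "d > 0" "!!h. 0 < h ==> h < d ==> psi (x+0 *\<^sub>R v) < psi (x+(0+h) *\<^sub>R v)"
  using DERIV_pos_inc_right[OF _ pos] by blast
 have psi0: "psi x = 0" by (simp add: psi_def vf_apply_def D0)
 define h where "h = min d T/2"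
 have h: "0 < h" "h < d" "h < T" using d(1) T by (auto simp: h_def)
 obtain z where z: "0 < z" "z < h" "f (x+h *\<^sub>R v) - f (x+0 *\<^sub>R v) = (h - 0) * psi (x+z *\<^sub>R v)"
  using MVT2[OF h(1), of "%t. f (x + t *\<^sub>R v)" "%t. psi (x + t *\<^sub>R v)"] g1 h by auto
 have "psi (x+z *\<^sub>R v) > 0" using d(2)[of z] z h psi0 by simp
 hence "h * psi (x+z *\<^sub>R v) > 0" using h(1) by simp
 hence "f (x+h *\<^sub>R v) > f x" using z(3) by simp
 moreover have "f (x+h *\<^sub>R v) <= f x" using mx inW[of h] h by simp
 ultimately show False by simp
qed

section \<open>Brackets of polynomial fields\<close>

lemma frechet_derivative_nth:
 assumes "Z differentiable (at x)"
 shows "frechet_derivative Z (at x) v $ i = frechet_derivative (%x. Z x $ i) (at x) v"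
 using frechet_derivative_eq[OF bounded_linear.has_derivative[OF bounded_linear_vec_nth frechet_derivative_works[THEN iffD1, OF assms]], of i]
 by simp

lemma svf_differentiable: "svf Z ==> Z differentiable (at x)"
proof -
 assume Z: "svf Z"
 have "(Z has_derivative (%v. \<chi> i. frechet_derivative (%x. Z x $ i) (at x) v)) (at x)"
 proof (rule has_derivative_componentwise_within[THEN iffD2], rule ballI)
  fix b :: "real^'a" assume "b : Basis"
  then obtain i where b: "b = axis i 1" by (auto simp: Basis_vec_def)
  have "((%x. Z x $ i) has_derivative frechet_derivative (%x. Z x $ i) (at x)) (at x)"
   by (rule has_derivative_frechet[where S=UNIV]) (use Z in "auto simp: svf_def")
  thus "((%x. Z x \<bullet> b) has_derivative (%v. (\<chi> i. frechet_derivative (%x. Z x $ i) (at x) v) \<bullet> b)) (at x)"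
   by (simp add: b inner_axis)
 qed
 thus ?thesis by (rule differentiableI)
qed

lemma lie_bracket_nth:
 assumes "svf Y" "svf Z"
 shows "lie_bracket Y Z x $ i = vf_apply Y (%x. Z x $ i) x - vf_apply Z (%x. Y x $ i) x"
 by (simp add: lie_bracket_def vf_apply_def frechet_derivative_nth svf_differentiable assms)

definition pvf :: "(real^'n::finite => real^'n) => bool" where
 "pvf Z \<longleftrightarrow> (ALL i. (%x. Z x $ i) : polyf)"

lemma pvf_svf: "pvf Z ==> svf Z"
 by (simp add: pvf_def svf_def polyf_smooth)

lemma polyf_diff: "f : polyf ==> g : polyf ==> (%x. f x - g x) : polyf"
 using polyf_add[OF _ polyf_mult[OF polyf_const[of "-1"]], of f g] by simp

lemma polyf_vf_apply: assumes "pvf Z" "f : polyf" shows "vf_apply Z f : polyf"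
proof -
 have "vf_apply Z f = (%x. SUM i:UNIV. Z x $ i * pdi i f x)"
  using vf_apply_pd[OF smooth_on_differentiable_at[OF polyf_smooth[OF assms(2)] open_UNIV UNIV_I]] by auto
 also have "... : polyf"
  by (intro polyf_sum polyf_mult polyf_pd assms) (use assms in "auto simp: pvf_def")
 finally show ?thesis .
qed

lemma pvf_lie_bracket: "pvf Y ==> pvf Z ==> pvf (lie_bracket Y Z)"
 by (simp add: pvf_def[of "lie_bracket Y Z"] lie_bracket_nth pvf_svf)
  (auto intro!: polyf_diff polyf_vf_apply simp: pvf_def)

section \<open>Homogeneous sums of squares\<close>

text \<open>\<open>i0\<close> is a coordinate of weight 1; the square of \<open>x $ i0\<close> will
  be the explicit function on which \<open>L\<close> is a positive constant.\<close>

locale hvf =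
 fixes X :: "nat => real^'n::finite => real^'n" and m :: nat and sg :: "'n => nat" and i0 :: 'n
 assumes smX: "!!j. j : {1..m} ==> smooth_on UNIV (X j)"
  and homX: "!!j. j : {1..m} ==> vf_homogeneous_1 sg (X j)"
  and hor: "hormander_condition m X"
  and sig1: "!!i. sg i >= 1" and sigi0: "sg i0 = 1"
begin

abbreviation L :: "(real^'n => real) => real^'n => real" where "L \<equiv> sum_of_squares m X"

abbreviation XX :: "nat => (real^'n => real) => real^'n => real" where "XX j \<equiv> vf_apply (X j)"

lemma svfX: "j : {1..m} ==> svf (X j)"
 unfolding svf_def by (intro allI smooth_on_bounded_linear[OF open_UNIV bounded_linear_vec_nth smX])

text \<open>Homogeneity of the field is tested on the coordinate function \<open>x $ i\<close>,
  which has degree \<open>sg i\<close>.\<close>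

lemma homog_comp:
 assumes "j : {1..m}" shows "homog sg (sg i - 1) (%x. X j x $ i)"
 unfolding homog_def
proof (intro allI impI)
 fix t :: real and x assume t: "t > 0"
 have d: "XX j (%x. x $ i) x = X j x $ i" for x
  by (simp add: vf_apply_pd smooth_on_differentiable_at[OF smooth_coord] pdi_coord if_distrib[of "(*) _"] cong: if_cong)
 have "XX j ((%x. x $ i) \<circ> dilation sg t) x = t*XX j (%x. x $ i) (dilation sg t x)"
  using homX[OF assms] t smooth_coord[of i] unfolding vf_homogeneous_1_def by blast
 moreover have "(%x. x $ i) \<circ> dilation sg t = (%x. t ^ sg i*x $ i)" by (auto simp: fun_eq_iff)
 moreover have "XX j (%x. t ^ sg i*x $ i) x = t ^ sg i*XX j (%x. x $ i) x"
  by (rule vf_apply_cmult) (rule smooth_on_differentiable_at[OF smooth_coord], auto)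
 ultimately have "t*X j (dilation sg t x) $ i = t ^ sg i*X j x $ i" by (simp add: d)
 also have "... = t*(t^(sg i - 1)*X j x $ i)"
  using sig1[of i] by (simp add: power_Suc[symmetric] del: power_Suc)
 finally show "X j (dilation sg t x) $ i = t^(sg i - 1)*X j x $ i" using t by simp
qed

lemma pvfX: "j : {1..m} ==> pvf (X j)"
 unfolding pvf_def using homog_polyf[OF sig1 _ homog_comp] svfX by (auto simp: svf_def)

text \<open>The \<open>i\<close>-th coefficient has degree \<open>sg i - 1\<close>, less than the
  weight of \<open>x $ i\<close>, so its derivative in that variable vanishes. This is what makes
  \<open>L\<close> formally self-adjoint.\<close>

lemma divX: assumes "j : {1..m}" shows "divergence (X j) x = 0"
proof -
 have "pdi i (%y. X j y $ i) x = 0" for i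
  by (rule homog_pd_zero[OF _ homog_comp[OF assms] _ sig1])
   (use svfX[OF assms] sig1[of i] in "auto simp: svf_def")
 thus ?thesis by (simp add: divergence_def)
qed

lemma L_cong_open:
 assumes "open S" "x : S" "!!y. y : S ==> f y = g y" shows "L f x = L g x"
 unfolding sum_of_squares_def
 by (intro sum.cong refl vf_apply_cong_open[OF assms(1,2)]) (rule vf_apply_cong_open[OF assms(1) _ assms(3)])

lemma smooth_XX: "j : {1..m} ==> open S ==> smooth_on S f ==> smooth_on S (XX j (XX j f))"
 by (intro smooth_vf_apply svfX)

lemma smooth_L: "open S ==> smooth_on S f ==> smooth_on S (L f)"
 unfolding sum_of_squares_def[abs_def] by (intro smooth_on_sum smooth_XX)

lemma csm_L: "csm f ==> csm (L f)"
 unfolding sum_of_squares_def[abs_def] by (intro csm_sum csm_vf_apply svfX)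

lemma L_add:
 assumes "open S" "x : S" "smooth_on S f" "smooth_on S g"
 shows "L (%x. f x+g x) x = L f x+L g x"
proof -
 have *: "XX j (XX j (%x. f x+g x)) x =
  XX j (XX j f) x+XX j (XX j g) x" if j: "j : {1..m}" for j
 proof -
  have "XX j (XX j (%x. f x+g x)) x =
   XX j (%x. XX j f x+XX j g x) x"
   by (rule vf_apply_cong_open[OF assms(1,2)])
    (simp add: vf_apply_add smooth_on_differentiable_at[OF assms(3,1)] smooth_on_differentiable_at[OF assms(4,1)])
  also have "... = XX j (XX j f) x+XX j (XX j g) x"
   by (rule vf_apply_add) (use smooth_on_differentiable_at[OF smooth_vf_apply[OF svfX[OF j] assms(1)] assms(1,2)] assms(3,4) in auto)
  finally show ?thesis .
 qed
 show ?thesis unfolding sum_of_squares_def sum.distrib[symmetric] by (rule sum.cong[OF refl *])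
qed

lemma L_mult:
 assumes "open S" "x : S" "smooth_on S f" "smooth_on S g"
 shows "L (%x. f x*g x) x = f x*L g x+2*(SUM j=1..m. XX j f x*XX j g x)+L f x*g x"
proof -
 have *: "XX j (XX j (%x. f x*g x)) x =
  f x*XX j (XX j g) x+2*(XX j f x*XX j g x) +
  XX j (XX j f) x*g x" if j: "j : {1..m}" for j
 proof -
  have d: "f differentiable (at x)" "g differentiable (at x)"
   "XX j f differentiable (at x)" "XX j g differentiable (at x)"
   using smooth_on_differentiable_at[OF _ assms(1,2)] assms(3,4) smooth_vf_apply[OF svfX[OF j] assms(1)] by auto
  have "XX j (XX j (%x. f x*g x)) x =
   XX j (%x. f x*XX j g x+XX j f x*g x) x"
   by (rule vf_apply_cong_open[OF assms(1,2)])
    (simp add: vf_apply_mult smooth_on_differentiable_at[OF assms(3,1)] smooth_on_differentiable_at[OF assms(4,1)])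
  also have "... = XX j (%x. f x*XX j g x) x+XX j (%x. XX j f x*g x) x"
   using d by (intro vf_apply_add differentiable_mult)
  finally show ?thesis using d by (simp add: vf_apply_mult)
 qed
 show ?thesis unfolding sum_of_squares_def sum_distrib_left sum_distrib_right sum.distrib[symmetric]
  by (rule sum.cong[OF refl *])
qed

lemma L_const [simp]: "L (%x. c) x = 0"
proof -
 have "XX j (%x. c) = (%x. 0)" for j by (simp add: fun_eq_iff)
 thus ?thesis by (simp add: sum_of_squares_def)
qed

lemma L_cmult:
 "open S ==> x : S ==> smooth_on S g ==> L (%x. c*g x) x = c*L g x"
 using L_mult[of S x "%_. c" g] by simp

lemma X_by_parts:
 "j : {1..m} ==> smooth_on UNIV f ==> csm g ==>
 (LINT x|lborel. XX j f x*g x) = - (LINT x|lborel. f x*XX j g x)"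
 by (rule vf_by_parts[OF svfX divX])

lemma L_form:
 assumes f: "smooth_on UNIV f" and g: "csm g"
 shows "(LINT x|lborel. L f x*g x) = - (SUM j=1..m. LINT x|lborel. XX j f x*XX j g x)"
proof -
 have i: "integrable lborel (%x. XX j (XX j f) x*g x)" if "j : {1..m}" for j
  by (intro csm_integrable csm_mult_left smooth_XX g f open_UNIV that)
 have "(LINT x|lborel. L f x*g x) = (SUM j=1..m. LINT x|lborel. XX j (XX j f) x*g x)"
  unfolding sum_of_squares_def sum_distrib_right by (rule int_sum[OF i])
 also have "... = (SUM j=1..m. - (LINT x|lborel. XX j f x*XX j g x))"
  by (intro sum.cong refl X_by_parts smooth_vf_apply svfX f g open_UNIV)
 finally show ?thesis by (simp add: sum_negf)
qed

lemma L_symm: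
 assumes f: "smooth_on UNIV f" and g: "csm g"
 shows "(LINT x|lborel. L f x*g x) = (LINT x|lborel. f x*L g x)"
proof -
 have i: "integrable lborel (%x. f x*XX j (XX j g) x)" if "j : {1..m}" for j
  by (intro csm_integrable csm_mult_left csm_vf_apply svfX f g that)
 have "(LINT x|lborel. f x*L g x) = (SUM j=1..m. LINT x|lborel. f x*XX j (XX j g) x)"
  unfolding sum_of_squares_def sum_distrib_left by (rule int_sum[OF i])
 also have "... = (SUM j=1..m. - (LINT x|lborel. XX j f x*XX j g x))"
  by (intro sum.cong refl) (subst X_by_parts[OF _ f csm_vf_apply[OF svfX g]], auto)
 finally show ?thesis by (simp add: L_form[OF f g] sum_negf)
qed

text \<open>This coefficient has degree 0, and its partial derivatives would have negative
  degree.\<close>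

lemma comp_i0: assumes "j : {1..m}" shows "X j x $ i0 = X j 0 $ i0"
proof -
 have s: "smooth_on UNIV (%x. X j x $ i0)" using svfX[OF assms] by (simp add: svf_def)
 have "((%x. X j x $ i0) has_derivative (%h. 0)) (at y)" for y
 proof -
  have "pdi k (%x. X j x $ i0) y = 0" for k
   by (rule homog_pd_zero[OF s homog_comp[OF assms] _ sig1]) (use sig1[of k] sigi0 in simp)
  hence "frechet_derivative (%x. X j x $ i0) (at y) = (%h. 0)"
   by (simp add: fun_eq_iff frechet_derivative_pd[OF smooth_on_differentiable_at[OF s]] sum_Basis_axis)
  thus ?thesis using has_derivative_frechet[OF s, of y] by simp
 qed
 then obtain c where "!!x. X j x $ i0 = c"
  using has_derivative_zero_constant[of UNIV "%x. X j x $ i0"] by auto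
 thus ?thesis by metis
qed

lemma Lie_pvf: "Z : Lie_generated (X ` {1..m}) ==> pvf Z"
proof (induction rule: Lie_generated.induct)
 case (generator Z) thus ?case using pvfX by auto
next
 case (add Y Z) thus ?case by (auto simp: pvf_def intro: polyf_add)
next
 case (scale Z c) thus ?case by (auto simp: pvf_def intro: polyf_mult polyf_const)
next
 case (bracket Y Z) thus ?case by (rule_tac pvf_lie_bracket)
qed (auto simp: pvf_def intro: polyf_const)

definition c0 :: real where "c0 = (SUM j=1..m. (X j 0 $ i0)^2)"

text \<open>If no \<open>X j\<close> had a component along \<open>i0\<close>, the same would hold
  for all brackets, and the rank condition would fail at the origin.\<close>

lemma c0_pos: "c0 > 0"
proof (rule ccontr)
 assume "~ c0 > 0"
 moreover have "c0 >= 0" by (auto simp: c0_def intro: sum_nonneg)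
 ultimately have "c0 = 0" by linarith
 hence z: "X j 0 $ i0 = 0" if "j : {1..m}" for j
  using that unfolding c0_def by (subst (asm) sum_nonneg_eq_0_iff) auto
 have "Z : Lie_generated (X ` {1..m}) ==> (%x. Z x $ i0) = (%x. 0)" for Z
 proof (induction rule: Lie_generated.induct)
  case (generator Z) thus ?case using comp_i0 z by (auto simp: fun_eq_iff)
 next
  case (add Y Z) thus ?case by (simp add: fun_eq_iff)
 next
  case (bracket Y Z)
  thus ?case using pvf_svf[OF Lie_pvf] by (simp add: fun_eq_iff lie_bracket_nth)
 qed (auto simp: fun_eq_iff)
 hence "(%Z. Z 0) ` Lie_generated (X ` {1..m}) <= {v. axis i0 1 \<bullet> v = 0}"
  by (auto simp: inner_axis' fun_eq_iff)
 hence "dim ((%Z. Z 0) ` Lie_generated (X ` {1..m})) <= dim {v::real^'n. axis i0 1 \<bullet> v = 0}"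
  by (rule dim_subset)
 also have "... = CARD('n) - 1" by (simp add: dim_hyperplane axis_eq_0_iff)
 also have "... < CARD('n)" by simp
 finally show False using hor by (simp add: hormander_condition_def)
qed

lemma L_x0_sq: "L (%x. x $ i0*x $ i0) x = 2 * c0"
proof -
 have v: "XX j (%x. x $ i0) = (%x. X j 0 $ i0)" if "j : {1..m}" for j
  using comp_i0[OF that]
  by (simp add: fun_eq_iff vf_apply_pd smooth_on_differentiable_at[OF smooth_coord] pdi_coord if_distrib[of "(*) _"] cong: if_cong)
 have "L (%x. x $ i0) x = 0" unfolding sum_of_squares_def by (rule sum.neutral) (simp add: v)
 thus ?thesis
  using L_mult[OF open_UNIV UNIV_I smooth_coord smooth_coord, of i0 i0 x]
  by (simp add: v c0_def power2_eq_square)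
qed

text \<open>Adding a small multiple of the square of \<open>x $ i0\<close> makes \<open>L\<close>
  strictly positive, which \<open>vf_interior_max\<close> excludes at an interior maximum.\<close>

lemma weak_max_principle:
 assumes W: "open W" "bounded W" and u: "smooth_on W u" "continuous_on (closure W) u"
  and sub: "!!x. x : W ==> L u x >= 0" and bd: "!!x. x : frontier W ==> u x <= c" and x: "x : W"
 shows "u x <= c"
proof (rule ccontr)
 assume "~ u x <= c"
 hence gap: "u x - c > 0" by simp
 have "bounded (closure W)" using W(2) by (rule bounded_closure)
 then obtain B where B: "B > 0" "!!y. y : closure W ==> norm y <= B" by (auto simp: bounded_pos)
 \<comment> \<open>The added term is then at most half of the gap on \<open>closure W\<close>, too
   little to move the maximum to the boundary.\<close>
 define ep where "ep = (u x - c)/(2*B^2)"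
 have ep: "ep > 0" using gap B(1) by (simp add: ep_def)
 define v where "v y = u y+ep*(y $ i0*y $ i0)" for y
 have q: "0 <= ep*(y $ i0*y $ i0)" "ep*(y $ i0*y $ i0) <= (u x - c)/2" if "y : closure W" for y
 proof -
  have "abs (y $ i0) <= B" using component_le_norm_cart[of y i0] B(2)[OF that] by linarith
  hence "(y $ i0)^2 <= B^2" using power_mono[of "abs (y $ i0)" B 2] by simp
  hence "ep*(y $ i0*y $ i0) <= ep*B^2" using ep by (simp add: power2_eq_square)
  also have "... = (u x - c)/2" using B(1) by (simp add: ep_def)
  finally show "ep*(y $ i0*y $ i0) <= (u x - c)/2" .
 qed (use ep in auto)
 have cv: "continuous_on (closure W) v"
  unfolding v_def by (intro continuous_intros u)
 have "compact (closure W)" "closure W ~= {}" using W x by (auto simp: compact_closure)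
 then obtain y where y: "y : closure W" "!!z. z : closure W ==> v z <= v y"
  using continuous_attains_sup[OF _ _ cv] by blast
 have "v y >= u x" using y(2)[of x] q(1)[of x] x closure_subset[of W] by (force simp: v_def)
 have "y ~: frontier W"
 proof
  assume f: "y : frontier W"
  have "v y <= c+(u x - c)/2" unfolding v_def by (rule add_mono[OF bd[OF f] q(2)[OF y(1)]])
  thus False using \<open>v y >= u x\<close> gap by argo
 qed
 hence yW: "y : W" using y(1) W(1) by (simp add: frontier_def interior_open)
 have sq: "smooth_on W (%y. y $ i0*y $ i0)"
  using smooth_on_subset[OF smooth_on_mult[OF open_UNIV smooth_coord smooth_coord]] by blast
 have sq': "smooth_on W (%y. ep*(y $ i0*y $ i0))" by (intro smooth_on_mult W sq smooth_on_const)
 have sv: "smooth_on W v" unfolding v_def by (intro smooth_on_add W u sq')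
 have "L v y = L u y+ep*(2 * c0)"
  unfolding v_def by (simp add: L_add[OF W(1) yW u(1) sq'] L_cmult[OF W(1) yW sq] L_x0_sq)
 hence "L v y > 0" using sub[OF yW] ep c0_pos by (simp add: add_nonneg_pos)
 moreover have "L v y <= 0"
  unfolding sum_of_squares_def
  by (intro sum_nonpos vf_interior_max[OF svfX W(1) yW sv]) (use y(2) closure_subset in auto)
 ultimately show False by simp
qed

end

section \<open>A priori estimates by Kohn's commutators\<close>

text \<open>The linear approximation is uniform for base points in a ball, as needed to
  differentiate under the integral of a convolution.\<close>

lemma smooth_unif_diff:
 fixes u :: "real^'n::finite => real"
 assumes u: "smooth_on UNIV u" and e: "e > 0"
 obtains d where "d > 0" "!!y v. norm y <= R ==> norm v < d ==>
  abs (u (y + v) - u y - (SUM i:UNIV. v $ i * pdi i u y)) <= e*norm v"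
proof -
 define e' where "e' = e/real CARD('n)"
 have e': "e' > 0" using e by (simp add: e'_def)
 have "EX d>0. ALL y:cball 0 (R+1). ALL z:cball 0 (R+1). dist z y < d --> dist (pdi i u z) (pdi i u y) < e'" for i
 proof -
  have "continuous_on (cball 0 (R+1)) (pdi i u)"
   by (rule continuous_on_subset[OF smooth_on_continuous[OF smooth_on_pd[OF u axis_Basis]]]) simp
  hence "uniformly_continuous_on (cball 0 (R+1)) (pdi i u)"
   by (rule compact_uniformly_continuous) simp
  thus ?thesis using e' by (simp add: uniformly_continuous_on_def)
 qed
 then obtain d where d: "!!i. d i > 0"
  "!!i y z. y : cball 0 (R+1) ==> z : cball 0 (R+1) ==> dist z y < d i ==> dist (pdi i u z) (pdi i u y) < e'"
  by metis
 define de where "de = min 1 (Min (range d))"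
 have de: "de > 0" "de <= 1" "!!i. de <= d i" using d(1) by (auto simp: de_def min.coboundedI2)
 show ?thesis
 proof (rule that[OF de(1)])
  fix y v :: "real^'n" assume y: "norm y <= R" and v: "norm v < de"
  define g where "g s = u (y + s *\<^sub>R v) - s*(SUM i:UNIV. v $ i * pdi i u y)" for s
  have g: "(g has_real_derivative (SUM i:UNIV. v $ i * pdi i u (y + s *\<^sub>R v)) - (SUM i:UNIV. v $ i * pdi i u y)) (at s)" for s
  proof -
   have Du: "(u has_derivative frechet_derivative u (at (y + s *\<^sub>R v))) (at (y + s *\<^sub>R v))"
    by (rule has_derivative_frechet[OF u]) auto
   have "((%s. y + s *\<^sub>R v) has_derivative (%h. h *\<^sub>R v)) (at s)" by (auto intro!: derivative_eq_intros)
   from has_derivative_compose[OF this Du]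
   have "((%s. u (y + s *\<^sub>R v)) has_derivative (%h. frechet_derivative u (at (y + s *\<^sub>R v)) (h *\<^sub>R v))) (at s)" .
   moreover have "frechet_derivative u (at (y + s *\<^sub>R v)) (h *\<^sub>R v) = (SUM i:UNIV. v $ i * pdi i u (y + s *\<^sub>R v))*h" for h
    using frechet_derivative_pd[OF differentiableI[OF Du], of "h *\<^sub>R v"]
    by (simp add: sum_Basis_axis inner_axis sum_distrib_left mult_ac)
   ultimately have "((%s. u (y + s *\<^sub>R v)) has_real_derivative (SUM i:UNIV. v $ i * pdi i u (y + s *\<^sub>R v))) (at s)"
    by (simp add: has_field_derivative_def)
   thus ?thesis unfolding g_def by (auto intro!: derivative_eq_intros)
  qed
  obtain s where s: "0 < s" "s < 1" "g 1 - g 0 = (1 - 0) *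
    ((SUM i:UNIV. v $ i * pdi i u (y + s *\<^sub>R v)) - (SUM i:UNIV. v $ i * pdi i u y))"
   using MVT2[of 0 1 g, OF _ g] by auto
  have sv: "norm (s *\<^sub>R v) <= norm v" using s by (simp add: mult_left_le_one_le)
  have "u (y + v) - u y - (SUM i:UNIV. v $ i * pdi i u y) = g 1 - g 0" by (simp add: g_def)
  also have "... = (SUM i:UNIV. v $ i*(pdi i u (y + s *\<^sub>R v) - pdi i u y))"
   using s(3) by (simp add: sum_subtractf[symmetric] algebra_simps)
  finally have eq: "u (y + v) - u y - (SUM i:UNIV. v $ i * pdi i u y) =
   (SUM i:UNIV. v $ i*(pdi i u (y + s *\<^sub>R v) - pdi i u y))" .
  have "abs (u (y + v) - u y - (SUM i:UNIV. v $ i * pdi i u y)) <=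
   (SUM i:UNIV. abs (v $ i*(pdi i u (y + s *\<^sub>R v) - pdi i u y)))"
   unfolding eq by (rule sum_abs)
  also have "... <= (SUM i:(UNIV::'n set). norm v * e')"
  proof (rule sum_mono)
   fix i
   have "dist (pdi i u (y + s *\<^sub>R v)) (pdi i u y) < e'"
   proof (rule d(2))
    show "y : cball 0 (R+1)" using y by simp
    show "y + s *\<^sub>R v : cball 0 (R+1)"
    using norm_triangle_ineq[of y "s *\<^sub>R v"] y v sv de(2) by simp
    show "dist (y + s *\<^sub>R v) y < d i" using sv v de(3)[of i] by (simp add: dist_norm)
   qed
   hence "abs (pdi i u (y + s *\<^sub>R v) - pdi i u y) <= e'" by (simp add: dist_real_def)
   thus "abs (v $ i*(pdi i u (y + s *\<^sub>R v) - pdi i u y)) <= norm v * e'"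
    unfolding abs_mult by (intro mult_mono component_le_norm_cart) auto
  qed
  also have "... = e*norm v" by (simp add: e'_def)
  finally show "abs (u (y + v) - u y - (SUM i:UNIV. v $ i * pdi i u y)) <= e*norm v" .
 qed
qed

text \<open>\<open>n\<close>-fold divergences of functions supported in the unit ball.\<close>

primrec Dn :: "nat => (real^'n::finite => real) => bool" where
 "Dn 0 psi \<longleftrightarrow> smooth_on UNIV psi & (ALL z. norm z > 1 --> psi z = 0)"
| "Dn (Suc n) psi \<longleftrightarrow> (EX f. (ALL i. Dn n (f i)) & psi = (%z. SUM i:UNIV. pdi i (f i) z))"

lemma Dn_pd_0: "Dn 0 psi ==> Dn 0 (pdi i psi)"
 using pd_zero_open[OF open_norm_gt[of 1]] smooth_on_pd[OF _ axis_Basis] by auto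

lemma Dn_add_0: "Dn 0 psi ==> Dn 0 phi ==> Dn 0 (%z. psi z + phi z)"
 by (auto intro: smooth_on_add)

lemma Dn_sum_0: "(!!i. i : I ==> Dn 0 (f i)) ==> Dn 0 (%z. SUM i:I. f i z)"
 by (induction I rule: infinite_finite_induct) (auto intro: smooth_on_add)

lemma Dn_base: "Dn n psi ==> Dn 0 psi"
proof (induction n arbitrary: psi)
 case (Suc n)
 then obtain f where f: "!!i. Dn n (f i)" "psi = (%z. SUM i:UNIV. pdi i (f i) z)" by auto
 show ?case unfolding f(2) by (intro Dn_sum_0 Dn_pd_0 Suc.IH f(1))
qed

lemma Dn_smooth: "Dn n psi ==> smooth_on UNIV psi" using Dn_base by fastforce

lemma Dn_diff: "Dn n psi ==> psi differentiable (at x)"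
 using smooth_on_differentiable_at[OF Dn_smooth open_UNIV] by blast

lemma Dn_csm: "Dn n psi ==> csm psi"
 using Dn_base[of n psi] unfolding csm_def by (auto intro!: exI[of _ 2])

lemma Dn_zero [simp]: "Dn n (%z. 0)"
 by (induction n) (auto intro!: exI[of _ "%i z. 0"])

lemma Dn_add: "Dn n psi ==> Dn n phi ==> Dn n (%z. psi z + phi z)"
proof (induction n arbitrary: psi phi)
 case 0 thus ?case by (rule Dn_add_0)
next
 case (Suc n)
 then obtain f g where f: "!!i. Dn n (f i)" "psi = (%z. SUM i:UNIV. pdi i (f i) z)"
  and g: "!!i. Dn n (g i)" "phi = (%z. SUM i:UNIV. pdi i (g i) z)" by auto
 thus ?case
  by (auto intro!: exI[of _ "%i z. f i z+g i z"] Suc.IH simp: pd_add[OF Dn_diff[OF f(1)] Dn_diff[OF g(1)]] sum.distrib)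
qed

lemma Dn_cmult: "Dn n psi ==> Dn n (%z. c * psi z)"
proof (induction n arbitrary: psi)
 case 0 thus ?case by (auto intro: smooth_on_mult)
next
 case (Suc n)
 then obtain f where f: "!!i. Dn n (f i)" "psi = (%z. SUM i:UNIV. pdi i (f i) z)" by auto
 thus ?case
  by (auto intro!: exI[of _ "%i z. c*f i z"] Suc.IH simp: pd_cmult[OF Dn_diff[OF f(1)]] sum_distrib_left)
qed

lemma Dn_mono1: "Dn (Suc n) psi ==> Dn n psi"
proof (induction n arbitrary: psi)
 case 0 thus ?case using Dn_base by blast
next
 case (Suc n)
 then obtain f where f: "!!i. Dn (Suc n) (f i)" "psi = (%z. SUM i:UNIV. pdi i (f i) z)" by auto
 thus ?case using Suc.IH by (auto intro!: exI[of _ f])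
qed

lemma Dn_mono: "Dn n psi ==> k <= n ==> Dn k psi"
proof (induction n)
 case (Suc n)
 thus ?case using Dn_mono1[OF Suc.prems(1)] by (cases "k = Suc n") (auto simp del: Dn.simps)
qed simp

lemma Dn_pd: "Dn n psi ==> Dn (Suc n) (pdi i psi)"
proof -
 assume a: "Dn n psi"
 let ?f = "%k. if k = i then psi else (%z. 0)"
 have "pdi k (?f k) z = (if k = i then pdi i psi z else 0)" for k z by simp
 hence "pdi i psi = (%z. SUM k:UNIV. pdi k (?f k) z)" by (simp add: fun_eq_iff)
 thus ?thesis using a by (auto intro!: exI[of _ ?f])
qed

text \<open>A coordinate costs one order: \<open>z $ k\<close> times a divergence is the divergence
  of the multiplied functions minus the single function \<open>f k\<close>.\<close>

lemma Dn_coord: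
 fixes psi :: "real^'n::finite => real"
 shows "Dn n psi ==> Dn (n - 1) (%z. z $ k * psi z)"
proof (induction n arbitrary: psi)
 case 0 thus ?case by (auto intro: smooth_on_mult smooth_coord)
next
 case (Suc n)
 then obtain f where f: "!!i. Dn n (f i)" "psi = (%z. SUM i:UNIV. pdi i (f i) z)" by auto
 show ?case
 proof (cases n)
  case 0
  have "Dn 0 psi" using Suc.prems Dn_base by blast
  thus ?thesis using 0 by (auto intro: smooth_on_mult smooth_coord)
 next
  case (Suc n')
  have d: "(%z. z $ k) differentiable (at z)" for z :: "real^'n" using smooth_on_differentiable_at[OF smooth_coord] by auto
  have "pdi i (%z. z $ k*f i z) z = z $ k * pdi i (f i) z+(if i = k then f k z else 0)" for i z
   by (simp add: pd_mult[OF d Dn_diff[OF f(1)]] pdi_coord)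
  hence "(%z. z $ k * psi z) = (%z. (SUM i:UNIV. pdi i (%z. z $ k*f i z) z)+(-1)*f k z)"
   by (simp add: fun_eq_iff f(2) sum.distrib sum_distrib_left)
  moreover have "Dn n (%z. SUM i:UNIV. pdi i (%z. z $ k*f i z) z)"
   using Suc.IH[OF f(1)] unfolding Suc by (auto intro!: exI[of _ "%i z. z $ k*f i z"])
  ultimately show ?thesis using Dn_add[OF _ Dn_cmult[OF f(1), of "-1" k]] by (simp del: Dn.simps)
 qed
qed

text \<open>Convolution with the kernel rescaled to size \<open>h\<close>, in substituted form. It
  keeps its meaning at \<open>h = 0\<close>, where it is \<open>u x\<close> times the integral of
  \<open>psi\<close>; the proof of the gradient bound starts from this value.\<close>

definition conv :: "(real^'n::finite => real) => real => (real^'n => real) => real^'n => real" where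
 "conv psi h u x = (LINT z|lborel. psi z*u (x - h *\<^sub>R z))"

lemma conv_integrable:
 assumes "csm psi" "continuous_on UNIV u"
 shows "integrable lborel (%z. psi z*u (x - h *\<^sub>R z))"
proof -
 obtain R where R: "!!x. norm x >= R ==> psi x = 0" using assms by (auto simp: csm_def)
 show ?thesis
  by (rule integrable_cont_supp[of _ R])
   (use R in "auto intro!: continuous_on_mult[OF csm_continuous[OF assms(1)]] continuous_on_compose2[OF assms(2)] continuous_intros")
qed

lemma conv_add_right:
 "csm psi ==> continuous_on UNIV u ==> continuous_on UNIV v ==>
 conv psi h (%x. u x + v x) x = conv psi h u x + conv psi h v x"
 unfolding conv_def by (subst int_add[symmetric]) (auto intro: conv_integrable simp: algebra_simps)

lemma conv_sum_left:
 "finite I ==> (!!i. i : I ==> csm (f i)) ==> continuous_on UNIV u ==>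
 conv (%z. SUM i:I. f i z) h u x = (SUM i:I. conv (f i) h u x)"
 unfolding conv_def sum_distrib_right by (rule int_sum) (auto intro: conv_integrable)

lemma conv_cmult_left: "conv (%z. c * psi z) h u x = c * conv psi h u x"
 unfolding conv_def by (simp add: mult.assoc)

lemma conv_has_derivative:
 assumes p: "csm psi" and u: "smooth_on UNIV u"
 shows "(conv psi h u has_derivative (%v. SUM i:UNIV. v $ i * conv psi h (pdi i u) x)) (at x)"
 unfolding has_derivative_at_alt
proof (intro conjI allI impI)
 show "bounded_linear (%v. SUM i:UNIV. v $ i * conv psi h (pdi i u) x)"
  by (intro bounded_linear_sum bounded_linear_mult_left bounded_linear_compose[OF bounded_linear_mult_left bounded_linear_vec_nth])
 obtain R where R: "!!x. norm x >= R ==> psi x = 0" using p by (auto simp: csm_def)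
 define I where "I = (LINT z|lborel. abs (psi z))"
 have ip: "integrable lborel (%z. abs (psi z))" using csm_integrable[OF p] by simp
 have I0: "I >= 0" unfolding I_def by simp
 fix e :: real assume e: "e > 0"
 hence e1: "e/(I+1) > 0" using I0 by simp
 obtain d where d: "d > 0" "!!y v. norm y <= norm x+abs h*abs R ==> norm v < d ==>
  abs (u (y + v) - u y - (SUM i:UNIV. v $ i * pdi i u y)) <= e/(I+1)*norm v"
  by (rule smooth_unif_diff[OF u e1, of "norm x+abs h*abs R"]) blast
 have cu: "continuous_on UNIV u" by (rule smooth_on_continuous[OF u])
 have cpu: "continuous_on UNIV (pdi i u)" for i by (rule smooth_on_continuous[OF smooth_on_pd[OF u axis_Basis]])
 show "EX d>0. ALL y. norm (y - x) < d -->
  norm (conv psi h u y - conv psi h u x - (SUM i:UNIV. (y - x) $ i * conv psi h (pdi i u) x)) <= e*norm (y - x)"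
 proof (intro exI[of _ d] conjI d(1) allI impI)
  fix y assume y: "norm (y - x) < d"
  let ?E = "%z. u (y - h *\<^sub>R z) - u (x - h *\<^sub>R z) - (SUM i:UNIV. (y - x) $ i * pdi i u (x - h *\<^sub>R z))"
  have "conv psi h u y - conv psi h u x - (SUM i:UNIV. (y - x) $ i * conv psi h (pdi i u) x) = (LINT z|lborel. psi z*?E z)"
  proof -
   have "(SUM i:UNIV. (y - x) $ i * conv psi h (pdi i u) x) =
    (LINT z|lborel. (SUM i:UNIV. (y - x) $ i*(psi z * pdi i u (x - h *\<^sub>R z))))"
    unfolding conv_def
    by (subst int_sum) (auto intro!: conv_integrable p cpu)
   moreover have "integrable lborel (%z. (SUM i:UNIV. (y - x) $ i*(psi z * pdi i u (x - h *\<^sub>R z))))"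
    by (intro intb_sum integrable_mult_right conv_integrable p cpu)
   ultimately have "conv psi h u y - conv psi h u x - (SUM i:UNIV. (y - x) $ i * conv psi h (pdi i u) x) =
    (LINT z|lborel. psi z*u (y - h *\<^sub>R z) - psi z*u (x - h *\<^sub>R z) - (SUM i:UNIV. (y - x) $ i*(psi z * pdi i u (x - h *\<^sub>R z))))"
    unfolding conv_def using conv_integrable[OF p cu] by simp
   also have "... = (LINT z|lborel. psi z*?E z)"
    by (intro int_cong refl) (simp add: algebra_simps sum_distrib_left)
   finally show ?thesis .
  qed
  also have "norm ... <= (LINT z|lborel. abs (psi z)*(e/(I+1)*norm (y - x)))"
  proof (rule int_norm_bound)
   have c: "continuous_on UNIV ?E"
    by (intro continuous_intros continuous_on_compose2[OF cu] continuous_on_compose2[OF cpu]) auto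
   show "integrable lborel (%z. psi z*?E z)"
    by (rule integrable_cont_supp[of _ R]) (use R c in "auto intro!: continuous_on_mult[OF csm_continuous[OF p]]")
   show "integrable lborel (%z. abs (psi z)*(e/(I+1)*norm (y - x)))" using ip by (rule integrable_mult_left)
   show "norm (psi z*?E z) <= abs (psi z)*(e/(I+1)*norm (y - x))" for z
   proof (cases "norm z >= R")
    case False
    hence "norm z <= abs R" by linarith
    hence "abs h*norm z <= abs h*abs R" by (rule mult_left_mono) simp
    hence "norm (x - h *\<^sub>R z) <= norm x+abs h*abs R"
    using norm_triangle_ineq4[of x "h *\<^sub>R z"] by simp
    from d(2)[OF this y] have "abs (?E z) <= e/(I+1)*norm (y - x)" by (simp add: algebra_simps)
    thus ?thesis unfolding real_norm_def abs_mult by (intro mult_left_mono) auto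
   qed (simp add: R)
  qed
  also have "... = I/(I+1)*(e*norm (y - x))" by (simp add: I_def mult_ac)
  also have "... <= 1*(e*norm (y - x))" using I0 e by (intro mult_right_mono) auto
  finally show "norm (conv psi h u y - conv psi h u x - (SUM i:UNIV. (y - x) $ i * conv psi h (pdi i u) x)) <= e*norm (y - x)"
   by simp
 qed
qed

lemma pdi_conv: "csm psi ==> smooth_on UNIV u ==> pdi i (conv psi h u) x = conv psi h (pdi i u) x"
 using pd_eq[OF conv_has_derivative, of psi u "axis i 1" h x]
 by (simp add: axis_def if_distrib[of "%c. c*_"] cong: if_cong)

lemma smooth_conv:
 assumes "csm psi" "smooth_on UNIV u" shows "smooth_on UNIV (conv psi h u)"
proof -
 have "Ck_on k UNIV (conv psi h u)" for k
  using assms(2)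
 proof (induction k arbitrary: u)
  case 0
  thus ?case using has_derivative_continuous[OF conv_has_derivative[OF assms(1)]]
   by (simp add: continuous_at_imp_continuous_on)
 next
  case (Suc k)
  show ?case
  proof (rule Ck_on_SucI[OF open_UNIV conv_has_derivative[OF assms(1) Suc.prems]])
   fix b :: "real^'a" assume "b : Basis"
   show "Ck_on k UNIV (%x. SUM i:UNIV. b $ i * conv psi h (pdi i u) x)"
    by (intro Ck_on_sum Ck_on_mult Ck_on_const open_UNIV Suc.IH smooth_on_pd Suc.prems axis_Basis)
  qed
 qed
 thus ?thesis by (simp add: smooth_on_def)
qed

text \<open>Integration by parts in \<open>z\<close>. A derivative on the kernel is worth a factor
  \<open>h\<close>, which is how divergence form turns into powers of \<open>h\<close>.\<close>

lemma conv_pd_left: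
 assumes p: "csm psi" and u: "smooth_on UNIV u"
 shows "conv (pdi i psi) h u x = h * conv psi h (pdi i u) x"
proof -
 have D: "((%z. x - h *\<^sub>R z) has_derivative (%v. (-h) *\<^sub>R v)) (at z)" for z :: "real^'a"
  by (auto intro!: derivative_eq_intros)
 have s: "smooth_on UNIV (%z. u (x - h *\<^sub>R z))"
  by (rule smooth_on_affine[OF open_UNIV open_UNIV _ D u]) auto
 have pd: "pdi i (%z. u (x - h *\<^sub>R z)) z = - h * pdi i u (x - h *\<^sub>R z)" for z
 proof -
  have Du: "(u has_derivative frechet_derivative u (at (x - h *\<^sub>R z))) (at (x - h *\<^sub>R z))"
   by (rule has_derivative_frechet[OF u]) auto
  show ?thesis
   using pd_eq[OF has_derivative_compose[OF D Du], of "axis i 1"] linear_scale[OF has_derivative_linear[OF Du], of "-h" "axis i 1"]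
   by (simp add: pd_def)
 qed
 have c: "csm (%z. psi z*u (x - h *\<^sub>R z))" by (rule csm_mult_right[OF p s])
 have "0 = (LINT z|lborel. pdi i (%z. psi z*u (x - h *\<^sub>R z)) z)"
  by (simp add: integral_pd_zero[OF c])
 also have "... = (LINT z|lborel. - h*(psi z * pdi i u (x - h *\<^sub>R z)) + pdi i psi z*u (x - h *\<^sub>R z))"
  by (intro int_cong refl)
   (simp add: pd_mult smooth_on_differentiable_at[OF csm_smooth[OF p]] smooth_on_differentiable_at[OF s] pd)
 also have "... = - h * conv psi h (pdi i u) x + conv (pdi i psi) h u x"
  unfolding conv_def
  by (subst int_add)
   (auto intro!: conv_integrable integrable_mult_right csm_pd p smooth_on_continuous[OF u]
    smooth_on_continuous[OF smooth_on_pd[OF u axis_Basis]])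
 finally show ?thesis by simp
qed

lemma conv_coord:
 assumes p: "csm psi" and u: "continuous_on UNIV u"
 shows "conv psi h (%y. y $ k*u y) x = x $ k * conv psi h u x - h * conv (%z. z $ k * psi z) h u x"
proof -
 have "integrable lborel (%z. x $ k*(psi z*u (x - h *\<^sub>R z)))"
  by (intro integrable_mult_right conv_integrable p u)
 moreover have "integrable lborel (%z. h*((z $ k * psi z)*u (x - h *\<^sub>R z)))"
  by (intro integrable_mult_right conv_integrable csm_mult_left smooth_coord p u)
 ultimately show ?thesis
  unfolding conv_def
  by (subst int_mult0[symmetric] , subst int_mult0[symmetric],
    subst int_diff[symmetric]) (auto simp: algebra_simps)
qed

lemma conv_local:
 assumes "Dn 0 psi" "h > 0" "!!y. dist y0 y < r ==> u y = 0" "dist y0 x < r - h"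
 shows "conv psi h u x = 0"
proof -
 have "psi z*u (x - h *\<^sub>R z) = 0" for z
 proof (cases "norm z > 1")
  case False
  hence "norm (h *\<^sub>R z) <= h" using assms(2) by simp
  hence "dist y0 (x - h *\<^sub>R z) < r"
   using assms(4) dist_triangle[of y0 "x - h *\<^sub>R z" x] by (simp add: dist_norm)
  thus ?thesis using assms(3) by simp
 qed (use assms(1) in auto)
 hence "(%z. psi z*u (x - h *\<^sub>R z)) = (%z. 0)" by (simp only: fun_eq_iff) blast
 thus ?thesis unfolding conv_def by (simp only: Bochner_Integration.integral_zero)
qed

lemma lborel_integral_affine:
 fixes f :: "'a::euclidean_space => real"
 assumes "f : borel_measurable borel" "c ~= 0"
 shows "(LINT x|lborel. f x) = abs c^DIM('a)*(LINT x|lborel. f (t + c *\<^sub>R x))"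
proof -
 have "(LINT x|lborel. f x) = (LINT x|density (distr lborel borel (%x. t + c *\<^sub>R x)) (%_. abs c^DIM('a)). f x)"
  using lborel_affine[OF assms(2), of t] by simp
 also have "... = (LINT x|distr lborel borel (%x. t + c *\<^sub>R x). abs c^DIM('a) *\<^sub>R f x)"
  using assms(1) by (subst integral_density) auto
 also have "... = (LINT x|lborel. abs c^DIM('a) *\<^sub>R f (t + c *\<^sub>R x))"
  using assms(1) by (subst integral_distr) auto
 finally show ?thesis by simp
qed

lemma integrable_indicator_cont:
 fixes f :: "'a::euclidean_space => real"
 assumes "continuous_on UNIV f" "bounded A" "A : sets borel"
 shows "integrable lborel (%x. indicator A x*f x)"
proof -
 obtain R where R: "!!x. x : A ==> norm x <= R" using assms(2) by (auto simp: bounded_iff)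
 have "integrable lborel (%x. indicator (cball 0 R) x *\<^sub>R f x)"
  by (rule borel_integrable_compact) (use continuous_on_subset[OF assms(1)] in auto)
 hence "integrable lborel (%x. (indicator (cball 0 R) x *\<^sub>R f x)*indicator A x)"
  by (rule integrable_real_mult_indicator[rotated]) (use assms(3) in simp)
 moreover have "(%x. (indicator (cball 0 R) x *\<^sub>R f x)*indicator A x) = (%x. indicator A x*f x)"
  using R by (auto simp: indicator_def fun_eq_iff)
 ultimately show ?thesis by simp
qed

text \<open>Undoing the substitution brings in the factor \<open>h^-N\<close>, \<open>N\<close> the
  dimension. From this crude bound by the local mass the bootstrap starts.\<close>

lemma conv_bound:
 fixes u :: "real^'n::finite => real"
 assumes p: "Dn 0 psi" and B: "!!z. abs (psi z) <= B" and h: "h > 0" and u: "continuous_on UNIV u"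
  and x: "dist y0 x < r - h"
 shows "abs (conv psi h u x) <= B/h^CARD('n)*(LINT y|lborel. indicator (ball y0 r) y*abs (u y))"
proof -
 let ?f = "%y. indicator (ball y0 r) y*abs (u y)"
 have B0: "B >= 0" using B[of 0] by linarith
 have fi: "integrable lborel ?f"
  by (rule integrable_indicator_cont) (auto intro: continuous_intros u)
 have fm: "?f : borel_measurable borel" using borel_measurable_integrable[OF fi] by simp
 have cp: "csm psi" using Dn_csm[OF p] .
 have int_aff: "integrable lborel (%z. ?f (x+(-h) *\<^sub>R z))"
 proof -
  have "integrable (density (distr lborel borel (%z. x+(-h) *\<^sub>R z)) (%_. abs (-h)^DIM(real^'n))) ?f"
   using fi lborel_affine[of "-h" x] h by simp
  hence "integrable (distr lborel borel (%z. x+(-h) *\<^sub>R z)) (%y. abs (-h)^DIM(real^'n) *\<^sub>R ?f y)"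
   by (subst (asm) integrable_density) (use fm in auto)
  hence "integrable lborel (%z. abs (-h)^DIM(real^'n) *\<^sub>R ?f (x+(-h) *\<^sub>R z))"
   by (subst (asm) integrable_distr_eq) (use fm in auto)
  thus ?thesis using h by simp
 qed
 have "abs (conv psi h u x) <= (LINT z|lborel. B*?f (x+(-h) *\<^sub>R z))"
  unfolding conv_def
 proof (subst real_norm_def[symmetric], rule int_norm_bound[OF conv_integrable[OF cp u] integrable_mult_right[OF int_aff]])
  fix z
  show "norm (psi z*u (x - h *\<^sub>R z)) <= B*?f (x+(-h) *\<^sub>R z)"
  proof (cases "norm z > 1")
   case False
   hence "norm (h *\<^sub>R z) <= h" using h by simp
   hence "dist y0 (x - h *\<^sub>R z) < r"
    using x dist_triangle[of y0 "x - h *\<^sub>R z" x] by (simp add: dist_norm)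
   thus ?thesis using B[of z] by (simp add: abs_mult mult_right_mono)
  next
   case True
   hence "psi z = 0" using p by simp
   thus ?thesis using B0 by simp
  qed
 qed
 also have "... = B*(1/h^CARD('n)*(LINT y|lborel. ?f y))"
  using lborel_integral_affine[OF fm, of "-h" x] h by simp
 finally show ?thesis by simp
qed

type_synonym 'n smop = "real => (real^'n => real) => real^'n => real"

text \<open>Convolution operators at scale \<open>h\<close> that gain \<open>n\<close> powers of \<open>h\<close> on smooth functions.\<close>

inductive Gop :: "nat => 'n::finite smop => bool" where
 Gop_base: "Dn k psi ==> n <= k+w ==> Gop n (%h u x. h^w * conv psi h u x)"
| Gop_mult: "a : polyf ==> Gop n G ==> Gop n (%h u x. a x*G h u x)"
| Gop_add: "Gop n G ==> Gop n G' ==> Gop n (%h u x. G h u x+G' h u x)"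

lemma Gop_conv: "Dn n psi ==> Gop n (%h u x. conv psi h u x)"
 using Gop_base[of n psi n 0] by simp

lemma Gop_zero: "Gop n (%h u x. 0)"
 using Gop_mult[OF polyf_const[of 0] Gop_conv[OF Dn_zero]] by simp

lemma Gop_cmult: "Gop n G ==> Gop n (%h u x. c*G h u x)"
 using Gop_mult[OF polyf_const] by blast

lemma Gop_diff: "Gop n G ==> Gop n G' ==> Gop n (%h u x. G h u x - G' h u x)"
 using Gop_add[OF _ Gop_cmult[of n G' "-1"]] by simp

lemma Gop_sum: "(!!i. i : I ==> Gop n (G i)) ==> Gop n (%h u x. SUM i:I. G i h u x)"
 by (induction I rule: infinite_finite_induct) (auto intro: Gop_zero Gop_add)

lemma Gop_mono: "Gop n G ==> k <= n ==> Gop k G"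
 by (induction rule: Gop.induct) (auto intro: Gop.intros)

lemma Gop_h: "Gop n G ==> Gop (Suc n) (%h u x. h*G h u x)"
proof (induction rule: Gop.induct)
 case (Gop_base k psi n w)
 thus ?case using Gop.Gop_base[of k psi "Suc n" "Suc w"] by (simp add: mult.assoc)
next
 case (Gop_mult a n G)
 thus ?case using Gop.Gop_mult[OF Gop_mult.hyps(1) Gop_mult.IH] by (simp add: mult.left_commute)
next
 case (Gop_add n G G')
 thus ?case using Gop.Gop_add[OF Gop_add.IH] by (simp add: distrib_left)
qed

lemma Gop_smooth: "Gop n G ==> smooth_on UNIV u ==> smooth_on UNIV (G h u)"
proof (induction rule: Gop.induct)
 case (Gop_base k psi n w)
 show ?case by (rule smooth_on_mult[OF open_UNIV smooth_on_const smooth_conv[OF Dn_csm[OF Gop_base(1)] Gop_base(3)]])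
next
 case (Gop_mult a n G)
 show ?case by (rule smooth_on_mult[OF open_UNIV polyf_smooth[OF Gop_mult.hyps(1)] Gop_mult.IH[OF Gop_mult.prems]])
next
 case (Gop_add n G G')
 show ?case by (rule smooth_on_add[OF open_UNIV Gop_add.IH(1)[OF Gop_add.prems] Gop_add.IH(2)[OF Gop_add.prems]])
qed

lemma Gop_differentiable: "Gop n G ==> smooth_on UNIV u ==> G h u differentiable (at x)"
 using smooth_on_differentiable_at[OF Gop_smooth] by auto

lemma Gop_add_arg:
 assumes "Gop n G" "continuous_on UNIV u" "continuous_on UNIV v"
 shows "G h (%x. u x + v x) x = G h u x+G h v x"
 using assms by (induction rule: Gop.induct) (auto simp: conv_add_right Dn_csm algebra_simps)

lemma Gop_zero_arg: "Gop n G ==> G h (%x. 0) x = 0"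
 by (induction rule: Gop.induct) (auto simp: conv_def)

lemma Gop_sum_arg:
 assumes "Gop n G" "!!i. i : I ==> continuous_on UNIV (u i)"
 shows "G h (%x. SUM i:I. u i x) x = (SUM i:I. G h (u i) x)"
 using assms(2)
 by (induction I rule: infinite_finite_induct)
  (auto simp: Gop_add_arg[OF assms(1)] Gop_zero_arg[OF assms(1)] continuous_on_sum)

lemma Gop_local:
 assumes "Gop n G" "h > 0" "!!y. dist y0 y < r ==> u y = 0" "dist y0 x < r - h"
 shows "G h u x = 0"
 using assms(1)
proof (induction rule: Gop.induct)
 case (Gop_base k psi n w)
 thus ?case using conv_local[OF Dn_base[OF Gop_base(1)] assms(2-4)] by simp
qed simp_all

text \<open>An outer derivative, once multiplied by \<open>h\<close>, can be moved onto the kernel,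
  where it does not lower the order.\<close>

lemma Gop_pdi:
 assumes "Gop n G"
 shows "EX G'. Gop n G' & (ALL h u x. h > 0 --> smooth_on UNIV u --> h * pdi i (G h u) x = G' h u x)"
 using assms
proof (induction rule: Gop.induct)
 case (Gop_base k psi n w)
 have p: "Dn k (pdi i psi)" using Dn_mono1[OF Dn_pd[OF Gop_base(1)]] .
 show ?case
 proof (intro exI[of _ "%h u x. h^w * conv (pdi i psi) h u x"] conjI allI impI)
  show "Gop n (%h u x. h^w * conv (pdi i psi) h u x)" using Gop.Gop_base[OF p Gop_base(2)] .
  fix h :: real and u :: "real^'a => real" and x assume u: "smooth_on UNIV u"
  show "h * pdi i (%x. h^w * conv psi h u x) x = h^w * conv (pdi i psi) h u x"
   using pd_cmult[OF smooth_on_differentiable_at[OF smooth_conv[OF Dn_csm[OF Gop_base(1)] u] open_UNIV UNIV_I]]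
   by (simp add: pdi_conv conv_pd_left Dn_csm[OF Gop_base(1)] u)
 qed
next
 case (Gop_mult a n G)
 then obtain G' where G': "Gop n G'" "!!h u x. h > 0 ==> smooth_on UNIV u ==> h * pdi i (G h u) x = G' h u x" by blast
 let ?H = "%h u x. a x*G' h u x + pdi i a x*(h*G h u x)"
 show ?case
 proof (intro exI[of _ ?H] conjI allI impI)
  show "Gop n ?H"
   using Gop.Gop_mult[OF Gop_mult.hyps(1) G'(1)] Gop_mono[OF Gop.Gop_mult[OF polyf_pd[OF Gop_mult.hyps(1)] Gop_h[OF Gop_mult.hyps(2)]], of n]
   by (intro Gop_add) auto
  fix h :: real and u :: "real^'a => real" and x assume h: "h > 0" and u: "smooth_on UNIV u"
  have "h * pdi i (%x. a x*G h u x) x = a x*(h * pdi i (G h u) x) + pdi i a x*(h*G h u x)"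
   by (subst pd_mult) (auto simp: algebra_simps intro: Gop_differentiable[OF Gop_mult.hyps(2) u]
    smooth_on_differentiable_at[OF polyf_smooth[OF Gop_mult.hyps(1)]])
  thus "h * pdi i (%x. a x*G h u x) x = ?H h u x" using G'(2)[OF h u] by simp
 qed
next
 case (Gop_add n G1 G2)
 then obtain H1 H2 where H: "Gop n H1" "!!h u x. h > 0 ==> smooth_on UNIV u ==> h * pdi i (G1 h u) x = H1 h u x"
  "Gop n H2" "!!h u x. h > 0 ==> smooth_on UNIV u ==> h * pdi i (G2 h u) x = H2 h u x" by blast
 show ?case
  by (rule exI[of _ "%h u x. H1 h u x+H2 h u x"])
   (auto intro!: Gop.Gop_add H simp: pd_add[OF Gop_differentiable[OF Gop_add.hyps(1)] Gop_differentiable[OF Gop_add.hyps(2)]] distrib_left H(2,4))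
qed

lemma Gop_comm_pdi:
 assumes "Gop n G"
 shows "EX G'. Gop n G' & (ALL h u x. smooth_on UNIV u --> G h (pdi i u) x = pdi i (G h u) x+G' h u x)"
 using assms
proof (induction rule: Gop.induct)
 case (Gop_base k psi n w)
 show ?case
  by (rule exI[of _ "%h u x. 0"])
   (auto simp: Gop_zero pdi_conv Dn_csm[OF Gop_base(1)]
    pd_cmult[OF smooth_on_differentiable_at[OF smooth_conv[OF Dn_csm[OF Gop_base(1)]] open_UNIV UNIV_I]])
next
 case (Gop_mult a n G)
 then obtain G' where G': "Gop n G'" "!!h u x. smooth_on UNIV u ==> G h (pdi i u) x = pdi i (G h u) x+G' h u x" by blast
 let ?H = "%h u x. a x*G' h u x - pdi i a x*G h u x"
 show ?case
 proof (intro exI[of _ ?H] conjI allI impI)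
  show "Gop n ?H" using Gop_mult.hyps G'(1) by (intro Gop_diff Gop.Gop_mult polyf_pd) auto
  fix h :: real and u :: "real^'a => real" and x assume u: "smooth_on UNIV u"
  show "a x*G h (pdi i u) x = pdi i (%x. a x*G h u x) x+?H h u x"
   by (subst pd_mult) (auto simp: algebra_simps G'(2)[OF u] intro: Gop_differentiable[OF Gop_mult.hyps(2) u]
    smooth_on_differentiable_at[OF polyf_smooth[OF Gop_mult.hyps(1)]])
 qed
next
 case (Gop_add n G1 G2)
 then obtain H1 H2 where H: "Gop n H1" "!!h u x. smooth_on UNIV u ==> G1 h (pdi i u) x = pdi i (G1 h u) x+H1 h u x"
  "Gop n H2" "!!h u x. smooth_on UNIV u ==> G2 h (pdi i u) x = pdi i (G2 h u) x+H2 h u x" by blast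
 show ?case
  by (rule exI[of _ "%h u x. H1 h u x+H2 h u x"])
   (auto intro!: Gop.Gop_add H simp: pd_add[OF Gop_differentiable[OF Gop_add.hyps(1)] Gop_differentiable[OF Gop_add.hyps(2)]] H(2,4))
qed

lemma Gop_h_pdi_arg:
 assumes "Gop n G"
 shows "EX G'. Gop (Suc n) G' & (ALL h u x. smooth_on UNIV u --> h*G h (pdi i u) x = G' h u x)"
 using assms
proof (induction rule: Gop.induct)
 case (Gop_base k psi n w)
 show ?case
  by (rule exI[of _ "%h u x. h^w * conv (pdi i psi) h u x"])
   (use Gop.Gop_base[OF Dn_pd[OF Gop_base(1)], of "Suc n" w] Gop_base(2) in "auto simp: conv_pd_left Dn_csm[OF Gop_base(1)]")
next
 case (Gop_mult a n G)
 then obtain G' where G': "Gop (Suc n) G'" "!!h u x. smooth_on UNIV u ==> h*G h (pdi i u) x = G' h u x" by blast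
 show ?case
  by (rule exI[of _ "%h u x. a x*G' h u x"])
   (use Gop_mult.hyps(1) G' in "auto intro: Gop.Gop_mult simp: mult.left_commute")
next
 case (Gop_add n G1 G2)
 then obtain H1 H2 where H: "Gop (Suc n) H1" "!!h u x. smooth_on UNIV u ==> h*G1 h (pdi i u) x = H1 h u x"
  "Gop (Suc n) H2" "!!h u x. smooth_on UNIV u ==> h*G2 h (pdi i u) x = H2 h u x" by blast
 show ?case
  by (rule exI[of _ "%h u x. H1 h u x+H2 h u x"])
   (auto intro!: Gop.Gop_add H simp: distrib_left H(2,4))
qed

lemma Gop_coord_arg:
 assumes "Gop n G"
 shows "EX G'. Gop (n - 1) G' & (ALL h u x. continuous_on UNIV u --> G h (%y. y $ k*u y) x = x $ k*G h u x+h*G' h u x)"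
 using assms
proof (induction rule: Gop.induct)
 case (Gop_base l psi n w)
 show ?case
 proof (intro exI[of _ "%h u x. (-1)*(h^w * conv (%z. z $ k * psi z) h u x)"] conjI allI impI)
  show "Gop (n - 1) (%h u x. (-1)*(h^w * conv (%z. z $ k * psi z) h u x))"
   by (rule Gop_cmult[OF Gop.Gop_base[OF Dn_coord[OF Gop_base(1)]]]) (use Gop_base(2) in simp)
  fix h :: real and u :: "real^'a => real" and x assume u: "continuous_on UNIV u"
  show "h^w * conv psi h (%y. y $ k*u y) x = x $ k*(h^w * conv psi h u x)+h*((-1)*(h^w * conv (%z. z $ k * psi z) h u x))"
   unfolding conv_coord[OF Dn_csm[OF Gop_base(1)] u] by (simp add: right_diff_distrib)
 qed
next
 case (Gop_mult a n G)
 then obtain G' where G': "Gop (n-1) G'" "!!h u x. continuous_on UNIV u ==> G h (%y. y $ k*u y) x = x $ k*G h u x+h*G' h u x" by blast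
 show ?case
  by (rule exI[of _ "%h u x. a x*G' h u x"])
   (use Gop_mult.hyps(1) G' in "auto intro: Gop.Gop_mult simp: algebra_simps")
next
 case (Gop_add n G1 G2)
 then obtain H1 H2 where H: "Gop (n-1) H1" "!!h u x. continuous_on UNIV u ==> G1 h (%y. y $ k*u y) x = x $ k*G1 h u x+h*H1 h u x"
  "Gop (n-1) H2" "!!h u x. continuous_on UNIV u ==> G2 h (%y. y $ k*u y) x = x $ k*G2 h u x+h*H2 h u x" by blast
 show ?case
 proof (intro exI[of _ "%h u x. H1 h u x+H2 h u x"] conjI Gop.Gop_add H allI impI)
  fix h :: real and u :: "real^'a => real" and x assume u: "continuous_on UNIV u"
  show "G1 h (%y. y $ k*u y) x+G2 h (%y. y $ k*u y) x = x $ k*(G1 h u x+G2 h u x)+h*(H1 h u x+H2 h u x)"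
   unfolding H(2,4)[OF u] by (simp add: algebra_simps)
 qed
qed

lemma Gop_poly_arg:
 assumes "a : polyf" "Gop n G"
 shows "EX G'. Gop (n - 1) G' & (ALL h u x. continuous_on UNIV u --> G h (%y. a y*u y) x = a x*G h u x+h*G' h u x)"
 using assms
proof (induction arbitrary: n G rule: polyf.induct)
 case (polyf_const c)
 have "G h (%y. c*u y) x = c*G h u x" for h u x
  using polyf_const by (induction rule: Gop.induct) (auto simp: conv_def algebra_simps)
 thus ?case by (intro exI[of _ "%h u x. 0"]) (auto simp: Gop_zero)
next
 case (polyf_coord i)
 thus ?case by (rule Gop_coord_arg)
next
 case (polyf_add f g)
 have c: "continuous_on UNIV f" "continuous_on UNIV g"
  using polyf_add.hyps polyf_smooth smooth_on_continuous by auto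
 obtain H1 where H1: "Gop (n-1) H1" "ALL h u x. continuous_on UNIV u --> G h (%y. f y*u y) x = f x*G h u x+h*H1 h u x"
  using polyf_add.IH(1)[OF polyf_add.prems] by (elim exE conjE)
 obtain H2 where H2: "Gop (n-1) H2" "ALL h u x. continuous_on UNIV u --> G h (%y. g y*u y) x = g x*G h u x+h*H2 h u x"
  using polyf_add.IH(2)[OF polyf_add.prems] by (elim exE conjE)
 note H = H1(1) H1(2)[rule_format] H2(1) H2(2)[rule_format]
 show ?case
 proof (intro exI[of _ "%h u x. H1 h u x+H2 h u x"] conjI Gop_add H allI impI)
  fix h :: real and u :: "real^'a => real" and x assume u: "continuous_on UNIV u"
  show "G h (%y. (f y+g y)*u y) x = (f x+g x)*G h u x+h*(H1 h u x+H2 h u x)"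
   using Gop_add_arg[OF polyf_add.prems continuous_on_mult[OF c(1) u] continuous_on_mult[OF c(2) u]]
   by (simp add: H(2,4)[OF u] algebra_simps)
 qed
next
 case (polyf_mult f g)
 have c: "continuous_on UNIV f" "continuous_on UNIV g"
  using polyf_mult.hyps polyf_smooth smooth_on_continuous by auto
 obtain H1 where H1': "Gop (n-1) H1" "ALL h u x. continuous_on UNIV u --> G h (%y. f y*u y) x = f x*G h u x+h*H1 h u x"
  using polyf_mult.IH(1)[OF polyf_mult.prems] by (elim exE conjE)
 note H1 = H1'(1) H1'(2)[rule_format]
 obtain H2 where H2': "Gop (n-1) H2" "ALL h u x. continuous_on UNIV u --> G h (%y. g y*u y) x = g x*G h u x+h*H2 h u x"
  using polyf_mult.IH(2)[OF polyf_mult.prems] by (elim exE conjE)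
 note H2 = H2'(1) H2'(2)[rule_format]
 obtain H3 where H3': "Gop (n-1-1) H3" "ALL h u x. continuous_on UNIV u --> H1 h (%y. g y*u y) x = g x*H1 h u x+h*H3 h u x"
  using polyf_mult.IH(2)[OF H1(1)] by (elim exE conjE)
 note H3 = H3'(1) H3'(2)[rule_format]
 let ?H = "%h u x. f x*H2 h u x+(g x*H1 h u x+h*H3 h u x)"
 show ?case
 proof (intro exI[of _ ?H] conjI allI impI)
  have "Gop (n - 1) (%h u x. h*H3 h u x)" using Gop_mono[OF Gop_h[OF H3(1)]] by simp
  thus "Gop (n - 1) ?H" using polyf_mult.hyps H1(1) H2(1) by (intro Gop_add Gop_mult)
  fix h :: real and u :: "real^'a => real" and x assume u: "continuous_on UNIV u"
  show "G h (%y. f y*g y*u y) x = f x*g x*G h u x+h*?H h u x"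
   using H1(2)[OF continuous_on_mult[OF c(2) u]] by (simp add: mult.assoc H2(2)[OF u] H3(2)[OF u] algebra_simps)
 qed
qed

lemma smooth_pdi_continuous: "smooth_on UNIV u ==> continuous_on UNIV (pdi i u)"
 by (intro smooth_on_continuous smooth_on_pd axis_Basis)

text \<open>Commuting with a coefficient loses an order but leaves a factor \<open>h\<close>, and
  \<open>h\<close> together with the derivative on the argument regains the order. So the commutator
  with a polynomial field is no worse than \<open>G\<close> itself.\<close>

lemma Gop_comm:
 assumes Z: "pvf Z" and G: "Gop n (G :: 'n::finite smop)"
 shows "EX G'. Gop n G' & (ALL h u x. smooth_on UNIV u -->
  G h (vf_apply Z u) x = vf_apply Z (G h u) x+G' h u x)"
proof -
 have Zi: "(%x. Z x $ i) : polyf" for i using Z by (simp add: pvf_def)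
 have cZ: "continuous_on UNIV (%x. Z x $ i)" for i using smooth_on_continuous[OF polyf_smooth[OF Zi]] .
 have "ALL i. EX H. Gop (n-1) H & (ALL h u x. continuous_on UNIV u --> G h (%y. Z y $ i*u y) x = Z x $ i*G h u x+h*H h u x)"
  using Gop_poly_arg[OF Zi G] by simp
 from choice[OF this] obtain H1 where "ALL i. Gop (n-1) (H1 i) & (ALL h u x. continuous_on UNIV u --> G h (%y. Z y $ i*u y) x = Z x $ i*G h u x+h*H1 i h u x)" ..
 hence H1: "!!i. Gop (n-1) (H1 i)" "!!i h u x. continuous_on UNIV u ==> G h (%y. Z y $ i*u y) x = Z x $ i*G h u x+h*H1 i h u x" by blast+
 have "ALL i. EX H. Gop n H & (ALL h u x. smooth_on UNIV u --> G h (pdi i u) x = pdi i (G h u) x+H h u x)"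
  using Gop_comm_pdi[OF G] by simp
 from choice[OF this] obtain H2 where "ALL i. Gop (n) (H2 i) & (ALL h u x. smooth_on UNIV u --> G h (pdi i u) x = pdi i (G h u) x+H2 i h u x)" ..
 hence H2: "!!i. Gop (n) (H2 i)" "!!i h u x. smooth_on UNIV u ==> G h (pdi i u) x = pdi i (G h u) x+H2 i h u x" by blast+
 have "ALL i. EX H. Gop (Suc (n-1)) H & (ALL h u x. smooth_on UNIV u --> h*H1 i h (pdi i u) x = H h u x)"
  using Gop_h_pdi_arg[OF H1(1)] by simp
 from choice[OF this] obtain H3 where "ALL i. Gop (Suc (n-1)) (H3 i) & (ALL h u x. smooth_on UNIV u --> h*H1 i h (pdi i u) x = H3 i h u x)" ..
 hence H3: "!!i. Gop (Suc (n-1)) (H3 i)" "!!i h u x. smooth_on UNIV u ==> h*H1 i h (pdi i u) x = H3 i h u x" by blast+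
 let ?H = "%h u x. SUM i:UNIV. Z x $ i*H2 i h u x+H3 i h u x"
 show ?thesis
 proof (intro exI[of _ ?H] conjI allI impI)
  show "Gop n ?H" by (intro Gop_sum Gop_add Gop_mult Zi H2(1) Gop_mono[OF H3(1)]) simp
  fix h :: real and u :: "real^'n => real" and x assume u: "smooth_on UNIV u"
  have "vf_apply Z u = (%y. SUM i:UNIV. Z y $ i * pdi i u y)"
   by (simp add: fun_eq_iff vf_apply_pd smooth_on_differentiable_at[OF u])
  hence "G h (vf_apply Z u) x = (SUM i:UNIV. G h (%y. Z y $ i * pdi i u y) x)"
   by (simp add: Gop_sum_arg[OF G] continuous_on_mult[OF cZ smooth_pdi_continuous[OF u]])
  also have "... = (SUM i:UNIV. Z x $ i * pdi i (G h u) x+(Z x $ i*H2 i h u x+H3 i h u x))"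
   unfolding H1(2)[OF smooth_pdi_continuous[OF u]] H2(2)[OF u] H3(2)[OF u] by (simp add: algebra_simps)
  also have "... = vf_apply Z (G h u) x+?H h u x"
   by (simp add: vf_apply_pd Gop_differentiable[OF G u] sum.distrib)
  finally show "G h (vf_apply Z u) x = vf_apply Z (G h u) x+?H h u x" .
 qed
qed

lemma Gop_h_vf:
 assumes Z: "pvf Z" and G: "Gop n (G :: 'n::finite smop)"
 shows "EX G'. Gop n G' & (ALL h u x. h > 0 --> smooth_on UNIV u --> h * vf_apply Z (G h u) x = G' h u x)"
proof -
 have "ALL i. EX H. Gop n H & (ALL h u x. h > 0 --> smooth_on UNIV u --> h * pdi i (G h u) x = H h u x)"
  using Gop_pdi[OF G] by simp
 from choice[OF this] obtain H where "ALL i. Gop n (H i) & (ALL h u x. h > 0 --> smooth_on UNIV u --> h * pdi i (G h u) x = H i h u x)" ..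
 hence H: "!!i. Gop n (H i)" "!!i h u x. h > 0 ==> smooth_on UNIV u ==> h * pdi i (G h u) x = H i h u x" by blast+
 let ?H = "%h u x. SUM i:UNIV. Z x $ i*H i h u x"
 show ?thesis
 proof (intro exI[of _ ?H] conjI allI impI)
  show "Gop n ?H" using Z by (intro Gop_sum Gop_mult H(1)) (auto simp: pvf_def)
  fix h :: real and u :: "real^'n => real" and x assume "h > 0" "smooth_on UNIV u"
  thus "h * vf_apply Z (G h u) x = ?H h u x"
   by (simp add: vf_apply_pd Gop_differentiable[OF G] sum_distrib_left mult.left_commute H(2)[symmetric])
 qed
qed

section \<open>Symmetry of second derivatives and identities for brackets\<close>

lemma pd_line_deriv:
 fixes f :: "'a::euclidean_space => real"
 assumes "smooth_on UNIV f"
 shows "((%s. f (x + s *\<^sub>R a)) has_real_derivative pd a f (x + s *\<^sub>R a)) (at s)"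
proof -
 have D: "((%s. x + s *\<^sub>R a) has_derivative (%v. v *\<^sub>R a)) (at s)"
  by (auto intro!: derivative_eq_intros)
 have Df: "(f has_derivative frechet_derivative f (at (x + s *\<^sub>R a))) (at (x + s *\<^sub>R a))"
  by (rule has_derivative_frechet[OF assms]) auto
 show ?thesis
  using has_derivative_compose[OF D Df] linear_scale[OF has_derivative_linear[OF Df]]
  by (simp add: has_field_derivative_def pd_def mult.commute[of _ "frechet_derivative f (at (x + s *\<^sub>R a)) a"])
qed

lemma second_difference:
 fixes f :: "'a::euclidean_space => real"
 assumes f: "smooth_on UNIV f" and a: "a : Basis" and b: "b : Basis" and s: "s > 0"
 shows "EX p. dist x p <= 2 * s &
  f (x + s *\<^sub>R a + s *\<^sub>R b) - f (x + s *\<^sub>R a) - f (x + s *\<^sub>R b)+f x = s^2 * pd b (pd a f) p"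
proof -
 let ?g = "%t. f (x + s *\<^sub>R b + t *\<^sub>R a) - f (x + t *\<^sub>R a)"
 have "EX z. 0 < z & z < s & ?g s - ?g 0 = (s - 0)*(pd a f (x + s *\<^sub>R b+z *\<^sub>R a) - pd a f (x+z *\<^sub>R a))"
  by (rule MVT2[OF s]) (intro DERIV_diff pd_line_deriv[OF f])
 then obtain z where z: "0 < z" "z < s" "?g s - ?g 0 = s*(pd a f (x + s *\<^sub>R b+z *\<^sub>R a) - pd a f (x+z *\<^sub>R a))" by auto
 let ?k = "%t. pd a f (x+z *\<^sub>R a + t *\<^sub>R b)"
 have "EX y. 0 < y & y < s & ?k s - ?k 0 = (s - 0) * pd b (pd a f) (x+z *\<^sub>R a+y *\<^sub>R b)"
  by (rule MVT2[OF s]) (intro pd_line_deriv smooth_on_pd[OF f a])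
 then obtain y where y: "0 < y" "y < s" "?k s - ?k 0 = s * pd b (pd a f) (x+z *\<^sub>R a+y *\<^sub>R b)" by auto
 show ?thesis
 proof (intro exI[of _ "x+z *\<^sub>R a+y *\<^sub>R b"] conjI)
  have "norm (z *\<^sub>R a+y *\<^sub>R b) <= z+y"
   using norm_triangle_ineq[of "z *\<^sub>R a" "y *\<^sub>R b"] z y a b by simp
  thus "dist x (x+z *\<^sub>R a+y *\<^sub>R b) <= 2 * s"
   using z(1,2) y(1,2) by (simp add: dist_norm norm_minus_commute add.assoc add.commute[of "z *\<^sub>R a"])
  show "f (x + s *\<^sub>R a + s *\<^sub>R b) - f (x + s *\<^sub>R a) - f (x + s *\<^sub>R b)+f x = s^2 * pd b (pd a f) (x+z *\<^sub>R a+y *\<^sub>R b)"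
   using z(3) y(3) by (simp add: power2_eq_square ac_simps)
 qed
qed

text \<open>The second difference is symmetric in \<open>a\<close> and \<open>b\<close>; two mean
  value theorems express it by either mixed derivative at points that approach
  \<open>x\<close>.\<close>

lemma pd_commute:
 fixes f :: "'a::euclidean_space => real"
 assumes f: "smooth_on UNIV f" and a: "a : Basis" and b: "b : Basis"
 shows "pd b (pd a f) x = pd a (pd b f) x"
proof -
 let ?s = "%n. inverse (real (Suc n))"
 have s: "?s n > 0" for n by simp
 from second_difference[OF f a b s] have "EX p. ALL n. dist x (p n) <= 2*?s n &
  f (x+?s n *\<^sub>R a+?s n *\<^sub>R b) - f (x+?s n *\<^sub>R a) - f (x+?s n *\<^sub>R b)+f x = (?s n)^2 * pd b (pd a f) (p n)"
  by (intro choice allI)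
 then obtain p where p: "!!n. dist x (p n) <= 2*?s n"
  "!!n. f (x+?s n *\<^sub>R a+?s n *\<^sub>R b) - f (x+?s n *\<^sub>R a) - f (x+?s n *\<^sub>R b)+f x = (?s n)^2 * pd b (pd a f) (p n)" by blast
 from second_difference[OF f b a s] have "EX p. ALL n. dist x (p n) <= 2*?s n &
  f (x+?s n *\<^sub>R b+?s n *\<^sub>R a) - f (x+?s n *\<^sub>R b) - f (x+?s n *\<^sub>R a)+f x = (?s n)^2 * pd a (pd b f) (p n)"
  by (intro choice allI)
 then obtain q where q: "!!n. dist x (q n) <= 2*?s n"
  "!!n. f (x+?s n *\<^sub>R b+?s n *\<^sub>R a) - f (x+?s n *\<^sub>R b) - f (x+?s n *\<^sub>R a)+f x = (?s n)^2 * pd a (pd b f) (q n)" by blast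
 have eq: "pd b (pd a f) (p n) = pd a (pd b f) (q n)" for n
 proof -
  have "(?s n)^2 * pd b (pd a f) (p n) = (?s n)^2 * pd a (pd b f) (q n)"
   unfolding p(2)[symmetric] q(2)[symmetric] by (simp add: ac_simps)
  thus ?thesis by simp
 qed
 have lim: "r \<longlonglongrightarrow> x" if "!!n. dist x (r n) <= 2*?s n" for r
 proof (rule metric_tendsto_imp_tendsto)
  show "(%n. 2*?s n) \<longlonglongrightarrow> 0" using tendsto_mult[OF tendsto_const LIMSEQ_inverse_real_of_nat, of 2] by simp
  show "\<forall>\<^sub>F n in sequentially. dist (r n) x <= dist (2*?s n) 0"
   using that by (intro always_eventually allI) (simp add: dist_commute)
 qed
 have c: "isCont (pd b (pd a f)) x" "isCont (pd a (pd b f)) x"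
  using smooth_on_continuous[OF smooth_on_pd[OF smooth_on_pd[OF f a] b]] smooth_on_continuous[OF smooth_on_pd[OF smooth_on_pd[OF f b] a]]
  by (auto simp: continuous_on_eq_continuous_at)
 have "(%n. pd b (pd a f) (p n)) \<longlonglongrightarrow> pd b (pd a f) x" by (rule isCont_tendsto_compose[OF c(1) lim[OF p(1)]])
 moreover have "(%n. pd a (pd b f) (q n)) \<longlonglongrightarrow> pd a (pd b f) x" by (rule isCont_tendsto_compose[OF c(2) lim[OF q(1)]])
 ultimately show ?thesis unfolding eq by (rule LIMSEQ_unique)
qed

lemma smooth_vf_UNIV: "svf Z ==> smooth_on UNIV f ==> smooth_on UNIV (vf_apply Z f)"
 by (rule smooth_vf_apply[OF _ open_UNIV])

lemma differentiable_UNIV: "smooth_on UNIV f ==> f differentiable (at x)"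
 by (rule smooth_on_differentiable_at[OF _ open_UNIV UNIV_I])

lemma vf_apply_pd_UNIV:
 "smooth_on UNIV f ==> vf_apply Z f = (%x. SUM i:UNIV. Z x $ i * pdi i f x)"
 by (rule ext) (rule vf_apply_pd[OF differentiable_UNIV])

lemma vf_apply_lie_bracket:
 assumes Y: "svf Y" and Z: "svf Z" and f: "smooth_on UNIV f"
 shows "vf_apply (lie_bracket Y Z) f x = vf_apply Y (vf_apply Z f) x - vf_apply Z (vf_apply Y f) x"
proof -
 have sp: "smooth_on UNIV (pdi i f)" for i by (rule smooth_on_pd[OF f axis_Basis])
 have E: "vf_apply A (vf_apply B f) x =
   (SUM i:UNIV. (SUM k:UNIV. B x $ i*(A x $ k * pdi k (pdi i f) x)) + vf_apply A (%x. B x $ i) x * pdi i f x)"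
  if A: "svf A" and B: "svf B" for A B
 proof -
  have sB: "smooth_on UNIV (%x. B x $ i)" for i using B by (simp add: svf_def)
  have "vf_apply A (vf_apply B f) x = (SUM i:UNIV. vf_apply A (%x. B x $ i * pdi i f x) x)"
   unfolding vf_apply_pd_UNIV[OF f, of B]
   by (rule vf_apply_sum) (rule differentiable_UNIV[OF smooth_on_mult[OF open_UNIV sB sp]])
  also have "... = (SUM i:UNIV. B x $ i * vf_apply A (pdi i f) x + vf_apply A (%x. B x $ i) x * pdi i f x)"
   by (intro sum.cong refl vf_apply_mult differentiable_UNIV sB sp)
  finally show ?thesis by (simp add: vf_apply_pd_UNIV[OF sp] sum_distrib_left)
 qed
 have "(SUM i:UNIV. SUM k:UNIV. Z x $ i*(Y x $ k * pdi k (pdi i f) x)) =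
    (SUM i:UNIV. SUM k:UNIV. Y x $ i*(Z x $ k * pdi k (pdi i f) x))"
  by (subst sum.swap) (simp add: pd_commute[OF f axis_Basis axis_Basis] mult_ac)
 thus ?thesis
  unfolding E[OF Y Z] E[OF Z Y] vf_apply_pd_UNIV[OF f, of "lie_bracket Y Z"]
  by (simp add: lie_bracket_nth[OF Y Z] sum.distrib left_diff_distrib sum_subtractf)
qed

lemma vf_apply_coord:
 fixes Z :: "real^'n::finite => real^'n"
 shows "vf_apply Z (%x. x $ i) x = Z x $ i"
 unfolding vf_apply_def
  frechet_derivative_eq[OF bounded_linear_imp_has_derivative[OF bounded_linear_vec_nth]] ..

lemma vf_eqI: "(!!i x. vf_apply Y (%x::real^'n::finite. x $ i) x = vf_apply Z (%x. x $ i) x) ==> Y = Z"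
 by (simp add: vf_apply_coord vec_eq_iff fun_eq_iff)

lemma vf_diff_UNIV: "smooth_on UNIV f ==> smooth_on UNIV g ==> vf_apply Z (%x. f x - g x) x = vf_apply Z f x - vf_apply Z g x"
 by (intro vf_apply_diff differentiable_UNIV)

lemma vf_apply_lie_bracket_fun:
 "svf Y ==> svf Z ==> smooth_on UNIV f ==>
  vf_apply (lie_bracket Y Z) f = (%x. vf_apply Y (vf_apply Z f) x - vf_apply Z (vf_apply Y f) x)"
 by (rule ext) (rule vf_apply_lie_bracket)

text \<open>Fields are compared through their action on coordinates, where brackets are commutators
  of operators and the identity is formal. It is written so that the left factors become
  shorter.\<close>

lemma jacobi:
 assumes X: "pvf X" and Y: "pvf Y" and Z: "pvf Z"
 shows "lie_bracket (lie_bracket X Y) Z =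
  (%x. lie_bracket X (lie_bracket Y Z) x+(-1) *\<^sub>R lie_bracket Y (lie_bracket X Z) x)"
proof (rule vf_eqI)
 fix i x
 note s = pvf_svf[OF X] pvf_svf[OF Y] pvf_svf[OF Z]
  pvf_svf[OF pvf_lie_bracket[OF X Y]] pvf_svf[OF pvf_lie_bracket[OF X Z]] pvf_svf[OF pvf_lie_bracket[OF Y Z]]
 let ?f = "%x::real^'a. x $ i"
 have f: "smooth_on UNIV ?f" by (rule smooth_coord)
 have "vf_apply (%x. lie_bracket X (lie_bracket Y Z) x+(-1) *\<^sub>R lie_bracket Y (lie_bracket X Z) x) ?f x =
  vf_apply (lie_bracket X (lie_bracket Y Z)) ?f x - vf_apply (lie_bracket Y (lie_bracket X Z)) ?f x"
  by (simp add: vf_apply_coord)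
 also have "... = vf_apply (lie_bracket (lie_bracket X Y) Z) ?f x"
  by (simp add: vf_apply_lie_bracket_fun s f smooth_vf_UNIV vf_diff_UNIV)
 finally show "vf_apply (lie_bracket (lie_bracket X Y) Z) ?f x =
  vf_apply (%x. lie_bracket X (lie_bracket Y Z) x+(-1) *\<^sub>R lie_bracket Y (lie_bracket X Z) x) ?f x" by simp
qed

lemma lie_bracket_linear:
 assumes "pvf Y" "pvf Z" "pvf V"
 shows "lie_bracket Y (%x. Z x+V x) = (%x. lie_bracket Y Z x+lie_bracket Y V x)"
  "lie_bracket Y (%x. c *\<^sub>R Z x) = (%x. c *\<^sub>R lie_bracket Y Z x)"
  "lie_bracket (%x. Z x+V x) Y = (%x. lie_bracket Z Y x+lie_bracket V Y x)"
  "lie_bracket (%x. c *\<^sub>R Z x) Y = (%x. c *\<^sub>R lie_bracket Z Y x)"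
proof -
 note d = svf_differentiable[OF pvf_svf[OF assms(1)]] svf_differentiable[OF pvf_svf[OF assms(2)]] svf_differentiable[OF pvf_svf[OF assms(3)]]
 have lin: "linear (frechet_derivative Y (at x))" for x
  using has_derivative_linear[OF d(1)[unfolded frechet_derivative_works]] .
 have pl: "frechet_derivative (%x. Z x+V x) (at x) = (%v. frechet_derivative Z (at x) v + frechet_derivative V (at x) v)" for x
  by (rule frechet_derivative_eq) (rule has_derivative_add[OF d(2,3)[unfolded frechet_derivative_works]])
 show "lie_bracket Y (%x. Z x+V x) = (%x. lie_bracket Y Z x+lie_bracket Y V x)"
  "lie_bracket (%x. Z x+V x) Y = (%x. lie_bracket Z Y x+lie_bracket V Y x)"
  by (auto simp: lie_bracket_def fun_eq_iff pl linear_add[OF lin])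
 have s: "frechet_derivative (%x. c *\<^sub>R Z x) (at x) = (%v. c *\<^sub>R frechet_derivative Z (at x) v)" for x
  by (rule frechet_derivative_eq) (rule has_derivative_scaleR_right[OF d(2)[unfolded frechet_derivative_works]])
 show "lie_bracket Y (%x. c *\<^sub>R Z x) = (%x. c *\<^sub>R lie_bracket Y Z x)"
  "lie_bracket (%x. c *\<^sub>R Z x) Y = (%x. c *\<^sub>R lie_bracket Z Y x)"
  by (auto simp: lie_bracket_def fun_eq_iff s linear_scale[OF lin] algebra_simps)
qed

text \<open>Formal skew-symmetry is stated as a property of the operator because in this form it
  passes to brackets directly: two integrations by parts reverse the order of the factors.\<close>

definition bparts :: "(real^'n::finite => real^'n) => bool" where
 "bparts Z \<longleftrightarrow> (ALL f g. smooth_on UNIV f --> csm g -->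
  (LINT x|lborel. vf_apply Z f x*g x) = - (LINT x|lborel. f x * vf_apply Z g x))"

lemma bparts_lie_bracket:
 assumes Y: "svf Y" "bparts Y" and Z: "svf Z" "bparts Z"
 shows "bparts (lie_bracket Y Z)"
 unfolding bparts_def
proof (intro allI impI)
 fix f g :: "real^'a => real" assume f: "smooth_on UNIV f" and g: "csm g"
 have gs: "smooth_on UNIV g" using csm_smooth[OF g] .
 have I: "integrable lborel (%x. vf_apply A (vf_apply B f) x*g x)" "integrable lborel (%x. f x * vf_apply A (vf_apply B g) x)"
  if "svf A" "svf B" for A B
  using csm_integrable[OF csm_mult_left[OF smooth_vf_UNIV[OF that(1) smooth_vf_UNIV[OF that(2) f]] g]]
   csm_integrable[OF csm_mult_left[OF f csm_vf_apply[OF that(1) csm_vf_apply[OF that(2) g]]]] by auto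
 have J: "(LINT x|lborel. vf_apply A (vf_apply B f) x*g x) = (LINT x|lborel. f x * vf_apply B (vf_apply A g) x)"
  if A: "svf A" "bparts A" and B: "svf B" "bparts B" for A B
  using A(2)[unfolded bparts_def, rule_format, OF smooth_vf_UNIV[OF B(1) f] g]
   B(2)[unfolded bparts_def, rule_format, OF f csm_vf_apply[OF A(1) g]] by simp
 show "(LINT x|lborel. vf_apply (lie_bracket Y Z) f x*g x) = - (LINT x|lborel. f x * vf_apply (lie_bracket Y Z) g x)"
  by (simp add: vf_apply_lie_bracket_fun[OF Y(1) Z(1)] f gs left_diff_distrib right_diff_distrib I Y Z J)
qed

section \<open>Left-normed brackets and the rank condition\<close>

context hvf begin

text \<open>Left-normed brackets; by the Jacobi identity they span the Lie algebra.\<close>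

inductive lnb :: "nat => (real^'n => real^'n) => bool" where
 lnb_0: "j : {1..m} ==> lnb 0 (X j)"
| lnb_Suc: "j : {1..m} ==> lnb k Z ==> lnb (Suc k) (lie_bracket (X j) Z)"

lemma lnb_pvf: "lnb k Z ==> pvf Z"
 by (induction rule: lnb.induct) (auto intro!: pvfX pvf_lie_bracket simp del: atLeastAtMost_iff)

lemma bpartsX: "j : {1..m} ==> bparts (X j)"
 unfolding bparts_def using X_by_parts by blast

lemma lnb_bparts: "lnb k Z ==> bparts Z"
proof (induction rule: lnb.induct)
 case (lnb_0 j)
 thus ?case by (rule bpartsX)
next
 case (lnb_Suc j k Z)
 show ?case by (rule bparts_lie_bracket[OF svfX[OF lnb_Suc.hyps(1)] bpartsX[OF lnb_Suc.hyps(1)] pvf_svf[OF lnb_pvf[OF lnb_Suc.hyps(2)]] lnb_Suc.IH])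
qed

inductive_set LS :: "(real^'n => real^'n) set" where
 LS_base: "lnb k Z ==> Z : LS"
| LS_zero: "(%x. 0) : LS"
| LS_add: "Y : LS ==> Z : LS ==> (%x. Y x+Z x) : LS"
| LS_scale: "Z : LS ==> (%x. c *\<^sub>R Z x) : LS"

lemma pvf_add: "pvf Y ==> pvf Z ==> pvf (%x. Y x+Z x)"
 by (auto simp: pvf_def intro: polyf_add)

lemma pvf_scale: "pvf Z ==> pvf (%x. c *\<^sub>R Z x)"
 by (auto simp: pvf_def intro: polyf_mult polyf_const)

lemma pvf_zero: "pvf (%x. 0)"
 by (auto simp: pvf_def intro: polyf_const)

lemma LS_pvf: "Z : LS ==> pvf Z"
 by (induction rule: LS.induct) (auto intro: lnb_pvf pvf_add pvf_scale pvf_zero)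

lemma lie_bracket_0: "pvf Y ==> lie_bracket Y (%x. 0) = (%x. 0)" "pvf Y ==> lie_bracket (%x. 0) Y = (%x. 0)"
 using lie_bracket_linear(2,4)[of Y "%x. 0" "%x. 0" 0] pvf_zero by auto

lemma LS_bracket_X:
 assumes "Z : LS" "j : {1..m}" shows "lie_bracket (X j) Z : LS"
 using assms(1)
proof (induction rule: LS.induct)
 case (LS_base k Z)
 thus ?case using LS.LS_base[OF lnb_Suc[OF assms(2)]] by blast
next
 case LS_zero
 thus ?case by (simp add: lie_bracket_0 pvfX[OF assms(2)] LS.LS_zero)
next
 case (LS_add Y Z)
 thus ?case by (simp add: lie_bracket_linear(1)[OF pvfX[OF assms(2)] LS_pvf LS_pvf] LS.LS_add)
next
 case (LS_scale Z c)
 thus ?case by (simp add: lie_bracket_linear(2)[OF pvfX[OF assms(2)] LS_pvf LS_pvf] LS.LS_scale)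
qed

text \<open>Induction on the left factor: the Jacobi identity turns a bracket with
  \<open>lie_bracket (X j) Y\<close> on the left into brackets with \<open>X j\<close> and with
  \<open>Y\<close> on the left.\<close>

lemma LS_bracket_lnb: "lnb k Y ==> Z : LS ==> lie_bracket Y Z : LS"
proof (induction arbitrary: Z rule: lnb.induct)
 case (lnb_0 j)
 thus ?case using LS_bracket_X by blast
next
 case (lnb_Suc j k Y)
 show ?case
  unfolding jacobi[OF pvfX[OF lnb_Suc.hyps(1)] lnb_pvf[OF lnb_Suc.hyps(2)] LS_pvf[OF lnb_Suc.prems]]
  by (intro LS_add LS_scale LS_bracket_X lnb_Suc.IH lnb_Suc.prems lnb_Suc.hyps)
qed

lemma LS_bracket: "Y : LS ==> Z : LS ==> lie_bracket Y Z : LS"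
proof (induction arbitrary: Z rule: LS.induct)
 case (LS_base k Y)
 thus ?case using LS_bracket_lnb by blast
next
 case LS_zero
 thus ?case by (simp add: lie_bracket_0 LS_pvf LS.LS_zero)
next
 case (LS_add Y V)
 thus ?case by (simp add: lie_bracket_linear(3)[OF LS_pvf LS_pvf LS_pvf] LS.LS_add)
next
 case (LS_scale Y c)
 thus ?case by (simp add: lie_bracket_linear(4)[OF LS_pvf LS_pvf LS_pvf] LS.LS_scale)
qed

lemma Lie_LS: "Z : Lie_generated (X ` {1..m}) ==> Z : LS"
 by (induction rule: Lie_generated.induct) (auto intro!: LS_zero LS_add LS_scale LS_bracket LS_base[OF lnb_0] simp del: atLeastAtMost_iff)

lemma LS_orth:
 assumes "Z : LS" "!!k Y. lnb k Y ==> Y x \<bullet> xi = 0" shows "Z x \<bullet> xi = 0"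
 using assms(1) by (induction rule: LS.induct) (auto simp: assms(2) inner_add_left)

text \<open>The rank condition in dual form: a covector annihilated by all left-normed brackets at
  \<open>x\<close> would be orthogonal to the whole Lie algebra there.\<close>

lemma lnb_separates:
 assumes "xi ~= 0" shows "EX k Z. lnb k Z & Z x \<bullet> xi ~= 0"
proof (rule ccontr)
 assume "\<nexists>k Z. lnb k Z & Z x \<bullet> xi ~= 0"
 hence o: "Z x \<bullet> xi = 0" if "Z : Lie_generated (X ` {1..m})" for Z
  using LS_orth[OF Lie_LS[OF that]] by blast
 let ?S = "(%Z. Z x) ` Lie_generated (X ` {1..m})"
 have "dim ?S = DIM(real^'n)" using hor by (simp add: hormander_condition_def)
 hence "span ?S = UNIV" by (simp only: dim_eq_full)
 hence "xi : span ?S" by simp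
 moreover have "span ?S <= {v. v \<bullet> xi = 0}"
  by (rule span_minimal) (auto simp: o subspace_def inner_add_left)
 ultimately show False using assms by auto
qed

text \<open>Compactness of a ball times the unit sphere leaves finitely many brackets and bounds
  their sum of squares from below; homogeneity in \<open>xi\<close> removes the
  normalization.\<close>

lemma lnb_elliptic:
 obtains I :: "(nat \<times> (real^'n => real^'n)) set" and C where "finite I" "!!k Z. (k, Z) : I ==> lnb k Z" "C > 0"
  "!!x xi. norm x <= R ==> (norm xi)^2 <= C*(SUM p:I. (snd p x \<bullet> xi)^2)"
proof -
 define B where "B = {p. lnb (fst p) (snd p)}"
 let ?K = "cball (0::real^'n) R \<times> sphere (0::real^'n) 1"
 let ?O = "%p. {z :: (real^'n) \<times> (real^'n). snd p (fst z) \<bullet> snd z ~= 0}"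
 have cZ: "continuous_on UNIV (%z :: (real^'n) \<times> (real^'n). Z (fst z) \<bullet> snd z)" if "pvf Z" for Z
 proof -
  have "continuous_on UNIV Z"
   by (intro continuous_at_imp_continuous_on ballI differentiable_imp_continuous_within svf_differentiable pvf_svf that)
  from continuous_on_compose2[OF this continuous_on_fst[OF continuous_on_id]]
  have "continuous_on UNIV (%z :: (real^'n) \<times> (real^'n). Z (fst z))" by simp
  thus ?thesis by (rule continuous_on_inner) (rule continuous_on_snd[OF continuous_on_id])
 qed
 have K: "compact ?K" by (intro compact_Times) auto
 have "EX I<=B. finite I & ?K <= (UN p:I. ?O p)"
 proof (rule compactE_image[OF K])
  show "open (?O p)" if "p : B" for p
  proof -
   have "pvf (snd p)" using that lnb_pvf by (auto simp: B_def)
   from open_Collect_neq[OF cZ[OF this] continuous_on_const, of 0] show ?thesis .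
  qed
  show "?K <= (UN p:B. ?O p)"
  proof
   fix z assume "z : ?K"
   hence "snd z ~= 0" by auto
   from lnb_separates[OF this, of "fst z"] show "z : (UN p:B. ?O p)" by (auto simp: B_def)
  qed
 qed blast
 then obtain I where I: "I <= B" "finite I" "?K <= (UN p:I. ?O p)" by blast
 let ?g = "%z. SUM p:I. (snd p (fst z) \<bullet> snd z)^2"
 have cg: "continuous_on ?K ?g"
 proof (intro continuous_on_sum continuous_on_power)
  fix p assume "p : I"
  hence "pvf (snd p)" using I(1) lnb_pvf by (auto simp: B_def)
  thus "continuous_on ?K (%z. snd p (fst z) \<bullet> snd z)" using continuous_on_subset[OF cZ] by blast
 qed
 have pos: "?g z > 0" if "z : ?K" for z
 proof -
  from that I(3) obtain p where p: "p : I" "snd p (fst z) \<bullet> snd z ~= 0" by blast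
  hence "(snd p (fst z) \<bullet> snd z)^2 > 0" by simp
  also have "... <= ?g z" by (rule member_le_sum[OF p(1)]) (auto simp: I(2))
  finally show ?thesis .
 qed
 have "EX c>0. ALL z:?K. c <= ?g z"
 proof (cases "?K = {}")
  case False
  from continuous_attains_inf[OF K False cg] obtain z where "z : ?K" "ALL y:?K. ?g z <= ?g y" by blast
  thus ?thesis using pos by blast
 qed (auto intro: exI[of _ 1])
 then obtain c where c: "c > 0" "!!z. z : ?K ==> c <= ?g z" by blast
 show thesis
 proof (rule that[OF I(2), of "1/c"])
  show "lnb k Z" if "(k, Z) : I" for k Z using that I(1) by (auto simp: B_def)
  show "1 / c > 0" using c by simp
  fix x xi :: "real^'n" assume x: "norm x <= R"
  show "(norm xi)^2 <= 1 / c*(SUM p:I. (snd p x \<bullet> xi)^2)"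
  proof (cases "xi = 0")
   case False
   have "(x, (1/norm xi) *\<^sub>R xi) : ?K" using x False by simp
   from c(2)[OF this] have "c <= (SUM p:I. (snd p x \<bullet> xi)^2)/(norm xi)^2"
    by (simp add: power_divide sum_divide_distrib)
   thus ?thesis using c(1) False by (simp add: field_simps)
  qed simp
 qed
qed

end

section \<open>Local norms, Kohn's inequality and the energy inequality\<close>

definition mass :: "(real^'n::finite) => real => (real^'n => real) => real" where
 "mass y r u = (LINT x|lborel. indicator (ball y r) x*abs (u x))"

text \<open>This is the square of the local norm, so a factor \<open>h\<close> in a function counts
  as 2 in the exponents of \<open>h\<close> below.\<close>

definition nrm2 :: "(real^'n::finite) => real => (real^'n => real) => real" where
 "nrm2 y r v = (LINT x|lborel. indicator (ball y r) x*(v x)^2)"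

lemma nrm2_integrable: "continuous_on UNIV v ==> integrable lborel (%x::real^'n::finite. indicator (ball y r) x*(v x)^2 :: real)"
 by (rule integrable_indicator_cont) (auto intro: continuous_intros)

lemma mass_integrable: "continuous_on UNIV v ==> integrable lborel (%x::real^'n::finite. indicator (ball y r) x*abs (v x) :: real)"
 by (rule integrable_indicator_cont) (auto intro: continuous_intros)

lemma nrm2_nonneg: "nrm2 y r v >= 0"
 unfolding nrm2_def by (rule int_nonneg) auto

lemma mass_nonneg: "mass y r v >= 0"
 unfolding mass_def by (rule int_nonneg) auto

lemma nrm2_le_sum:
 assumes "finite I" "continuous_on UNIV v" "!!i. i : I ==> continuous_on UNIV (w i)"
  and c: "!!i. i : I ==> c i >= 0" and r: "r' <= r"
  and le: "!!x. dist y x < r' ==> (v x)^2 <= (SUM i:I. c i*(w i x)^2)"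
 shows "nrm2 y r' v <= (SUM i:I. c i*nrm2 y r (w i))"
proof -
 have i: "integrable lborel (%x. c i*(indicator (ball y r) x*(w i x)^2))" if "i : I" for i
  by (intro integrable_mult_right nrm2_integrable assms(3) that)
 have "nrm2 y r' v <= (LINT x|lborel. (SUM i:I. c i*(indicator (ball y r) x*(w i x)^2)))"
  unfolding nrm2_def
 proof (rule integral_mono[OF nrm2_integrable[OF assms(2)] intb_sum[OF i]])
  fix x
  show "indicator (ball y r') x*(v x)^2 <= (SUM i:I. c i*(indicator (ball y r) x*(w i x)^2))"
  proof (cases "dist y x < r'")
   case True
   thus ?thesis using le[OF True] r by simp
  next
   case False
   thus ?thesis by (auto intro!: sum_nonneg mult_nonneg_nonneg c)
  qed
 qed
 also have "... = (SUM i:I. c i*nrm2 y r (w i))"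
  unfolding nrm2_def using nrm2_integrable[OF assms(3)] by (subst int_sum) (auto simp: i)
 finally show ?thesis .
qed

lemma nrm2_mono_radius: "continuous_on UNIV v ==> r' <= r ==> nrm2 y r' v <= nrm2 y r v"
 using nrm2_le_sum[of "{()}" v "%_. v" "%_. 1" r' r y] by simp

lemma polyf_bounded:
 assumes "a : polyf" obtains B where "B > 0" "!!x. norm x <= R ==> \<bar>a x\<bar> <= B"
proof -
 have "compact (a ` cball 0 R)"
  by (intro compact_continuous_image continuous_on_subset[OF smooth_on_continuous[OF polyf_smooth[OF assms]]]) auto
 then obtain B where "B > 0" "ALL z:a ` cball 0 R. norm z <= B" using compact_imp_bounded bounded_pos by blast
 thus thesis by (intro that[of B]) auto
qed

lemma cutoff_vf_bound:
 fixes Z :: "real^'n::finite => real^'n"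
 assumes Z: "pvf Z"
 obtains B where "B > 0" "!!y r x. norm y <= R ==> 0 < r ==> r <= 1 ==> dist y x < r ==>
  abs (vf_apply Z (cutoff y (r/2)) x) <= B/r"
proof -
 have "EX b. b > 0 & (ALL x. norm x <= R+1 --> \<bar>Z x $ i\<bar> <= b)" for i
  using polyf_bounded[of "%x. Z x $ i" "R+1"] Z unfolding pvf_def by metis
 hence "EX b::'n => real. ALL i. b i > 0 & (ALL x. norm x <= R+1 --> \<bar>Z x $ i\<bar> <= b i)" by (intro choice allI)
 then obtain b :: "'n => real" where b: "!!i. b i > 0" "!!i x. norm x <= R+1 ==> \<bar>Z x $ i\<bar> <= b i" by blast
 have "EX c. c > 0 & (ALL x. abs (pdi i cut0 x) <= c)" for i :: 'n
  using csm_bounded[OF csm_pd[OF cut0(1) axis_Basis]] by metis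
 hence "EX c::'n => real. ALL i. c i > 0 & (ALL x. abs (pdi i cut0 x) <= c i)" by (intro choice allI)
 then obtain c :: "'n => real" where c: "!!i. c i > 0" "!!i x. abs (pdi i cut0 x) <= c i" by blast
 show thesis
 proof (rule that[of "SUM i:UNIV. b i*(2 * c i)"])
  show "0 < (SUM i:UNIV. b i*(2 * c i))" by (rule sum_pos) (auto simp: b c)
  fix y x :: "real^'n" and r :: real assume y: "norm y <= R" and r: "0 < r" "r <= 1" and d: "dist y x < r"
  have x: "norm x <= R+1" using y r d norm_triangle_sub[of x y] by (simp add: dist_norm norm_minus_commute)
  have s: "smooth_on UNIV (cutoff y (r/2))" by (rule csm_smooth[OF csm_cutoff]) (use r in simp)
  have "abs (vf_apply Z (cutoff y (r/2)) x) <= (SUM i:UNIV. abs (Z x $ i * pdi i (cutoff y (r/2)) x))"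
   unfolding vf_apply_pd_UNIV[OF s] by (rule sum_abs)
  also have "... <= (SUM i:UNIV. b i*(2 * c i)/r)"
  proof (rule sum_mono)
   fix i
   have "abs (Z x $ i * pdi i (cutoff y (r/2)) x) = abs (Z x $ i)*(2/r*abs (pdi i cut0 ((1/(r/2)) *\<^sub>R (x - y))))"
    using r by (simp add: pd_cutoff abs_mult)
   also have "... <= b i*(2/r * c i)"
    using b(1)[of i] r by (intro mult_mono b c x mult_nonneg_nonneg) auto
   finally show "abs (Z x $ i * pdi i (cutoff y (r/2)) x) <= b i*(2 * c i)/r" by simp
  qed
  finally show "abs (vf_apply Z (cutoff y (r/2)) x) <= (SUM i:UNIV. b i*(2 * c i))/r"
   by (simp add: sum_divide_distrib)
 qed
qed

lemma vf_apply_cut_sq: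
 assumes c: "smooth_on UNIV c" and g: "smooth_on UNIV (g :: real^'n::finite => real)"
 shows "vf_apply Z (%x. (c x)^2*g x) x = (c x)^2 * vf_apply Z g x+2 * c x * vf_apply Z c x*g x"
proof -
 have "vf_apply Z (%x. (c x)^2*g x) x = vf_apply Z (%x. c x*(c x*g x)) x"
  by (simp add: power2_eq_square mult.assoc)
 also have "... = c x*(c x * vf_apply Z g x + vf_apply Z c x*g x) + vf_apply Z c x*(c x*g x)"
  by (simp add: vf_apply_mult differentiable_UNIV c g smooth_on_mult)
 finally show ?thesis by (simp add: power2_eq_square algebra_simps)
qed

lemma two_mult_le: fixes a b :: real assumes "l > 0" shows "2*abs (a*b) <= l*a^2+(1/l)*b^2"
proof -
 have "0 <= (l*abs a - abs b)^2" by simp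
 hence "2*(l*abs (a*b)) <= l*(l*a^2)+b^2" by (simp add: power2_diff power_mult_distrib abs_mult power2_eq_square algebra_simps)
 thus ?thesis using assms by (simp add: field_simps)
qed

text \<open>Kohn's commutator estimate; \<open>w\<close> stands for \<open>h [Y, Z] v\<close>.\<close>

lemma kohn_ineq:
 fixes Y Z :: "real^'n::finite => real^'n"
 assumes Y: "pvf Y" "bparts Y" and Z: "pvf Z" "bparts Z"
 obtains K where "K > 0" "!!y r v w h l. norm y <= R ==> 0 < r ==> r <= 1 ==> smooth_on UNIV v ==> smooth_on UNIV w ==>
  0 < h ==> (ALL x. h * vf_apply (lie_bracket Y Z) v x = w x) ==> 0 < l ==> l <= 1 ==>
  h*nrm2 y (r/2) (vf_apply (lie_bracket Y Z) v) <= K/r*(l*(nrm2 y r (vf_apply Z v)+nrm2 y r (vf_apply Z w)) +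
   (1/l)*(nrm2 y r (vf_apply Y v)+nrm2 y r w+nrm2 y r (vf_apply Y w)))"
proof -
 obtain B1 where B1: "B1 > 0" "!!y r x. norm y <= R ==> 0 < r ==> r <= 1 ==> dist y x < r ==>
  abs (vf_apply Y (cutoff y (r/2)) x) <= B1/r" by (rule cutoff_vf_bound[OF Y(1), of R]) (rule that)
 obtain B2 where B2: "B2 > 0" "!!y r x. norm y <= R ==> 0 < r ==> r <= 1 ==> dist y x < r ==>
  abs (vf_apply Z (cutoff y (r/2)) x) <= B2/r" by (rule cutoff_vf_bound[OF Z(1), of R]) (rule that)
 define K where "K = 1+B1+B2"
 have K: "K > 0" using B1(1) B2(1) by (simp add: K_def)
 show thesis
 proof (rule that[OF K])
  fix y :: "real^'n" and r h l :: real and v w :: "real^'n => real"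
  assume y: "norm y <= R" and r: "0 < r" "r <= 1" and v: "smooth_on UNIV v" and w: "smooth_on UNIV w"
   and h: "0 < h" and hw0: "ALL x. h * vf_apply (lie_bracket Y Z) v x = w x" and l: "0 < l" "l <= 1"
  note hw = hw0[rule_format]
  let ?c = "cutoff y (r/2)"
  let ?W = "lie_bracket Y Z"
  note sY = pvf_svf[OF Y(1)] and sZ = pvf_svf[OF Z(1)]
  have cc: "csm ?c" by (rule csm_cutoff) (use r in simp)
  have c: "smooth_on UNIV ?c" using csm_smooth[OF cc] .
  have g: "csm (%x. (?c x)^2*w x)"
   using csm_mult_right[OF csm_mult_left[OF c cc] w] by (simp add: power2_eq_square)
  note sm = smooth_vf_UNIV[OF sY] smooth_vf_UNIV[OF sZ] smooth_vf_UNIV[OF pvf_svf[OF pvf_lie_bracket[OF Y(1) Z(1)]]]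
  \<comment> \<open>Integration by parts for \<open>Y\<close> and for \<open>Z\<close> makes the
    integral of \<open>?F\<close> zero. Its second-order terms combine to the bracket and leave the
    square to be estimated, besides products of first-order terms.\<close>
  let ?F = "%x. vf_apply Y (vf_apply Z v) x*((?c x)^2*w x) + vf_apply Z v x * vf_apply Y (%x. (?c x)^2*w x) x
   - (vf_apply Z (vf_apply Y v) x*((?c x)^2*w x) + vf_apply Y v x * vf_apply Z (%x. (?c x)^2*w x) x)"
  have I: "integrable lborel (%x. vf_apply Y (vf_apply Z v) x*((?c x)^2*w x))"
   "integrable lborel (%x. vf_apply Z v x * vf_apply Y (%x. (?c x)^2*w x) x)"
   "integrable lborel (%x. vf_apply Z (vf_apply Y v) x*((?c x)^2*w x))"
   "integrable lborel (%x. vf_apply Y v x * vf_apply Z (%x. (?c x)^2*w x) x)"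
   by (intro csm_integrable csm_mult_left g sm v csm_vf_apply sY sZ)+
  have IF: "integrable lborel ?F" by (intro intb_add intb_diff I)
  have "(LINT x|lborel. ?F x) = 0"
   using Y(2)[unfolded bparts_def, rule_format, OF sm(2)[OF v] g] Z(2)[unfolded bparts_def, rule_format, OF sm(1)[OF v] g] I
   by simp
  let ?i = "%x. indicator (ball y r) x :: real"
  let ?G = "%x. h*(indicator (ball y (r/2)) x*(vf_apply ?W v x)^2) - K/r*(l*(?i x*(vf_apply Z v x)^2+?i x*(vf_apply Z w x)^2)
   +(1/l)*(?i x*(vf_apply Y v x)^2+?i x*(w x)^2+?i x*(vf_apply Y w x)^2))"
  note N = nrm2_integrable[OF smooth_on_continuous]
  have IG: "integrable lborel ?G"
   by (intro intb_diff integrable_mult_right intb_add N sm v w)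
  have le: "?G x <= ?F x" for x
  proof (cases "dist y x < r")
   case False
   have "vf_apply V (%x. (?c x)^2*w x) x = 0" for V
    by (rule vf_apply_zero_open[of "{x. dist y x > 3/4*r}"])
    (use False r cutoff(4)[of "r/2" y] in "auto intro!: open_Collect_less continuous_intros")
   thus ?thesis using False r cutoff(4)[of "r/2" y x] by simp
  next
   case True
   have F: "?F x = (?c x)^2*(h*(vf_apply ?W v x)^2)+(vf_apply Z v x*((?c x)^2 * vf_apply Y w x)+2*?c x * vf_apply Y ?c x*(vf_apply Z v x*w x))
    - (vf_apply Y v x*((?c x)^2 * vf_apply Z w x)+2*?c x * vf_apply Z ?c x*(vf_apply Y v x*w x))"
   proof -
    have W: "vf_apply ?W v x = vf_apply Y (vf_apply Z v) x - vf_apply Z (vf_apply Y v) x"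
    by (rule vf_apply_lie_bracket[OF sY sZ v])
    have "(?c x)^2*(h*(vf_apply ?W v x)^2) = (?c x)^2*(vf_apply ?W v x*w x)"
    unfolding hw[of x, symmetric] by (simp add: power2_eq_square)
    also have "... = vf_apply Y (vf_apply Z v) x*((?c x)^2*w x) - vf_apply Z (vf_apply Y v) x*((?c x)^2*w x)"
    unfolding W by (simp add: algebra_simps)
    finally have e: "(?c x)^2*(h*(vf_apply ?W v x)^2) = ..." .
    have t: "a*((?c x)^2*b+2*?c x*d*w x) = a*((?c x)^2*b)+2*?c x*d*(a*w x)" for a b d :: real
    by (simp add: algebra_simps)
    show ?thesis unfolding e vf_apply_cut_sq[OF c w] t by linarith
   qed
   have c01: "0 <= ?c x" "?c x <= 1" using cutoff[of "r/2" y x] r by auto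
   hence c2: "(?c x)^2 <= 1" "(?c x)^2 >= 0" by (simp_all add: power_le_one)
   let ?a = "vf_apply Z v x" and ?b = "vf_apply Z w x" and ?d = "vf_apply Y v x" and ?e = "vf_apply Y w x" and ?f = "w x"
   have s1: "abs (?a*((?c x)^2*?e)) <= abs (?a*?e)" "abs (?d*((?c x)^2*?b)) <= abs (?d*?b)"
    using mult_left_le_one_le[OF abs_ge_zero c2(2,1), of "?a*?e"] mult_left_le_one_le[OF abs_ge_zero c2(2,1), of "?d*?b"] c2
    by (simp_all add: abs_mult mult_ac)
   have s2: "abs (2*?c x * vf_apply V ?c x * t) <= B/r*(2*abs t)" if "abs (vf_apply V ?c x) <= B/r" for V t B
   proof -
    have "abs (2*?c x * vf_apply V ?c x * t) = (?c x*abs (vf_apply V ?c x))*(2*abs t)" using c01 by (simp add: abs_mult)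
    also have "... <= (1*(B/r))*(2*abs t)" using c01 that by (intro mult_right_mono mult_mono) auto
    finally show ?thesis by simp
   qed
   let ?T = "l*(?a\<^sup>2+?b\<^sup>2)+(1/l)*(?d\<^sup>2+?f\<^sup>2+?e\<^sup>2)"
   have l1: "l*z^2 <= (1/l)*z^2" for z :: real
   proof -
    have "l <= 1/l" using l by (simp add: le_divide_eq mult_le_one)
    thus ?thesis by (rule mult_right_mono) simp
   qed
   have p: "l*z^2 >= 0" "(1/l)*z^2 >= 0" for z :: real using l by simp_all
   note q = p[of ?a] p[of ?b] p[of ?d] p[of ?e] p[of ?f] l1[of ?f]
   \<comment> \<open>Young's inequality puts the weight \<open>l\<close> on the derivatives along
     \<open>Z\<close>, whose bounds will be weak, and \<open>1/l\<close> on those along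
     \<open>Y\<close>, whose bounds will be good.\<close>
   have T0: "2*abs (?a*?e)+2*abs (?d*?b) <= ?T"
    using two_mult_le[OF l(1), of ?a ?e] two_mult_le[OF l(1), of ?b ?d] q
    unfolding distrib_left by (simp add: mult.commute[of ?b])
   have T1: "2*abs (?a*?f) <= ?T" using two_mult_le[OF l(1), of ?a ?f] q unfolding distrib_left by linarith
   have T2: "2*abs (?d*?f) <= ?T" using two_mult_le[OF l(1), of ?f ?d] q unfolding distrib_left mult.commute[of ?d] by linarith
   have T: "?T >= 0" using T1 abs_ge_zero[of "?a*?f"] by linarith
   have "1 <= 1/r" using r by simp
   from mult_right_mono[OF this T] have "?T <= (1/r)*?T" by (simp only: mult_1_left)
   hence "abs (?a*?e)+abs (?d*?b) <= (1/r)*?T" using T0 by linarith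
   moreover have "abs (2*?c x * vf_apply Y ?c x*(?a*?f)) <= B1/r*?T"
    by (rule order_trans[OF s2[OF B1(2)[OF y r True]]]) (use T1 B1(1) r in "intro mult_left_mono; simp")
   moreover have "abs (2*?c x * vf_apply Z ?c x*(?d*?f)) <= B2/r*?T"
    by (rule order_trans[OF s2[OF B2(2)[OF y r True]]]) (use T2 B2(1) r in "intro mult_left_mono; simp")
   moreover have "K/r*?T = (1/r)*?T+B1/r*?T+B2/r*?T"
    by (simp add: K_def add_divide_distrib distrib_right)
   moreover have "h*(indicator (ball y (r/2)) x*(vf_apply ?W v x)^2) <= (?c x)^2*(h*(vf_apply ?W v x)^2)"
    using cutoff(3)[of "r/2" y x] r h c2 by (cases "dist y x < r/2") auto
   moreover have "?i x = 1" using True by simp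
   ultimately show ?thesis unfolding F using s1 by (simp only: mult_1_left)
  qed
  have "(LINT x|lborel. ?G x) <= 0" using integral_mono[OF IG IF le] \<open>(LINT x|lborel. ?F x) = 0\<close> by simp
  thus "h*nrm2 y (r/2) (vf_apply ?W v) <= K/r*(l*(nrm2 y r (vf_apply Z v)+nrm2 y r (vf_apply Z w)) +
   (1/l)*(nrm2 y r (vf_apply Y v)+nrm2 y r w+nrm2 y r (vf_apply Y w)))"
   unfolding nrm2_def
   by (subst (asm) int_diff; (subst int_mult0 | simp add: N sm v w))
 qed
qed

context hvf begin

text \<open>A Caccioppoli inequality: the equation is tested with \<open>c^2 v\<close>,
  \<open>c\<close> a cutoff. The right-hand side is in divergence form, so no derivative of
  \<open>f j\<close> enters the bound.\<close>

lemma energy_ineq: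
 obtains K where "K > 0" "!!y r v f0 f. norm y <= R ==> 0 < r ==> r <= 1 ==> smooth_on UNIV v ==> smooth_on UNIV f0 ==>
  (ALL j:{1..m}. smooth_on UNIV (f j)) ==>
  (ALL x. dist y x < r --> L v x = f0 x+(SUM j=1..m. XX j (f j) x)) ==>
  (SUM j=1..m. nrm2 y (r/2) (XX j v)) <= K/r^2*(nrm2 y r v + nrm2 y r f0+(SUM j=1..m. nrm2 y r (f j)))"
proof -
 have "EX b. b > 0 & (ALL y r x. norm y <= R --> 0 < r --> r <= 1 --> dist y x < r -->
  abs (XX j (cutoff y (r/2)) x) <= b/r)" if "j : {1..m}" for j
  using cutoff_vf_bound[OF pvfX[OF that], of R] by metis
 hence "EX b. ALL j:{1..m}. b j > 0 & (ALL y r x. norm y <= R --> 0 < r --> r <= 1 --> dist y x < r -->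
  abs (XX j (cutoff y (r/2)) x) <= b j/r)" by (intro bchoice ballI)
 then obtain b where b: "!!j. j : {1..m} ==> b j > 0" "!!j y r x. j : {1..m} ==> norm y <= R ==> 0 < r ==> r <= 1 ==> dist y x < r ==>
  abs (XX j (cutoff y (r/2)) x) <= b j/r" by blast
 \<comment> \<open>5 is 4 + 1: the derivative of the cutoff occurs in two products, split by Young's
   inequality so that half of the main term survives.\<close>
 define B where "B = (SUM j=1..m. 5*(b j)^2)"
 define K where "K = 2*(B+3)"
 have B: "B >= 0" unfolding B_def by (intro sum_nonneg) auto
 hence K: "K > 0" by (simp add: K_def)
 show thesis
 proof (rule that[OF K])
  fix y :: "real^'n" and r :: real and v f0 :: "real^'n => real" and f :: "nat => real^'n => real"
  assume y: "norm y <= R" and r: "0 < r" "r <= 1" and v: "smooth_on UNIV v" and f0: "smooth_on UNIV f0"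
   and f': "ALL j:{1..m}. smooth_on UNIV (f j)"
   and Lv': "ALL x. dist y x < r --> L v x = f0 x+(SUM j=1..m. XX j (f j) x)"
  note f = f'[rule_format] and Lv = Lv'[rule_format]
  let ?c = "cutoff y (r/2)"
  have cc: "csm ?c" by (rule csm_cutoff) (use r in simp)
  have c: "smooth_on UNIV ?c" using csm_smooth[OF cc] .
  have g: "csm (%x. (?c x)^2*w x)" if "smooth_on UNIV w" for w
   using csm_mult_right[OF csm_mult_left[OF c cc] that] by (simp add: power2_eq_square)
  note sm = smooth_vf_UNIV[OF svfX]
  note N = nrm2_integrable[OF smooth_on_continuous]
  let ?p = "%j x. XX j v x"
  let ?F = "%j x. ?p j x*((?c x)^2*?p j x) + v x*XX j (%x. (?c x)^2*?p j x) x
   - (XX j (f j) x*((?c x)^2 * v x)+f j x*XX j (%x. (?c x)^2 * v x) x)"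
  have I: "integrable lborel (%x. ?p j x*((?c x)^2*?p j x))"
    "integrable lborel (%x. v x*XX j (%x. (?c x)^2*?p j x) x)"
    "integrable lborel (%x. XX j (f j) x*((?c x)^2 * v x))"
    "integrable lborel (%x. f j x*XX j (%x. (?c x)^2 * v x) x)" if j: "j : {1..m}" for j
   by (intro csm_integrable csm_mult_left g sm v csm_vf_apply svfX j f)+
  have IFj: "integrable lborel (?F j)" if "j : {1..m}" for j
   by (intro intb_add intb_diff I that)
  have "(LINT x|lborel. ?F j x) = 0" if j: "j : {1..m}" for j
   using bpartsX[OF j, unfolded bparts_def, rule_format, OF v g[OF sm[OF j v]]]
    bpartsX[OF j, unfolded bparts_def, rule_format, OF f[OF j] g[OF v]] I[OF j] by simp
  hence "(SUM j=1..m. LINT x|lborel. ?F j x) = 0" by simp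
  moreover have IF: "integrable lborel (%x. SUM j=1..m. ?F j x)"
   by (rule intb_sum) (rule IFj)
  ultimately have F0: "(LINT x|lborel. (SUM j=1..m. ?F j x)) = 0"
   by (subst int_sum) (auto intro: IFj)
  let ?i = "%x. indicator (ball y r) x :: real"
  let ?G = "%x. (1/2)*(SUM j=1..m. indicator (ball y (r/2)) x*(?p j x)^2) -
   (B+3)/r^2*(?i x*(v x)^2+?i x*(f0 x)^2+(SUM j=1..m. ?i x*(f j x)^2))"
  have IG: "integrable lborel ?G"
   by (intro intb_diff integrable_mult_right intb_add
    intb_sum N sm v f0 f)
  have le: "?G x <= (SUM j=1..m. ?F j x)" for x
  proof (cases "dist y x < r")
   case False
   have "vf_apply V (%x. (?c x)^2*w x) x = 0" for V w
    by (rule vf_apply_zero_open[of "{x. dist y x > 3/4*r}"])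
    (use False r cutoff(4)[of "r/2" y] in "auto intro!: open_Collect_less continuous_intros")
   thus ?thesis using False r cutoff(4)[of "r/2" y x] by simp
  next
   case True
   have c01: "0 <= ?c x" "?c x <= 1" using cutoff[of "r/2" y x] r by auto
   let ?q = "(?c x)^2"
   let ?a = "%j. XX j ?c x"
   have c2: "?q <= 1" "?q >= 0" using c01 by (simp_all add: power_le_one)
   have Fj: "?F j x = (?q*(?p j x)^2+2*(?c x*?p j x)*(?a j * v x) - ?q*(f j x*?p j x) - 2*?c x*(?a j * v x)*f j x)
    +?q * v x*(XX j (?p j) x - XX j (f j) x)" if "j : {1..m}" for j
    unfolding vf_apply_cut_sq[OF c sm[OF that v]] vf_apply_cut_sq[OF c v]
    by (simp add: power2_eq_square algebra_simps)
   have Fle: "?F j x >= (1/2)*(?q*(?p j x)^2) - 5*(b j)^2/r^2*(v x)^2 - 2*(f j x)^2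
    +?q * v x*(XX j (?p j) x - XX j (f j) x)" if j: "j : {1..m}" for j
   proof -
    have a: "(?a j * v x)^2 <= (b j)^2/r^2*(v x)^2"
    unfolding power_mult_distrib power_divide[symmetric]
    using b(2)[OF j y r True] b(1)[OF j] r(1) by (intro mult_right_mono abs_le_square_iff[THEN iffD1]) auto
    have "2*(?c x*?p j x)*(?a j * v x) >= - (1/4*(?c x*?p j x)^2+4*(?a j * v x)^2)"
    using two_mult_le[of "1/4" "?c x*?p j x" "?a j * v x"] by simp
    moreover have "- ?q*(f j x*?p j x) >= - (1/4*(?c x*?p j x)^2+(f j x)^2)"
    proof -
    have "2*abs ((?c x*?p j x)*(?c x*f j x)) <= 1/2*(?c x*?p j x)^2+2*(?c x*f j x)^2"
    using two_mult_le[of "1/2" "?c x*?p j x" "?c x*f j x"] by simp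
    moreover have "(?c x*f j x)^2 <= (f j x)^2"
    unfolding power_mult_distrib using c2 by (intro mult_left_le_one_le) auto
    moreover have "(?c x*?p j x)*(?c x*f j x) = ?q*(f j x*?p j x)" by (simp add: power2_eq_square)
    ultimately show ?thesis by (simp add: abs_le_iff)
    qed
    moreover have "- 2*?c x*(?a j * v x)*f j x >= - ((?a j * v x)^2+(f j x)^2)"
    proof -
    have "2*abs ((?a j * v x)*(?c x*f j x)) <= (?a j * v x)^2+(?c x*f j x)^2"
    using two_mult_le[of 1 "?a j * v x" "?c x*f j x"] by simp
    moreover have "(?c x*f j x)^2 <= (f j x)^2"
    unfolding power_mult_distrib using c2 by (intro mult_left_le_one_le) auto
    moreover have "(?a j * v x)*(?c x*f j x) = ?c x*(?a j * v x)*f j x" by simp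
    ultimately show ?thesis by (simp add: abs_le_iff)
    qed
    moreover have "(?c x*?p j x)^2 = ?q*(?p j x)^2" by (simp add: power_mult_distrib)
    ultimately show ?thesis unfolding Fj[OF j] using a by linarith
   qed
   have "(SUM j=1..m. ?F j x) >= (SUM j=1..m. (1/2)*(?q*(?p j x)^2) - 5*(b j)^2/r^2*(v x)^2 - 2*(f j x)^2
    +?q * v x*(XX j (?p j) x - XX j (f j) x))" (is "_ >= ?S")
    by (rule sum_mono) (rule Fle)
   moreover have "?S = (1/2)*(?q*(SUM j=1..m. (?p j x)^2)) - B/r^2*(v x)^2 - 2*(SUM j=1..m. (f j x)^2)
    +?q * v x*(L v x - (SUM j=1..m. XX j (f j) x))"
    by (simp add: sum.distrib sum_subtractf sum_distrib_left[symmetric] sum_distrib_right[symmetric] sum_divide_distrib[symmetric]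
    B_def sum_of_squares_def)
   moreover have "?q * v x*(L v x - (SUM j=1..m. XX j (f j) x)) >= - ((v x)^2+(f0 x)^2)"
   proof -
    have "abs (?q*(v x*f0 x)) <= abs (v x*f0 x)"
    using mult_left_le_one_le[OF abs_ge_zero c2(2,1), of "v x*f0 x"] c2 by (simp add: abs_mult)
    moreover have "2*abs (v x*f0 x) <= (v x)^2+(f0 x)^2" using two_mult_le[of 1 "v x" "f0 x"] by simp
    moreover have "?q * v x*(L v x - (SUM j=1..m. XX j (f j) x)) = ?q*(v x*f0 x)" using Lv[OF True] by simp
    ultimately show ?thesis by linarith
   qed
   moreover have "?q*(SUM j=1..m. (?p j x)^2) >= (SUM j=1..m. indicator (ball y (r/2)) x*(?p j x)^2)"
    using cutoff(3)[of "r/2" y x] r c2 by (cases "dist y x < r/2") (auto intro!: sum_nonneg mult_nonneg_nonneg)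
   moreover have "(B+3)/r^2*(?i x*(v x)^2+?i x*(f0 x)^2+(SUM j=1..m. ?i x*(f j x)^2)) >=
    B/r^2*(v x)^2+2*(SUM j=1..m. (f j x)^2)+((v x)^2+(f0 x)^2)"
   proof -
    let ?A = "(v x)^2" and ?D = "(f0 x)^2+(SUM j=1..m. (f j x)^2)"
    have D: "?D >= 0" "(SUM j=1..m. (f j x)^2) >= 0" by (auto intro!: add_nonneg_nonneg sum_nonneg)
    have r1: "1/r^2 >= 1" using r by (simp add: power_le_one)
    have "B/r^2*(?A+?D) >= B/r^2*?A" using B D by (intro mult_left_mono) auto
    moreover have "(1/r^2)*(3*(?A+?D)) >= 1*(3*(?A+?D))" using D by (intro mult_right_mono r1) auto
    moreover have "3*(?A+?D) >= 2*(SUM j=1..m. (f j x)^2)+((v x)^2+(f0 x)^2)"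
    using D(2) zero_le_power2[of "v x"] zero_le_power2[of "f0 x"] by argo
    ultimately have "B/r^2*?A+2*(SUM j=1..m. (f j x)^2)+((v x)^2+(f0 x)^2) <=
    B/r^2*(?A+?D)+(1/r^2)*(3*(?A+?D))" by linarith
    also have "... = (B+3)/r^2*(?A+?D)" by (simp add: add_divide_distrib distrib_right)
    also have "?A+?D = ?i x*(v x)^2+?i x*(f0 x)^2+(SUM j=1..m. ?i x*(f j x)^2)" using True by simp
    finally show ?thesis .
   qed
   ultimately show ?thesis by linarith
  qed
  have G0: "(LINT x|lborel. ?G x) <= 0" using integral_mono[OF IG IF le] F0 by simp
  have "(LINT x|lborel. ?G x) = (1/2)*(SUM j=1..m. nrm2 y (r/2) (?p j)) -
   (B+3)/r^2*(nrm2 y r v + nrm2 y r f0+(SUM j=1..m. nrm2 y r (f j)))"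
  proof -
   have s1: "(LINT x|lborel. (SUM j=1..m. indicator (ball y (r/2)) x*(?p j x)^2)) = (SUM j=1..m. nrm2 y (r/2) (?p j))"
    unfolding nrm2_def by (rule int_sum) (intro N sm v)
   have s2: "(LINT x|lborel. (SUM j=1..m. ?i x*(f j x)^2)) = (SUM j=1..m. nrm2 y r (f j))"
    unfolding nrm2_def by (rule int_sum) (intro N f)
   have i1: "integrable lborel (%x. SUM j=1..m. indicator (ball y (r/2)) x*(?p j x)^2)"
    by (rule intb_sum) (intro N sm v)
   have i2: "integrable lborel (%x. SUM j=1..m. ?i x*(f j x)^2)"
    by (rule intb_sum) (intro N f)
   have i3: "integrable lborel (%x. (1/2)*(SUM j=1..m. indicator (ball y (r/2)) x*(?p j x)^2))"
    by (rule integrable_mult_right) (rule i1)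
   have i4: "integrable lborel (%x. ?i x*(v x)^2+?i x*(f0 x)^2)"
    by (intro intb_add N v f0)
   have i5: "integrable lborel (%x. (B+3)/r^2*(?i x*(v x)^2+?i x*(f0 x)^2+(SUM j=1..m. ?i x*(f j x)^2)))"
    by (rule integrable_mult_right) (rule intb_add[OF i4 i2])
   show ?thesis
    unfolding int_diff[OF i3 i5] int_mult0
    int_add[OF i4 i2] int_add[OF N[OF v] N[OF f0]] s1 s2 nrm2_def[symmetric] ..
  qed
  with G0 have "(1/2)*(SUM j=1..m. nrm2 y (r/2) (?p j)) -
   (B+3)/r^2*(nrm2 y r v + nrm2 y r f0+(SUM j=1..m. nrm2 y r (f j))) <= 0" by (simp only:)
  moreover have "K/r^2*T = 2*((B+3)/r^2*T)" for T by (simp add: K_def)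
  ultimately show "(SUM j=1..m. nrm2 y (r/2) (?p j)) <= K/r^2*(nrm2 y r v + nrm2 y r f0+(SUM j=1..m. nrm2 y r (f j)))"
   by (simp only:)
 qed
qed

section \<open>Bootstrap of the decay in the scale\<close>

text \<open>\<open>u\<close> is smooth everywhere, so that all convolutions exist, but harmonic only
  in the ball; \<open>h <= q*r\<close> keeps the operators from seeing beyond it.\<close>

definition adm :: "real => real^'n => real => real => (real^'n => real) => real => bool" where
 "adm R y r h u q \<longleftrightarrow> norm y <= R & 0 < r & r <= 1 & 0 < h & h <= q*r & smooth_on UNIV u &
  (ALL x. dist y x < r --> L u x = 0)"

text \<open>An a priori bound of order \<open>h powr E\<close>, with a polynomial loss in the radius \<open>r\<close>.\<close>

definition bdc :: "real => real => real => nat => real => 'n smop => bool" where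
 "bdc R q C D E T \<longleftrightarrow> (ALL y r h u. adm R y r h u q -->
  nrm2 y (q*r) (T h u) <= C*(1/r)^D*h powr E*(mass y r u)^2)"

definition reg :: "'n smop => bool" where
 "reg T \<longleftrightarrow> (ALL h u. smooth_on UNIV u --> smooth_on UNIV (T h u))"

text \<open>Only the exponent of \<open>h\<close> is tracked. The fraction of the radius, the
  constant and the power of \<open>1/r\<close> may get worse at every step and are hidden.\<close>

definition bd :: "real => real => 'n smop => bool" where
 "bd R E T \<longleftrightarrow> reg T & (EX q C D. 0 < q & q <= 1/4 & 0 <= C & bdc R q C D E T)"

lemma adm_mono: "adm R y r h u q ==> q <= q' ==> adm R y r h u q'"
 unfolding adm_def by (meson less_imp_le mult_right_mono order_trans)

lemma adm_h: "adm R y r h u q ==> q <= 1/4 ==> h <= r/4" "adm R y r h u q ==> q <= 1/4 ==> h <= 1"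
proof -
 have "h <= r/4 & h <= 1" if "adm R y r h u q" "q <= 1/4"
 proof -
  have "q*r <= (1/4)*r" using that by (intro mult_right_mono) (auto simp: adm_def)
  moreover have "h <= q*r" "r <= 1" using that by (auto simp: adm_def)
  ultimately show ?thesis by linarith
 qed
 thus "adm R y r h u q ==> q <= 1/4 ==> h <= r/4" "adm R y r h u q ==> q <= 1/4 ==> h <= 1" by auto
qed

lemma bdc_mono:
 assumes b: "bdc R q C D E T" and r: "reg T" and q: "q' <= q" "q <= 1/4" and C: "0 <= C" "C <= C'"
  and D: "D <= D'" and E: "E' <= E"
 shows "bdc R q' C' D' E' T"
 unfolding bdc_def
proof (intro allI impI)
 fix y r h u assume a': "adm R y r h u q'"
 have a: "adm R y r h u q" using adm_mono[OF a' q(1)] .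
 have sm: "smooth_on UNIV (T h u)" using r a by (auto simp: reg_def adm_def)
 have "nrm2 y (q'*r) (T h u) <= nrm2 y (q*r) (T h u)"
  by (rule nrm2_mono_radius[OF smooth_on_continuous[OF sm]]) (use q a in "auto simp: adm_def intro: mult_right_mono")
 also have "... <= C*(1/r)^D*h powr E*(mass y r u)^2" using b a by (auto simp: bdc_def)
 also have "... <= C'*(1/r)^D'*h powr E'*(mass y r u)^2"
 proof (intro mult_right_mono mult_mono C)
  show "(1/r)^D <= (1/r)^D'" using a D by (intro power_increasing) (auto simp: adm_def)
  show "h powr E <= h powr E'" using adm_h(2)[OF a q(2)] a E by (intro powr_mono') (auto simp: adm_def)
 qed (use a C in "auto simp: adm_def")
 finally show "nrm2 y (q'*r) (T h u) <= C'*(1/r)^D'*h powr E'*(mass y r u)^2" .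
qed

text \<open>The bookkeeping rule for the bounds below: finitely many controlled operators dominate
  \<open>S\<close> on the ball of half the radius, and the weights \<open>h powr a i\<close> add to
  their exponents.\<close>

lemma bd_dom:
 assumes fin: "finite I" and b: "!!i. i : I ==> bd R (E i) (T i)" and S: "reg S" and qq: "qq > 0" and CC: "!!q. q > 0 ==> CC q >= 0"
  and dom: "!!y r h u q. adm R y r h u q ==> 0 < q ==> q <= qq ==> q <= 1/4 ==>
   nrm2 y (q*r/2) (S h u) <= CC q*(1/r)^DD*(SUM i:I. h powr a i*nrm2 y (q*r) (T i h u))"
  and E: "!!i. i : I ==> E' <= E i+a i"
 shows "bd R E' S"
proof -
 have *: "ALL i:I. EX p. 0 < fst p & fst p <= 1/4 & 0 <= fst (snd p) & bdc R (fst p) (fst (snd p)) (snd (snd p)) (E i) (T i)"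
  using b unfolding bd_def by (metis fst_conv snd_conv)
 from bchoice[OF *] obtain p where "ALL i:I. 0 < fst (p i) & fst (p i) <= 1/4 & 0 <= fst (snd (p i)) &
  bdc R (fst (p i)) (fst (snd (p i))) (snd (snd (p i))) (E i) (T i)" ..
 hence p: "!!i. i : I ==> 0 < fst (p i)" "!!i. i : I ==> fst (p i) <= 1/4" "!!i. i : I ==> 0 <= fst (snd (p i))"
  "!!i. i : I ==> bdc R (fst (p i)) (fst (snd (p i))) (snd (snd (p i))) (E i) (T i)"
  by blast+
 define q where "q = Min (insert (min qq (1/4)) ((%i. fst (p i)) ` I))"
 define C where "C = (SUM i:I. fst (snd (p i)))"
 define D where "D = (SUM i:I. snd (snd (p i)))"
 have q: "q > 0" "q <= qq" "q <= 1/4" "!!i. i : I ==> q <= fst (p i)"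
 proof -
  show "q > 0" "!!i. i : I ==> q <= fst (p i)" using fin qq p(1) by (auto simp: q_def)
  have "q <= min qq (1/4)" unfolding q_def by (rule Min_le) (use fin in auto)
  thus "q <= qq" "q <= 1/4" by auto
 qed
 have C: "0 <= C" "!!i. i : I ==> fst (snd (p i)) <= C"
  unfolding C_def by (auto intro!: sum_nonneg p(3) member_le_sum fin)
 have D: "!!i. i : I ==> snd (snd (p i)) <= D" unfolding D_def by (auto intro!: member_le_sum fin)
 have B: "bdc R q C D (E i) (T i)" if "i : I" for i
  by (rule bdc_mono[OF p(4)[OF that]]) (use b[OF that] q that C D p in "auto simp: bd_def")
 show ?thesis
  unfolding bd_def
 proof (intro conjI exI S)
  show "0 < q/2" "q/2 <= 1/4" using q by auto
  show "0 <= CC q*(card I*C)" using CC C q by simp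
  show "bdc R (q/2) (CC q*(card I*C)) (DD+D) E' S"
   unfolding bdc_def
  proof (intro allI impI)
   fix y r h u assume "adm R y r h u (q/2)"
   hence a: "adm R y r h u q" by (rule adm_mono) (use q in auto)
   have h: "0 < h" "h <= 1" and r: "0 < r" using adm_h(2)[OF a q(3)] a by (auto simp: adm_def)
   have "(SUM i:I. h powr a i*nrm2 y (q*r) (T i h u)) <= (SUM i:I. C*(1/r)^D*h powr E'*(mass y r u)^2)"
   proof (rule sum_mono)
    fix i assume i: "i : I"
    have "h powr a i*nrm2 y (q*r) (T i h u) <= h powr a i*(C*(1/r)^D*h powr E i*(mass y r u)^2)"
    using B[OF i] a by (intro mult_left_mono) (auto simp: bdc_def)
    also have "... = C*(1/r)^D*h powr (E i+a i)*(mass y r u)^2" by (simp add: powr_add)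
    also have "... <= C*(1/r)^D*h powr E'*(mass y r u)^2"
    using h E[OF i] C(1) r by (intro mult_right_mono mult_left_mono powr_mono') auto
    finally show "h powr a i*nrm2 y (q*r) (T i h u) <= C*(1/r)^D*h powr E'*(mass y r u)^2" .
   qed
   hence s: "(SUM i:I. h powr a i*nrm2 y (q*r) (T i h u)) <= card I*(C*(1/r)^D*h powr E'*(mass y r u)^2)" by simp
   have "nrm2 y (q*r/2) (S h u) <= CC q*(1/r)^DD*(card I*(C*(1/r)^D*h powr E'*(mass y r u)^2))"
    by (rule order_trans[OF dom[OF a q(1-3)]]) (use s CC q r in "intro mult_left_mono; simp")
   thus "nrm2 y (q/2*r) (S h u) <= CC q*(card I*C)*(1/r)^(DD+D)*h powr E'*(mass y r u)^2"
    by (simp add: power_add mult_ac)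
  qed
 qed
qed

lemma bd_pt:
 assumes fin: "finite I" and b: "!!i. i : I ==> bd R (E i) (T i)" and S: "reg S" and B: "B >= 0"
  and dom: "!!h u x. 0 < h ==> h <= 1 ==> smooth_on UNIV u ==> norm x <= R+1 ==>
   (S h u x)\<^sup>2 <= B*(SUM i:I. h powr a i*(T i h u x)^2)"
  and E: "!!i. i : I ==> E' <= E i+a i"
 shows "bd R E' S"
proof (rule bd_dom[where qq=1 and CC="%_. B" and DD=0 and a=a, OF fin b S])
 fix y r h u q assume a: "adm R y r h u q" and q: "0 < q" "q <= 1" "q <= 1/4"
 have u: "smooth_on UNIV u" and h: "0 < h" "h <= 1" and r: "0 < r" "r <= 1" and y: "norm y <= R"
  using a adm_h(2)[OF a q(3)] by (auto simp: adm_def)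
 have "nrm2 y (q*r/2) (S h u) <= (SUM i:I. (B*h powr a i)*nrm2 y (q*r) (T i h u))"
 proof (rule nrm2_le_sum[OF fin])
  show "continuous_on UNIV (S h u)" using S u by (auto simp: reg_def intro: smooth_on_continuous)
  show "continuous_on UNIV (T i h u)" if "i : I" for i using b[OF that] u by (auto simp: bd_def reg_def intro: smooth_on_continuous)
  show "q*r/2 <= q*r" using q r by simp
  fix x assume x: "dist y x < q*r/2"
  have "q*r <= 1*1" using q r by (intro mult_mono) auto
  hence "norm x <= R+1" using y x norm_triangle_sub[of x y] by (simp add: dist_norm norm_minus_commute)
  from dom[OF h u this] show "(S h u x)^2 <= (SUM i:I. B*h powr a i*(T i h u x)^2)"
   by (simp add: sum_distrib_left mult.assoc)
 qed (use B in auto)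
 thus "nrm2 y (q*r/2) (S h u) <= B*(1/r)^0*(SUM i:I. h powr a i*nrm2 y (q*r) (T i h u))"
  by (simp add: sum_distrib_left mult.assoc)
qed (use B E in auto)

lemma bd_pt1:
 assumes b: "bd R E T" and S: "reg S" and B: "B >= 0"
  and dom: "!!h u x. 0 < h ==> h <= 1 ==> smooth_on UNIV u ==> norm x <= R+1 ==>
   (S h u x)\<^sup>2 <= B*(h powr a*(T h u x)^2)"
  and E: "E' <= E+a"
 shows "bd R E' S"
 by (rule bd_pt[of "{()}" R "%_. E" "%_. T" S B "%_. a"]) (use assms in auto)

lemma bd_add:
 assumes "bd R E S" "bd R E T" shows "bd R E (%h u x. S h u x+T h u x)"
proof (rule bd_pt[of "{True, False}" R "%_. E" "%b. if b then S else T" _ 2 "%_. 0"])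
 show "reg (%h u x. S h u x+T h u x)" using assms by (auto simp: bd_def reg_def intro: smooth_on_add)
 fix h :: real and u :: "real^'n => real" and x :: "real^'n"
 have "(S h u x+T h u x)^2 <= 2*((S h u x)^2+(T h u x)^2)"
  using zero_le_power2[of "S h u x - T h u x"] by (simp add: power2_eq_square algebra_simps)
 thus "(S h u x+T h u x)^2 <= 2*(SUM b:{True, False}. h powr 0*((if b then S else T) h u x)^2)" if "0 < h"
  using that by simp
qed (use assms in auto)

lemma bd_polymult:
 assumes p: "p : polyf" and "bd R E T" shows "bd R E (%h u x. p x*T h u x)"
proof -
 obtain B where B: "B > 0" "!!x. norm x <= R+1 ==> \<bar>p x\<bar> <= B" by (rule polyf_bounded[OF p, of "R+1"]) (rule that)
 show ?thesis
 proof (rule bd_pt1[where B="B^2" and a=0, OF assms(2)])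
  show "reg (%h u x. p x*T h u x)" using assms(2) polyf_smooth[OF p] by (auto simp: bd_def reg_def intro: smooth_on_mult)
  fix h :: real and u :: "real^'n => real" and x :: "real^'n" assume h: "0 < h" and x: "norm x <= R+1"
  have "(p x)^2 <= B^2" using B(2)[OF x] B(1) by (intro abs_le_square_iff[THEN iffD1]) auto
  thus "(p x*T h u x)^2 <= B^2*(h powr 0*(T h u x)^2)"
   using h by (simp add: power_mult_distrib mult_right_mono)
 qed auto
qed

lemma Gop_reg: "Gop n G ==> reg G"
 unfolding reg_def using Gop_smooth by blast

lemma reg_vf: "svf Z ==> reg T ==> reg (%h u. vf_apply Z (T h u))"
 unfolding reg_def using smooth_vf_UNIV by blast

lemma reg_pd: "reg T ==> reg (%h u. pdi i (T h u))"
 unfolding reg_def by (auto intro: smooth_on_pd)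

text \<open>The starting exponent is that of the factor \<open>h^-N\<close> in
  \<open>conv_bound\<close>, squared.\<close>

lemma bd_conv:
 assumes p: "Dn 0 psi" shows "bd R (- 2*real CARD('n)) (conv psi)"
proof -
 let ?N = "CARD('n)"
 obtain B where B: "B > 0" "!!x. abs (psi x) <= B" by (rule csm_bounded[OF Dn_csm[OF p]]) (rule that)
 define V where "V = nrm2 (0::real^'n) (R+1) (%x. 1)"
 have rg: "reg (conv psi)" unfolding reg_def using smooth_conv[OF Dn_csm[OF p]] by blast
 show ?thesis
  unfolding bd_def
 proof (intro conjI exI rg)
  show "0 < (1/4::real)" "(1/4::real) <= 1/4" by auto
  show "0 <= B^2*V" by (simp add: V_def nrm2_nonneg)
  show "bdc R (1/4) (B^2*V) 0 (- 2*real ?N) (conv psi)"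
   unfolding bdc_def
  proof (intro allI impI)
   fix y r h u assume a: "adm R y r h u (1/4)"
   have u: "smooth_on UNIV u" and h: "0 < h" "h <= r/4" and r: "0 < r" "r <= 1" and y: "norm y <= R"
    using a adm_h(1)[OF a] by (auto simp: adm_def)
   let ?M = "mass y r u"
   have c: "continuous_on UNIV (conv psi h u)" using rg u by (auto simp: reg_def intro: smooth_on_continuous)
   have "nrm2 y (1/4*r) (conv psi h u) <= (SUM i:{()}. (B/h^?N*?M)^2*nrm2 y (1/4*r) (%x. 1))"
   proof (rule nrm2_le_sum)
    fix x assume x: "dist y x < 1/4*r"
    hence "dist y x < r - h" using h by simp
    from conv_bound[OF p B(2) h(1) smooth_on_continuous[OF u] this]
    have "abs (conv psi h u x) <= B/h^?N*?M" by (simp add: mass_def)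
    thus "(conv psi h u x)^2 <= (SUM i:{()}. (B/h^?N*?M)^2*1^2)"
    using power_mono[of "abs (conv psi h u x)" "B/h^?N*?M" 2] by simp
   qed (use c in auto)
   also have "... <= (B/h^?N*?M)^2*V"
   proof -
    have "ball y (1/4*r) <= ball 0 (R+1)"
    proof
    fix x assume "x : ball y (1/4*r)"
    thus "x : ball 0 (R+1)" using y r norm_triangle_sub[of x y] by (simp add: dist_norm norm_minus_commute)
    qed
    hence "nrm2 y (1/4*r) (%x. 1) <= V"
    unfolding nrm2_def V_def by (intro integral_mono nrm2_integrable[unfolded nrm2_def]) (auto simp: indicator_def split: if_splits)
    thus ?thesis by (simp add: mult_left_mono)
   qed
   also have "... = B^2*V*(1/r)^0*h powr (- 2*real ?N)*?M\<^sup>2"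
   proof -
    have "h powr (- 2*real ?N) = 1/(h^?N)^2"
    proof -
    have "h powr (- 2*real ?N) = inverse (h powr real (?N*2))"
    unfolding powr_minus[symmetric] by (simp add: mult.commute)
    also have "... = inverse (h^(?N*2))" by (simp only: powr_realpow[OF h(1)])
    finally show ?thesis by (simp add: power_mult divide_inverse)
    qed
    thus ?thesis by (simp add: power_mult_distrib power_divide)
   qed
   finally show "nrm2 y (1/4*r) (conv psi h u) <= B^2*V*(1/r)^0*h powr (- 2*real ?N)*?M\<^sup>2" .
  qed
 qed
qed

lemma bd_Gop_base: "Gop n G ==> bd R (- 2*real CARD('n)) G"
proof (induction rule: Gop.induct)
 case (Gop_base k psi n w)
 show ?case
 proof (rule bd_pt1[where B=1 and a=0, OF bd_conv[OF Dn_base[OF Gop_base(1)]]])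
  show "reg (%h u x. h^w * conv psi h u x)" by (rule Gop_reg[OF Gop.Gop_base[OF Gop_base]])
  fix h :: real and u :: "real^'n => real" and x :: "real^'n" assume h: "0 < h" "h <= 1"
  hence "(h^w)^2 <= 1" by (simp add: power_le_one)
  thus "(h^w * conv psi h u x)^2 <= 1*(h powr 0*(conv psi h u x)^2)"
   using h by (simp add: power_mult_distrib mult_left_le_one_le)
 qed auto
next
 case (Gop_mult a n G)
 thus ?case by (intro bd_polymult)
next
 case (Gop_add n G G')
 thus ?case by (intro bd_add)
qed

lemma bd_mono: "bd R E T ==> E' <= E ==> bd R E' T"
 by (rule bd_pt1[where B=1 and a=0]) (auto simp: bd_def)

text \<open>Commuting \<open>G\<close> past both factors of each \<open>X j\<close> squared leaves
  remainders of the same order. They are arranged as a zero-order term plus derivatives along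
  \<open>X j\<close>, the form that \<open>energy_ineq\<close> accepts.\<close>

lemma L_Gop:
 assumes G: "Gop n G"
 obtains F0 F where "Gop n F0" "!!j. j : {1..m} ==> Gop n (F j)"
  "!!h u x. smooth_on UNIV u ==> L (G h u) x = G h (L u) x+F0 h u x+(SUM j=1..m. XX j (F j h u) x)"
proof -
 have "ALL j:{1..m}. EX T. Gop n T & (ALL h u x. smooth_on UNIV u --> G h (XX j u) x = XX j (G h u) x+T h u x)"
  using Gop_comm[OF pvfX G] by blast
 from bchoice[OF this] obtain T where T: "ALL j:{1..m}. Gop n (T j) &
  (ALL h u x. smooth_on UNIV u --> G h (XX j u) x = XX j (G h u) x+T j h u x)" ..
 have "ALL j:{1..m}. EX S. Gop n S & (ALL h u x. smooth_on UNIV u --> T j h (XX j u) x = XX j (T j h u) x+S h u x)"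
  using Gop_comm[OF pvfX] T by blast
 from bchoice[OF this] obtain S where S: "ALL j:{1..m}. Gop n (S j) &
  (ALL h u x. smooth_on UNIV u --> T j h (XX j u) x = XX j (T j h u) x+S j h u x)" ..
 show thesis
 proof (rule that)
  show "Gop n (%h u x. (-1)*(SUM j=1..m. S j h u x))" by (intro Gop_cmult Gop_sum) (use S in blast)
  show "Gop n (%h u x. (-2)*T j h u x)" if "j : {1..m}" for j using T that by (intro Gop_cmult) blast
  fix h :: real and u :: "real^'n => real" and x assume u: "smooth_on UNIV u"
  have XX: "XX j (XX j (G h u)) x =
    G h (XX j (XX j u)) x - S j h u x+XX j (%x. (-2)*T j h u x) x" if j: "j : {1..m}" for j
  proof -
   have Tj: "Gop n (T j)" "!!h u x. smooth_on UNIV u ==> G h (XX j u) x = XX j (G h u) x+T j h u x"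
    and Sj: "!!h u x. smooth_on UNIV u ==> T j h (XX j u) x = XX j (T j h u) x+S j h u x"
    using T S j by blast+
   have Xu: "smooth_on UNIV (XX j u)" by (rule smooth_vf_UNIV[OF svfX[OF j] u])
   have e: "XX j (G h u) = (%x. G h (XX j u) x - T j h u x)"
    using Tj(2)[OF u] by (simp add: fun_eq_iff)
   have "XX j (XX j (G h u)) x = XX j (G h (XX j u)) x - XX j (T j h u) x"
    unfolding e by (rule vf_diff_UNIV[OF Gop_smooth[OF G Xu] Gop_smooth[OF Tj(1) u]])
   also have "XX j (G h (XX j u)) x = G h (XX j (XX j u)) x - T j h (XX j u) x"
    using Tj(2)[OF Xu] by simp
   also have "T j h (XX j u) x = XX j (T j h u) x+S j h u x" by (rule Sj[OF u])
   also have "XX j (%x. (-2)*T j h u x) x = (-2)*XX j (T j h u) x"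
    by (rule vf_apply_cmult[OF differentiable_UNIV[OF Gop_smooth[OF Tj(1) u]]])
   ultimately show ?thesis by simp
  qed
  have "L u = (%x. SUM j=1..m. XX j (XX j u) x)" by (simp add: fun_eq_iff sum_of_squares_def)
  hence "G h (L u) x = (SUM j=1..m. G h (XX j (XX j u)) x)"
   by (simp only:) (rule Gop_sum_arg[OF G], intro smooth_on_continuous smooth_XX open_UNIV u)
  thus "L (G h u) x = G h (L u) x+(-1)*(SUM j=1..m. S j h u x)+(SUM j=1..m. XX j (%x. (-2)*T j h u x) x)"
   by (simp add: sum_of_squares_def XX sum.distrib sum_subtractf)
 qed
qed

text \<open>A derivative along \<open>X j\<close> costs nothing, where a general one would cost 2 in
  the exponent: as \<open>L u = 0\<close> in the ball, the equation for \<open>G h u\<close>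
  contains only remainders of order \<open>n\<close>, which \<open>hyp\<close> covers.\<close>

lemma bd_energy:
 assumes hyp: "!!G. Gop n G ==> bd R E G" and G: "Gop n G" and j: "j : {1..m}"
 shows "bd R E (%h u. XX j (G h u))"
proof -
 obtain F0 F where F: "Gop n F0" "!!j. j : {1..m} ==> Gop n (F j)"
  "!!h u x. smooth_on UNIV u ==> L (G h u) x = G h (L u) x+F0 h u x+(SUM j=1..m. XX j (F j h u) x)"
  by (rule L_Gop[OF G]) (rule that)
 obtain K where K: "K > 0" "!!y r v f0 f. norm y <= R ==> 0 < r ==> r <= 1 ==> smooth_on UNIV v ==> smooth_on UNIV f0 ==>
  (ALL j:{1..m}. smooth_on UNIV (f j)) ==>
  (ALL x. dist y x < r --> L v x = f0 x+(SUM j=1..m. XX j (f j) x)) ==>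
  (SUM j=1..m. nrm2 y (r/2) (XX j v)) <= K/r^2*(nrm2 y r v + nrm2 y r f0+(SUM j=1..m. nrm2 y r (f j)))"
  by (rule energy_ineq[where R=R]) (rule that)
 define T where "T i = (if i = 0 then G else if i = Suc m then F0 else F i)" for i
 have T: "Gop n (T i)" if "i : {0..Suc m}" for i using that G F by (auto simp: T_def)
 show ?thesis
 proof (rule bd_dom[where I="{0..Suc m}" and E="%_. E" and T=T and qq=1 and CC="%q. K/q^2" and DD=2 and a="%_. 0"])
  show "reg (%h u. XX j (G h u))" by (rule reg_vf[OF svfX[OF j] Gop_reg[OF G]])
  fix y r h u q assume a: "adm R y r h u q" and q: "0 < q" "q <= 1" "q <= 1/4"
  have u: "smooth_on UNIV u" and h: "0 < h" "h <= 1" "h <= r/4" and r: "0 < r" "r <= 1" and y: "norm y <= R" and Lu: "!!x. dist y x < r ==> L u x = 0"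
   using a adm_h[OF a q(3)] by (auto simp: adm_def)
  have qr: "0 < q*r" "q*r <= 1" using q r mult_mono[of q 1 r 1] by auto
  have qr4: "q*r <= r/4" using mult_right_mono[OF q(3), of r] r by simp
  have "nrm2 y (q*r/2) (XX j (G h u)) <= (SUM j=1..m. nrm2 y (q*r/2) (XX j (G h u)))"
   by (rule member_le_sum[OF j]) (auto intro: nrm2_nonneg)
  also have "... <= K/(q*r)^2*(nrm2 y (q*r) (G h u)+nrm2 y (q*r) (F0 h u)+(SUM j=1..m. nrm2 y (q*r) (F j h u)))"
  proof (rule K(2)[OF y qr])
   show "smooth_on UNIV (G h u)" "smooth_on UNIV (F0 h u)" "ALL j:{1..m}. smooth_on UNIV (F j h u)"
    using Gop_smooth G F u by blast+
   show "ALL x. dist y x < q*r --> L (G h u) x = F0 h u x+(SUM j=1..m. XX j (F j h u) x)"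
   proof (intro allI impI)
   fix x assume x: "dist y x < q*r"
   have d: "dist y x < r - h" using x qr4 h(3) r(1) by linarith
   have "G h (L u) x = 0" by (rule Gop_local[OF G h(1), of y r "L u", OF Lu d])
   thus "L (G h u) x = F0 h u x+(SUM j=1..m. XX j (F j h u) x)" using F(3)[OF u] by simp
   qed
  qed
  also have "nrm2 y (q*r) (G h u)+nrm2 y (q*r) (F0 h u)+(SUM j=1..m. nrm2 y (q*r) (F j h u)) =
   (SUM i:{0..Suc m}. nrm2 y (q*r) (T i h u))"
   by (simp add: sum.atLeast_Suc_atMost T_def)
  finally show "nrm2 y (q*r/2) (XX j (G h u)) <= K/q^2*(1/r)^2*(SUM i:{0..Suc m}. h powr 0*nrm2 y (q*r) (T i h u))"
   using h by (simp add: power_mult_distrib power_divide)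
 qed (use hyp T K in auto)
qed

lemma div_bound: fixes h a b :: real shows "0 < h ==> h*a <= b ==> a <= (1/h)*b"
 by (simp add: pos_le_divide_eq mult.commute)

text \<open>Against the trivial loss 2 the gain is \<open>2*(1/2)^k\<close>, halved by each bracket.
  The function \<open>w\<close> of \<open>kohn_ineq\<close> is \<open>h\<close> times a derivative
  of \<open>G h u\<close> and so comes again from an operator of order \<open>n\<close>.\<close>

lemma bd_kohn:
 assumes hyp: "!!G. Gop n G ==> bd R E G"
 shows "lnb k Z ==> Gop n G ==> bd R (E - 2+2*(1/2) ^ k) (%h u. vf_apply Z (G h u))"
proof (induction arbitrary: G rule: lnb.induct)
 case (lnb_0 j)
 thus ?case using bd_energy[OF hyp, of n G j] by simp
next
 case (lnb_Suc j k Z)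
 let ?W = "lie_bracket (X j) Z"
 note pX = pvfX[OF lnb_Suc.hyps(1)] and pZ = lnb_pvf[OF lnb_Suc.hyps(2)]
 obtain W where W: "Gop n W" "ALL h u x. h > 0 --> smooth_on UNIV u --> h * vf_apply ?W (G h u) x = W h u x"
  using Gop_h_vf[OF pvf_lie_bracket[OF pX pZ] lnb_Suc.prems] by blast
 obtain K where K: "K > 0" "!!y r v w h l. norm y <= R ==> 0 < r ==> r <= 1 ==> smooth_on UNIV v ==> smooth_on UNIV w ==>
  0 < h ==> (ALL x. h * vf_apply ?W v x = w x) ==> 0 < l ==> l <= 1 ==>
  h*nrm2 y (r/2) (vf_apply ?W v) <= K/r*(l*(nrm2 y r (vf_apply Z v)+nrm2 y r (vf_apply Z w)) +
   (1/l)*(nrm2 y r (XX j v)+nrm2 y r w+nrm2 y r (XX j w)))"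
  by (rule kohn_ineq[where R=R, OF pX bpartsX[OF lnb_Suc.hyps(1)] pZ lnb_bparts[OF lnb_Suc.hyps(2)]]) (rule that)
 \<comment> \<open>This weight balances the two sides of Kohn's inequality: since
   \<open>?E1 = E - 2*al\<close>, the exponents \<open>?E1 + al - 1\<close> and
   \<open>E - al - 1\<close> agree.\<close>
 define al :: real where "al = 1 - (1/2) ^ k"
 let ?E1 = "E - 2+2*(1/2) ^ k"
 define T where "T = (%i::nat. [%h u. vf_apply Z (G h u), %h u. vf_apply Z (W h u), %h u. XX j (G h u), W, %h u. XX j (W h u)] ! i)"
 define e where "e = (%i::nat. [?E1, ?E1, E, E, E] ! i)"
 define b where "b = (%i::nat. [al - 1, al - 1, - al - 1, - al - 1, - al - 1] ! i)"
 have k1: "(1/2) ^ k <= (1::real)" by (simp add: power_le_one)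
 have five: "{..<5} = {0,1,2,3,4::nat}" by auto
 show ?case
 proof (rule bd_dom[where I="{..<5}" and E=e and T=T and qq=1 and CC="%q. K/q" and DD=1 and a=b])
  show "bd R (e i) (T i)" if "i : {..<5}" for i
   using that lnb_Suc.IH[OF lnb_Suc.prems] lnb_Suc.IH[OF W(1)] bd_energy[OF hyp lnb_Suc.prems lnb_Suc.hyps(1)]
    bd_energy[OF hyp W(1) lnb_Suc.hyps(1)] hyp[OF W(1)]
   unfolding five e_def T_def by auto
  show "E - 2+2*(1/2)^Suc k <= e i+b i" if "i : {..<5}" for i
   using that unfolding five e_def b_def by (auto simp: al_def)
  show "reg (%h u. vf_apply ?W (G h u))" by (rule reg_vf[OF pvf_svf[OF pvf_lie_bracket[OF pX pZ]] Gop_reg[OF lnb_Suc.prems]])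
  fix y r h u q assume a: "adm R y r h u q" and q: "0 < q" "q <= 1" "q <= 1/4"
  have u: "smooth_on UNIV u" and h: "0 < h" "h <= 1" and r: "0 < r" "r <= 1" and y: "norm y <= R"
   using a adm_h[OF a q(3)] by (auto simp: adm_def)
  have qr: "0 < q*r" "q*r <= 1" using q r mult_mono[of q 1 r 1] by auto
  define l where "l = h powr al"
  have l: "0 < l" "l <= 1" using h k1 by (auto simp: l_def al_def powr_le1)
  have "h*nrm2 y (q*r/2) (vf_apply ?W (G h u)) <= K/(q*r)*(l*(nrm2 y (q*r) (vf_apply Z (G h u))+nrm2 y (q*r) (vf_apply Z (W h u))) +
   (1/l)*(nrm2 y (q*r) (XX j (G h u))+nrm2 y (q*r) (W h u)+nrm2 y (q*r) (XX j (W h u))))"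
   using W(2) h u by (intro K(2)[OF y qr _ _ h(1) _ l] Gop_smooth[OF lnb_Suc.prems] Gop_smooth[OF W(1)]) auto
  hence "nrm2 y (q*r/2) (vf_apply ?W (G h u)) <= (1/h)*(K/(q*r)*(l*(nrm2 y (q*r) (vf_apply Z (G h u))+nrm2 y (q*r) (vf_apply Z (W h u))) +
   (1/l)*(nrm2 y (q*r) (XX j (G h u))+nrm2 y (q*r) (W h u)+nrm2 y (q*r) (XX j (W h u)))))"
   by (rule div_bound[OF h(1)])
  also have "... = K/q*(1/r)^1*(SUM i<5. h powr b i*nrm2 y (q*r) (T i h u))"
  proof -
   have p: "h powr (al - 1) = l/h" "h powr (- al - 1) = (1/l)/h"
    unfolding l_def powr_diff powr_minus using h by (simp_all add: divide_inverse)
   have "(SUM i<5. h powr b i*nrm2 y (q*r) (T i h u)) = l/h*nrm2 y (q*r) (vf_apply Z (G h u))+l/h*nrm2 y (q*r) (vf_apply Z (W h u)) +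
    ((1/l)/h*nrm2 y (q*r) (XX j (G h u))+(1/l)/h*nrm2 y (q*r) (W h u)+(1/l)/h*nrm2 y (q*r) (XX j (W h u)))"
    unfolding five b_def T_def by (simp add: p)
   thus ?thesis by (simp add: add_divide_distrib distrib_left mult_ac)
  qed
  finally show "nrm2 y (q*r/2) (vf_apply ?W (G h u)) <= K/q*(1/r)^1*(SUM i<5. h powr b i*nrm2 y (q*r) (T i h u))" .
 qed (use K in auto)
qed

text \<open>Finitely many brackets control every partial derivative on the ball, so the least of
  their gains is a positive \<open>e\<close> that serves all \<open>n\<close>, \<open>E\<close> and
  \<open>G\<close>.\<close>

lemma bd_pdi_gain:
 obtains e where "0 < e" "e <= 2" "!!n E G i. (ALL G. Gop n G --> bd R E G) ==> Gop n G ==> bd R (E - 2+e) (%h u. pdi i (G h u))"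
proof -
 obtain I :: "(nat \<times> (real^'n => real^'n)) set" and C where I: "finite I" "!!k Z. (k, Z) : I ==> lnb k Z" "C > 0"
  "!!x xi. norm x <= R+1 ==> (norm xi)^2 <= C*(SUM p:I. (snd p x \<bullet> xi)^2)" by (rule lnb_elliptic[of "R+1"]) (rule that)
 define e :: real where "e = Min (insert 2 ((%p. 2*(1/2)^fst p) ` I))"
 show thesis
 proof (rule that[of e])
  show "0 < e" using I(1) by (simp add: e_def)
  show "e <= 2" unfolding e_def by (rule Min_le) (use I(1) in auto)
  have e: "e <= 2*(1/2)^fst p" if "p : I" for p unfolding e_def by (rule Min_le) (use I(1) that in auto)
  fix n E G i assume hyp: "ALL G. Gop n G --> bd R E G" and G: "Gop n (G :: 'n smop)"
  show "bd R (E - 2+e) (%h u. pdi i (G h u))"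
  proof (rule bd_pt[where I=I and E="%p. E - 2+2*(1/2)^fst p" and T="%p h u. vf_apply (snd p) (G h u)" and B=C and a="%_. 0"])
   show "bd R (E - 2+2*(1/2)^fst p) (%h u. vf_apply (snd p) (G h u))" if "p : I" for p
    using bd_kohn[OF hyp[rule_format] _ G] I(2)[of "fst p" "snd p"] that by simp
   show "reg (%h u. pdi i (G h u))" by (rule reg_pd[OF Gop_reg[OF G]])
   fix h :: real and u :: "real^'n => real" and x :: "real^'n" assume h: "0 < h" and u: "smooth_on UNIV u" and x: "norm x <= R+1"
   let ?xi = "\<chi> k. pdi k (G h u) x"
   have sG: "smooth_on UNIV (G h u)" by (rule Gop_smooth[OF G u])
   have "abs (pdi i (G h u) x) <= norm ?xi" using component_le_norm_cart[of ?xi i] by simp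
   hence "(pdi i (G h u) x)^2 <= (norm ?xi)^2" using power_mono[of "abs (pdi i (G h u) x)" "norm ?xi" 2] by simp
   also have "... <= C*(SUM p:I. (snd p x \<bullet> ?xi)^2)" by (rule I(4)[OF x])
   also have "... = C*(SUM p:I. h powr 0*(vf_apply (snd p) (G h u) x)^2)"
    using h by (simp add: inner_vec_def vf_apply_pd_UNIV[OF sG])
   finally show "(pdi i (G h u) x)^2 <= C*(SUM p:I. h powr 0*(vf_apply (snd p) (G h u) x)^2)" .
  qed (use I e in auto)
 qed
qed

text \<open>A kernel with one more divergence amounts to \<open>h\<close> times derivatives of
  convolutions of order \<open>n\<close>. The factor \<open>h\<close> gives back 2 in the squared
  norm, so the gain of \<open>bd_pdi_gain\<close> over the trivial loss remains.\<close>

lemma bd_step: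
 obtains e where "0 < e" "!!n E G. (ALL G. Gop n G --> bd R E G) ==> Gop (Suc n) G ==> bd R (E+e) G"
proof -
 obtain e where e: "0 < e" "e <= 2" "!!n E G i. (ALL G. Gop n G --> bd R E G) ==> Gop n G ==> bd R (E - 2+e) (%h u. pdi i (G h u))"
  by (rule bd_pdi_gain[where R=R]) (rule that)
 show thesis
 proof (rule that[OF e(1)])
  fix n E G assume hyp: "ALL G. Gop n G --> bd R E G" and G: "Gop (Suc n) (G :: 'n smop)"
  have "Gop k G ==> k = Suc n ==> bd R (E+e) G" for k G
  proof (induction rule: Gop.induct)
   case (Gop_base l psi k w)
   have rg: "reg (%h u x. h^w * conv psi h u x)" by (rule Gop_reg[OF Gop.Gop_base[OF Gop_base(1,2)]])
   show ?case
   proof (cases "l >= Suc n")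
    case True
    hence "Dn (Suc n) psi" using Dn_mono[OF Gop_base(1)] by blast
    then obtain f where f: "!!i. Dn n (f i)" "psi = (%z. SUM i:UNIV. pdi i (f i) z)" by auto
    show ?thesis
    proof (rule bd_pt[where I=UNIV and E="%_. E - 2+e" and T="%i h u. pdi i (conv (f i) h u)" and B="CARD('n)" and a="%_. 2", OF _ _ rg])
    show "bd R (E - 2+e) (%h u. pdi i (conv (f i) h u))" for i
    by (rule e(3)[OF hyp Gop_conv[OF f(1)]])
    fix h :: real and u :: "real^'n => real" and x :: "real^'n" assume h: "0 < h" "h <= 1" and u: "smooth_on UNIV u"
    have "conv psi h u x = (SUM i:UNIV. conv (pdi i (f i)) h u x)"
    unfolding f(2) by (rule conv_sum_left) (auto intro: csm_pd[OF Dn_csm[OF f(1)] axis_Basis] smooth_on_continuous[OF u])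
    also have "... = (SUM i:UNIV. h * pdi i (conv (f i) h u) x)"
    by (simp add: conv_pd_left[OF Dn_csm[OF f(1)] u] pdi_conv[OF Dn_csm[OF f(1)] u])
    finally have c: "conv psi h u x = ..." .
    have "(h^w * conv psi h u x)^2 <= (conv psi h u x)^2"
    using h by (simp add: power_mult_distrib mult_left_le_one_le power_le_one)
    also have "... <= (SUM i:UNIV. (h * pdi i (conv (f i) h u) x)^2) * card (UNIV :: 'n set)"
    unfolding c by (rule sum_squared_le_sum_of_squares)
    also have "... = CARD('n)*(SUM i:UNIV. h powr 2*(pdi i (conv (f i) h u) x)^2)"
    using h by (simp add: power_mult_distrib mult.commute)
    finally show "(h^w * conv psi h u x)^2 <= CARD('n)*(SUM i:UNIV. h powr 2*(pdi i (conv (f i) h u) x)^2)" .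
    qed auto
   next
    case False
    then obtain w' where w: "w = Suc w'" using Gop_base(2,3) by (cases w) auto
    hence G': "Gop n (%h u x. h^w' * conv psi h u x)" using Gop.Gop_base[OF Gop_base(1), of n w'] Gop_base(2,3) by simp
    show ?thesis
    proof (rule bd_pt1[where B=1 and a=2, OF hyp[rule_format, OF G'] rg])
    fix h :: real and u :: "real^'n => real" and x :: "real^'n" assume "0 < h"
    thus "(h^w * conv psi h u x)^2 <= 1*(h powr 2*(h^w' * conv psi h u x)^2)"
    by (simp add: w power_mult_distrib)
    qed (use e in auto)
   qed
  next
   case (Gop_mult a k G)
   thus ?case by (intro bd_polymult) auto
  next
   case (Gop_add k G G')
   thus ?case by (intro bd_add) auto
  qed
  thus "bd R (E+e) G" using G by blast
 qed
qed

text \<open>Each further order adds the same \<open>e\<close>, so any decay in \<open>h\<close> is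
  reached from the crude bound.\<close>

lemma bd_any: "EX n. ALL G. Gop n G --> bd R E G"
proof -
 obtain e where e: "0 < e" "!!n E G. (ALL G. Gop n G --> bd R E G) ==> Gop (Suc n) G ==> bd R (E+e) G"
  by (rule bd_step[of R]) (rule that)
 have *: "Gop n G ==> bd R (- 2*real CARD('n)+n*e) G" for n G
 proof (induction n arbitrary: G)
  case 0
  thus ?case using bd_Gop_base by simp
 next
  case (Suc n)
  show ?case using e(2)[of n "- 2*real CARD('n)+n*e" G] Suc by (simp add: algebra_simps)
 qed
 obtain n :: nat where "real n > (E+2*real CARD('n))/e" using reals_Archimedean2 by blast
 hence "E <= - 2*real CARD('n)+n*e" using e(1) by (simp add: divide_less_eq)
 thus ?thesis using bd_mono[OF *] by blast
qed

end

section \<open>From square integrals to pointwise bounds; approximate identities of high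
  order\<close>

lemma smooth_lipschitz:
 fixes f :: "real^'n::finite => real"
 assumes f: "smooth_on UNIV f" and S: "convex S" and B: "!!z i. z : S ==> \<bar>pdi i f z\<bar> <= B" and xy: "x : S" "y : S"
 shows "abs (f x - f y) <= real CARD('n)*B*dist x y"
proof -
 have "norm (f x - f y) <= (real CARD('n)*B)*norm (x - y)"
 proof (rule differentiable_bound[OF S _ _ xy])
  fix z assume z: "z : S"
  show "(f has_derivative frechet_derivative f (at z)) (at z within S)"
   by (rule has_derivative_at_withinI[OF has_derivative_frechet[OF f open_UNIV UNIV_I]])
  show "onorm (frechet_derivative f (at z)) <= real CARD('n)*B"
  proof (rule onorm_le)
   fix v :: "real^'n"
   have "frechet_derivative f (at z) v = (SUM i:UNIV. v $ i * pdi i f z)"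
    using frechet_derivative_pd[OF differentiable_UNIV[OF f], of z v] by (simp add: sum_Basis_axis inner_axis)
   also have "abs (...) <= (SUM i:UNIV. abs (v $ i * pdi i f z))" by (rule sum_abs)
   also have "... <= (SUM i:(UNIV::'n set). norm v * B)"
    unfolding abs_mult by (intro sum_mono mult_mono component_le_norm_cart B z) auto
   finally show "norm (frechet_derivative f (at z) v) <= real CARD('n)*B*norm v" by (simp add: mult_ac)
  qed
 qed
 thus ?thesis by (simp add: dist_norm)
qed

definition V1 :: "'n::finite itself => real" where "V1 _ = nrm2 (0::real^'n) 1 (%x. 1)"

lemma V1_pos: "V1 TYPE('n::finite) > 0"
proof -
 have "V1 TYPE('n) = measure lborel (ball (0::real^'n) 1)"
  unfolding V1_def nrm2_def by simp
 also have "... > 0" using content_ball_pos[of 1 "0::real^'n"] by (simp add: measure_completion)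
 finally show ?thesis .
qed

lemma nrm2_one: assumes "r > 0" shows "nrm2 (x::real^'n::finite) r (%x. 1) = r^CARD('n)*V1 TYPE('n)"
proof -
 have "nrm2 x r (%x. 1) = (LINT z|lborel. indicator (ball x r) z)" unfolding nrm2_def by simp
 also have "... = abs r^DIM(real^'n)*(LINT z|lborel. indicator (ball x r) (x+r *\<^sub>R z))"
  by (rule lborel_integral_affine) (use assms in "auto intro!: borel_measurable_indicator")
 also have "(%z. indicator (ball x r) (x+r *\<^sub>R z) :: real) = indicator (ball 0 1)"
  using assms by (auto simp: indicator_def fun_eq_iff dist_norm)
 finally show ?thesis using assms by (simp add: V1_def nrm2_def)
qed

lemma nrm2_subset:
 assumes "continuous_on UNIV v" "ball x s <= ball y r" shows "nrm2 x s v <= nrm2 y r v"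
 unfolding nrm2_def
 by (rule integral_mono[OF nrm2_integrable nrm2_integrable]) (use assms in "auto simp: indicator_def")

text \<open>The value at the centre differs from those on a small ball by the oscillation
  \<open>G\<close>, so it is bounded by the square mean and \<open>G\<close>.\<close>

lemma sup_from_L2:
 fixes w :: "real^'n::finite => real"
 assumes w: "continuous_on UNIV w" and s: "s > 0" and G: "!!z. dist x z < s ==> \<bar>w z - w x\<bar> <= G"
 shows "(w x)^2 <= 2*nrm2 x s w/(s^CARD('n)*V1 TYPE('n))+2*G^2"
proof -
 let ?V = "s^CARD('n)*V1 TYPE('n)"
 have V: "?V > 0" using s V1_pos[where 'n='n] by simp
 have "nrm2 x s (%z. w x) <= (SUM b:{True, False}. 2*nrm2 x s (if b then w else (%z. G)))"
 proof (rule nrm2_le_sum)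
  fix z assume "dist x z < s"
  from G[OF this] have "(w z - w x)^2 <= G^2" using power_mono[of "abs (w z - w x)" G 2] by simp
  moreover have "(w x)^2 <= 2*(w z)^2+2*(w z - w x)^2"
   using zero_le_power2[of "2*w z - w x"] by (simp add: power2_eq_square algebra_simps)
  ultimately show "(w x)^2 <= (SUM b:{True, False}. 2*((if b then w else (%z. G)) z)^2)" by simp
 qed (use w in auto)
 moreover have "nrm2 x s (%z. c) = c^2*?V" for c
  unfolding nrm2_one[OF s, of x, symmetric] by (simp add: nrm2_def)
 ultimately have "(w x)^2*?V <= 2*nrm2 x s w+2*G^2*?V" by simp
 hence "(w x)^2 <= (2*nrm2 x s w+2*G^2*?V)/?V" using V by (simp only: pos_le_divide_eq)
 moreover have "(2*nrm2 x s w+2*G^2*?V)/?V = 2*nrm2 x s w/?V+2*G^2"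
  using V by (simp only: add_divide_distrib nonzero_mult_div_cancel_right less_imp_neq[symmetric] not_False_eq_True)
 ultimately show ?thesis by simp
qed

lemma conv_deriv_h:
 fixes u :: "real^'n::finite => real"
 assumes p: "csm psi" and u: "smooth_on UNIV u"
 shows "((%t. conv psi t u x) has_real_derivative (- (SUM k:UNIV. conv (%z. z $ k * psi z) h (pdi k u) x))) (at h)"
 unfolding has_field_derivative_def has_derivative_at_alt
proof (intro conjI allI impI)
 let ?D = "- (SUM k:UNIV. conv (%z. z $ k * psi z) h (pdi k u) x)"
 show "bounded_linear ((*) ?D)" by (rule bounded_linear_mult_right)
 obtain R where R: "!!x. norm x >= R ==> psi x = 0" using p by (auto simp: csm_def)
 define I where "I = (LINT z|lborel. abs (psi z))"
 have ip: "integrable lborel (%z. abs (psi z))" using csm_integrable[OF p] by simp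
 have I0: "I >= 0" unfolding I_def by simp
 define R' where "R' = abs R+1"
 have R': "R' > 0" by (simp add: R'_def)
 fix e :: real assume e: "e > 0"
 hence e1: "e/((I+1) * R') > 0" using I0 R' by simp
 obtain d where d: "d > 0" "!!y v. norm y <= norm x+abs h * R' ==> norm v < d ==>
  abs (u (y + v) - u y - (SUM i:UNIV. v $ i * pdi i u y)) <= e/((I+1) * R')*norm v"
  by (rule smooth_unif_diff[OF u e1, of "norm x+abs h * R'"]) blast
 have cu: "continuous_on UNIV u" by (rule smooth_on_continuous[OF u])
 have cpu: "continuous_on UNIV (pdi i u)" for i by (rule smooth_pdi_continuous[OF u])
 have cz: "csm (%z. z $ k * psi z)" for k by (rule csm_mult_left[OF smooth_coord p])
 show "EX d>0. ALL y. norm (y - h) < d --> norm (conv psi y u x - conv psi h u x - ?D*(y - h)) <= e*norm (y - h)"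
 proof (intro exI[of _ "d / R'"] conjI allI impI)
  show "d / R' > 0" using d(1) R' by simp
  fix y assume y: "norm (y - h) < d / R'"
  let ?E = "%z. u (x - y *\<^sub>R z) - u (x - h *\<^sub>R z) - (SUM i:UNIV. (- (y - h) *\<^sub>R z) $ i * pdi i u (x - h *\<^sub>R z))"
  have ii0: "integrable lborel (%z. (z $ i * psi z) * pdi i u (x - h *\<^sub>R z))" for i
   by (intro conv_integrable cz cpu)
  have ii: "integrable lborel (%z. (y - h)*((z $ i * psi z) * pdi i u (x - h *\<^sub>R z)))" for i
   by (intro integrable_mult_right conv_integrable cz cpu)
  have "(y - h)*(SUM k:UNIV. conv (%z. z $ k * psi z) h (pdi k u) x) =
    (LINT z|lborel. (SUM i:UNIV. (y - h)*((z $ i * psi z) * pdi i u (x - h *\<^sub>R z))))"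
   unfolding conv_def by (subst int_sum) (auto simp: ii0 sum_distrib_left)
  hence "conv psi y u x - conv psi h u x - ?D*(y - h) =
   (LINT z|lborel. psi z*u (x - y *\<^sub>R z)) - (LINT z|lborel. psi z*u (x - h *\<^sub>R z))+(LINT z|lborel. (SUM i:UNIV. (y - h)*((z $ i * psi z) * pdi i u (x - h *\<^sub>R z))))"
   unfolding conv_def by (simp add: mult.commute)
  also have "... = (LINT z|lborel. psi z*u (x - y *\<^sub>R z) - psi z*u (x - h *\<^sub>R z)+(SUM i:UNIV. (y - h)*((z $ i * psi z) * pdi i u (x - h *\<^sub>R z))))"
   by (subst int_add, intro intb_diff conv_integrable p cu,
    intro intb_sum ii, subst int_diff)
    (auto intro: conv_integrable p cu)
  also have "... = (LINT z|lborel. psi z*?E z)"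
   by (intro int_cong refl) (simp add: algebra_simps sum_distrib_left sum_subtractf sum_negf)
  also have "norm ... <= (LINT z|lborel. abs (psi z)*(e/(I+1)*norm (y - h)))"
  proof (rule int_norm_bound)
   have c: "continuous_on UNIV ?E"
    by (intro continuous_intros continuous_on_compose2[OF cu] continuous_on_compose2[OF cpu]) auto
   show "integrable lborel (%z. psi z*?E z)"
    by (rule integrable_cont_supp[of _ R]) (use R c in "auto intro!: continuous_on_mult[OF csm_continuous[OF p]]")
   show "integrable lborel (%z. abs (psi z)*(e/(I+1)*norm (y - h)))" using ip by (rule integrable_mult_left)
   show "norm (psi z*?E z) <= abs (psi z)*(e/(I+1)*norm (y - h))" for z
   proof (cases "norm z >= R")
    case False
    hence z: "norm z <= R'" by (simp add: R'_def)
    hence "abs h*norm z <= abs h * R'" by (rule mult_left_mono) simp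
    hence 1: "norm (x - h *\<^sub>R z) <= norm x+abs h * R'"
    using norm_triangle_ineq4[of x "h *\<^sub>R z"] by simp
    have "abs (y - h)*norm z <= abs (y - h) * R'" using z by (rule mult_left_mono) simp
    also have "... < d" using y R' by (simp add: pos_less_divide_eq)
    finally have 2: "norm (- (y - h) *\<^sub>R z) < d" by (simp add: abs_minus_commute)
    have "abs (?E z) <= e/((I+1) * R')*norm (- (y - h) *\<^sub>R z)"
    using d(2)[OF 1 2] by (simp add: algebra_simps)
    also have "... <= e/((I+1) * R')*(abs (y - h) * R')"
    using e1 z by (intro mult_left_mono) (auto intro: mult_left_mono simp: abs_minus_commute)
    also have "... = e/(I+1)*norm (y - h)" using R' by simp
    finally have "abs (?E z) <= e/(I+1)*norm (y - h)" .
    thus ?thesis unfolding real_norm_def abs_mult by (intro mult_left_mono) auto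
   qed (simp add: R)
  qed
  also have "... = I/(I+1)*(e*norm (y - h))" by (simp add: I_def mult_ac)
  also have "... <= 1*(e*norm (y - h))" using I0 e by (intro mult_right_mono) auto
  finally show "norm (conv psi y u x - conv psi h u x - ?D*(y - h)) <= e*norm (y - h)" by simp
 qed
qed

text \<open>The derivative of \<open>conv psi h u\<close> in \<open>h\<close> is \<open>conv (AA psi) h u / h\<close>.\<close>

definition AA :: "(real^'n::finite => real) => real^'n => real" where
 "AA psi z = - (SUM k:UNIV. pdi k (%z. z $ k * psi z) z)"

lemma conv_deriv_AA:
 fixes u :: "real^'n::finite => real"
 assumes p: "csm psi" and u: "smooth_on UNIV u" and h: "h ~= 0"
 shows "(- (SUM k:UNIV. conv (%z. z $ k * psi z) h (pdi k u) x)) = (1/h) * conv (AA psi) h u x"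
proof -
 have cz: "csm (%z. z $ k * psi z)" for k by (rule csm_mult_left[OF smooth_coord p])
 have "conv (AA psi) h u x = (-1) * conv (%z. SUM k:UNIV. pdi k (%z. z $ k * psi z) z) h u x"
  unfolding conv_cmult_left[symmetric] by (simp add: AA_def[abs_def])
 also have "... = (-1)*(SUM k:UNIV. h * conv (%z. z $ k * psi z) h (pdi k u) x)"
  by (subst conv_sum_left) (auto intro: csm_pd[OF cz axis_Basis] smooth_on_continuous[OF u] simp: conv_pd_left[OF cz u])
 finally show ?thesis using h by (simp add: sum_distrib_left[symmetric])
qed

lemma smooth_coord_mult: "smooth_on UNIV (f :: real^'n::finite => real) ==> smooth_on UNIV (%z. z $ k*f z)"
 by (rule smooth_on_mult[OF open_UNIV smooth_coord])

lemma AA_smooth: "smooth_on UNIV f ==> smooth_on UNIV (AA f)"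
 unfolding AA_def[abs_def] by (intro smooth_on_minus smooth_on_sum smooth_on_pd smooth_coord_mult open_UNIV axis_Basis)

lemma AA_diff:
 assumes f: "smooth_on UNIV f" and g: "smooth_on UNIV g"
 shows "AA (%z. f z - c*g z) z = AA f z - c*AA g z"
proof -
 have "pdi k (%z. z $ k*(f z - c*g z)) z = pdi k (%z. z $ k*f z) z+(- c) * pdi k (%z. z $ k*g z) z" for k
 proof -
  have "(%z. z $ k*(f z - c*g z)) = (%z. z $ k*f z+(- c)*(z $ k*g z))" by (simp add: algebra_simps)
  thus ?thesis
   using pd_add[of "%z. z $ k*f z" z "%z. (- c)*(z $ k*g z)" "axis k 1"] pd_cmult[of "%z. z $ k*g z" z "axis k 1" "-c"]
    differentiable_UNIV[OF smooth_coord_mult[OF f]] differentiable_UNIV[OF smooth_coord_mult[OF g]]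
    differentiable_UNIV[OF smooth_on_mult[OF open_UNIV smooth_on_const smooth_coord_mult[OF g]]] by simp
 qed
 thus ?thesis by (simp add: AA_def sum.distrib sum_subtractf sum_distrib_left)
qed

lemma AA_sum:
 assumes f: "!!i. i : I ==> smooth_on UNIV (f i)"
 shows "AA (%z. SUM i:I. f i z) z = (SUM i:I. AA (f i) z)"
proof -
 have "pdi k (%z. z $ k*(SUM i:I. f i z)) z = (SUM i:I. pdi k (%z. z $ k*f i z) z)" for k
  unfolding sum_distrib_left by (rule pd_sum) (rule differentiable_UNIV[OF smooth_coord_mult[OF f]])
 thus ?thesis unfolding AA_def by (simp add: sum_negf sum.swap[of _ I])
qed

lemma AA_pdi:
 assumes f: "smooth_on UNIV f" shows "AA (pdi i f) z = pdi i (AA f) z + pdi i f z"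
proof -
 have s: "smooth_on UNIV (%z. z $ k*f z)" for k by (rule smooth_coord_mult[OF f])
 have 1: "(%z. z $ k * pdi i f z) = (%z. pdi i (%z. z $ k*f z) z+(- (if i = k then 1 else 0))*f z)" for k
 proof
  fix z
  have "pdi i (%z. z $ k*f z) z = z $ k * pdi i f z + pdi i (%z. z $ k) z*f z"
   by (rule pd_mult) (intro differentiable_UNIV smooth_coord f)+
  thus "z $ k * pdi i f z = pdi i (%z. z $ k*f z) z+(- (if i = k then 1 else 0))*f z"
   by (simp add: pdi_coord)
 qed
 have 2: "pdi k (%z. z $ k * pdi i f z) z = pdi i (pdi k (%z. z $ k*f z)) z+(- (if i = k then 1 else 0)) * pdi k f z" for k
 proof -
  have "pdi k (%z. z $ k * pdi i f z) z = pdi k (pdi i (%z. z $ k*f z)) z + pdi k (%z. (- (if i = k then 1 else 0))*f z) z"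
   unfolding 1 by (rule pd_add[OF differentiable_UNIV[OF smooth_on_pd[OF s axis_Basis]] differentiable_UNIV[OF smooth_on_mult[OF open_UNIV smooth_on_const f]]])
  also have "pdi k (%z. (- (if i = k then 1 else 0))*f z) z = (- (if i = k then 1 else 0)) * pdi k f z"
   by (rule pd_cmult[OF differentiable_UNIV[OF f]])
  finally show ?thesis using pd_commute[OF s axis_Basis axis_Basis] by simp
 qed
 have "(SUM k:UNIV. pdi k (%z. z $ k * pdi i f z) z) = (SUM k:UNIV. pdi i (pdi k (%z. z $ k*f z)) z) - pdi i f z"
  unfolding 2 by (simp add: sum.distrib if_distrib[of uminus] if_distrib[of "%c. c*_"] cong: if_cong)
 also have "(SUM k:UNIV. pdi i (pdi k (%z. z $ k*f z)) z) = pdi i (%z. SUM k:UNIV. pdi k (%z. z $ k*f z) z) z"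
  by (rule pd_sum[symmetric]) (rule differentiable_UNIV[OF smooth_on_pd[OF s axis_Basis]])
 also have "... = - pdi i (AA f) z"
 proof -
  have sA: "smooth_on UNIV (%z. SUM k:UNIV. pdi k (%z. z $ k*f z) z)"
   by (intro smooth_on_sum smooth_on_pd s open_UNIV axis_Basis)
  have "AA f = (%z. (-1)*(SUM k:UNIV. pdi k (%z. z $ k*f z) z))" by (simp add: AA_def fun_eq_iff)
  thus ?thesis using pd_cmult[OF differentiable_UNIV[OF sA], of "axis i 1" "-1" z] by simp
 qed
 finally show ?thesis by (simp add: AA_def)
qed

lemma Dn_AA0: "Dn 0 psi ==> Dn (Suc 0) (AA psi)"
proof -
 assume p: "Dn 0 psi"
 have "Dn (Suc 0) (%z. SUM k:UNIV. pdi k (%z. z $ k * psi z) z)"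
  using Dn_coord[OF p] by (auto simp: Dn.simps(2) intro!: exI[of _ "%k z. z $ k * psi z"])
 from Dn_cmult[OF this, of "-1"] show ?thesis by (simp add: AA_def[abs_def] del: Dn.simps)
qed

text \<open>Moving \<open>AA\<close> past one derivative adds that derivative once. On
  \<open>n\<close>-fold divergences the additions amount to \<open>n\<close>, and \<open>AA\<close>
  itself supplies the extra divergence.\<close>

lemma Dn_AA: "Dn n psi ==> Dn (Suc n) (%z. AA psi z - real n * psi z)"
proof (induction n arbitrary: psi)
 case 0
 thus ?case using Dn_AA0 by simp
next
 case (Suc n)
 then obtain f where f: "!!i. Dn n (f i)" "psi = (%z. SUM i:UNIV. pdi i (f i) z)" by auto
 have s: "smooth_on UNIV (f i)" for i by (rule Dn_smooth[OF f(1)])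
 let ?g = "%i z. AA (f i) z - real n*f i z"
 have "AA psi z - real (Suc n) * psi z = (SUM i:UNIV. pdi i (?g i) z)" for z
 proof -
  have e: "pdi i (?g i) z = pdi i (AA (f i)) z - real n * pdi i (f i) z" for i
  proof -
   have "pdi i (?g i) z = pdi i (%z. AA (f i) z+(- real n)*f i z) z" by simp
   also have "... = pdi i (AA (f i)) z + pdi i (%z. (- real n)*f i z) z"
    by (rule pd_add[OF differentiable_UNIV[OF AA_smooth[OF s]] differentiable_UNIV[OF smooth_on_mult[OF open_UNIV smooth_on_const s]]])
   also have "pdi i (%z. (- real n)*f i z) z = (- real n) * pdi i (f i) z" by (rule pd_cmult[OF differentiable_UNIV[OF s]])
   finally show ?thesis by simp
  qed
  have "AA psi z = (SUM i:UNIV. pdi i (AA (f i)) z + pdi i (f i) z)"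
   unfolding f(2) by (simp add: AA_sum AA_pdi smooth_on_pd s)
  thus ?thesis unfolding e by (simp add: f(2) sum.distrib sum_subtractf sum_distrib_left[symmetric] algebra_simps)
 qed
 hence "(%z. AA psi z - real (Suc n) * psi z) = (%z. SUM i:UNIV. pdi i (?g i) z)" by blast
 thus ?case unfolding Dn.simps(2)[of "Suc n"]
  by (intro exI[of _ ?g] conjI allI Suc.IH[OF f(1)])
qed

text \<open>The operators \<open>1 - AA/k\<close> for \<open>k = 1..n\<close>, applied one after the
  other to \<open>phi\<close>. Each raises the order of \<open>AA\<close> of the kernel by one and
  keeps the integral, because \<open>AA\<close> is a divergence. The outcome is an approximate
  identity whose derivative in \<open>h\<close> has a kernel of order \<open>n + 1\<close>.\<close>

primrec gg :: "(real^'n::finite => real) => nat => real^'n => real" where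
 "gg phi 0 = phi"
| "gg phi (Suc n) = (%z. gg phi n z - (1/real (Suc n))*AA (gg phi n) z)"

lemma gg:
 assumes p: "Dn 0 phi"
 shows "Dn 0 (gg phi n)" "Dn (Suc n) (AA (gg phi n))" "(LINT z|lborel. gg phi n z) = (LINT z|lborel. phi z)"
proof -
 have "Dn 0 (gg phi n) & Dn (Suc n) (AA (gg phi n)) & (LINT z|lborel. gg phi n z) = (LINT z|lborel. phi z)"
 proof (induction n)
  case 0
  thus ?case using p Dn_AA0[OF p] by (simp del: Dn.simps)
 next
  case (Suc n)
  let ?g = "gg phi n"
  have g: "Dn 0 ?g" "Dn (Suc n) (AA ?g)" using Suc by auto
  have sg: "smooth_on UNIV ?g" by (rule Dn_smooth[OF g(1)])
  have "Dn 0 (%z. ?g z+(- (1/real (Suc n)))*AA ?g z)"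
   by (intro Dn_add Dn_cmult g(1) Dn_base[OF g(2)])
  hence 1: "Dn 0 (gg phi (Suc n))" by (simp del: Dn.simps)
  have "AA (gg phi (Suc n)) z = - (1/real (Suc n))*(AA (AA ?g) z - real (Suc n)*AA ?g z)" for z
   by (simp only: gg.simps AA_diff[OF sg AA_smooth[OF sg]]) (simp add: field_simps)
  hence "AA (gg phi (Suc n)) = (%z. - (1/real (Suc n))*(AA (AA ?g) z - real (Suc n)*AA ?g z))" by blast
  hence 2: "Dn (Suc (Suc n)) (AA (gg phi (Suc n)))"
   using Dn_cmult[OF Dn_AA[OF g(2)], of "- (1/real (Suc n))"] by (simp only:)
  have cz: "csm (%z. z $ k*?g z)" for k by (rule csm_mult_left[OF smooth_coord Dn_csm[OF g(1)]])
  have "(LINT z|lborel. AA ?g z) = - (SUM k:UNIV. LINT z|lborel. pdi k (%z. z $ k*?g z) z)"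
   unfolding AA_def by (subst Bochner_Integration.integral_minus, subst int_sum)
    (auto intro: csm_integrable csm_pd[OF cz axis_Basis])
  hence "(LINT z|lborel. AA ?g z) = 0" by (simp add: integral_pd_zero[OF cz axis_Basis])
  hence 3: "(LINT z|lborel. gg phi (Suc n) z) = (LINT z|lborel. phi z)"
   using Suc csm_integrable[OF Dn_csm[OF g(1)]] csm_integrable[OF Dn_csm[OF g(2)]] by simp
  show ?case using 1 2 3 by blast
 qed
 thus "Dn 0 (gg phi n)" "Dn (Suc n) (AA (gg phi n))" "(LINT z|lborel. gg phi n z) = (LINT z|lborel. phi z)" by auto
qed

lemma Dn0_unit: "EX phi :: real^'n::finite => real. Dn 0 phi & (LINT z|lborel. phi z) = 1"
proof -
 let ?c = "cutoff (0::real^'n) (1/2)"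
 have c: "csm ?c" by (rule csm_cutoff) simp
 have I: "(LINT z|lborel. ?c z) > 0"
  by (rule integral_pos_cont[OF csm_continuous[OF c] csm_integrable[OF c], of 0]) (use cutoff[of "1/2" "0::real^'n"] in auto)
 have "Dn 0 ?c" using csm_smooth[OF c] cutoff(4)[of "1/2" "0::real^'n"] by simp
 from Dn_cmult[OF this, of "1/(LINT z|lborel. ?c z)"]
 have "Dn 0 (%z. 1/(LINT z|lborel. ?c z)*?c z)" .
 moreover have "(LINT z|lborel. 1/(LINT z|lborel. ?c z)*?c z) = 1" using I by simp
 ultimately show ?thesis by blast
qed

section \<open>The gradient bound with polynomial loss\<close>

context hvf begin

text \<open>On a tiny ball the crude gradient bound makes the convolution nearly constant, so its
  value is controlled by its square mean there. The power of \<open>h\<close> lost in the volume of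
  the ball is regained from \<open>bd_any\<close>.\<close>

lemma sup_conv:
 obtains n :: nat where "!!psi. Dn n psi ==> EX q C D. 0 < q & q <= 1/4 & 0 <= C &
  (ALL y r h u x. adm R y r h u q --> dist y x < q*r/2 --> \<bar>conv psi h u x\<bar> <= C*(1/r)^D*h^2*mass y r u)"
proof -
 let ?N = "CARD('n)"
 \<comment> \<open>Gradients are at most of order \<open>h^-(?N+1)\<close>, so a radius of order
   \<open>h^?K\<close> leaves an oscillation of order \<open>h^2\<close>. The exponent
   \<open>?K*?N+4\<close> required next pays for the volume and leaves the square of
   \<open>h^2\<close>.\<close>
 let ?K = "?N+3"
 obtain n where n: "!!G. Gop n G ==> bd R (real (?K*?N+4)) G" using bd_any by blast
 show thesis
 proof (rule that)
  fix psi :: "real^'n => real" assume psi: "Dn n psi"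
  obtain q C D where b: "0 < q" "q <= 1/4" "0 <= C" "bdc R q C D (real (?K*?N+4)) (conv psi)"
   using n[OF Gop_conv[OF psi]] by (auto simp: bd_def)
  have "ALL i. EX B>0. ALL x. abs (pdi i psi x) <= B" using csm_bounded[OF csm_pd[OF Dn_csm[OF psi] axis_Basis]] by metis
  from choice[OF this] obtain Bi :: "'n => real" where "ALL i. 0 < Bi i & (ALL x. abs (pdi i psi x) <= Bi i)" ..
  hence Bi: "!!i. 0 < Bi i" "!!i x. abs (pdi i psi x) <= Bi i" by blast+
  define B where "B = (SUM i:UNIV. Bi i)"
  have Bl: "Bi i <= B" for i unfolding B_def by (rule member_le_sum) (auto intro: less_imp_le Bi)
  hence B: "B > 0" "!!i x. abs (pdi i psi x) <= B" using Bi order_trans less_le_trans by blast+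
  let ?V = "V1 TYPE('n)"
  define C1 where "C1 = 2*C/((q/2)^?N*?V)+2*(q/2*?N*B)^2"
  have C1: "C1 >= 0" unfolding C1_def using b V1_pos[where 'n='n] by (intro add_nonneg_nonneg divide_nonneg_nonneg mult_nonneg_nonneg) auto
  show "EX q C D. 0 < q & q <= 1/4 & 0 <= C &
   (ALL y r h u x. adm R y r h u q --> dist y x < q*r/2 --> \<bar>conv psi h u x\<bar> <= C*(1/r)^D*h^2*mass y r u)"
  proof (intro exI conjI allI impI)
   show "0 < q" "q <= 1/4" "0 <= sqrt C1" using b C1 by auto
   fix y r h u x assume a: "adm R y r h u q" and x: "dist y x < q*r/2"
   have u: "smooth_on UNIV u" and h: "0 < h" "h <= 1" "h <= r/4" "h <= q*r" and r: "0 < r" "r <= 1" and y: "norm y <= R"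
    using a adm_h[OF a b(2)] by (auto simp: adm_def)
   let ?w = "conv psi h u" and ?M = "mass y r u" and ?s = "q/2*h^?K"
   have M: "?M >= 0" by (rule mass_nonneg)
   have sw: "smooth_on UNIV ?w" by (rule smooth_conv[OF Dn_csm[OF psi] u])
   have s: "?s > 0" using b h by simp
   have hK: "h^?K <= h" using power_decreasing[of 1 ?K h] h by simp
   have "?s <= q/2*r" using hK h(3) r b(1) by (intro mult_left_mono) auto
   hence sub: "dist y z < q*r" if "dist x z < ?s" for z
    using that x dist_triangle[of y z x] by (simp add: mult.commute)
   have qr4: "q*r <= r/4" using mult_right_mono[OF b(2), of r] r by simp
   have pd: "abs (pdi i ?w z) <= B/h^(?N+1)*?M" if "dist x z < ?s" for i z
   proof -
    have d: "dist y z < r - h" using sub[OF that] qr4 h(3) r(1) by linarith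
    have "h * pdi i ?w z = conv (pdi i psi) h u z"
    by (simp add: pdi_conv[OF Dn_csm[OF psi] u] conv_pd_left[OF Dn_csm[OF psi] u])
    moreover have "abs (conv (pdi i psi) h u z) <= B/h^?N*?M"
    using conv_bound[OF Dn_base[OF Dn_pd[OF psi]] B(2) h(1) smooth_on_continuous[OF u] d] by (simp add: mass_def)
    ultimately have "h*abs (pdi i ?w z) <= B/h^?N*?M" using h by (metis abs_mult abs_of_pos)
    from div_bound[OF h(1) this] show ?thesis by simp
   qed
   have G: "abs (?w z - ?w x) <= (q/2*?N*B)*h^2*?M" if "dist x z < ?s" for z
   proof -
    have "abs (?w z - ?w x) <= real ?N*(B/h^(?N+1)*?M)*dist z x"
    by (rule smooth_lipschitz[OF sw convex_ball[of x ?s]]) (use pd that s in auto)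
    also have "... <= real ?N*(B/h^(?N+1)*?M)*?s"
    using that B M h by (intro mult_left_mono) (auto simp: dist_commute)
    also have "h^?K = h^(?N+1)*h^2" by (simp add: power_add power2_eq_square power3_eq_cube)
    also have "real ?N*(B/h^(?N+1)*?M)*(q/2*(h^(?N+1)*h^2)) = (q/2*?N*B)*h^2*?M"
    using h by (simp add: field_simps)
    finally show ?thesis .
   qed
   have bal: "ball x ?s <= ball y (q*r)" using sub by auto
   have N: "nrm2 x ?s ?w <= C*(1/r)^D*h^(?K*?N+4)*?M\<^sup>2"
   proof -
    have "nrm2 x ?s ?w <= nrm2 y (q*r) ?w" by (rule nrm2_subset[OF smooth_on_continuous[OF sw] bal])
    also have "... <= C*(1/r)^D*h powr (real (?K*?N+4))*?M\<^sup>2" using b(4) a by (auto simp: bdc_def)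
    finally show ?thesis using h by (simp only: powr_realpow)
   qed
   have r1: "(1/r)^D >= 1" using r by (simp add: one_le_power)
   have "(?w x)^2 <= 2*nrm2 x ?s ?w/(?s^?N*?V)+2*((q/2*?N*B)*h^2*?M)^2"
    by (rule sup_from_L2[OF smooth_on_continuous[OF sw] s G])
   also have "... <= 2*(C*(1/r)^D*h^(?K*?N+4)*?M\<^sup>2)/(?s^?N*?V)+2*((q/2*?N*B)*h^2*?M)^2"
    using N s V1_pos[where 'n='n] by (intro add_right_mono divide_right_mono mult_left_mono) auto
   also have "2*(C*(1/r)^D*h^(?K*?N+4)*?M\<^sup>2)/(?s^?N*?V) = (2*C/((q/2)^?N*?V))*((1/r)^D*h^4*?M\<^sup>2)"
   proof -
    have "?s^?N = (q/2)^?N*h^(?K*?N)" by (simp only: power_mult_distrib power_mult)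
    moreover have "h^(?K*?N+4) = h^(?K*?N)*h^4" by (rule power_add)
    moreover have "h^(?K*?N) ~= 0" using h by simp
    ultimately show ?thesis by (simp only:) (simp add: field_simps)
   qed
   also have "2*((q/2*?N*B)*h^2*?M)^2 <= (2*(q/2*?N*B)^2)*((1/r)^D*h^4*?M\<^sup>2)"
   proof -
    have "2*((q/2*?N*B)*h^2*?M)^2 = (2*(q/2*?N*B)^2)*(1*(h^4*?M\<^sup>2))"
    proof -
    have "(A*h^2*?M)^2 = A^2*(h^4*?M\<^sup>2)" for A :: real
    by (simp add: power_mult_distrib power_mult[symmetric])
    from this[of "q/2*?N*B"] show ?thesis by (simp only: mult_1_left mult.assoc[of 2])
    qed
    also have "... <= (2*(q/2*?N*B)^2)*((1/r)^D*(h^4*?M\<^sup>2))"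
    by (intro mult_left_mono mult_right_mono r1) auto
    finally show ?thesis by (simp add: mult.assoc)
   qed
   finally have "(?w x)^2 <= C1*((1/r)^D*h^4*?M\<^sup>2)" by (simp add: C1_def distrib_right)
   also have "... <= C1*(((1/r)^D)^2*h^4*?M\<^sup>2)"
   proof -
    have "(1/r)^D*1 <= (1/r)^D*(1/r)^D" using r1 by (intro mult_left_mono) auto
    thus ?thesis by (intro mult_left_mono[OF _ C1] mult_right_mono) (auto simp: power2_eq_square)
   qed
   also have "... = (sqrt C1*(1/r)^D*h^2*?M)^2" using C1 by (simp add: power_mult_distrib power_mult[symmetric])
   finally have "abs (?w x) <= abs (sqrt C1*(1/r)^D*h^2*?M)" by (simp only: abs_le_square_iff)
   thus "abs (?w x) <= sqrt C1*(1/r)^D*h^2*?M" using C1 r M by (simp add: abs_mult)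
  qed
 qed
qed

text \<open>At \<open>h = 0\<close> the convolution with \<open>gg phi n\<close> is
  \<open>u\<close>. The mean value theorem in \<open>h\<close> between 0 and a multiple of
  \<open>r\<close> leaves the convolution at the larger scale, bounded crudely, and
  \<open>1/h\<close> times a convolution with a kernel of high order, whose gradient is bounded by a
  multiple of \<open>h\<close>.\<close>

lemma harmonic_lipschitz:
 obtains q C D where "0 < q" "q <= 1/4" "0 <= C" "!!y r u x x'. norm y <= R ==> 0 < r ==> r <= 1 ==> smooth_on UNIV u ==>
  (ALL x. dist y x < r --> L u x = 0) ==> dist y x < q*r ==> dist y x' < q*r ==>
  abs (u x - u x') <= C*(1/r)^D*mass y r u*dist x x'"
proof -
 let ?N = "CARD('n)"
 obtain n :: nat where n: "!!psi. Dn n psi ==> EX q C D. 0 < q & q <= 1/4 & 0 <= C &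
  (ALL y r h u x. adm R y r h u q --> dist y x < q*r/2 --> \<bar>conv psi h u x\<bar> <= C*(1/r)^D*h^2*mass y r u)"
  by (rule sup_conv) (rule that)
 obtain phi :: "real^'n => real" where phi: "Dn 0 phi" "(LINT z|lborel. phi z) = 1" using Dn0_unit by blast
 let ?g = "gg phi n"
 note g = gg[OF phi(1), of n, unfolded phi(2)]
 define psi where "psi = AA ?g"
 have psi: "Dn (Suc n) psi" using g(2) by (simp only: psi_def)
 have "ALL i. EX p. 0 < fst p & fst p <= 1/4 & 0 <= fst (snd p) &
  (ALL y r h u x. adm R y r h u (fst p) --> dist y x < fst p*r/2 --> \<bar>conv (pdi i psi) h u x\<bar> <= fst (snd p)*(1/r) ^ snd (snd p)*h^2*mass y r u)"
 proof
  fix i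
  have "Dn n (pdi i psi)" using Dn_mono[OF Dn_pd[OF psi]] by simp
  from n[OF this] show "EX p. 0 < fst p & fst p <= 1/4 & 0 <= fst (snd p) &
  (ALL y r h u x. adm R y r h u (fst p) --> dist y x < fst p*r/2 --> \<bar>conv (pdi i psi) h u x\<bar> <= fst (snd p)*(1/r) ^ snd (snd p)*h^2*mass y r u)"
   by (auto simp: split_paired_Ex)
 qed
 from choice[OF this] obtain p :: "'n => real \<times> real \<times> nat" where p: "ALL i. 0 < fst (p i) & fst (p i) <= 1/4 & 0 <= fst (snd (p i)) &
  (ALL y r h u x. adm R y r h u (fst (p i)) --> dist y x < fst (p i)*r/2 --> \<bar>conv (pdi i psi) h u x\<bar> <= fst (snd (p i))*(1/r) ^ snd (snd (p i))*h^2*mass y r u)" ..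
 define q where "q = Min (range (%i. fst (p i)))"
 define C where "C = (SUM i:UNIV. fst (snd (p i)))"
 define D where "D = (SUM i:UNIV. snd (snd (p i)))"
 have q: "q > 0" "q <= fst (p i)" for i using p by (auto simp: q_def)
 have q4: "q <= 1/4" using q(2)[of i0] p by (meson order_trans)
 have C: "0 <= C" "fst (snd (p i)) <= C" for i using p by (auto simp: C_def intro!: sum_nonneg member_le_sum)
 have D: "snd (snd (p i)) <= D" for i by (auto simp: D_def intro!: member_le_sum)
 have sup: "abs (conv (pdi i psi) h u x) <= C*(1/r)^D*h^2*mass y r u" if a: "adm R y r h u q" and x: "dist y x < q*r/2" for i y r h u x
 proof -
  have r: "0 < r" "r <= 1" using a by (auto simp: adm_def)
  have "q*r/2 <= fst (p i)*r/2" using q(2)[of i] r by (simp add: mult_right_mono)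
  hence "abs (conv (pdi i psi) h u x) <= fst (snd (p i))*(1/r) ^ snd (snd (p i))*h^2*mass y r u"
   using p adm_mono[OF a q(2)[of i]] x by (meson less_le_trans)
  also have "... <= C*(1/r)^D*h^2*mass y r u"
   using C D[of i] p r by (intro mult_right_mono mult_mono power_increasing mass_nonneg) auto
  finally show ?thesis .
 qed
 have "ALL i. EX B>0. ALL x. abs (pdi i ?g x) <= B" using csm_bounded[OF csm_pd[OF Dn_csm[OF g(1)] axis_Basis]] by metis
 from choice[OF this] obtain Bi :: "'n => real" where "ALL i. 0 < Bi i & (ALL x. abs (pdi i ?g x) <= Bi i)" ..
 hence Bi: "!!i. 0 < Bi i" "!!i x. abs (pdi i ?g x) <= Bi i" by blast+
 define B where "B = (SUM i:UNIV. Bi i)"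
 have Bl: "Bi i <= B" for i unfolding B_def by (rule member_le_sum) (auto intro: less_imp_le Bi)
 hence B: "B > 0" "!!i x. abs (pdi i ?g x) <= B" using Bi order_trans less_le_trans by blast+
 define C2 where "C2 = ?N*B/q^(?N+1)+?N*C"
 show thesis
 proof (rule that[of "q/2" C2 "D+?N+1"])
  show "0 < q/2" "q/2 <= 1/4" using q q4 by auto
  show "0 <= C2" unfolding C2_def using B C q by (intro add_nonneg_nonneg divide_nonneg_nonneg) auto
  fix y r u x x' assume y: "norm y <= R" and r: "0 < r" "r <= 1" and u: "smooth_on UNIV u" and Lu: "ALL x. dist y x < r --> L u x = 0"
   and x: "dist y x < q/2*r" and x': "dist y x' < q/2*r"
  let ?M = "mass y r u"
  let ?h0 = "q*r"
  have M: "?M >= 0" by (rule mass_nonneg)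
  have h0: "?h0 > 0" "?h0 <= 1" using q r q4 mult_mono[of q 1 r 1] by auto
  have ad: "adm R y r h u q" if "0 < h" "h <= ?h0" for h using that y r u Lu by (simp add: adm_def)
  let ?F = "%t. conv ?g t u x - conv ?g t u x'"
  let ?dF = "%t. - (SUM k:UNIV. conv (%z. z $ k*?g z) t (pdi k u) x) - - (SUM k:UNIV. conv (%z. z $ k*?g z) t (pdi k u) x')"
  have "EX z>0. z < ?h0 & ?F ?h0 - ?F 0 = (?h0 - 0)*?dF z"
   by (rule MVT2[OF h0(1)]) (intro DERIV_diff conv_deriv_h[OF Dn_csm[OF g(1)] u])
  then obtain t where t: "0 < t" "t < ?h0" "?F ?h0 - ?F 0 = ?h0*?dF t" by auto
  have F0: "?F 0 = u x - u x'" using g(3) by (simp add: conv_def)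
  have dF: "?dF t = (1/t)*(conv psi t u x - conv psi t u x')"
   using conv_deriv_AA[OF Dn_csm[OF g(1)] u, of t] t(1) by (simp add: psi_def right_diff_distrib)
  \<comment> \<open>The \<open>h^2\<close> of \<open>sup_conv\<close> is used up exactly: one factor
    for this derivative, one for the \<open>1/t\<close> in \<open>dF\<close>.\<close>
  have tle: "abs (conv psi t u x - conv psi t u x') <= ?N*(C*(1/r)^D * t*?M)*dist x x'"
  proof (rule smooth_lipschitz[OF smooth_conv[OF Dn_csm[OF psi] u] convex_ball[of y "q*r/2"]])
   fix z i assume z: "z : ball y (q*r/2)"
   have "t*abs (pdi i (conv psi t u) z) = abs (conv (pdi i psi) t u z)"
    using t(1) by (simp add: pdi_conv[OF Dn_csm[OF psi] u] conv_pd_left[OF Dn_csm[OF psi] u] abs_mult)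
   also have "... <= C*(1/r)^D * t^2*?M" by (rule sup[OF ad]) (use t z in auto)
   finally have "abs (pdi i (conv psi t u) z) <= (1/t)*(C*(1/r)^D * t^2*?M)" by (rule div_bound[OF t(1)])
   thus "abs (pdi i (conv psi t u) z) <= C*(1/r)^D * t*?M" using t(1) by (simp add: power2_eq_square)
  qed (use x x' in auto)
  have hle: "abs (?F ?h0) <= ?N*(B/?h0^(?N+1)*?M)*dist x x'"
  proof (rule smooth_lipschitz[OF smooth_conv[OF Dn_csm[OF g(1)] u] convex_ball[of y "q*r/2"]])
   fix z i assume z: "z : ball y (q*r/2)"
   have d: "dist y z < r - ?h0"
   proof -
    have "q*r <= r/4" using mult_right_mono[OF q4, of r] r by simp
    moreover have "dist y z < q*r/2" using z by simp
    ultimately show ?thesis using r(1) by linarith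
   qed
   have "?h0*abs (pdi i (conv ?g ?h0 u) z) = abs (conv (pdi i ?g) ?h0 u z)"
    unfolding conv_pd_left[OF Dn_csm[OF g(1)] u] abs_mult[of ?h0] abs_of_pos[OF h0(1)] pdi_conv[OF Dn_csm[OF g(1)] u] ..
   also have "... <= B/?h0^?N*?M"
    using conv_bound[OF Dn_base[OF Dn_pd[OF g(1)]] B(2) h0(1) smooth_on_continuous[OF u] d] by (simp add: mass_def)
   finally have "?h0*abs (pdi i (conv ?g ?h0 u) z) <= B/?h0^?N*?M" .
   from div_bound[OF h0(1) this] show "abs (pdi i (conv ?g ?h0 u) z) <= B/?h0^(?N+1)*?M" by simp
  qed (use x x' in auto)
  have "abs (?h0*?dF t) <= 1*((1/t)*(?N*(C*(1/r)^D * t*?M)*dist x x'))"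
   unfolding dF abs_mult using h0 t tle by (intro mult_mono) (auto simp: divide_right_mono)
  also have "... = ?N*C*((1/r)^D*(?M*dist x x'))" using t by simp
  also have "... <= ?N*C*((1/r)^(D+?N+1)*(?M*dist x x'))"
   using C r M by (intro mult_left_mono mult_right_mono power_increasing) auto
  finally have 1: "abs (?h0*?dF t) <= ..." .
  have "?N*(B/?h0^(?N+1)*?M)*dist x x' = ?N*B/q^(?N+1)*((1/r)^(?N+1)*(?M*dist x x'))"
   by (simp add: power_mult_distrib power_divide mult_ac)
  also have "... <= ?N*B/q^(?N+1)*((1/r)^(D+?N+1)*(?M*dist x x'))"
   using B r M q by (intro mult_left_mono mult_right_mono power_increasing) auto
  finally have 2: "abs (?F ?h0) <= ..." using hle by linarith
  have "abs (u x - u x') <= abs (?F ?h0)+abs (?h0*?dF t)" using t(3) F0 by linarith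
  also have "... <= C2*((1/r)^(D+?N+1)*(?M*dist x x'))"
   using 1 2 unfolding C2_def by (simp only: distrib_right)
  finally show "abs (u x - u x') <= C2*(1/r)^(D+?N+1)*?M*dist x x'" by (simp add: mult.assoc)
 qed
qed

end

section \<open>The fundamental solution\<close>

locale fund = hvf X m sg i0
 for X :: "nat => real^'n::finite => real^'n" and m :: nat and sg :: "'n => nat" and i0 :: 'n +
 fixes Ga :: "real^'n => real^'n => real"
 assumes card3: "CARD('n) >= 3" and fs: "fundamental_solution sg (sum_of_squares m X) Ga"
begin

lemma G_pos: "x ~= y ==> Ga x y > 0" using fs by (auto simp: fundamental_solution_def)
lemma G_sym: "x ~= y ==> Ga x y = Ga y x" using fs unfolding fundamental_solution_def by blast
lemma G_int: "compact K ==> set_integrable lborel K (Ga x)" using fs unfolding fundamental_solution_def by blast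
lemma G_rep:
 assumes "csm phi" shows "(LINT y|lborel. Ga x y*L phi y) = - phi x"
proof -
 have "ALL phi x. test_function phi --> (LINT y|lborel. Ga x y*L phi y) = - phi x"
  using fs unfolding fundamental_solution_def by (elim conjE)
 thus ?thesis using csm_test_function[OF assms] by simp
qed
lemma G_top: "filterlim (Ga x) at_top (at x)" using fs unfolding fundamental_solution_def by (elim conjE) simp
lemma G_0: "(Ga x \<longlongrightarrow> 0) at_infinity" using fs unfolding fundamental_solution_def by (elim conjE) simp
lemma G_smooth2: "smooth_on {(x, y). x ~= y} (%(x, y). Ga x y)" using fs unfolding fundamental_solution_def by (elim conjE)
lemma G_hom0: "x ~= y ==> t > 0 ==> Ga (dilation sg t x) (dilation sg t y) = t powi (2 - int (SUM i:UNIV. sg i))*Ga x y"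
 using fs unfolding fundamental_solution_def by (elim conjE) simp

definition Q :: nat where "Q = (SUM i:UNIV. sg i)"

lemma Q3: "Q >= 3"
proof -
 have "(SUM i:(UNIV::'n set). 1) <= Q" unfolding Q_def by (rule sum_mono) (rule sig1)
 thus ?thesis using card3 by simp
qed

lemma G_hom: assumes "x ~= y" "t > 0" shows "t^(Q - 2)*Ga (dilation sg t x) (dilation sg t y) = Ga x y"
proof -
 have "Ga (dilation sg t x) (dilation sg t y) = t powi (2 - int Q)*Ga x y"
  using G_hom0[OF assms] by (simp add: Q_def)
 also have "2 - int Q = - int (Q - 2)" using Q3 by simp
 finally show ?thesis using assms(2) by (simp add: power_int_minus)
qed

lemma open_neq: "open {(x::real^'n, y). x ~= y}"
proof -
 have "{(x::real^'n, y). x ~= y} = {z. fst z ~= snd z}" by auto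
 thus ?thesis by (simp add: open_Collect_neq continuous_on_fst continuous_on_snd)
qed

lemma G_cont2: "continuous_on {(x, y). x ~= y} (%(x, y). Ga x y)"
 by (rule smooth_on_continuous[OF G_smooth2])

lemma smooth_G: "smooth_on (- {x}) (Ga x)"
proof -
 have D: "((%y. (x, y)) has_derivative (%v. (0, v))) (at y)" for y :: "real^'n"
  by (auto intro!: derivative_eq_intros)
 have "smooth_on (- {x}) (%y. (%(x, y). Ga x y) (x, y))"
  by (rule smooth_on_affine[OF _ open_neq _ D G_smooth2]) auto
 thus ?thesis by simp
qed

lemma G_cont: "continuous_on (- {x}) (Ga x)"
 by (rule smooth_on_continuous[OF smooth_G])

lemma G_isCont: "y ~= x ==> isCont (Ga x) y"
 using G_cont continuous_on_eq_continuous_at[of "- {x}" "Ga x"] by auto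

lemma G_integrable:
 fixes f :: "real^'n => real"
 assumes f: "f : borel_measurable borel" and B: "!!y. abs (f y) <= B" and R: "!!y. norm y >= R ==> f y = 0"
 shows "integrable lborel (%y. Ga x y*f y)"
proof -
 let ?g = "%y. indicator (cball 0 R) y *\<^sub>R Ga x y"
 have g: "integrable lborel ?g" using G_int[of "cball 0 R" x] by (simp add: set_integrable_def)
 have eq: "(%y. Ga x y*f y) = (%y. ?g y*f y)"
  using R by (auto simp: fun_eq_iff indicator_def)
 show ?thesis
  unfolding eq
 proof (rule Bochner_Integration.integrable_bound[of lborel "%y. B*abs (?g y)"])
  show "integrable lborel (%y. B*abs (?g y))" using g by (intro integrable_mult_right Bochner_Integration.integrable_abs)
  show "(%y. ?g y*f y) : borel_measurable lborel" using g f by (intro borel_measurable_times) (auto intro: borel_measurable_integrable)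
  show "AE y in lborel. norm (?g y*f y) <= norm (B*abs (?g y))"
  proof (rule AE_I2)
   fix y
   have "abs (?g y)*abs (f y) <= abs (?g y)*abs B" using B[of y] by (intro mult_left_mono) auto
   thus "norm (?g y*f y) <= norm (B*abs (?g y))" by (simp add: abs_mult mult.commute)
  qed
 qed
qed

lemma G_integrable_csm: "csm f ==> integrable lborel (%y. Ga x y*f y)"
proof -
 assume f: "csm f"
 obtain B where "!!y. abs (f y) <= B" using csm_bounded[OF f] by blast
 moreover obtain R where "!!y. norm y >= R ==> f y = 0" using f by (auto simp: csm_def)
 moreover have "f : borel_measurable borel" using csm_continuous[OF f] by (rule borel_measurable_continuous_onI)
 ultimately show ?thesis using G_integrable by blast
qed

text \<open>As \<open>Ga x\<close> is smooth off its pole, the representation formula can be tested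
  with a cutoff times \<open>L H\<close>, where \<open>H\<close> is a localization of
  \<open>Ga x\<close>. The test function vanishes at the pole, and self-adjointness turns the
  formula into a vanishing integral of the cutoff times the square of \<open>L H\<close>.\<close>

lemma LG: assumes "y ~= x" shows "L (Ga x) y = 0"
proof (rule ccontr)
 assume ne: "L (Ga x) y ~= 0"
 define r where "r = dist x y/4"
 have r: "r > 0" using assms by (simp add: r_def)
 let ?e = "cutoff y (2*r)"
 define H where "H z = ?e z*Ga x z" for z
 have sH: "smooth_on UNIV H"
  unfolding H_def
 proof (rule smooth_on_cut_mult[OF _ _ smooth_G[of x], of _ "cball y (3*r)"])
  show "smooth_on UNIV ?e" by (rule csm_smooth[OF csm_cutoff]) (use r in simp)
  show "cball y (3*r) <= - {x}" using r by (auto simp: r_def dist_commute)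
  show "?e z = 0" if "z ~: cball y (3*r)" for z using that r cutoff(4)[of "2*r" y z] by simp
 qed auto
 have HG: "H z = Ga x z" if "dist y z < 2*r" for z using that r cutoff(3)[of "2*r" y z] by (simp add: H_def)
 let ?c = "cutoff y r"
 define phi where "phi z = ?c z*L H z" for z
 have cc: "csm ?c" by (rule csm_cutoff[OF r])
 have phi: "csm phi" unfolding phi_def by (rule csm_mult_right[OF cc smooth_L[OF open_UNIV sH]])
 have p0: "phi z = 0" if "dist y z >= 3/2*r" for z using that r cutoff(4)[of r y z] by (simp add: phi_def)
 have "phi x = 0" using p0[of x] r by (simp add: r_def dist_commute)
 hence "(LINT z|lborel. Ga x z*L phi z) = 0" using G_rep[OF phi] by simp
 also have "(%z. Ga x z*L phi z) = (%z. H z*L phi z)"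
 proof
  fix z
  show "Ga x z*L phi z = H z*L phi z"
  proof (cases "dist y z < 2*r")
   case False
   have "L phi z = L (%z. 0) z"
    by (rule L_cong_open[of "{z. dist y z > 3/2*r}"]) (use False r p0 in "auto intro!: open_Collect_less continuous_intros")
   thus ?thesis by simp
  qed (simp add: HG)
 qed
 also have "(LINT z|lborel. H z*L phi z) = (LINT z|lborel. L H z * phi z)" by (rule L_symm[OF sH phi, symmetric])
 also have "(%z. L H z * phi z) = (%z. ?c z*(L H z)^2)" by (simp add: fun_eq_iff phi_def power2_eq_square)
 finally have I0: "(LINT z|lborel. ?c z*(L H z)^2) = 0" .
 have sL: "smooth_on UNIV (%z. (L H z)^2)" by (intro smooth_on_power smooth_L open_UNIV sH)
 have c: "csm (%z. ?c z*(L H z)^2)" by (rule csm_mult_right[OF cc sL])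
 have "L H y = L (Ga x) y"
  by (rule L_cong_open[of "ball y (2*r)"]) (use r HG in auto)
 hence "?c y*(L H y)^2 > 0" using ne r cutoff(3)[of r y y] by simp
 moreover have "?c z*(L H z)^2 >= 0" for z using cutoff(1)[OF r, of y z] by simp
 ultimately have "(LINT z|lborel. ?c z*(L H z)^2) > 0"
  by (intro integral_pos_cont[OF csm_continuous[OF c] csm_integrable[OF c]]) auto
 thus False using I0 by simp
qed

section \<open>Comparison of subharmonic with harmonic functions\<close>

lemma harmonic_G: "x ~: S ==> harmonic_on L S (Ga x)"
 unfolding harmonic_on_def using LG smooth_on_subset[OF smooth_G] by (metis Compl_iff singletonD subsetI)

lemma harmonic_combination:
 assumes S: "open S" and "harmonic_on L S g" "harmonic_on L S h"
 shows "harmonic_on L S (%x. a+b*g x + c*h x)"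
proof -
 have s: "smooth_on S g" "smooth_on S h" using assms by (auto simp: harmonic_on_def)
 have s1: "smooth_on S (%x. b*g x)" "smooth_on S (%x. c*h x)" "smooth_on S (%x. a+b*g x)"
  by (intro smooth_on_add smooth_on_mult S s smooth_on_const)+
 show ?thesis
  unfolding harmonic_on_def
 proof (intro conjI ballI)
  show "smooth_on S (%x. a+b*g x + c*h x)" by (intro smooth_on_add S s1)
  fix x assume x: "x : S"
  have "L (%x. a+b*g x + c*h x) x = L (%x. a+b*g x) x+L (%x. c*h x) x" by (rule L_add[OF S x s1(3,2)])
  also have "L (%x. a+b*g x) x = L (%x. a) x+L (%x. b*g x) x" by (rule L_add[OF S x smooth_on_const s1(1)])
  finally show "L (%x. a+b*g x + c*h x) x = 0"
   using assms x by (simp add: L_cmult[OF S x] s harmonic_on_def)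
 qed
qed

lemma harmonic_const: "harmonic_on L S (%x. c)" by (simp add: harmonic_on_def)

lemma harmonic_subset: "harmonic_on L S g ==> T <= S ==> harmonic_on L T g"
 by (auto simp: harmonic_on_def intro: smooth_on_subset)

lemma harmonic_cont: "harmonic_on L S g ==> continuous_on S g"
 by (auto simp: harmonic_on_def intro: smooth_on_continuous)

lemma compact_nbhd:
 fixes K :: "(real^'n) set"
 assumes "compact K" "open D" "K <= D"
 obtains W where "open W" "bounded W" "K <= W" "closure W <= D"
proof -
 obtain e where e: "e > 0" "(UN x:K. cball x e) <= D"
  using compact_subset_open_imp_cball_epsilon_subset[OF assms] by blast
 let ?W = "UN x:K. ball x (e/2)"
 show thesis
 proof (rule that)
  show "open ?W" by auto
  obtain R where R: "!!x. x : K ==> norm x <= R" using compact_imp_bounded[OF assms(1)] by (auto simp: bounded_iff)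
  have "norm y <= R+e" if yW: "y : ?W" for y
  proof -
   obtain x where x: "x : K" "dist x y < e/2" using yW by auto
   thus ?thesis using R[OF x(1)] e(1) norm_triangle_sub[of y x] by (simp add: dist_norm norm_minus_commute)
  qed
  thus "bounded ?W" unfolding bounded_iff by blast
  show "K <= ?W" using e(1) by auto
  show "closure ?W <= D"
  proof
   fix y assume "y : closure ?W"
   then obtain z where z: "z : ?W" "dist z y < e/2" using e(1) closure_approachable[of y ?W] by (meson half_gt_zero)
   then obtain x where x: "x : K" "dist x z < e/2" by auto
   hence "dist x y <= e" using z(2) dist_triangle[of x y z] by simp
   hence "y : cball x e" by simp
   thus "y : D" using e(2) x(1) by blast
  qed
 qed
qed

lemma subharmonicD:
 assumes "subharmonic_on L Om u" "open W" "bounded W" "closure W <= Om" "harmonic_on L W h" "continuous_on (closure W) h"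
  "!!x. x : frontier W ==> u x <= ereal (h x)" "x : W"
 shows "u x <= ereal (h x)"
 using assms unfolding subharmonic_on_def by blast

lemma comparison:
 assumes u: "subharmonic_on L Om u" and D: "open D" "D <= Om" and g: "harmonic_on L D g"
  and K: "!!e. e > 0 ==> EX K. compact K & K <= D & (ALL x:D - K. u x <= ereal (g x+e))" and x: "x : D"
 shows "u x <= ereal (g x)"
proof (rule ereal_le_epsilon2)
 fix e :: real assume e: "e > 0"
 obtain K where K: "compact K" "K <= D" "!!x. x : D - K ==> u x <= ereal (g x+e)" using K[OF e] by blast
 show "u x <= ereal (g x)+ereal e"
 proof (cases "x : K")
  case False
  thus ?thesis using K(3) x by simp
 next
  case True
  obtain W where W: "open W" "bounded W" "K <= W" "closure W <= D" by (rule compact_nbhd[OF K(1) D(1) K(2)])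
  have WD: "W <= D" using W(4) closure_subset by blast
  have h: "harmonic_on L D (%x. g x+e)" using harmonic_combination[OF D(1) g g, of e 1 0] by (simp add: add.commute)
  have fr: "frontier W <= D - K" using W frontier_subset_closed[of "closure W"] by (auto simp: frontier_def interior_open)
  have "u x <= ereal (g x+e)"
  proof (rule subharmonicD[OF u W(1,2) order_trans[OF W(4) D(2)] harmonic_subset[OF h WD] continuous_on_subset[OF harmonic_cont[OF h] W(4)]])
   show "u y <= ereal (g y+e)" if "y : frontier W" for y using K(3) fr that by blast
   show "x : W" using True W(3) by blast
  qed
  thus ?thesis by simp
 qed
qed

end

section \<open>Maximum principle sets and thinness\<close>

context fund begin

lemma usc_open: "subharmonic_on L Om u ==> open Om ==> open {x:Om. u x < c}"
 unfolding subharmonic_on_def upper_semicontinuous_on_def by (simp add: openin_open_eq)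

lemma usc_closed:
 fixes U :: "real^'n => ereal"
 assumes U: "!!c. open {x. U x < c}" and h: "continuous_on S h" and S: "closed S"
 shows "closed {x:S. ereal (h x) <= U x}"
 unfolding closed_def
proof (subst open_subopen, intro ballI)
 fix x assume x: "x : - {x:S. ereal (h x) <= U x}"
 show "EX T. open T & x : T & T <= - {x:S. ereal (h x) <= U x}"
 proof (cases "x : S")
  case False
  thus ?thesis using S by (intro exI[of _ "- S"]) auto
 next
  case True
  hence "U x < ereal (h x)" using x by auto
  then obtain c where c: "U x < c" "c < ereal (h x)" using dense by blast
  have "EX A. open A & {y : S. c < ereal (h y)} = S Int A"
  proof -
   have "continuous_on S (%y. ereal (h y))" by (intro continuous_on_ereal h)
   hence "openin (top_of_set S) (S Int (%y. ereal (h y)) -` {c<..})"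
    by (rule continuous_openin_preimage_gen) auto
   moreover have "S Int (%y. ereal (h y)) -` {c<..} = {y : S. c < ereal (h y)}" by auto
   ultimately show ?thesis unfolding openin_open by blast
  qed
  then obtain A where A: "open A" "{y : S. c < ereal (h y)} = S Int A" by blast
  show ?thesis
  proof (intro exI[of _ "A Int {x. U x < c}"] conjI)
   show "open (A Int {x. U x < c})" using A U by blast
   show "x : A Int {x. U x < c}" using A c True by blast
   show "A Int {x. U x < c} <= - {x:S. ereal (h x) <= U x}"
   proof
    fix y assume y: "y : A Int {x. U x < c}"
    show "y : - {x:S. ereal (h x) <= U x}"
    proof (cases "y : S")
    case True
    hence "c < ereal (h y)" using y A by blast
    thus ?thesis using y by auto
    qed auto
   qed
  qed
 qed
qed

text \<open>A harmonic majorant of \<open>U\<close> on \<open>frontier W\<close> is nonnegative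
  there, hence in \<open>W\<close> by the weak maximum principle. This settles the points off
  \<open>Om\<close>; on \<open>W Int Om\<close> it permits the comparison with
  \<open>u\<close>.\<close>

lemma glue_subharmonic:
 fixes u :: "real^'n => ereal"
 assumes O: "open Om" and u: "u : subharmonic_bdd_above L Om"
  and lim: "!!xi. xi : frontier Om ==> Limsup (at xi within Om) u <= 0"
 defines "U \<equiv> (%x. if x : Om then max 0 (u x) else 0)"
 shows "subharmonic_on L UNIV U"
proof -
 have us: "subharmonic_on L Om u" using u by (auto simp: subharmonic_bdd_above_def)
 have U0: "0 <= U x" for x by (simp add: U_def)
 have op: "open {x. U x < c}" for c
 proof (cases "c <= 0")
  case True
  hence "{x. U x < c} = {}" using U0 order_trans by (auto simp: not_less)
  thus ?thesis by simp
 next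
  case False
  hence c: "0 < c" by simp
  show ?thesis
  proof (subst open_subopen, intro ballI)
   fix x assume x: "x : {x. U x < c}"
   show "EX T. open T & x : T & T <= {x. U x < c}"
   proof (cases "x : Om")
    case True
    thus ?thesis
    by (intro exI[of _ "{x:Om. u x < c}"]) (use x c usc_open[OF us O] in "auto simp: U_def")
   next
    case False
    show ?thesis
    proof (cases "x : closure Om")
    case True
    hence "x : frontier Om" using False O by (simp add: frontier_def interior_open)
    from lim[OF this] c have "Limsup (at x within Om) u < c" by (rule order.strict_trans1)
    hence "\<forall>\<^sub>F y in at x within Om. u y < c" by (rule Limsup_lessD)
    then obtain T where T: "open T" "x : T" "!!y. y : T ==> y ~= x ==> y : Om ==> u y < c"
    unfolding eventually_at_topological by blast
    show ?thesis
    by (intro exI[of _ T]) (use T False c in "auto simp: U_def")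
    next
    case False
    have "- closure Om <= {x. U x < c}" using c closure_subset[of Om] by (auto simp: U_def)
    thus ?thesis using False by (intro exI[of _ "- closure Om"]) auto
    qed
   qed
  qed
 qed
 show ?thesis
  unfolding subharmonic_on_def
 proof (intro conjI allI impI ballI)
  show "U x < \<infinity>" for x using us by (auto simp: U_def subharmonic_on_def max_def)
  show "upper_semicontinuous_on UNIV U" unfolding upper_semicontinuous_on_def using op by simp
  have "- \<infinity> < U x" for x using U0[of x] by (rule less_le_trans[rotated]) simp
  thus "UNIV <= closure {x : UNIV. - \<infinity> < U x}" by simp
  fix W h x assume "open W & bounded W & closure W <= UNIV & harmonic_on L W h & continuous_on (closure W) h & (ALL x:frontier W. U x <= ereal (h x))"
  hence W: "open W" "bounded W" and h: "harmonic_on L W h" "continuous_on (closure W) h"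
   and le: "!!x. x : frontier W ==> U x <= ereal (h x)" by auto
  have hpos: "h x >= 0" if "x : W" for x
  proof -
   have hm: "harmonic_on L W (%x. - h x)" using harmonic_combination[OF W(1) h(1) h(1), of 0 "-1" 0] by simp
   have "- h x <= 0"
   proof (rule weak_max_principle[OF W _ _ _ _ that])
    show "smooth_on W (%x. - h x)" "!!x. x : W ==> 0 <= L (%x. - h x) x" using hm by (auto simp: harmonic_on_def)
    show "continuous_on (closure W) (%x. - h x)" by (intro continuous_intros h)
    show "- h y <= 0" if "y : frontier W" for y using order_trans[OF U0 le[OF that]] by simp
   qed
   thus ?thesis by simp
  qed
  assume x: "x : W"
  show "U x <= ereal (h x)"
  proof (cases "x : Om")
   case False
   thus ?thesis using hpos[OF x] by (simp add: U_def)
  next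
   case True
   have "u x <= ereal (h x)"
   proof (rule comparison[OF us, of "W Int Om"])
    show "harmonic_on L (W Int Om) h" by (rule harmonic_subset[OF h(1)]) auto
    fix e :: real assume e: "e > 0"
    \<comment> \<open>On the boundaries of \<open>W\<close> and of \<open>Om\<close> the value
      \<open>h + e\<close> strictly exceeds \<open>U\<close>, so this closed set stays inside
      \<open>W Int Om\<close>.\<close>
    let ?K = "{x:closure W. ereal (h x+e) <= U x}"
    have "closed ?K" by (rule usc_closed[OF op]) (auto intro: continuous_intros h)
    moreover have "bounded ?K" using bounded_closure[OF W(2)] by (rule bounded_subset) auto
    ultimately have "compact ?K" by (simp add: compact_eq_bounded_closed)
    moreover have "?K <= W Int Om"
    proof
    fix y assume y: "y : ?K"
    have yW: "y : W"
    proof (rule ccontr)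
    assume "y ~: W"
    hence "y : frontier W" using y W(1) by (simp add: frontier_def interior_open)
    from order_trans[OF _ le[OF this], of "ereal (h y+e)"] y e show False by simp
    qed
    moreover have "y : Om"
    proof (rule ccontr)
    assume "y ~: Om"
    thus False using y hpos[OF yW] e by (auto simp: U_def zero_ereal_def)
    qed
    ultimately show "y : W Int Om" by simp
    qed
    moreover have "u y <= ereal (h y+e)" if "y : W Int Om - ?K" for y
    proof -
    have "U y < ereal (h y+e)" using that closure_subset[of W] by (auto simp: not_le)
    moreover have "u y <= U y" using that by (simp add: U_def)
    ultimately show ?thesis by simp
    qed
    ultimately show "EX K. compact K & K <= W Int Om & (ALL x:W Int Om - K. u x <= ereal (h x+e))" by blast
   qed (use O W True x in auto)
   thus ?thesis using True hpos[OF x] by (simp add: U_def)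
  qed
 qed
qed

text \<open>\<open>S\<close> is the exact supremum of \<open>v\<close>; the arguments for cones and
  coverings end by bounding \<open>v\<close> by a fixed fraction of \<open>S\<close>.\<close>

lemma not_mps:
 assumes O: "open Om" and n: "~ maximum_principle_set L Om"
 obtains v :: "real^'n => real" and S where "subharmonic_on L UNIV (%x. ereal (v x))" "!!x. x ~: Om ==> v x = 0"
  "!!x. 0 <= v x" "!!x. v x <= S" "S > 0" "!!c. c < S ==> EX x. v x > c"
proof -
 obtain u x0 where u: "u : subharmonic_bdd_above L Om" and lim: "!!xi. xi : frontier Om ==> Limsup (at xi within Om) u <= 0"
  and x0: "x0 : Om" "u x0 > 0"
  using n O unfolding maximum_principle_set_def by (auto simp: not_le)
 obtain M where M: "!!x. x : Om ==> u x <= ereal M" using u by (auto simp: subharmonic_bdd_above_def)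
 define U where "U = (%x. if x : Om then max 0 (u x) else 0)"
 have U: "subharmonic_on L UNIV U" unfolding U_def by (rule glue_subharmonic[OF O u lim])
 have U0: "0 <= U x" and UM: "U x <= ereal \<bar>M\<bar>" for x
 proof -
  show "0 <= U x" by (simp add: U_def)
  have "ereal M <= ereal \<bar>M\<bar>" by simp
  thus "U x <= ereal \<bar>M\<bar>" using M[of x] order_trans[of "u x" "ereal M" "ereal \<bar>M\<bar>"] by (auto simp: U_def zero_ereal_def max_def)
 qed
 define v where "v x = real_of_ereal (U x)" for x
 have Uv: "U x = ereal (v x)" for x
  unfolding v_def using U0[of x] UM[of x] by (intro ereal_real'[symmetric]) auto
 have Ue: "U = (%x. ereal (v x))" using Uv by blast
 have v0: "0 <= v x" for x using U0[of x] by (simp add: Uv)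
 have bd: "bdd_above (range v)" using UM by (intro bdd_aboveI[of _ "abs M"]) (auto simp: Uv)
 show thesis
 proof (rule that[of v "Sup (range v)"])
  show "subharmonic_on L UNIV (%x. ereal (v x))" using U by (simp add: Ue)
  show "v x = 0" if "x ~: Om" for x using that by (simp add: v_def U_def)
  show "0 <= v x" for x by (rule v0)
  show le: "v x <= Sup (range v)" for x by (rule cSup_upper[OF _ bd]) auto
  have "U x0 > 0" using x0 by (simp add: U_def)
  hence "v x0 > 0" by (simp add: Uv zero_ereal_def[symmetric])
  thus "Sup (range v) > 0" using le[of x0] by linarith
  show "EX x. v x > c" if "c < Sup (range v)" for c using less_cSupD[OF _ that] by auto
 qed
qed

lemma G_lower_bound:
 obtains c where "c > 0" "!!y. norm y <= R ==> y ~= x ==> Ga x y >= c"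
proof -
 have "\<forall>\<^sub>F y in at x. Ga x y >= 1" using G_top by (simp add: filterlim_at_top)
 then obtain d where d: "d > 0" "!!y. y ~= x ==> dist y x < d ==> Ga x y >= 1" unfolding eventually_at by blast
 let ?K = "cball 0 R - ball x d"
 have K: "compact ?K" by (rule compact_diff) auto
 have c: "continuous_on ?K (Ga x)" by (rule continuous_on_subset[OF G_cont]) (use d in auto)
 have "EX c>0. ALL y:?K. c <= Ga x y"
 proof (cases "?K = {}")
  case False
  from continuous_attains_inf[OF K False c] obtain z where "z : ?K" "ALL y:?K. Ga x z <= Ga x y" by blast
  moreover hence "Ga x z > 0" using d by (intro G_pos) auto
  ultimately show ?thesis by blast
 qed (auto intro: exI[of _ 1])
 then obtain c where c: "c > 0" "!!y. y : ?K ==> c <= Ga x y" by blast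
 show thesis
 proof (rule that[of "min c 1"])
  show "min c 1 > 0" using c by simp
  fix y assume "norm y <= R" "y ~= x"
  thus "min c 1 <= Ga x y" using c(2)[of y] d(2)[of y] by (cases "dist y x < d") (auto simp: dist_commute)
 qed
qed

text \<open>The counterexample is \<open>u - g\<close>. For a bounded complement \<open>g\<close> is
  a constant. Otherwise thinness controls \<open>u\<close> on the complement only near infinity; a
  multiple of \<open>Ga x0\<close> with its pole in the complement takes care of the rest, and as it
  tends to 0 it cannot undo the larger upper limit at infinity.\<close>

lemma thin_not_mps:
 assumes O: "open Om" and thin: "thin_at_infinity L (- Om)"
 shows "~ maximum_principle_set L Om"
proof -
 obtain u g c0 where u: "u : subharmonic_bdd_above L UNIV" and g: "harmonic_on L Om g" and gc: "!!x. x : Om ==> g x >= c0"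
  and x1: "EX x:Om. u x > ereal (g x)"
  and fr: "!!xi e. xi : frontier Om ==> e > 0 ==> \<forall>\<^sub>F x in at xi within Om. u x < ereal (g x+e)"
 proof (cases "bounded (- Om)")
  case True
  then obtain u where u: "u : subharmonic_bdd_above L UNIV" "(SUP x\<in>- Om. u x) < (SUP x. u x)"
   using thin by (auto simp: thin_at_infinity_def)
  have us: "subharmonic_on L UNIV u" using u(1) by (simp add: subharmonic_bdd_above_def)
  obtain c where c: "(SUP x\<in>- Om. u x) < ereal c" "ereal c < (SUP x. u x)" using ereal_dense2[OF u(2)] by blast
  have F: "u x < ereal c" if "x ~: Om" for x using c(1) that by (meson ComplI SUP_upper le_less_trans)
  show thesis
  proof (rule that[of u "%x. c" c])
   obtain x where "u x > ereal c" using c(2) by (auto simp: less_SUP_iff)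
   thus "EX x:Om. ereal c < u x" using F by (meson not_less_iff_gr_or_eq)
   fix xi and e :: real assume x: "xi : frontier Om" and e: "e > 0"
   hence "xi ~: Om" using O by (simp add: frontier_def interior_open)
   hence "xi : {x. u x < ereal c}" using F by simp
   moreover have "open {x. u x < ereal c}" using usc_open[OF us open_UNIV, of "ereal c"] by simp
   ultimately have "\<forall>\<^sub>F x in at xi within Om. x : {x. u x < ereal c}" by (rule topological_tendstoD[OF tendsto_ident_at, rotated 1])
   thus "\<forall>\<^sub>F x in at xi within Om. u x < ereal (c+e)"
    by eventually_elim (use e in "auto elim: less_trans")
  qed (use u harmonic_const in auto)
 next
  case False
  then obtain u where u: "u : subharmonic_bdd_above L UNIV" "Limsup (inf at_infinity (principal (- Om))) u < Limsup at_infinity u"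
   using thin by (auto simp: thin_at_infinity_def)
  have us: "subharmonic_on L UNIV u" using u(1) by (simp add: subharmonic_bdd_above_def)
  have opu: "open {x. u x < c}" for c using usc_open[OF us open_UNIV, of c] by simp
  obtain M where M: "!!x. u x <= ereal M" using u(1) by (auto simp: subharmonic_bdd_above_def)
  obtain c where c: "Limsup (inf at_infinity (principal (- Om))) u < ereal c" "ereal c < Limsup at_infinity u" using ereal_dense2[OF u(2)] by blast
  obtain c2 where c2: "ereal c < ereal c2" "ereal c2 < Limsup at_infinity u" using ereal_dense2[OF c(2)] by blast
  have "\<forall>\<^sub>F x in inf at_infinity (principal (- Om)). u x < ereal c" by (rule Limsup_lessD[OF c(1)])
  then obtain R where R: "!!x. norm x >= R ==> x ~: Om ==> u x < ereal c"
   unfolding eventually_inf_principal eventually_at_infinity by auto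
  obtain x0 where x0: "x0 ~: Om" using False by (metis ComplD bounded_empty ex_in_conv)
  obtain b where b: "b > 0" "!!y. norm y <= R ==> y ~= x0 ==> Ga x0 y >= b" by (rule G_lower_bound[of R x0]) (rule that)
  \<comment> \<open>\<open>Ga x0\<close> is at least \<open>b\<close> on the ball of radius
    \<open>R\<close>, so this multiple of it is at least \<open>M - c\<close> there.\<close>
  define T where "T = abs (M - c)/b+1"
  have T: "T > 0" "T*b >= M - c"
  proof -
   show "T > 0" using b by (simp add: T_def add_nonneg_pos)
   have "T*b = abs (M - c)+b" using b by (simp add: T_def distrib_right)
   thus "T*b >= M - c" using b by linarith
  qed
  let ?g = "%x. c+T*Ga x0 x"
  have F: "u x < ereal (?g x+e)" if "x ~: Om" "x ~= x0" "e > 0" for x e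
  proof (cases "norm x >= R")
   case True
   have "u x < ereal c" by (rule R[OF True that(1)])
   also have "ereal c <= ereal (?g x+e)" using T(1) G_pos[of x0 x] that by simp
   finally show ?thesis .
  next
   case False
   hence "Ga x0 x >= b" using b that by auto
   hence "T*Ga x0 x >= T*b" using T by simp
   hence "M < ?g x+e" using T that by linarith
   thus ?thesis using M[of x] by (meson ereal_less_eq(3) less_ereal.simps(1) order.strict_trans1)
  qed
  show thesis
  proof (rule that[of u ?g c])
   have h: "harmonic_on L Om (Ga x0)" by (rule harmonic_G[OF x0])
   show "harmonic_on L Om ?g" using harmonic_combination[OF O h h, of c T 0] by simp
   show "c <= ?g x" if "x : Om" for x using T G_pos[of x0 x] x0 that by (cases "x = x0") auto
   show "EX x:Om. ereal (?g x) < u x"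
   proof -
    have e1: "\<forall>\<^sub>F x in at_infinity. Ga x0 x < (c2 - c)/T"
    by (rule order_tendstoD(2)[OF G_0]) (use c2 T in simp)
    have e2: "\<forall>\<^sub>F x in at_infinity. norm x >= max R (norm x0+1)"
    unfolding eventually_at_infinity by (rule exI[of _ "max R (norm x0+1)"]) blast
    have f: "\<exists>\<^sub>F x in at_infinity. ereal c2 < u x"
    proof (rule ccontr)
    assume "~ (\<exists>\<^sub>F x in at_infinity. ereal c2 < u x)"
    hence "\<forall>\<^sub>F x in at_infinity. u x <= ereal c2" by (simp add: frequently_def not_less)
    hence "Limsup at_infinity u <= ereal c2" by (rule Limsup_bounded)
    thus False using c2 by simp
    qed
    from eventually_conj[OF e1 e2]
    have "\<forall>\<^sub>F x in at_infinity. ereal c2 < u x --> ereal c2 < u x & Ga x0 x < (c2 - c)/T & norm x >= R & norm x >= norm x0+1"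
    by eventually_elim simp
    from frequently_rev_mp[OF f this]
    obtain x where x: "ereal c2 < u x" "Ga x0 x < (c2 - c)/T" "norm x >= R" "norm x >= norm x0+1" by (auto dest: frequently_ex)
    have "x : Om" using R[OF x(3)] x(1) c2 by (meson less_trans not_less_iff_gr_or_eq)
    moreover have "?g x < c2" using x(2) T by (simp add: pos_less_divide_eq mult.commute)
    hence "ereal (?g x) < u x" using x(1) by (meson less_ereal.simps(1) less_trans)
    ultimately show ?thesis by blast
   qed
   fix xi and e :: real assume x: "xi : frontier Om" and e: "e > 0"
   hence xi: "xi ~: Om" using O by (simp add: frontier_def interior_open)
   show "\<forall>\<^sub>F x in at xi within Om. u x < ereal (?g x+e)"
   \<comment> \<open>The diagonal value of \<open>Ga\<close> is junk, so a boundary point at the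
     pole needs the blow-up of \<open>Ga x0\<close> in place of continuity.\<close>
   proof (cases "xi = x0")
    case True
    have "\<forall>\<^sub>F x in at x0. Ga x0 x > (M - c)/T" using G_top by (simp add: filterlim_at_top_dense)
    hence "\<forall>\<^sub>F x in at xi within Om. Ga x0 x > (M - c)/T" unfolding True by (rule filter_leD[OF at_le, rotated]) simp
    thus ?thesis
    proof eventually_elim
    fix x assume "(M - c)/T < Ga x0 x"
    hence "M < ?g x+e" using T e by (simp add: pos_divide_less_eq mult.commute)
    thus "u x < ereal (?g x+e)" using M[of x] by (meson less_ereal.simps(1) order.strict_trans1)
    qed
   next
    case False
    have "u xi < ereal (?g xi+e/2)" by (rule F[OF xi False]) (use e in simp)
    hence "xi : {x. u x < ereal (?g xi+e/2)}" by simp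
    hence "\<forall>\<^sub>F x in at xi within Om. x : {x. u x < ereal (?g xi+e/2)}"
    by (rule topological_tendstoD[OF tendsto_ident_at opu])
    moreover have "\<forall>\<^sub>F x in at xi within Om. ?g x > ?g xi - e/2"
    proof -
    have "isCont ?g xi" using G_isCont[OF False] by (intro continuous_intros)
    hence "(?g \<longlongrightarrow> ?g xi) (at xi within Om)" unfolding isCont_def by (rule tendsto_within_subset) simp
    thus ?thesis by (rule order_tendstoD) (use e in simp)
    qed
    ultimately show ?thesis
    proof eventually_elim
    case (elim x)
    have "ereal (?g xi+e/2) <= ereal (?g x+e)" using elim(2) by simp
    thus ?case using elim(1) by (auto intro: less_le_trans)
    qed
   qed
  qed (rule u)
 qed
 have us: "subharmonic_on L UNIV u" using u by (simp add: subharmonic_bdd_above_def)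
 obtain M where M: "!!x. u x <= ereal M" using u by (auto simp: subharmonic_bdd_above_def)
 define w where "w x = u x - ereal (g x)" for x
 have le: "w x <= ereal a \<longleftrightarrow> u x <= ereal (a+g x)" "w x < ereal a \<longleftrightarrow> u x < ereal (a+g x)" for x a
  unfolding w_def by (cases "u x"; simp; linarith)+
 have fin: "u x < \<infinity>" for x using M[of x] by auto
 have "subharmonic_on L Om w"
  unfolding subharmonic_on_def
 proof (intro conjI allI impI ballI)
  show "w x < \<infinity>" for x using fin[of x] unfolding w_def by (cases "u x") auto
  show "upper_semicontinuous_on Om w"
   unfolding upper_semicontinuous_on_def
  proof (intro allI)
   fix c
   have "open {x:Om. w x < c}"
   proof (subst open_subopen, intro ballI)
    fix x assume x: "x : {x:Om. w x < c}"
    then obtain a where a: "w x < ereal a" "ereal a < c" using ereal_dense2 by blast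
    hence "u x < ereal (a+g x)" by (simp add: le)
    then obtain b where b: "u x < ereal b" "ereal b < ereal (a+g x)" using ereal_dense2 by blast
    have "isCont g x" using harmonic_cont[OF g] O x by (simp add: continuous_on_eq_continuous_at)
    moreover have "b - a < g x" using b by simp
    ultimately have "\<forall>\<^sub>F y in at x. b - a < g y" using order_tendstoD(1) unfolding isCont_def by blast
    then obtain T where T: "open T" "x : T" "!!y. y : T ==> y ~= x ==> b - a < g y" unfolding eventually_at_topological by blast
    have ob: "open {x. u x < ereal b}" using usc_open[OF us open_UNIV, of "ereal b"] by simp
    show "EX T. open T & x : T & T <= {x:Om. w x < c}"
    proof (intro exI[of _ "T Int {x. u x < ereal b} Int Om"] conjI subsetI)
    show "open (T Int {x. u x < ereal b} Int Om)" using T ob O by blast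
    show "x : T Int {x. u x < ereal b} Int Om" using T b x by simp
    fix y assume y: "y : T Int {x. u x < ereal b} Int Om"
    have "b - a < g y" using T(3)[of y] y b(2) by (cases "y = x") auto
    hence "ereal b <= ereal (a+g y)" by simp
    hence "u y < ereal (a+g y)" using y by (auto intro: less_le_trans)
    hence "w y < ereal a" by (simp add: le)
    thus "y : {x:Om. w x < c}" using y a(2) by (auto intro: less_trans)
    qed
   qed
   thus "openin (top_of_set Om) {x:Om. w x < c}" using O by (simp add: openin_open_eq)
  qed
  have "UNIV <= closure {x. u x > - \<infinity>}" using us by (simp add: subharmonic_on_def)
  hence "Om <= closure (Om Int {x. u x > - \<infinity>})" using open_Int_closure_subset[OF O, of "{x. u x > - \<infinity>}"] by blast
  moreover have "Om Int {x. u x > - \<infinity>} = {x:Om. w x > - \<infinity>}"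
  proof -
   have "- \<infinity> < w x \<longleftrightarrow> - \<infinity> < u x" for x unfolding w_def by (cases "u x") auto
   thus ?thesis by blast
  qed
  ultimately show "Om <= closure {x:Om. w x > - \<infinity>}" by simp
  fix W h x assume "open W & bounded W & closure W <= Om & harmonic_on L W h & continuous_on (closure W) h & (ALL x:frontier W. w x <= ereal (h x))"
  hence W: "open W" "bounded W" "closure W <= Om" and h: "harmonic_on L W h" "continuous_on (closure W) h"
   and fw: "!!x. x : frontier W ==> w x <= ereal (h x)" by auto
  assume x: "x : W"
  have WO: "W <= Om" using W(3) closure_subset by blast
  have "u x <= ereal (h x+g x)"
  proof (rule subharmonicD[OF us W(1,2) _ _ _ _ x])
   show "harmonic_on L W (%x. h x+g x)" using harmonic_combination[OF W(1) h(1) harmonic_subset[OF g WO], of 0 1 1] by simp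
   show "continuous_on (closure W) (%x. h x+g x)" by (intro continuous_intros h continuous_on_subset[OF harmonic_cont[OF g] W(3)])
   show "u y <= ereal (h y+g y)" if "y : frontier W" for y using fw[OF that] by (simp add: le)
  qed simp
  thus "w x <= ereal (h x)" by (simp add: le)
 qed
 moreover have "w x <= ereal (M - c0)" if "x : Om" for x
 proof -
  have "ereal M <= ereal (M - c0+g x)" using gc[OF that] by simp
  thus ?thesis using M[of x] by (auto simp: le intro: order_trans)
 qed
 ultimately have wb: "w : subharmonic_bdd_above L Om" by (auto simp: subharmonic_bdd_above_def)
 have wl: "Limsup (at xi within Om) w <= 0" if x: "xi : frontier Om" for xi
 proof (rule ereal_le_epsilon2)
  fix e :: real assume e: "e > 0"
  from fr[OF x e] have "\<forall>\<^sub>F x in at xi within Om. w x <= ereal e"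
  proof eventually_elim
   fix x assume "u x < ereal (g x+e)"
   hence "u x <= ereal (e+g x)" by (simp add: add.commute)
   thus "w x <= ereal e" by (simp only: le)
  qed
  from Limsup_bounded[OF this] show "Limsup (at xi within Om) w <= 0+ereal e" by simp
 qed
 obtain x1 where x1: "x1 : Om" "u x1 > ereal (g x1)" using x1 by blast
 hence "~ w x1 <= 0" using le(1)[of x1 0] by (simp add: zero_ereal_def not_le)
 thus ?thesis using wb wl x1(1) unfolding maximum_principle_set_def by blast
qed

text \<open>For the converse the function \<open>v\<close> of \<open>not_mps\<close> witnesses
  thinness, being 0 on the complement. Its upper limit at infinity is positive, for otherwise
  \<open>v\<close> would be at most \<open>v x1/2\<close> on a large sphere and hence at
  \<open>x1\<close>.\<close>

lemma mps_iff:
 assumes O: "open Om"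
 shows "maximum_principle_set L Om \<longleftrightarrow> large_at_infinity L (- Om)"
proof
 assume "maximum_principle_set L Om"
 thus "large_at_infinity L (- Om)" using thin_not_mps[OF O] by (auto simp: large_at_infinity_def)
next
 assume large: "large_at_infinity L (- Om)"
 show "maximum_principle_set L Om"
 proof (rule ccontr)
  assume "~ maximum_principle_set L Om"
  then obtain v :: "real^'n => real" and S where v: "subharmonic_on L UNIV (%x. ereal (v x))" "!!x. x ~: Om ==> v x = 0"
   "!!x. 0 <= v x" "!!x. v x <= S" "S > 0" "!!c. c < S ==> EX x. v x > c"
   by (rule not_mps[OF O]) (rule that)
  let ?U = "%x. ereal (v x)"
  have U: "?U : subharmonic_bdd_above L UNIV" using v(1,4) by (auto simp: subharmonic_bdd_above_def)
  obtain x1 where x1: "v x1 > 0" using v(6)[OF v(5)] by blast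
  have "thin_at_infinity L (- Om)"
  proof (cases "bounded (- Om)")
   case True
   have "(SUP x\<in>- Om. ?U x) <= 0" by (rule SUP_least) (simp add: v(2))
   also have "0 < ?U x1" using x1 by simp
   also have "?U x1 <= (SUP x. ?U x)" by (rule SUP_upper) simp
   finally show ?thesis using True U by (auto simp: thin_at_infinity_def)
  next
   case False
   have "Limsup (inf at_infinity (principal (- Om))) ?U <= 0"
    by (rule Limsup_bounded) (auto simp: eventually_inf_principal v(2) intro!: always_eventually)
   also have "0 < Limsup at_infinity ?U"
   proof (rule ccontr)
    assume "~ 0 < Limsup at_infinity ?U"
    hence "Limsup at_infinity ?U <= 0" by simp
    also have "0 < ereal (v x1/2)" using x1 by simp
    finally have "\<forall>\<^sub>F x in at_infinity. ?U x < ereal (v x1/2)" by (rule Limsup_lessD)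
    then obtain b where b: "!!x. norm x >= b ==> v x < v x1/2" unfolding eventually_at_infinity by auto
    define r where "r = max b (norm x1+1)"
    have r: "r > 0" using norm_ge_zero[of x1] unfolding r_def by linarith
    have "?U x1 <= ereal (v x1/2)"
    proof (rule subharmonicD[OF v(1), of "ball 0 r" "%_. v x1/2"])
    show "?U x <= ereal (v x1/2)" if "x : frontier (ball 0 r)" for x
    using that b[of x] r by (auto simp: r_def)
    show "x1 : ball 0 r" by (auto simp: r_def)
    qed (use harmonic_const in auto)
    thus False using x1 by simp
   qed
   finally show ?thesis using False U by (auto simp: thin_at_infinity_def)
  qed
  thus False using large by (simp add: large_at_infinity_def)
 qed
qed

section \<open>Level sets of the fundamental solution, scaling and cones\<close>

lemma open_G_greater: "open {x. x = p | Ga p x > b}"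
proof (subst open_subopen, intro ballI)
 fix x assume x: "x : {x. x = p | Ga p x > b}"
 have ev: "\<forall>\<^sub>F y in at x. Ga p y > b"
 proof (cases "x = p")
  case True
  thus ?thesis using G_top[of p] by (simp add: filterlim_at_top_dense)
 next
  case False
  thus ?thesis using G_isCont[OF False] x order_tendstoD(1) unfolding isCont_def by blast
 qed
 then obtain T where T: "open T" "x : T" "!!y. y : T ==> y ~= x ==> b < Ga p y" unfolding eventually_at_topological by blast
 show "EX T. open T & x : T & T <= {x. x = p | Ga p x > b}"
  by (intro exI[of _ T]) (use T x in auto)
qed

lemma closed_G_le: "closed {x. x ~= p & Ga p x <= b}"
proof -
 have "- {x. x ~= p & Ga p x <= b} = {x. x = p | Ga p x > b}" by auto
 thus ?thesis using open_G_greater[of p b] by (simp add: closed_def)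
qed

lemma open_G_less: "open {x. x ~= p & Ga p x < b}"
proof -
 have "open (- {p} Int Ga p -` {..<b})" by (rule continuous_open_preimage[OF G_cont]) auto
 moreover have "- {p} Int Ga p -` {..<b} = {x. x ~= p & Ga p x < b}" by auto
 ultimately show ?thesis by simp
qed

lemma bounded_G_ge: "a > 0 ==> bounded {x. a <= Ga p x}"
proof -
 assume "a > 0"
 hence "\<forall>\<^sub>F x in at_infinity. Ga p x < a" by (rule order_tendstoD(2)[OF G_0])
 then obtain b where b: "!!x. norm x >= b ==> Ga p x < a" unfolding eventually_at_infinity by auto
 show ?thesis unfolding bounded_iff by (rule exI[of _ b]) (use b in "force simp: not_le[symmetric]")
qed

lemma Gamma_ball_eq: "r > 0 ==> Gamma_ball Ga p r = {y. y = p | Ga p y > 1/r}"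
 unfolding Gamma_ball_def quasi_dist_def using G_pos[of p] by (auto simp: divide_less_eq field_simps)

lemma compact_annulus:
 assumes "a > 0" shows "compact {w. w ~= 0 & a <= Ga 0 w & Ga 0 w <= b}"
proof -
 have "{w. w ~= 0 & a <= Ga 0 w & Ga 0 w <= b} = {w. w ~= 0 & Ga 0 w <= b} - {w. w ~= 0 & Ga 0 w < a}" by auto
 moreover have "closed ..." by (rule closed_Diff[OF closed_G_le open_G_less])
 moreover have "bounded {w. w ~= 0 & a <= Ga 0 w & Ga 0 w <= b}" by (rule bounded_subset[OF bounded_G_ge[OF assms, of 0]]) auto
 ultimately show ?thesis by (simp only: compact_eq_bounded_closed)
qed

lemma G_unif_at_0:
 assumes A: "compact A" "0 ~: A"
 obtains rho where "rho > 0" "!!w x. w : A ==> norm x < rho ==> x ~= w & Ga w x >= 1/2*Ga w 0"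
proof (cases "A = {}")
 case False
 have "open (- A)" using A compact_imp_closed by auto
 then obtain r where r: "r > 0" "cball 0 r <= - A" using A(2) open_contains_cball by blast
 have sy: "Ga 0 w = Ga w 0" if "w : A" for w using that A(2) by (intro G_sym) auto
 have "continuous_on A (Ga 0)" by (rule continuous_on_subset[OF G_cont]) (use A in auto)
 hence cA: "continuous_on A (%w. Ga w 0)" by (simp add: sy cong: continuous_on_cong)
 obtain w0 where w0: "w0 : A" "!!w. w : A ==> Ga w0 0 <= Ga w 0" using continuous_attains_inf[OF A(1) False cA] by blast
 have m: "Ga w0 0 > 0" using w0 A(2) by (intro G_pos) auto
 have "uniformly_continuous_on (A \<times> cball 0 r) (%(x, y). Ga x y)"
  by (rule compact_uniformly_continuous[OF continuous_on_subset[OF G_cont2] compact_Times[OF A(1) compact_cball]]) (use r in auto)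
 from this[unfolded uniformly_continuous_on_def, rule_format, of "Ga w0 0/2"] m
 obtain d where d: "d > 0" "!!p q. p : A \<times> cball 0 r ==> q : A \<times> cball 0 r ==> dist q p < d ==> dist (case q of (x, y) => Ga x y) (case p of (x, y) => Ga x y) < Ga w0 0/2"
  by (metis half_gt_zero)
 show thesis
 proof (rule that[of "min r d"])
  show "min r d > 0" using r d by simp
  fix w x :: "real^'n" assume w: "w : A" and x: "norm x < min r d"
  have "dist (Ga w x) (Ga w 0) < Ga w0 0/2"
   using d(2)[of "(w, 0)" "(w, x)"] w x r by (simp add: dist_Pair_Pair)
  moreover have "Ga w0 0 <= Ga w 0" by (rule w0(2)[OF w])
  moreover have "x ~= w"
  proof -
   have "x : cball 0 r" using x by simp
   thus ?thesis using r(2) w by blast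
  qed
  ultimately show "x ~= w & Ga w x >= 1/2*Ga w 0" unfolding dist_real_def by linarith
 qed
qed (auto intro: that[of 1])

lemma dilation_normalize:
 assumes "z ~= 0"
 obtains t w where "t > 0" "w ~= 0" "Ga 0 w = 1" "z = dilation sg t w" "t^(Q - 2)*Ga 0 z = 1"
proof -
 have G: "Ga 0 z > 0" using assms by (intro G_pos) auto
 define t where "t = root (Q - 2) (1/Ga 0 z)"
 have Q: "Q - 2 > 0" using Q3 by simp
 have t: "t > 0" using G Q by (simp add: t_def)
 have tp: "t^(Q - 2)*Ga 0 z = 1" using G Q by (simp add: t_def real_root_pow_pos)
 let ?w = "dilation sg (1/t) z"
 have z: "z = dilation sg t ?w" using t by (simp add: dilation_dilation)
 have w: "?w ~= 0" using z assms by (metis dilation_zero)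
 have "Ga 0 ?w = 1" using G_hom[of 0 ?w t] w t z tp by simp
 thus thesis using that t w z tp by blast
qed

text \<open>Scaling moves \<open>z\<close> to the compact level set \<open>Ga 0 w = 1\<close>. If
  \<open>z\<close> is far away, the same scaling moves \<open>x\<close> close to 0, where
  \<open>Ga w\<close> is at least half of \<open>Ga w 0\<close>, uniformly in
  \<open>w\<close>.\<close>

lemma far_ratio:
 "EX R. ALL z. norm z >= R --> z ~= 0 & z ~= x & Ga z x >= 1/2*Ga 0 z"
proof -
 let ?A = "{w. w ~= 0 & 1 <= Ga 0 w & Ga 0 w <= 1}"
 obtain rho where rho: "rho > 0" "!!w x. w : ?A ==> norm x < rho ==> x ~= w & Ga w x >= 1/2*Ga w 0"
  by (rule G_unif_at_0[of ?A]) (auto intro: compact_annulus that)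
 have "\<forall>\<^sub>F t in at_right 0. norm (dilation sg t x) < rho"
  using tendstoD[OF dilation_tendsto_0[where x=x, OF sig1] rho(1)] by simp
 then obtain b where b: "b > 0" "!!t. 0 < t ==> t < b ==> norm (dilation sg t x) < rho"
  unfolding eventually_at_right_field by auto
 have "\<forall>\<^sub>F z in at_infinity. Ga 0 z < b^(Q - 2)" by (rule order_tendstoD(2)[OF G_0]) (use b in simp)
 then obtain R where R: "!!z. norm z >= R ==> Ga 0 z < b^(Q - 2)" unfolding eventually_at_infinity by auto
 show ?thesis
 proof (intro exI[of _ "max R 1"] allI impI)
  fix z :: "real^'n" assume z: "max R 1 <= norm z"
  have z0: "z ~= 0" using z by auto
  obtain t w where t: "t > 0" "w ~= 0" "Ga 0 w = 1" "z = dilation sg t w" "t^(Q - 2)*Ga 0 z = 1"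
   by (rule dilation_normalize[OF z0]) (rule that)
  let ?x = "dilation sg (1/t) x"
  have "1/t < b"
  proof (rule ccontr)
   assume "~ 1/t < b"
   hence "b * t <= 1" using t(1) by (simp add: field_simps)
   hence "(b * t)^(Q - 2) <= 1" using b t by (intro power_le_one) auto
   hence "b^(Q - 2) * t^(Q - 2) <= t^(Q - 2)*Ga 0 z" using t(5) by (simp add: power_mult_distrib)
   hence "b^(Q - 2) <= Ga 0 z" using t(1) by (simp add: mult.commute)
   thus False using R[of z] z by simp
  qed
  hence "norm ?x < rho" using b t by simp
  hence w: "?x ~= w" "Ga w ?x >= 1/2*Ga w 0" using rho(2)[of w ?x] t by auto
  have x: "x = dilation sg t ?x" using t(1) by (simp add: dilation_dilation)
  have zx: "z ~= x"
  proof
   assume "z = x"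
   hence "?x = dilation sg (1/t) (dilation sg t w)" using t by simp
   thus False using w t(1) by (simp add: dilation_dilation)
  qed
  have "t^(Q - 2)*Ga z x = Ga w ?x" using G_hom[of w ?x t] w t x by metis
  also have "Ga w ?x >= 1/2*(t^(Q - 2)*Ga 0 z)" using w(2) t G_sym[of w 0] by simp
  finally have "t^(Q - 2)*(1/2*Ga 0 z) <= t^(Q - 2)*Ga z x" by simp
  hence "1/2*Ga 0 z <= Ga z x" using t(1) by (simp only: mult_le_cancel_left_pos zero_less_power)
  thus "z ~= 0 & z ~= x & Ga z x >= 1/2*Ga 0 z" using z0 zx by blast
 qed
qed

text \<open>The comparison takes place where \<open>Ga z < 2/r\<close>. The comparison function
  reaches 0 at the level \<open>2/r\<close>, inside the ball on which \<open>v\<close> vanishes; the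
  factor 2 separates this level from the boundary level \<open>1/r\<close> of the ball.\<close>

lemma zero_ball_bound:
 assumes v: "subharmonic_on L UNIV (%x. ereal (v x))" "!!x. x ~: Om ==> v x = 0" "!!x. v x <= S" "S > 0"
  and r: "r > 0" and ball: "Gamma_ball Ga z r <= - Om" and x: "v x > 0"
 shows "v x <= S*(1 - r/2*Ga z x)"
proof -
 let ?D = "{x. x ~= z & Ga z x < 2/r}"
 have z: "v y = 0" if "y = z | Ga z y > 1/r" for y using ball that v(2) unfolding Gamma_ball_eq[OF r] by blast
 have r2: "1/r < 2/r" using r by (simp add: divide_strict_right_mono)
 have xz: "x ~= z" "~ Ga z x > 1/r" using z[of x] x by auto
 have xD: "x : ?D" using xz r2 by simp
 have "(%x. ereal (v x)) x <= ereal (S+(- S*(r/2))*Ga z x+0*Ga z x)"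
 proof (rule comparison[OF v(1) open_G_less[of z "2/r"] _ harmonic_combination[OF open_G_less harmonic_G harmonic_G] _ xD])
  fix e :: real assume e: "e > 0"
  let ?g = "%x. S+(- S*(r/2))*Ga z x+0*Ga z x"
  let ?C = "{x. x ~= z & Ga z x <= 2/r}"
  let ?K = "{x:?C. ereal (?g x+e) <= ereal (v x)}"
  have opv: "open {x. ereal (v x) < c}" for c using usc_open[OF v(1) open_UNIV, of c] by simp
  have "closed ?K"
   by (rule usc_closed[OF opv _ closed_G_le]) (auto intro!: continuous_intros continuous_on_subset[OF G_cont])
  moreover have "bounded ?K"
  proof (rule bounded_subset[OF bounded_G_ge[of "e/(S*r)" z]])
   show "e/(S*r) > 0" using e v(4) r by simp
   show "?K <= {x. e/(S*r) <= Ga z x}"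
   proof
    fix y assume "y : ?K"
    hence "S - S*(r/2)*Ga z y+e <= S" using v(3)[of y] by simp
    hence "e <= (S*r)*Ga z y/2" by simp
    hence "e <= (S*r)*Ga z y" using e by linarith
    thus "y : {x. e/(S*r) <= Ga z x}" using v(4) r by (simp add: pos_divide_le_eq mult.commute)
   qed
  qed
  ultimately have "compact ?K" by (simp add: compact_eq_bounded_closed)
  moreover have "?K <= ?D"
  proof
   fix y assume y: "y : ?K"
   have "Ga z y ~= 2/r"
   proof
    assume a: "Ga z y = 2/r"
    hence "v y = 0" using z r2 by simp
    thus False using y a e r by simp
   qed
   thus "y : ?D" using y by auto
  qed
  ultimately show "EX K. compact K & K <= ?D & (ALL x:?D - K. ereal (v x) <= ereal (?g x+e))"
   by (intro exI[of _ ?K]) auto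
 qed auto
 thus ?thesis by (simp add: algebra_simps)
qed

lemma cone_mps:
 assumes O: "open Om" and K: "K <= - Om" "Gamma_cone Ga K"
 shows "maximum_principle_set L Om"
proof (rule ccontr)
 assume "~ maximum_principle_set L Om"
 then obtain v :: "real^'n => real" and S where v: "subharmonic_on L UNIV (%x. ereal (v x))" "!!x. x ~: Om ==> v x = 0"
  "!!x. 0 <= v x" "!!x. v x <= S" "S > 0" "!!c. c < S ==> EX x. v x > c"
  by (rule not_mps[OF O]) (rule that)
 obtain z :: "nat => real^'n" and R where R: "!!j. R j > 0" "!!j. Gamma_ball Ga (z j) (R j) <= K"
  and z: "filterlim (%j. norm (z j)) at_top sequentially" and li: "liminf (%j. ereal (R j/quasi_dist Ga 0 (z j))) > 0"
  using K(2) unfolding Gamma_cone_def by blast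
 obtain c where c: "0 < ereal c" "ereal c < liminf (%j. ereal (R j/quasi_dist Ga 0 (z j)))" using ereal_dense2[OF li] by blast
 have ev: "\<forall>\<^sub>F j in sequentially. ereal c < ereal (R j/quasi_dist Ga 0 (z j))" by (rule less_LiminfD[OF c(2)])
 have c0: "c > 0" using c(1) by simp
 \<comment> \<open>The 4 is the product of the halves in \<open>zero_ball_bound\<close> and
   \<open>far_ratio\<close>.\<close>
 have "max 0 (S*(1 - c/4)) < S" using v(5) c0 by simp
 from v(6)[OF this] obtain x where x: "v x > 0" "v x > S*(1 - c/4)" by auto
 obtain T where T: "!!z. norm z >= T ==> z ~= 0 & z ~= x & Ga z x >= 1/2*Ga 0 z" using far_ratio[of x] by blast
 have "\<forall>\<^sub>F j in sequentially. norm (z j) >= T" using z by (simp add: filterlim_at_top)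
 with ev have "\<forall>\<^sub>F j in sequentially. norm (z j) >= T & c < R j/quasi_dist Ga 0 (z j)" by eventually_elim simp
 then obtain j where j: "norm (z j) >= T" "c < R j/quasi_dist Ga 0 (z j)" using eventually_happens[of _ sequentially] by auto
 have "c < R j*Ga 0 (z j)" using j(2) T[OF j(1)] by (auto simp: quasi_dist_def)
 moreover have "R j*Ga (z j) x >= R j*(1/2*Ga 0 (z j))" using T[OF j(1)] R(1)[of j] by (intro mult_left_mono) auto
 ultimately have "R j/2*Ga (z j) x >= c/4" by simp
 hence "S*(1 - R j/2*Ga (z j) x) <= S*(1 - c/4)" using v(5) by (intro mult_left_mono) auto
 moreover have "v x <= S*(1 - R j/2*Ga (z j) x)"
  by (rule zero_ball_bound[OF v(1,2,4,5) R(1) _ x(1)]) (use R(2)[of j] K(1) in auto)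
 ultimately show False using x(2) by linarith
qed

end

section \<open>Stability of the balls\<close>

text \<open>Joint smoothness in both variables will make bounds on derivatives in the second one
  uniform over compact sets of poles.\<close>

lemma smooth_slice_vf:
 fixes F :: "(real^'n::finite) \<times> (real^'n) => real"
 assumes S: "open S" and F: "smooth_on S F" and Z: "svf Z"
 shows "smooth_on S (%z. vf_apply Z (%y. F (fst z, y)) (snd z))"
proof (rule smooth_on_cong[OF S])
 have "smooth_on S (%z. Z (snd z) $ i)" for i
 proof -
  have D: "(snd has_derivative snd) (at z)" for z :: "(real^'n) \<times> (real^'n)"
   by (rule bounded_linear_imp_has_derivative[OF bounded_linear_snd])
  show ?thesis by (rule smooth_on_affine[OF S open_UNIV _ D]) (use Z in "auto simp: svf_def")
 qed
 moreover have "smooth_on S (pd (0, axis i 1) F)" for i by (rule smooth_on_pd[OF F]) (simp add: Basis_prod_def)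
 ultimately show "smooth_on S (%z. SUM i:UNIV. Z (snd z) $ i * pd (0, axis i 1) F z)"
  by (intro smooth_on_sum smooth_on_mult S)
 fix z assume z: "z : S"
 let ?D = "frechet_derivative F (at z)"
 have DF: "(F has_derivative ?D) (at (fst z, snd z))" using has_derivative_frechet[OF F S z] by simp
 have "((%y. (fst z, y)) has_derivative (%v. (0, v))) (at (snd z))" by (auto intro!: derivative_eq_intros)
 from has_derivative_compose[OF this DF] have sl: "((%y. F (fst z, y)) has_derivative (%v. ?D (0, v))) (at (snd z))" .
 have "(SUM i:UNIV. Z (snd z) $ i * pd (0, axis i 1) F z) = vf_apply Z (%y. F (fst z, y)) (snd z)"
  using vf_apply_pd[OF differentiableI[OF sl], of Z] by (simp add: pd_eq[OF sl]) (simp add: pd_def)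
 thus "(SUM i:UNIV. Z (snd z) $ i * pd (0, axis i 1) F z) = vf_apply Z (%y. F (fst z, y)) (snd z)" .
qed

lemma vf_apply_chain:
 fixes f :: "real^'n::finite => real"
 assumes f: "f differentiable (at x)" and P: "(P has_real_derivative P') (at (f x))"
 shows "vf_apply Z (%x. P (f x)) x = P' * vf_apply Z f x"
proof -
 have "((%x. P (f x)) has_derivative (%v. P'*frechet_derivative f (at x) v)) (at x)"
  using has_derivative_compose[OF f[unfolded frechet_derivative_works] P[unfolded has_field_derivative_def]] .
 thus ?thesis by (simp add: vf_apply_def frechet_derivative_eq)
qed

text \<open>A concave truncation, the identity up to 1 and constant from 2 on. By
  \<open>L_chain\<close>, concavity gives \<open>L\<close> of a truncated harmonic function the sign
  of a superharmonic one.\<close>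

lemma trunc_exists:
 obtains P s w :: "real => real" and k
 where "smooth_on UNIV P" "!!t. (P has_real_derivative s t) (at t)" "!!t. (s has_real_derivative - w t) (at t)"
  "!!t. w t >= 0" "!!t. t > 2 ==> w t = 0" "!!t. t <= 1 ==> P t = t" "!!t. P t <= t" "!!t. t >= 2 ==> P t = k" "1 <= k" "k <= 2" "!!t. P t <= 2"
  "smooth_on UNIV s" "smooth_on UNIV w" "!!t. t >= 0 ==> P t >= 0"
proof -
 obtain s w :: "real => real"
 where s: "smooth_on UNIV s" "!!t. t <= 1 ==> s t = 1" "!!t. t >= 2 ==> s t = 0"
  "!!t. 0 <= s t" "!!t. s t <= 1" "!!t. (s has_real_derivative - w t) (at t)" "!!t. w t >= 0"
  "smooth_on UNIV w" by (rule smooth_step_exists) (rule that)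
 have Dsh: "((%t::real. t + c) has_derivative (%v. v)) (at t)" for c t by (auto intro!: derivative_eq_intros)
 have s1: "smooth_on UNIV (%t. 1 - s (t+1))"
  by (intro smooth_on_diff smooth_on_const open_UNIV smooth_on_affine[OF open_UNIV open_UNIV _ Dsh s(1)]) auto
 obtain W where W: "!!t. (W has_real_derivative (1 - s (t+1))) (at t)" "smooth_on UNIV W" "!!t. t <= 0 ==> W t = 0"
  by (rule smooth_antiderivative[OF s1]) (use s(2) that in auto)
 define P where "P t = t - W (t+(-1))" for t
 have sP: "smooth_on UNIV P"
  unfolding P_def by (intro smooth_on_diff open_UNIV smooth_on_affine[OF open_UNIV open_UNIV _ Dsh W(2)] smooth_on_linear bounded_linear_ident) auto
 have dP: "(P has_real_derivative s t) (at t)" for t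
 proof -
  have "((%t. W (t+(-1))) has_real_derivative (1 - s (t+(-1)+1))) (at t)"
   using DERIV_shift[of W "1 - s (t+(-1)+1)" t "-1"] W(1)[of "t+(-1)"] by simp
  hence "(P has_real_derivative (1 - (1 - s (t+(-1)+1)))) (at t)" unfolding P_def by (intro DERIV_diff DERIV_ident)
  thus ?thesis by simp
 qed
 have Wpos: "W t >= 0" for t
 proof (cases "t <= 0")
  case False
  have "W 0 <= W t" by (rule DERIV_nonneg_imp_nondecreasing[of 0 t W]) (use False W(1) s(5) in "auto intro!: exI simp: le_diff_eq")
  thus ?thesis using W(3)[of 0] by simp
 qed (simp add: W)
 have mono: "P a <= P b" if "a <= b" for a b
  by (rule DERIV_nonneg_imp_nondecreasing[OF that]) (use dP s(4) in blast)
 have P1: "P t = t" if "t <= 1" for t using that W(3) by (simp add: P_def)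
 have Pt: "P t <= t" for t using Wpos by (simp add: P_def)
 have P2: "P t = P 2" if "t >= 2" for t
 proof (cases "t = 2")
  case False
  hence "2 < t" using that by simp
  from MVT2[OF this, of P s] dP obtain z where "2 < z" "P t - P 2 = (t - 2) * s z" by auto
  thus ?thesis using s(3)[of z] by simp
 qed simp
 show thesis
 proof (rule that[of P s w "P 2"])
  show "w t = 0" if "t > 2" for t
  proof -
   have "(s has_real_derivative 0) (at t)"
   proof (rule has_field_derivative_transform_within_open[of "%_. 0" 0 t "{2<..}"])
    show "0 = s z" if "z : {2<..}" for z using s(3)[of z] that by simp
   qed (use that in auto)
   from DERIV_unique[OF s(6)[of t] this] show ?thesis by simp
  qed
  show "1 <= P 2" using mono[of 1 2] P1[of 1] by simp
  show "P 2 <= 2" by (rule Pt)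
  show "P t <= 2" for t using Pt[of t] P2[of t] Pt[of 2] by (cases "t >= 2") auto
  show "P t >= 0" if "t >= 0" for t using mono[OF that] P1[of 0] by simp
  show "smooth_on UNIV P" "smooth_on UNIV s" "smooth_on UNIV w" by (rule sP s)+
  show "(P has_real_derivative s t) (at t)" "(s has_real_derivative - w t) (at t)" "w t >= 0" "P t <= t" for t
   by (rule dP s Pt)+
  show "P t = t" if "t <= 1" for t by (rule P1[OF that])
  show "P t = P 2" if "t >= 2" for t by (rule P2[OF that])
 qed
qed

context hvf begin

lemma smooth_slice_L:
 fixes F :: "(real^'n) \<times> (real^'n) => real"
 assumes S: "open S" and F: "smooth_on S F"
 shows "smooth_on S (%z. L (%y. F (fst z, y)) (snd z))"
proof -
 have "smooth_on S (%z. XX j (XX j (%y. F (fst z, y))) (snd z))" if "j : {1..m}" for j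
  using smooth_slice_vf[OF S smooth_slice_vf[OF S F svfX[OF that]] svfX[OF that]] by simp
 thus ?thesis unfolding sum_of_squares_def by (intro smooth_on_sum S)
qed

lemma L_chain:
 assumes S: "open S" "x : S" and f: "smooth_on S f" and P: "!!t. (P has_real_derivative P1 t) (at t)" "!!t. (P1 has_real_derivative P2 t) (at t)"
  and Lf: "L f x = 0"
 shows "L (%x. P (f x)) x = P2 (f x)*(SUM j=1..m. (XX j f x)^2)"
proof -
 have "XX j (XX j (%x. P (f x))) x = P1 (f x)*XX j (XX j f) x+P2 (f x)*(XX j f x)^2" if j: "j : {1..m}" for j
 proof -
  have d: "f differentiable (at y)" if "y : S" for y by (rule smooth_on_differentiable_at[OF f S(1) that])
  have d1: "(%y. P1 (f y)) differentiable (at x)"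
  proof -
   have "((%x. P1 (f x)) has_derivative (%v. P2 (f x)*frechet_derivative f (at x) v)) (at x)"
    using has_derivative_compose[OF d[OF S(2), unfolded frechet_derivative_works] P(2)[of "f x", unfolded has_field_derivative_def]] .
   thus ?thesis by (rule differentiableI)
  qed
  have d2: "XX j f differentiable (at x)" by (rule smooth_on_differentiable_at[OF smooth_vf_apply[OF svfX[OF j] S(1) f] S])
  have "XX j (XX j (%x. P (f x))) x = XX j (%x. P1 (f x)*XX j f x) x"
   by (rule vf_apply_cong_open[OF S]) (rule vf_apply_chain[OF d P(1)])
  also have "... = P1 (f x)*XX j (XX j f) x+XX j (%x. P1 (f x)) x*XX j f x"
   by (rule vf_apply_mult[OF d1 d2])
  finally show ?thesis by (simp add: vf_apply_chain[OF d[OF S(2)] P(2)] power2_eq_square)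
 qed
 hence "L (%x. P (f x)) x = P1 (f x)*L f x+P2 (f x)*(SUM j=1..m. (XX j f x)^2)"
  by (simp add: sum_of_squares_def sum.distrib sum_distrib_left)
 thus ?thesis using Lf by simp
qed

text \<open>Second derivatives of the cutoff give \<open>r^-2\<close>; as \<open>r <= 1\<close>, the
  first-order terms are no worse.\<close>

lemma L_cutoff_bound:
 obtains B where "B > 0" "!!x r y. norm x <= R ==> 0 < r ==> r <= 1 ==> \<bar>L (cutoff x r) y\<bar> <= B/r^2"
  "!!x r y. 0 < r ==> dist x y > 3/2*r ==> L (cutoff x r) y = 0"
proof -
 have zero: "L (cutoff x r) y = 0" if "0 < r" "dist x y > 3/2*r" for x r y
 proof -
  have "L (cutoff x r) y = L (%_. 0) y"
   by (rule L_cong_open[of "{y. dist x y > 3/2*r}"]) (use that cutoff(4)[of r x] in "auto intro!: open_Collect_less continuous_intros")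
  thus ?thesis by simp
 qed
 have bX: "EX b. b > 0 & (ALL x. norm x <= R+2 --> \<bar>f x\<bar> <= b)" if "f : polyf" for f :: "real^'n => real"
  using polyf_bounded[OF that, of "R+2"] by metis
 have bc: "EX b. b > 0 & (ALL x. abs (f x) <= b)" if "csm f" for f :: "real^'n => real"
  using csm_bounded[OF that] by metis
 define c1 where "c1 k = (SOME b. b > 0 & (ALL x. abs (pdi k cut0 x) <= b))" for k :: 'n
 define c2 where "c2 i k = (SOME b. b > 0 & (ALL x. abs (pdi i (pdi k cut0) x) <= b))" for i k :: 'n
 define a where "a j i = (SOME b. b > 0 & (ALL x. norm x <= R+2 --> \<bar>X j x $ i\<bar> <= b))" for j i
 define d where "d j i = (SOME b. b > 0 & (ALL x. norm x <= R+2 --> \<bar>XX j (%x. X j x $ i) x\<bar> <= b))" for j i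
 have c1: "c1 k > 0 & (ALL x. abs (pdi k cut0 x) <= c1 k)" for k
  unfolding c1_def by (rule someI_ex[OF bc[OF csm_pd[OF cut0(1) axis_Basis]]])
 have c2: "c2 i k > 0 & (ALL x. abs (pdi i (pdi k cut0) x) <= c2 i k)" for i k
  unfolding c2_def by (rule someI_ex[OF bc[OF csm_pd[OF csm_pd[OF cut0(1) axis_Basis] axis_Basis]]])
 have pX: "(%x. X j x $ i) : polyf" if "j : {1..m}" for j i using pvfX[OF that] by (simp add: pvf_def)
 have a: "a j i > 0 & (ALL x. norm x <= R+2 --> \<bar>X j x $ i\<bar> <= a j i)" if "j : {1..m}" for j i
  unfolding a_def by (rule someI_ex[OF bX[OF pX[OF that]]])
 have d: "d j i > 0 & (ALL x. norm x <= R+2 --> \<bar>XX j (%x. X j x $ i) x\<bar> <= d j i)" if "j : {1..m}" for j i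
  unfolding d_def by (rule someI_ex[OF bX[OF polyf_vf_apply[OF pvfX[OF that] pX[OF that]]]])
 define B where "B = (SUM j=1..m. SUM i:UNIV. a j i*(SUM k:UNIV. a j k * c2 k i)+d j i * c1 i)+1"
 have Bn: "(SUM j=1..m. SUM i:UNIV. a j i*(SUM k:UNIV. a j k * c2 k i)+d j i * c1 i) >= 0"
  using a d c1 c2 by (intro sum_nonneg add_nonneg_nonneg mult_nonneg_nonneg) (auto intro: less_imp_le)
 show thesis
 proof (rule that[of B])
  show "B > 0" using Bn by (simp add: B_def)
  show "L (cutoff x r) y = 0" if "0 < r" "dist x y > 3/2*r" for x y :: "real^'n" and r using zero[OF that] .
  fix x y :: "real^'n" and r assume x: "norm x <= R" and r: "0 < r" "r <= (1::real)"
  show "abs (L (cutoff x r) y) <= B/r^2"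
  proof (cases "dist x y > 3/2*r")
   case True
   thus ?thesis using zero[OF r(1) True] Bn r by (simp add: B_def)
  next
   case False
   have "norm y <= norm x+dist x y" using norm_triangle_sub[of y x] by (simp add: dist_norm norm_minus_commute)
   hence y: "norm y <= R+2" using x False r by linarith
   let ?c = "cutoff x r" and ?z = "(1/r) *\<^sub>R (y - x)"
   have sc: "smooth_on UNIV ?c" by (rule csm_smooth[OF csm_cutoff[OF r(1)]])
   have r1: "1/r <= 1/r^2" using r by (simp add: field_simps power2_eq_square)
   have "abs (XX j (XX j ?c) y) <= (SUM i:UNIV. (a j i*(SUM k:UNIV. a j k * c2 k i)+d j i * c1 i)/r^2)" if j: "j : {1..m}" for j
   proof -
    have sp: "smooth_on UNIV (pdi i ?c)" for i by (rule smooth_on_pd[OF sc axis_Basis])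
    have "XX j (XX j ?c) y = (SUM i:UNIV. XX j (%y. X j y $ i * pdi i ?c y) y)"
    unfolding vf_apply_pd_UNIV[OF sc, of "X j"]
    by (rule vf_apply_sum) (rule differentiable_UNIV[OF smooth_on_mult[OF open_UNIV polyf_smooth[OF pX[OF j]] sp]])
    also have "... = (SUM i:UNIV. X j y $ i*XX j (pdi i ?c) y+XX j (%x. X j x $ i) y * pdi i ?c y)"
    by (intro sum.cong refl vf_apply_mult differentiable_UNIV polyf_smooth[OF pX[OF j]] sp)
    also have "abs (...) <= (SUM i:UNIV. (a j i*(SUM k:UNIV. a j k * c2 k i)+d j i * c1 i)/r^2)"
    proof (rule order_trans[OF sum_abs], rule sum_mono)
    fix i
    have p2: "abs (pdi k (pdi i ?c) y) <= c2 k i/r^2" for k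
    proof -
    have "abs (pdi k (pdi i ?c) y) = (1/r)^2*abs (pdi k (pdi i cut0) ?z)" by (simp add: pd_pd_cutoff abs_mult)
    also have "... <= (1/r)^2 * c2 k i" using c2[of k i] by (intro mult_left_mono) auto
    finally show ?thesis by (simp add: power_divide)
    qed
    have "abs (XX j (pdi i ?c) y) <= (SUM k:UNIV. a j k*(c2 k i/r^2))"
    unfolding vf_apply_pd_UNIV[OF sp]
    proof (rule order_trans[OF sum_abs], rule sum_mono)
    fix k
    show "abs (X j y $ k * pdi k (pdi i ?c) y) <= a j k*(c2 k i/r^2)"
    unfolding abs_mult by (rule mult_mono) (use a[OF j] y p2 in "auto intro: less_imp_le")
    qed
    hence q1: "abs (X j y $ i*XX j (pdi i ?c) y) <= a j i*((SUM k:UNIV. a j k * c2 k i)/r^2)"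
    unfolding abs_mult using a[OF j] y by (intro mult_mono) (auto simp: sum_divide_distrib intro: less_imp_le)
    have "abs (pdi i ?c y) = (1/r)*abs (pdi i cut0 ?z)" using r by (simp add: pd_cutoff abs_mult)
    also have "... <= (1/r^2) * c1 i" using c1[of i] r1 r by (intro mult_mono) auto
    finally have "abs (pdi i ?c y) <= c1 i/r^2" by simp
    hence q2: "abs (XX j (%x. X j x $ i) y * pdi i ?c y) <= d j i*(c1 i/r^2)"
    unfolding abs_mult using d[OF j] y by (intro mult_mono) (auto intro: less_imp_le)
    show "abs (X j y $ i*XX j (pdi i ?c) y+XX j (%x. X j x $ i) y * pdi i ?c y)
    <= (a j i*(SUM k:UNIV. a j k * c2 k i)+d j i * c1 i)/r^2"
    using q1 q2 by (simp add: add_divide_distrib)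
    qed
    finally show ?thesis .
   qed
   hence "abs (L ?c y) <= (SUM j=1..m. SUM i:UNIV. (a j i*(SUM k:UNIV. a j k * c2 k i)+d j i * c1 i)/r^2)"
    unfolding sum_of_squares_def by (intro order_trans[OF sum_abs] sum_mono)
   also have "... <= B/r^2" unfolding sum_divide_distrib[symmetric] B_def by (intro divide_right_mono) auto
   finally show ?thesis .
  qed
 qed
qed

end

section \<open>The fundamental solution near the diagonal\<close>

context fund begin

lemma G_bound_off_diag:
 assumes C: "compact C" "C <= {(x, y). x ~= y}" and F: "continuous_on {(x, y). x ~= y} F"
 shows "EX B>0. ALL z:C. abs (F z :: real) <= B"
proof -
 have "compact (F ` C)" by (rule compact_continuous_image[OF continuous_on_subset[OF F C(2)] C(1)])
 then obtain B where "B > 0" "ALL z:F ` C. norm z <= B" using compact_imp_bounded bounded_pos by blast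
 thus ?thesis by auto
qed

lemma compact_shell: "compact (cball (0::real^'n) R \<times> (cball (0::real^'n) b - ball 0 a))"
 by (intro compact_Times compact_diff) auto

lemma G_int_ball: "integrable lborel (%y. indicator (ball 0 r) y*abs (Ga x y))"
proof -
 have "integrable lborel (%y. Ga x y*indicator (ball 0 r) y)"
  by (rule G_integrable[of _ 1 r]) (auto simp: indicator_def intro!: borel_measurable_indicator)
 hence "integrable lborel (%y. abs (Ga x y*indicator (ball 0 r) y))" by (rule Bochner_Integration.integrable_abs)
 thus ?thesis by (simp add: abs_mult mult.commute)
qed

text \<open>The representation formula is tested with a cutoff of the square of
  \<open>y $ i0\<close>. Where the cutoff is 1, \<open>L phi\<close> is the constant
  \<open>2 * c0\<close>, so the integral of \<open>Ga x\<close> appears; in the shell where the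
  cutoff varies the pole is far away and all terms are bounded.\<close>

lemma G_L1:
 assumes R: "R >= 0"
 obtains B where "B > 0" "!!x. norm x <= R ==> (LINT y|lborel. indicator (ball 0 (R+2)) y*abs (Ga x y)) <= B"
proof -
 let ?R3 = "3/2*(R+2)"
 have "EX B>0. ALL z:cball (0::real^'n) R \<times> (cball (0::real^'n) ?R3 - ball 0 (R+1)). abs ((%(x, y). Ga x y) z) <= B"
  by (rule G_bound_off_diag[OF compact_shell _ G_cont2]) (auto simp: not_less)
 then obtain M0 where M0: "M0 > 0" "!!x y. norm x <= R ==> norm y <= ?R3 ==> R+1 <= norm y ==> \<bar>Ga x y\<bar> <= M0" by auto
 let ?c = "cutoff (0::real^'n) (R+2)"
 have r: "R+2 > 0" using R by simp
 define phi where "phi y = ?c y*(y $ i0*y $ i0)" for y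
 have sq: "smooth_on UNIV (%y::real^'n. y $ i0*y $ i0)" by (intro smooth_on_mult open_UNIV smooth_coord)
 have phi: "csm phi" unfolding phi_def by (rule csm_mult_right[OF csm_cutoff[OF r] sq])
 obtain B1 where B1: "B1 > 0" "!!y. abs (L phi y) <= B1" by (rule csm_bounded[OF csm_L[OF phi]]) (rule that)
 have L1: "L phi y = 2 * c0" if "norm y < R+2" for y
 proof -
  have "L phi y = L (%y. y $ i0*y $ i0) y"
   by (rule L_cong_open[of "ball 0 (R+2)"]) (use that cutoff(3)[OF r, of "0::real^'n"] in "auto simp: phi_def less_imp_le")
  thus ?thesis by (simp add: L_x0_sq)
 qed
 have L2: "L phi y = 0" if "norm y > ?R3" for y
 proof -
  have "L phi y = L (%_. 0) y"
   by (rule L_cong_open[of "{y. norm y > ?R3}"]) (use that cutoff(4)[OF r, of "0::real^'n"] in "auto simp: phi_def intro!: open_Collect_less continuous_intros")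
  thus ?thesis by simp
 qed
 let ?V = "LINT y|lborel. indicator (ball (0::real^'n) (?R3+1)) y*(1::real)"
 have iV: "integrable lborel (%y. indicator (ball (0::real^'n) (?R3+1)) y*(1::real))"
  by (rule integrable_indicator_cont) auto
 have V: "?V >= 0" by (rule int_nonneg) auto
 show thesis
 proof (rule that[of "M0*B1*?V/(2 * c0)+1"])
  show "M0*B1*?V/(2 * c0)+1 > 0" using M0 B1 V c0_pos by (intro add_nonneg_pos) auto
  fix x :: "real^'n" assume x: "norm x <= R"
  have "2 * c0*(LINT y|lborel. indicator (ball 0 (R+2)) y*abs (Ga x y)) = (LINT y|lborel. 2 * c0*(indicator (ball 0 (R+2)) y*abs (Ga x y)))" by simp
  also have "... <= (LINT y|lborel. Ga x y*L phi y+M0*B1*(indicator (ball 0 (?R3+1)) y*1))"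
  proof (rule integral_mono_AE)
   show "integrable lborel (%y. 2 * c0*(indicator (ball 0 (R+2)) y*abs (Ga x y)))" by (rule integrable_mult_right[OF G_int_ball])
   show "integrable lborel (%y. Ga x y*L phi y+M0*B1*(indicator (ball 0 (?R3+1)) y*1))"
    by (intro intb_add integrable_mult_right iV G_integrable_csm csm_L phi)
   show "AE y in lborel. 2 * c0*(indicator (ball 0 (R+2)) y*abs (Ga x y)) <= Ga x y*L phi y+M0*B1*(indicator (ball 0 (?R3+1)) y*1)"
    using AE_lborel_singleton[of x]
   proof eventually_elim
    fix y assume "y ~= x"
    hence G: "Ga x y > 0" by (intro G_pos) auto
    consider "norm y < R+2" | "norm y >= R+2" "norm y <= ?R3" | "norm y > ?R3" by linarith
    thus "2 * c0*(indicator (ball 0 (R+2)) y*abs (Ga x y)) <= Ga x y*L phi y+M0*B1*(indicator (ball 0 (?R3+1)) y*1)"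
    proof cases
    case 1
    thus ?thesis using G L1[OF 1] M0 B1 by simp
    next
    case 2
    have "abs (Ga x y*L phi y) <= M0*B1" unfolding abs_mult using 2 M0 B1 x by (intro mult_mono) auto
    moreover have "indicator (ball 0 (?R3+1)) y = (1::real)" "indicator (ball 0 (R+2)) y = (0::real)"
    using 2 by (auto simp: indicator_def field_simps)
    ultimately show ?thesis by (simp only: mult_zero_left mult_zero_right mult_1_right)
    next
    case 3
    thus ?thesis using L2[OF 3] M0 B1 R by (simp add: indicator_def)
    qed
   qed
  qed
  also have "... = - phi x+M0*B1*?V"
   using G_rep[OF phi, of x] iV by (subst int_add) (auto intro: G_integrable_csm csm_L phi)
  also have "... <= M0*B1*?V" using cutoff(1)[OF r, of 0 x] by (simp add: phi_def)
  finally have "(LINT y|lborel. indicator (ball 0 (R+2)) y*abs (Ga x y)) <= M0*B1*?V/(2 * c0)"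
   using c0_pos by (simp add: pos_le_divide_eq mult.commute)
  thus "(LINT y|lborel. indicator (ball 0 (R+2)) y*abs (Ga x y)) <= M0*B1*?V/(2 * c0)+1" by simp
 qed
qed

text \<open>This is \<open>harmonic_lipschitz\<close> about \<open>x\<close> with radius
  \<open>r/2\<close>, for \<open>Ga y\<close> times a cutoff that removes the pole;
  \<open>G_L1\<close> bounds the mass uniformly in \<open>y\<close>.\<close>

lemma G_lipschitz:
 assumes R: "R >= 0"
 obtains q C D where "0 < q" "q <= 1/4" "0 <= C" "!!x y x' r. norm x <= R ==> norm y <= R ==> 0 < r ==> r <= 1 ==> r <= dist x y ==>
  dist x x' < q*r ==> \<bar>Ga y x - Ga y x'\<bar> <= C*(1/r)^D*dist x x'"
proof -
 obtain B where B: "B > 0" "!!x. norm x <= R ==> (LINT y|lborel. indicator (ball 0 (R+2)) y*abs (Ga x y)) <= B"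
  by (rule G_L1[OF R]) (rule that)
 obtain q C D where h: "0 < q" "q <= 1/4" "0 <= C" "!!y r u x x'. norm y <= R ==> 0 < r ==> r <= 1 ==> smooth_on UNIV u ==>
  (ALL x. dist y x < r --> L u x = 0) ==> dist y x < q*r ==> dist y x' < q*r ==>
  abs (u x - u x') <= C*(1/r)^D*mass y r u*dist x x'" by (rule harmonic_lipschitz[of R]) (rule that)
 show thesis
 proof (rule that[of "q/2" "C*2^D*B" D])
  show "0 < q/2" "q/2 <= 1/4" "0 <= C*2^D*B" using h B by auto
  fix x y x' :: "real^'n" and r :: real
  assume x: "norm x <= R" and y: "norm y <= R" and r: "0 < r" "r <= 1" and xy: "r <= dist x y" and x': "dist x x' < q/2*r"
  let ?c = "cutoff x (r/2)"
  have r2: "r/2 > 0" "r/2 <= 1" using r by auto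
  define u where "u z = ?c z*Ga y z" for z
  have su: "smooth_on UNIV u"
   unfolding u_def
  proof (rule smooth_on_cut_mult[OF _ _ smooth_G[of y], of _ "cball x (3/4*r)"])
   show "smooth_on UNIV ?c" by (rule csm_smooth[OF csm_cutoff[OF r2(1)]])
   show "cball x (3/4*r) <= - {y}" using r xy by auto
   show "?c z = 0" if "z ~: cball x (3/4*r)" for z using that cutoff(4)[OF r2(1), of x z] by simp
  qed auto
  have uG: "u z = Ga y z" if "dist x z < r/2" for z using cutoff(3)[OF r2(1), of x z] that by (simp add: u_def)
  have Lu: "ALL z. dist x z < r/2 --> L u z = 0"
  proof (intro allI impI)
   fix z assume z: "dist x z < r/2"
   have "L u z = L (Ga y) z" by (rule L_cong_open[of "ball x (r/2)"]) (use z uG in auto)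
   also have "... = 0" by (rule LG) (use z xy r in auto)
   finally show "L u z = 0" .
  qed
  have m: "mass x (r/2) u <= B"
  proof -
   have "mass x (r/2) u <= (LINT z|lborel. indicator (ball 0 (R+2)) z*abs (Ga y z))"
    unfolding mass_def
   proof (rule integral_mono[OF mass_integrable[OF smooth_on_continuous[OF su]] G_int_ball])
    fix z
    show "indicator (ball x (r/2)) z*abs (u z) <= indicator (ball 0 (R+2)) z*abs (Ga y z)"
    proof (cases "dist x z < r/2")
    case True
    have "norm z <= norm x+dist x z" using norm_triangle_sub[of z x] by (simp add: dist_norm norm_minus_commute)
    hence "norm z < R+2" using x True r by linarith
    thus ?thesis using True uG by simp
    qed simp
   qed
   also have "... <= B" by (rule B(2)[OF y])
   finally show ?thesis .
  qed
  have qr: "q*(r/2) <= r/2" "0 < q*(r/2)" using h r by auto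
  have d: "dist x x < q*(r/2)" "dist x x' < q*(r/2)" using x' qr by auto
  have "abs (Ga y x - Ga y x') = abs (u x - u x')" using uG[of x] uG[of x'] d qr by simp
  also have "... <= C*(1/(r/2))^D*mass x (r/2) u*dist x x'" by (rule h(4)[OF x r2 su Lu d])
  also have "... <= C*(1/(r/2))^D*B*dist x x'" using h r m by (intro mult_right_mono mult_left_mono) auto
  also have "... = C*2^D*B*(1/r)^D*dist x x'" by (simp add: power_divide)
  finally show "abs (Ga y x - Ga y x') <= C*2^D*B*(1/r)^D*dist x x'" .
 qed
qed

lemma smooth_OFF_mult:
 assumes c: "smooth_on UNIV c"
 shows "smooth_on {(x::real^'n, y). x ~= y} (%z. c (snd z)*(%(x, y). Ga x y) z)"
proof (rule smooth_on_mult[OF open_neq _ G_smooth2])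
 have D: "(snd has_derivative snd) (at z)" for z :: "(real^'n) \<times> (real^'n)"
  by (rule bounded_linear_imp_has_derivative[OF bounded_linear_snd])
 show "smooth_on {(x::real^'n, y). x ~= y} (%z. c (snd z))"
  by (rule smooth_on_affine[OF open_neq open_UNIV _ D c]) auto
qed

text \<open>A capacity argument. With \<open>Ga x\<close> truncated at a height of order
  \<open>M\<close> and \<open>F\<close> equal to minus \<open>L\<close> of the result
  \<open>th\<close>, the drop \<open>th x - th z\<close> is the integral of
  \<open>(Ga x - Ga z) F\<close>. At distance at least \<open>rho\<close> from \<open>x\<close> the
  kernels differ by at most 1, by the Lipschitz bound; closer to \<open>x\<close> the kernel is at
  most \<open>2*M\<close> on the support of \<open>F\<close>, whose mass there is at most 1/8. So
  the drop is at most \<open>M/2\<close>.\<close>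

lemma near_diag:
 assumes R: "R >= 0"
 obtains c rho0 and D :: nat where "c > 0" "rho0 > 0" "rho0 <= 1"
  "!!x z rho. norm x <= R ==> norm z <= R ==> 0 < rho ==> rho <= rho0 ==> x ~= z ==> dist x z <= rho^D ==> Ga x z >= c/rho"
proof -
 let ?N = "CARD('n)"
 define R3 where "R3 = 3/2*(R+2)"
 have R3: "R+2 < R3" using R by (simp add: R3_def)
 let ?c = "cutoff (0::real^'n) (R+2)"
 have R2: "R+2 > 0" using R by simp
 have cc: "csm ?c" by (rule csm_cutoff[OF R2])
 have sc: "smooth_on UNIV ?c" by (rule csm_smooth[OF cc])
 have sh: "cball (0::real^'n) R \<times> (cball 0 (R3+1) - ball 0 (R+1)) <= {(x, y). x ~= y}" by (auto simp: not_less)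
 obtain M0 where M0: "M0 > 0" "!!x y. norm x <= R ==> norm y <= R3+1 ==> R+1 <= norm y ==> \<bar>Ga x y\<bar> <= M0"
  using G_bound_off_diag[OF compact_shell[of R "R3+1" "R+1"] sh G_cont2] by auto
 have cL: "continuous_on {(x::real^'n, y). x ~= y} (%z. L (%y. ?c y*Ga (fst z) y) (snd z))"
  using smooth_on_continuous[OF smooth_slice_L[OF open_neq smooth_OFF_mult[OF sc]]] by simp
 obtain E0 where E0: "E0 > 0" "!!x y. norm x <= R ==> norm y <= R3+1 ==> R+1 <= norm y ==> \<bar>L (%y. ?c y*Ga x y) y\<bar> <= E0"
  using G_bound_off_diag[OF compact_shell[of R "R3+1" "R+1"] sh cL] by auto
 obtain q1 C1 D1 where lip: "0 < q1" "q1 <= 1/4" "0 <= C1" "!!x y x' r. norm x <= R+2 ==> norm y <= R+2 ==> 0 < r ==> r <= 1 ==> r <= dist x y ==>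
  dist x x' < q1*r ==> \<bar>Ga y x - Ga y x'\<bar> <= C1*(1/r)^D1*dist x x'"
  by (rule G_lipschitz[of "R+2"]) (use R that in auto)
 obtain B2 where B2: "B2 > 0" "!!x r y. norm x <= R ==> 0 < r ==> r <= 1 ==> \<bar>L (cutoff x r) y\<bar> <= B2/r^2"
  "!!x r y. 0 < r ==> dist x y > 3/2*r ==> L (cutoff x r) y = 0" by (rule L_cutoff_bound[of R]) (rule that)
 obtain P s w :: "real => real" and k
 where P: "smooth_on UNIV P" "!!t. (P has_real_derivative s t) (at t)" "!!t. (s has_real_derivative - w t) (at t)"
  "!!t. w t >= 0" "!!t. t > 2 ==> w t = 0" "!!t. t <= 1 ==> P t = t" "!!t. P t <= t" "!!t. t >= 2 ==> P t = k" "1 <= k" "k <= 2" "!!t. P t <= 2"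
  "smooth_on UNIV s" "smooth_on UNIV w" "!!t. t >= 0 ==> P t >= 0" by (rule trunc_exists) (rule that)
 define V where "V = (LINT y|lborel. indicator (ball (0::real^'n) (R3+1)) y*(1::real))"
 have iV: "integrable lborel (%y. indicator (ball (0::real^'n) (R3+1)) y*(1::real))"
  by (rule integrable_indicator_cont) auto
 have V: "V >= 0" unfolding V_def by (rule int_nonneg) auto
 define K where "K = 2*M0*E0*V+E0*V"
 have K: "K >= 0" unfolding K_def using M0 E0 V by (intro add_nonneg_nonneg mult_nonneg_nonneg) auto
 define K2 where "K2 = B2*2^?N*V1 TYPE('n)"
 have K2: "K2 > 0" unfolding K2_def using B2 V1_pos[where 'n='n] by simp
 define c1 where "c1 = 1/(16*K2)"
 have c1: "c1 > 0" using K2 by (simp add: c1_def)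
 define rho0 where "rho0 = Min {1, 1/(C1+1), q1/2, c1/(M0+4*K+1)}"
 have r0: "rho0 > 0" "rho0 <= 1" "rho0 <= 1/(C1+1)" "rho0 <= q1/2" "rho0 <= c1/(M0+4*K+1)"
 proof -
  show "rho0 > 0" unfolding rho0_def using lip(1,3) c1 M0(1) K by (simp add: add_nonneg_pos add_pos_nonneg)
  show "rho0 <= 1" "rho0 <= 1/(C1+1)" "rho0 <= q1/2" "rho0 <= c1/(M0+4*K+1)"
   unfolding rho0_def by (rule Min_le; simp)+
 qed
 show thesis
 proof (rule that[of "c1/2" rho0 "D1+2"])
  show "c1/2 > 0" "rho0 > 0" "rho0 <= 1" using c1 r0 by auto
  fix x z :: "real^'n" and rho :: real
  assume x: "norm x <= R" and z: "norm z <= R" and rho: "0 < rho" "rho <= rho0" and xz: "x ~= z" and d: "dist x z <= rho^(D1+2)"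
  have rho1: "rho <= 1" using rho r0 by simp
  \<comment> \<open>The mass of \<open>F\<close> near \<open>x\<close> is at most
    \<open>2*M*K2*rho^(?N - 2)\<close>, and this height makes it 1/8. As the dimension is at least
    3, \<open>M\<close> is still at least \<open>c1/rho\<close>.\<close>
  define M where "M = c1/rho^(?N - 2)"
  have rp: "rho^(?N - 2) <= rho" using power_decreasing[of 1 "?N - 2" rho] card3 rho rho1 by simp
  have M1: "M >= c1/rho" unfolding M_def using c1 rp rho by (intro divide_left_mono) auto
  have "c1/rho >= M0+4*K+1"
  proof -
   have "rho*(M0+4*K+1) <= c1/(M0+4*K+1)*(M0+4*K+1)"
    using r0(5) rho M0(1) K by (intro mult_right_mono) auto
   also have "... = c1" using M0(1) K by simp
   finally have "rho*(M0+4*K+1) <= c1" .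
   thus ?thesis using rho by (simp add: pos_le_divide_eq mult.commute)
  qed
  hence M: "M > 0" "M > M0" "M >= 4*K" using M1 M0 K by linarith+
  \<comment> \<open>Near the pole the truncation has the constant value \<open>M * k\<close>;
    assigning it at \<open>x\<close> makes \<open>g\<close> smooth.\<close>
  define g where "g y = (if y = x then M * k else M*P (1/M*Ga x y))" for y
  have DM: "((%t::real. 1/M * t) has_derivative (%v. 1/M * v)) (at t)" for t
   by (rule bounded_linear_imp_has_derivative[OF bounded_linear_mult_right])
  have sP1: "smooth_on UNIV (%t. P (1/M * t))"
   by (rule smooth_on_affine[OF open_UNIV open_UNIV _ DM P(1)]) simp
  have sPM: "smooth_on UNIV (%t. M*P (1/M * t))"
   by (rule smooth_on_mult[OF open_UNIV smooth_on_const sP1])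
  have sg1: "smooth_on (- {x}) g"
  proof (rule smooth_on_cong[of "- {x}" "%y. M*P (1/M*Ga x y)"])
   show "smooth_on (- {x}) (%y. M*P (1/M*Ga x y))"
    by (rule smooth_on_comp[OF _ open_UNIV _ sPM smooth_G]) auto
  qed (auto simp: g_def)
  have "\<forall>\<^sub>F y in at x. Ga x y >= 2*M" using G_top by (simp add: filterlim_at_top)
  then obtain T where T: "open T" "x : T" "!!y. y : T ==> y ~= x ==> 2*M <= Ga x y" unfolding eventually_at_topological by blast
  have gT: "g y = M * k" if "y : T" for y
  proof (cases "y = x")
   case False
   hence "2 <= 1/M*Ga x y" using T(3)[OF that] M by (simp add: pos_le_divide_eq)
   thus ?thesis using False P(8) by (simp add: g_def)
  qed (simp add: g_def)
  have sg: "smooth_on UNIV g"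
  proof (rule smooth_on_UN_local[OF open_UNIV])
   fix y :: "real^'n"
   show "EX T. open T & y : T & smooth_on T g"
   proof (cases "y = x")
    case True
    have "smooth_on T g" by (rule smooth_on_cong[OF T(1) _ smooth_on_const]) (simp add: gT)
    thus ?thesis using T True by blast
   qed (use sg1 in \<open>auto intro!: exI[of _ "- {x}"]\<close>)
  qed
  have g2: "0 <= g y" "g y <= 2*M" for y
  proof -
   show "0 <= g y" using M P(9) P(14)[of "1/M*Ga x y"] G_pos[of x y] by (auto simp: g_def)
   have "M*P (1/M*Ga x y) <= M*2" using M P(11) by (intro mult_left_mono) auto
   moreover have "M * k <= M*2" using M P(10) by (intro mult_left_mono) auto
   ultimately show "g y <= 2*M" by (simp add: g_def)
  qed
  have Lg: "L g y <= 0" "L g y ~= 0 ==> y ~= x & Ga x y <= 2*M" for y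
  proof -
   have "L g y <= 0 & (L g y ~= 0 --> y ~= x & Ga x y <= 2*M)"
   proof (cases "y = x")
    case True
    have "L g y = L (%_. M * k) y" by (rule L_cong_open[OF T(1)]) (use True T gT in auto)
    thus ?thesis by simp
   next
    case False
    have "L g y = L (%y. M*P (1/M*Ga x y)) y"
    by (rule L_cong_open[of "- {x}"]) (use False in "auto simp: g_def")
    also have "... = (- (w (1/M*Ga x y)/M))*(SUM j=1..m. (XX j (Ga x) y)^2)"
    proof (rule L_chain[OF _ _ smooth_G, of _ _ "%t. M*P (1/M * t)" "%t. s (1/M * t)"])
    have sh: "((%t. f (1/M * t)) has_real_derivative f'*(1/M)) (at t)" if "(f has_real_derivative f') (at (1/M * t))" for f f' t
    proof (rule DERIV_chain2[of f f' "%t. 1/M * t" t "1/M" UNIV, OF that])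
    show "((%t. 1/M * t) has_real_derivative 1/M) (at t)" using DERIV_cmult[OF DERIV_ident, of "1/M" t] by simp
    qed
    show "((%t. M*P (1/M * t)) has_real_derivative s (1/M * t)) (at t)" for t
    using DERIV_cmult[OF sh[OF P(2)], of M t] M by simp
    show "((%t. s (1/M * t)) has_real_derivative (- (w (1/M * t)/M))) (at t)" for t
    using sh[OF P(3)] by simp
    show "L (Ga x) y = 0" by (rule LG[OF False])
    qed (use False in auto)
    finally have e: "L g y = (- (w (1/M*Ga x y)/M))*(SUM j=1..m. (XX j (Ga x) y)^2)" .
    have "w (1/M*Ga x y)/M*(SUM j=1..m. (XX j (Ga x) y)^2) >= 0"
    using P(4) M by (intro mult_nonneg_nonneg sum_nonneg) auto
    moreover have "Ga x y <= 2*M" if "L g y ~= 0"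
    proof (rule ccontr)
    assume "~ Ga x y <= 2*M"
    hence "1/M*Ga x y > 2" using M by (simp add: pos_less_divide_eq)
    hence "w (1/M*Ga x y) = 0" by (rule P(5))
    thus False using that e by simp
    qed
    ultimately show ?thesis using e False by simp
   qed
   thus "L g y <= 0" "L g y ~= 0 ==> y ~= x & Ga x y <= 2*M" by auto
  qed
  define th where "th y = ?c y*g y" for y
  have th: "csm th" unfolding th_def by (rule csm_mult_right[OF cc sg])
  have ths: "smooth_on UNIV th" by (rule csm_smooth[OF th])
  have th2: "abs (th y) <= 2*M" for y
  proof -
   have "abs (th y) = ?c y*g y" using cutoff(1)[OF R2, of 0 y] g2(1)[of y] by (simp add: th_def)
   also have "... <= 1*(2*M)" using cutoff(1,2)[OF R2, of 0 y] g2[of y] by (intro mult_mono) auto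
   finally show ?thesis by simp
  qed
  define F where "F y = - L th y" for y
  have cF: "csm F" unfolding F_def using csm_mult_left[OF smooth_on_const[of UNIV "-1"] csm_L[OF th]] by simp
  have Fin: "F y >= 0" "F y ~= 0 ==> y ~= x & Ga x y <= 2*M" if "norm y < R+2" for y
  proof -
   have "L th y = L g y" by (rule L_cong_open[of "ball 0 (R+2)"]) (use that cutoff(3)[OF R2, of "0::real^'n"] in "auto simp: th_def less_imp_le")
   thus "F y >= 0" "F y ~= 0 ==> y ~= x & Ga x y <= 2*M" using Lg[of y] by (auto simp: F_def)
  qed
  \<comment> \<open>Since \<open>M > M0\<close>, the truncation is inactive in this shell, and
    \<open>th\<close> is the cutoff of \<open>Ga x\<close> itself.\<close>
  have Fout: "abs (F y) <= E0" if "norm y >= R+2" "norm y <= R3" for y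
  proof -
   have "L th y = L (%y. ?c y*Ga x y) y"
   proof (rule L_cong_open[of "{y. R+1 < norm y} Int ball 0 (R3+1)"])
    fix t :: "real^'n" assume t: "t : {y. R+1 < norm y} Int ball 0 (R3+1)"
    hence tx: "t ~= x" using x by auto
    have "abs (Ga x t) <= M0" by (rule M0(2)[OF x]) (use t in auto)
    hence "1/M*Ga x t <= 1" using M by (simp add: divide_le_eq)
    hence "g t = Ga x t" using P(6) tx M by (simp add: g_def)
    thus "th t = ?c t*Ga x t" by (simp add: th_def)
   qed (use that in "auto intro!: open_Int open_Collect_less continuous_intros simp: field_simps")
   thus ?thesis using E0(2)[OF x, of y] that by (simp add: F_def)
  qed
  have F0: "F y = 0" if "norm y > R3" for y
  proof -
   have "L th y = L (%_. 0) y"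
    by (rule L_cong_open[of "{y. norm y > R3}"]) (use that cutoff(4)[OF R2, of "0::real^'n"] in "auto simp: th_def R3_def intro!: open_Collect_less continuous_intros")
   thus ?thesis by (simp add: F_def)
  qed
  \<comment> \<open>As the total integral vanishes, the mass of \<open>F\<close> inside is balanced
    by the shell where the outer cutoff varies, and there \<open>F\<close> is bounded by
    \<open>E0\<close> whatever \<open>rho\<close> is.\<close>
  have IF: "(LINT y|lborel. F y) = 0"
  proof -
   have "(LINT y|lborel. L (%_. 1) y * th y) = (LINT y|lborel. 1*L th y)" by (rule L_symm[OF smooth_on_const th])
   thus ?thesis by (simp add: F_def)
  qed
  let ?I = "%y. indicator (ball (0::real^'n) (R3+1)) y*(1::real)"
  let ?A = "%y. indicator (ball 0 (R+2)) y*F y"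
  have iA: "integrable lborel ?A" by (rule integrable_indicator_cont[OF csm_continuous[OF cF]]) auto
  have A: "(LINT y|lborel. ?A y) <= E0*V"
  proof -
   have "(LINT y|lborel. ?A y) <= (LINT y|lborel. F y+E0*?I y)"
   proof (rule integral_mono[OF iA])
    show "integrable lborel (%y. F y+E0*?I y)"
    by (intro intb_add csm_integrable[OF cF] integrable_mult_right iV)
    fix y :: "real^'n"
    consider "norm y < R+2" | "norm y >= R+2" "norm y <= R3" | "norm y > R3" by linarith
    thus "?A y <= F y+E0*?I y"
    proof cases
    case 1
    thus ?thesis using E0 by simp
    next
    case 2
    have i: "indicator (ball (0::real^'n) (R3+1)) y = (1::real)" "indicator (ball (0::real^'n) (R+2)) y = (0::real)"
    using 2 by (auto simp: indicator_def field_simps)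
    show ?thesis unfolding i using Fout[OF 2] by simp
    next
    case 3
    thus ?thesis using F0[OF 3] E0 by simp
    qed
   qed
   also have "... = E0*V" unfolding V_def using IF iV by (subst int_add) (auto intro: csm_integrable[OF cF])
   finally show ?thesis .
  qed
  let ?e = "cutoff x rho"
  have ce: "csm ?e" by (rule csm_cutoff[OF rho(1)])
  have ceF: "csm (%y. ?e y*F y)" by (rule csm_mult_right[OF ce csm_smooth[OF cF]])
  \<comment> \<open>Self-adjointness moves \<open>L\<close> onto the cutoff \<open>?e\<close>, where
    it is of size \<open>rho^-2\<close> on a ball of radius \<open>2*rho\<close>.\<close>
  have eF: "(LINT y|lborel. ?e y*F y) <= 2*M*(K2*rho^(?N - 2))"
  proof -
   have "(LINT y|lborel. ?e y*F y) = - (LINT y|lborel. L th y*?e y)" by (simp add: F_def mult.commute)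
   also have "(LINT y|lborel. L th y*?e y) = (LINT y|lborel. th y*L ?e y)" by (rule L_symm[OF ths ce])
   also have "- ... = (LINT y|lborel. - (th y*L ?e y))" by simp
   also have "... <= (LINT y|lborel. (2*M*(B2/rho^2))*(indicator (ball x (2*rho)) y*1^2))"
   proof (rule integral_mono)
    show "integrable lborel (%y. - (th y*L ?e y))"
    by (intro Bochner_Integration.integrable_minus csm_integrable csm_mult_left ths csm_L ce)
    show "integrable lborel (%y. (2*M*(B2/rho^2))*(indicator (ball x (2*rho)) y*1^2))"
    by (rule integrable_mult_right[OF nrm2_integrable]) auto
    fix y :: "real^'n"
    show "- (th y*L ?e y) <= (2*M*(B2/rho^2))*(indicator (ball x (2*rho)) y*1^2)"
    proof (cases "dist x y < 2*rho")
    case True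
    have "abs (th y*L ?e y) <= 2*M*(B2/rho^2)"
    unfolding abs_mult using th2[of y] B2(2)[OF x rho(1) rho1, of y] M by (intro mult_mono) auto
    thus ?thesis using True by simp
    next
    case False
    hence "L ?e y = 0" using B2(3)[OF rho(1), of x y] rho(1) by simp
    thus ?thesis using False by simp
    qed
   qed
   also have "... = (2*M*(B2/rho^2))*((2*rho)^?N*V1 TYPE('n))"
    using nrm2_one[of "2*rho" x] rho(1) by (simp add: nrm2_def)
   also have "... = 2*M*(K2*rho^(?N - 2))"
   proof -
    have "rho^((?N - 2)+2) = rho^(?N - 2)*rho^2" by (rule power_add)
    moreover have "(?N - 2)+2 = ?N" using card3 by simp
    ultimately have "rho^?N = rho^(?N - 2)*rho^2" by (simp only:)
    thus ?thesis using rho(1) by (simp add: power_mult_distrib K2_def)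
   qed
   finally show ?thesis .
  qed
  have "th x - th z = (LINT y|lborel. Ga x y*F y) - (LINT y|lborel. Ga z y*F y)"
   using G_rep[OF th, of x] G_rep[OF th, of z] by (simp add: F_def)
  also have "... = (LINT y|lborel. Ga x y*F y - Ga z y*F y)"
   by (rule int_diff[symmetric]) (intro G_integrable_csm cF)+
  also have "... <= (LINT y|lborel. 2*M0*E0*?I y+?A y+2*M*(?e y*F y))"
  proof (rule integral_mono_AE)
   show "integrable lborel (%y. Ga x y*F y - Ga z y*F y)" by (intro intb_diff G_integrable_csm cF)
   show "integrable lborel (%y. 2*M0*E0*?I y+?A y+2*M*(?e y*F y))"
    by (intro intb_add integrable_mult_right iV iA csm_integrable[OF ceF])
   show "AE y in lborel. Ga x y*F y - Ga z y*F y <= 2*M0*E0*?I y+?A y+2*M*(?e y*F y)"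
    using AE_lborel_singleton[of x] AE_lborel_singleton[of z]
   proof eventually_elim
    fix y :: "real^'n" assume y: "y ~= x" "y ~= z"
    have Gx: "Ga x y > 0" and Gz: "Ga z y > 0" using y by (auto intro!: G_pos)
    consider "norm y < R+2" | "norm y >= R+2" "norm y <= R3" | "norm y > R3" by linarith
    thus "Ga x y*F y - Ga z y*F y <= 2*M0*E0*?I y+?A y+2*M*(?e y*F y)"
    proof cases
    case 1
    note f = Fin[OF 1]
    have A1: "?A y = F y" using 1 by simp
    have I0: "2*M0*E0*?I y >= 0" using M0 E0 by simp
    have e0: "2*M*(?e y*F y) >= 0" using M f(1) cutoff(1)[OF rho(1), of x y] by simp
    show ?thesis
    proof (cases "dist x y < rho")
    case False
    have "dist x z < q1*rho"
    proof -
    have "rho^(D1+2) <= rho^2" using rho rho1 by (intro power_decreasing) auto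
    also have "rho^2 <= (q1/2)*rho" using rho r0(4) by (simp add: power2_eq_square mult_right_mono)
    also have "... < q1*rho" using lip(1) rho by simp
    finally show ?thesis using d by simp
    qed
    hence "abs (Ga y x - Ga y z) <= C1*(1/rho)^D1*dist x z"
    by (intro lip(4)) (use x 1 rho rho1 False in auto)
    also have "... <= C1*(1/rho)^D1*rho^(D1+2)" using d lip(3) rho by (intro mult_left_mono) auto
    also have "... = C1*(rho*rho)" using rho by (simp add: power_add power_divide power2_eq_square)
    also have "... <= C1*(rho*1)" using lip(3) rho rho1 by (intro mult_left_mono) auto
    also have "... <= 1"
    proof -
    have "rho <= 1/(C1+1)" using rho r0 by simp
    hence "rho*(C1+1) <= 1" using lip(3) by (simp add: pos_le_divide_eq)
    thus ?thesis using rho by (simp add: algebra_simps)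
    qed
    finally have "Ga x y - Ga z y <= 1" using G_sym[of x y] G_sym[of z y] y by (simp add: abs_le_iff)
    hence "(Ga x y - Ga z y)*F y <= 1*F y" using f(1) by (rule mult_right_mono)
    hence "Ga x y*F y - Ga z y*F y <= F y" by (simp add: left_diff_distrib)
    thus ?thesis unfolding A1 using I0 e0 by linarith
    next
    case True
    have e1: "?e y = 1" using cutoff(3)[OF rho(1), of x y] True by simp
    have "Ga x y*F y <= 2*M*F y" using f by (cases "F y = 0") (auto intro: mult_right_mono)
    moreover have "Ga z y*F y >= 0" using Gz f(1) by simp
    ultimately show ?thesis unfolding A1 e1 mult_1_left using I0 f(1) by linarith
    qed
    next
    case 2
    have i: "indicator (ball (0::real^'n) (R3+1)) y = (1::real)" "indicator (ball (0::real^'n) (R+2)) y = (0::real)"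
    using 2 by (auto simp: indicator_def field_simps)
    have "dist x y >= 2" using 2(1) x norm_triangle_sub[of y x] by (simp add: dist_norm norm_minus_commute)
    hence e: "?e y = 0" using cutoff(4)[OF rho(1), of x y] rho1 by simp
    have "abs (Ga x y) <= M0" "abs (Ga z y) <= M0" using M0(2)[OF x, of y] M0(2)[OF z, of y] 2 by auto
    hence "abs ((Ga x y - Ga z y)*F y) <= (2*M0)*E0"
    unfolding abs_mult using Fout[OF 2] M0 by (intro mult_mono) auto
    thus ?thesis unfolding i e by (simp add: left_diff_distrib abs_le_iff)
    next
    case 3
    thus ?thesis using F0[OF 3] M0 E0 by simp
    qed
   qed
  qed
  also have "... = 2*M0*E0*V+(LINT y|lborel. ?A y)+2*M*(LINT y|lborel. ?e y*F y)"
   unfolding V_def using iV iA csm_integrable[OF ceF] by simp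
  also have "... <= K+2*M*(2*M*(K2*rho^(?N - 2)))"
   using A eF M by (intro add_mono mult_left_mono) (auto simp: K_def)
  also have "2*M*(2*M*(K2*rho^(?N - 2))) = M/4"
  proof -
   have "M*(K2*rho^(?N - 2)) = 1/16" using rho K2 by (simp add: M_def c1_def)
   hence "4*M*(M*(K2*rho^(?N - 2))) = M/4" by (simp only:)
   thus ?thesis by (simp add: mult_ac)
  qed
  finally have "th x - th z <= K+M/4" .
  moreover have "th x >= M"
  proof -
   have "?c x = 1" using cutoff(3)[OF R2, of 0 x] x by simp
   thus ?thesis using M P(9) by (simp add: th_def g_def)
  qed
  moreover have "th z <= Ga x z"
  proof -
   have "?c z = 1" using cutoff(3)[OF R2, of 0 z] z by simp
   moreover have "M*P (1/M*Ga x z) <= M*(1/M*Ga x z)" using M P(7) by (intro mult_left_mono) auto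
   ultimately show ?thesis using M xz by (simp add: th_def g_def)
  qed
  ultimately have "Ga x z >= M/2" using M(3) by linarith
  thus "c1/2/rho <= Ga x z" using M1 by simp
 qed
qed

text \<open>If \<open>y'\<close> is not too close to \<open>x\<close>, the Lipschitz bound away from
  the pole changes \<open>Ga x\<close> by at most \<open>1/(2*r)\<close>; if it is close,
  \<open>y\<close> is close as well and \<open>near_diag\<close> gives the lower bound directly.
  Both losses are polynomial, so one power \<open>r^D\<close> serves.\<close>

lemma G_stable:
 assumes R: "R >= 0"
 obtains r0 and D :: nat where "r0 > 0" "r0 <= 1" "D >= 1"
  "!!x y y' r. norm x <= R ==> norm y <= R ==> norm y' <= R ==> 0 < r ==> r <= r0 ==> dist y y' <= r^D ==>
   x = y' | Ga x y' > 1/r ==> x = y | Ga x y > 1/(4*r)"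
proof -
 obtain c rho0 and Da :: nat where nd: "c > 0" "rho0 > 0" "rho0 <= 1"
  "!!x z rho. norm x <= R ==> norm z <= R ==> 0 < rho ==> rho <= rho0 ==> x ~= z ==> dist x z <= rho^Da ==> Ga x z >= c/rho"
  by (rule near_diag[OF R]) (rule that)
 obtain q1 C1 D1 where lip: "0 < q1" "q1 <= 1/4" "0 <= C1" "!!x y x' r. norm x <= R ==> norm y <= R ==> 0 < r ==> r <= 1 ==> r <= dist x y ==>
  dist x x' < q1*r ==> \<bar>Ga y x - Ga y x'\<bar> <= C1*(1/r)^D1*dist x x'"
  by (rule G_lipschitz[OF R]) (rule that)
 \<comment> \<open>\<open>r^D\<close> must stay below the distance \<open>t\<close>, of order
   \<open>r^Da\<close>, and must beat the Lipschitz constant at that distance, of order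
   \<open>r^-(Da*D1)\<close>.\<close>
 define D where "D = Da*D1+Da+2"
 define K where "K = C1*(2 / c^Da)^D1"
 have K: "K >= 0" unfolding K_def using lip nd by simp
 define r0 where "r0 = Min {1, rho0 / c, 1/(2*K+1), q1 * c^Da/4}"
 have r0: "r0 > 0" "r0 <= 1" "r0 <= rho0 / c" "r0 <= 1/(2*K+1)" "r0 <= q1 * c^Da/4"
 proof -
  show "r0 > 0" unfolding r0_def using nd(1,2) lip(1) K by (simp add: add_nonneg_pos)
  show "r0 <= 1" "r0 <= rho0 / c" "r0 <= 1/(2*K+1)" "r0 <= q1 * c^Da/4"
   unfolding r0_def by (rule Min_le; simp)+
 qed
 show thesis
 proof (rule that[OF r0(1,2), of D])
  show "D >= 1" by (simp add: D_def)
  fix x y y' :: "real^'n" and r :: real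
  assume x: "norm x <= R" and y: "norm y <= R" and y': "norm y' <= R" and r: "0 < r" "r <= r0" and d: "dist y y' <= r^D"
   and G: "x = y' | Ga x y' > 1/r"
  have r1: "r <= 1" using r r0 by simp
  \<comment> \<open>With this choice the bound \<open>c/rho\<close> of \<open>near_diag\<close> is
    \<open>1/r\<close>.\<close>
  define rho where "rho = c*r"
  have rho: "0 < rho" "rho <= rho0"
  proof -
   show "0 < rho" using nd r by (simp add: rho_def)
   have "r <= rho0 / c" using r r0 by simp
   thus "rho <= rho0" using nd by (simp add: rho_def pos_le_divide_eq mult.commute)
  qed
  define t where "t = 1/2*rho^Da"
  have "rho^Da <= 1" using rho nd(3) by (intro power_le_one) auto
  hence t: "0 < t" "t <= 1" using rho by (auto simp: t_def)
  have rD: "r^D < q1 * t"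
  proof -
   have "r^D = r^Da*(r^(Da*D1)*(r*r))" by (simp add: D_def power_add mult_ac power2_eq_square)
   also have "... <= r^Da*(1*(1*r))" using r r1 by (intro mult_left_mono mult_mono power_le_one) (auto simp: mult_left_le_one_le)
   also have "... <= r^Da*(q1 * c^Da/4)" using r r0 by (intro mult_left_mono) auto
   also have "... < r^Da*(q1 * c^Da/2)" using r lip nd by (intro mult_strict_left_mono) auto
   also have "... = q1 * t" by (simp add: t_def rho_def power_mult_distrib)
   finally show ?thesis .
  qed
  show "x = y | Ga x y > 1/(4*r)"
  proof (cases "t <= dist y' x")
   case True
   hence "x ~= y'" using t by auto
   hence Gr: "Ga x y' > 1/r" using G by simp
   have "abs (Ga x y' - Ga x y) <= C1*(1/t)^D1*dist y' y"
    by (rule lip(4)[OF y' x t True]) (use d rD in "simp add: dist_commute")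
   also have "... <= C1*(1/t)^D1*r^D" using d lip t by (intro mult_left_mono) (auto simp: dist_commute)
   also have "... = K*(r^Da*(r*r))"
   proof -
    have "1 / t = (2 / c^Da)*(1/r^Da)" by (simp add: t_def rho_def power_mult_distrib)
    hence "(1/t)^D1 = (2 / c^Da)^D1*(1/r^(Da*D1))" by (simp only: power_mult_distrib power_one_over power_mult)
    moreover have "r^D = r^(Da*D1)*(r^Da*(r*r))" by (simp add: D_def power_add mult_ac power2_eq_square)
    ultimately show ?thesis using r by (simp add: K_def)
   qed
   also have "... <= K*(1*(1*r))" using K r r1 by (intro mult_left_mono mult_mono power_le_one) auto
   also have "... <= 1/2"
   proof -
    have "r <= 1/(2*K+1)" using r r0 by simp
    hence "r*(2*K+1) <= 1" using K by (simp add: pos_le_divide_eq)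
    thus ?thesis using r by (simp add: algebra_simps)
   qed
   also have "1/2 <= 1/(2*r)" using r r1 by (simp add: field_simps)
   finally have "Ga x y > 1/r - 1/(2*r)" using Gr by linarith
   also have "1/r - 1/(2*r) = 2*(1/(4*r))" using r by (simp add: field_simps)
   finally have "2*(1/(4*r)) < Ga x y" .
   moreover have "1/(4*r) > 0" using r by simp
   ultimately show ?thesis by linarith
  next
   case False
   have "dist x y <= dist y' x+dist y y'" using dist_triangle[of x y y'] by (simp add: dist_commute)
   moreover have "q1 * t <= 1 * t" using lip(2) t by (intro mult_right_mono) auto
   hence "r^D <= t" using rD by linarith
   ultimately have "dist x y <= rho^Da" using False d by (simp add: t_def)
   hence "x = y | Ga x y >= c/rho" using nd(4)[OF x y rho] by blast
   moreover have "c/rho > 1/(4*r)" using nd r by (simp add: rho_def field_simps)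
   ultimately show ?thesis by auto
  qed
 qed
qed

end

section \<open>Potentials and coverings\<close>

text \<open>The exact minimizer of a high power mean of the payoffs
 has nearly optimal payoffs, and its first-order conditions are a dual certificate.\<close>

lemma approx_minimax:
 fixes M :: "'a => 'b => real"
 assumes W: "finite W" "W ~= {}" and E: "finite E" "E ~= {}" and M: "!!w e. w : W ==> e : E ==> M w e > 0"
 obtains nu mu V where "!!e. e : E ==> 0 <= nu e" "sum nu E = 1" "!!w. w : W ==> 0 <= mu w" "sum mu W = 1" "V > 0"
  "!!w. w : W ==> (SUM e:E. M w e*nu e) <= V" "!!e. e : E ==> (SUM w:W. mu w*M w e) >= V/5"
proof -
 \<comment> \<open>With this exponent the rows with payoff below \<open>V/4\<close> contribute
   together at most \<open>V^Suc q\<close> to \<open>V*Z\<close>.\<close>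
 obtain q :: nat where q: "real (card W) <= 4^q" using real_arch_pow[of 4 "real (card W)"] by (auto intro: less_imp_le)
 define De where "De = {nu. (ALL e. nu e : (if e : E then {0..1} else {0})) & sum nu E = (1::real)}"
 define a where "a nu w = (SUM e:E. M w e*nu e)" for nu w
 define F where "F nu = (SUM w:W. a nu w^Suc q)" for nu
 have cc: "continuous_on UNIV (%nu::'b => real. nu e)" for e by simp
 have comp: "compact De"
 proof -
  have "compactin (product_topology (%i. euclidean) UNIV) (PiE UNIV (%e. if e : E then {0..1::real} else {0}))"
   unfolding compactin_PiE by auto
  hence "compact (PiE UNIV (%e. if e : E then {0..1::real} else {0}))"
   by (simp only: euclidean_product_topology compactin_euclidean_iff)
  moreover have "closed {nu::'b => real. sum nu E = 1}"
   by (rule closed_Collect_eq) (intro continuous_on_sum cc continuous_on_const)+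
  ultimately have "compact (PiE UNIV (%e. if e : E then {0..1::real} else {0}) Int {nu. sum nu E = 1})"
   by (rule compact_Int_closed)
  moreover have "PiE UNIV (%e. if e : E then {0..1::real} else {0}) Int {nu. sum nu E = 1} = De"
   unfolding De_def PiE_UNIV_domain by (rule set_eqI) (simp add: Pi_iff)
  ultimately show ?thesis by simp
 qed
 have ne: "De ~= {}"
 proof -
  obtain e0 where e0: "e0 : E" using E(2) by blast
  have "(%e. if e = e0 then 1 else 0) : De" unfolding De_def using e0 E(1) by auto
  thus ?thesis by blast
 qed
 have cF: "continuous_on De F"
  unfolding F_def a_def by (intro continuous_on_sum continuous_on_power continuous_on_mult continuous_on_const continuous_on_subset[OF cc]) auto
 obtain nu where nu: "nu : De" "!!nu'. nu' : De ==> F nu <= F nu'" using continuous_attains_inf[OF comp ne cF] by blast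
 have nuE: "!!e. e : E ==> 0 <= nu e & nu e <= 1" "sum nu E = 1" "!!e. e ~: E ==> nu e = 0"
  using nu(1) unfolding De_def by (auto split: if_splits dest!: spec)
 have apos: "a nu w > 0" if "w : W" for w
 proof -
  obtain e where e: "e : E" "nu e > 0"
  proof (rule ccontr)
   assume "~ thesis"
   hence "nu e = 0" if "e : E" for e using nuE(1)[OF that] that \<open>~ thesis\<close> \<open>!!e. [|e : E; 0 < nu e|] ==> thesis\<close> by force
   thus False using nuE(2) by simp
  qed
  have "0 < M w e*nu e" using M[OF that e(1)] e(2) by simp
  also have "... <= a nu w" unfolding a_def using M[OF that] nuE(1) E(1) e(1)
   by (intro member_le_sum mult_nonneg_nonneg) (auto intro: less_imp_le)
  finally show ?thesis .
 qed
 \<comment> \<open>Optimality of \<open>nu\<close> along the segment towards the point mass at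
   \<open>e\<close>.\<close>
 have foc: "(SUM w:W. a nu w^q*M w e) >= F nu" if e: "e : E" for e
 proof (rule ccontr)
  assume c: "~ F nu <= (SUM w:W. a nu w^q*M w e)"
  define h where "h t = (SUM w:W. (a nu w + t*(M w e - a nu w))^Suc q)" for t :: real
  have "((%t. (a nu w + t*(M w e - a nu w))^Suc q) has_real_derivative (real (Suc q)*(a nu w^q*(M w e - a nu w)))) (at 0)" for w
   by (auto intro!: derivative_eq_intros simp del: power_Suc)
  hence "(h has_real_derivative (SUM w:W. real (Suc q)*(a nu w^q*(M w e - a nu w)))) (at 0)"
   unfolding h_def by (intro DERIV_sum)
  moreover have "(SUM w:W. real (Suc q)*(a nu w^q*(M w e - a nu w))) = real (Suc q)*((SUM w:W. a nu w^q*M w e) - F nu)"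
   unfolding F_def sum_distrib_left[symmetric] sum_subtractf[symmetric] by (simp add: right_diff_distrib mult.commute)
  ultimately have "(h has_real_derivative (real (Suc q)*((SUM w:W. a nu w^q*M w e) - F nu))) (at 0)" by (simp only:)
  moreover have "real (Suc q)*((SUM w:W. a nu w^q*M w e) - F nu) < 0" using c by (intro mult_pos_neg) auto
  ultimately obtain d where d: "d > 0" "!!t. t > 0 ==> t < d ==> h (0 + t) < h 0" using DERIV_neg_dec_right by blast
  define t where "t = min (d/2) 1"
  have t: "0 < t" "t < d" "t <= 1" using d(1) by (auto simp: t_def)
  define nu' where "nu' x = (1 - t)*nu x+(if x = e then t else 0)" for x
  have sE: "(SUM x:E. c x*(if x = e then t else 0)) = c e * t" for c :: "'b => real"
   using E(1) e by (simp add: if_distrib[of "%u. _*u"] cong: if_cong)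
  have s: "sum nu' E = 1"
   using sE[of "%_. 1"] unfolding nu'_def sum.distrib sum_distrib_left[symmetric] nuE(2) by simp
  have "nu' : De"
  proof -
   have p: "0 <= nu' x" if "x : E" for x using nuE(1)[OF that] t by (auto simp: nu'_def)
   have "nu' x <= 1" if "x : E" for x using member_le_sum[OF that, of nu'] p E(1) s by auto
   moreover have "nu' x = 0" if "x ~: E" for x using nuE(3)[OF that] that e by (auto simp: nu'_def)
   ultimately show ?thesis using p s by (auto simp: De_def)
  qed
  hence "F nu <= F nu'" by (rule nu(2))
  moreover have "F nu' = h t"
  proof -
   have "a nu' w = a nu w + t*(M w e - a nu w)" for w
   proof -
    have "a nu' w = (1 - t)*a nu w+M w e * t"
    unfolding a_def nu'_def distrib_left sum.distrib sE by (simp add: sum_distrib_left mult.left_commute)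
    thus ?thesis by (simp add: algebra_simps)
   qed
   thus ?thesis by (simp add: F_def h_def)
  qed
  moreover have "F nu = h 0" by (simp add: F_def h_def)
  ultimately show False using d(2)[OF t(1,2)] by simp
 qed
 define V where "V = Max (a nu ` W)"
 have Vle: "a nu w <= V" if "w : W" for w unfolding V_def using W that by (intro Max_ge) auto
 have "V : a nu ` W" unfolding V_def by (rule Max_in) (use W in auto)
 then obtain w0 where w0: "w0 : W" "a nu w0 = V" by blast
 have V: "V > 0" using apos[OF w0(1)] w0 by simp
 define Z where "Z = (SUM w:W. a nu w^q)"
 have Z: "Z > 0" unfolding Z_def by (rule sum_pos) (use W apos in auto)
 have FV: "V^Suc q <= F nu"
  unfolding F_def w0(2)[symmetric] using W w0 apos by (intro member_le_sum[of w0 W "%w. a nu w^Suc q"]) (auto intro: less_imp_le)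
 \<comment> \<open>5 is 4 for the rows with payoff at least \<open>V/4\<close>, plus 1 for the
   others.\<close>
 have VZ: "V*Z <= 5*F nu"
 proof -
  have "V*a nu w^q <= 4*a nu w^Suc q+V^Suc q/4^q" if w: "w : W" for w
  proof (cases "a nu w >= V/4")
   case True
   hence "V*a nu w^q <= (4*a nu w)*a nu w^q" using apos[OF w] by (intro mult_right_mono) auto
   also have "(4*a nu w)*a nu w^q = 4*a nu w^Suc q" by simp
   finally have "V*a nu w^q <= 4*a nu w^Suc q" .
   moreover have "V^Suc q/4^q >= 0" using V by simp
   ultimately show ?thesis by linarith
  next
   case False
   hence "a nu w^q <= (V/4)^q" using apos[OF w] by (intro power_mono) auto
   hence "V*a nu w^q <= V*(V/4)^q" using V by simp
   moreover have "V*(V/4)^q = V^Suc q/4^q" by (simp add: power_divide)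
   moreover have "4*a nu w^Suc q >= 0" using apos[OF w] by simp
   ultimately show ?thesis by linarith
  qed
  hence "V*Z <= (SUM w:W. 4*a nu w^Suc q+V^Suc q/4^q)" unfolding Z_def sum_distrib_left by (rule sum_mono)
  also have "... = 4*F nu+real (card W)*(V^Suc q/4^q)" by (simp add: F_def sum.distrib sum_distrib_left)
  also have "real (card W)*(V^Suc q/4^q) <= 4^q*(V^Suc q/4^q)" using q V by (intro mult_right_mono) auto
  also have "... = V^Suc q" by simp
  finally show ?thesis using FV by linarith
 qed
 show thesis
 proof (rule that[of nu "%w. a nu w^q/Z" V])
  show "0 <= nu e" if "e : E" for e using nuE(1)[OF that] by blast
  show "sum nu E = 1" by (rule nuE)
  show "0 <= a nu w^q/Z" if "w : W" for w using apos[OF that] Z by simp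
  show "(SUM w:W. a nu w^q/Z) = 1" using Z by (simp add: sum_divide_distrib[symmetric] Z_def[symmetric])
  show "V > 0" by (rule V)
  show "(SUM e:E. M w e*nu e) <= V" if "w : W" for w using Vle[OF that] by (simp add: a_def)
  show "(SUM w:W. a nu w^q/Z*M w e) >= V/5" if "e : E" for e
  proof -
   have "V*Z <= 5*(SUM w:W. a nu w^q*M w e)" using VZ foc[OF that] by linarith
   hence "V/5 <= (SUM w:W. a nu w^q*M w e)/Z" using Z by (simp add: field_simps)
   thus ?thesis by (simp add: sum_divide_distrib)
  qed
 qed
qed

text \<open>Greedy choice. By averaging, some point lies in at least the fraction
  \<open>th / ka\<close> of the sets still to be met; discarding those lowers the logarithm of their
  number by \<open>th / ka\<close>, which pays for the point.\<close>

lemma hitting_set: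
 fixes mu :: "'a => real" and A :: "'b => 'a set"
 assumes W: "finite W" and mu: "!!w. w : W ==> 0 <= mu w" "sum mu W <= ka" and th: "th > 0"
 shows "finite I ==> I ~= {} ==> (!!i. i : I ==> A i <= W & sum mu (A i) >= th) ==>
  EX H<=W. finite H & (ALL i:I. H Int A i ~= {}) & real (card H) <= ka / th*(1+ln (card I))"
proof (induction "card I" arbitrary: I rule: less_induct)
 case less
 note I = less.prems
 let ?n = "real (card I)"
 have n: "?n >= 1" using I by (simp add: Suc_le_eq card_gt_0_iff)
 obtain i0 where i0: "i0 : I" using I by blast
 have "th <= sum mu (A i0)" using I(3)[OF i0] by blast
 also have "... <= sum mu W" using I(3)[OF i0] W mu by (intro sum_mono2) auto
 finally have tW: "th <= sum mu W" .
 hence tk: "th <= ka" using mu(2) by simp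
 hence k: "ka > 0" using th by simp
 let ?h = "%w. {i:I. w : A i}"
 have "EX w:W. ?n * th <= ka*real (card (?h w))"
 proof (rule ccontr)
  assume "~ ?thesis"
  hence lt: "ka*real (card (?h w)) < ?n * th" if "w : W" for w using that by auto
  have "(SUM w:W. mu w*real (card (?h w))) = (SUM w:W. SUM i:I. if w : A i then mu w else 0)"
  proof (rule sum.cong[OF refl])
   fix w
   have "(SUM i:I. if w : A i then mu w else 0) = (SUM i:?h w. mu w)" by (rule sum.inter_filter[OF I(1), symmetric])
   thus "mu w*real (card (?h w)) = (SUM i:I. if w : A i then mu w else 0)" by simp
  qed
  also have "... = (SUM i:I. SUM w:W. if w : A i then mu w else 0)" by (rule sum.swap)
  also have "... = (SUM i:I. sum mu (A i))"
  proof (rule sum.cong[OF refl])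
   fix i assume "i : I"
   hence "{w:W. w : A i} = A i" using I(3) by blast
   thus "(SUM w:W. if w : A i then mu w else 0) = sum mu (A i)" using W by (simp add: sum.inter_filter[symmetric])
  qed
  also have "... >= (SUM i:I. th)" using I(3) by (intro sum_mono) blast
  finally have ge: "?n * th <= (SUM w:W. mu w*real (card (?h w)))" by simp
  have "0 < (SUM w:W. mu w*(?n * th - ka*real (card (?h w))))"
  proof -
   obtain w where w: "w : W" "mu w > 0"
   proof (rule ccontr)
    assume a: "~ thesis"
    have "mu w = 0" if "w : W" for w using mu(1)[OF that] a that \<open>!!w. [|w : W; 0 < mu w|] ==> thesis\<close> by force
    hence "sum mu W = 0" by simp
    thus False using tW th by simp
   qed
   have "0 < mu w*(?n * th - ka*real (card (?h w)))" using w lt[OF w(1)] by simp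
   also have "... <= (SUM w:W. mu w*(?n * th - ka*real (card (?h w))))"
    using w(1) W mu(1) lt by (intro member_le_sum mult_nonneg_nonneg) (auto intro: less_imp_le)
   finally show ?thesis .
  qed
  also have "... = ?n * th * sum mu W - ka*(SUM w:W. mu w*real (card (?h w)))"
   unfolding sum_distrib_left sum_subtractf[symmetric] by (intro sum.cong refl) (simp add: algebra_simps)
  also have "... <= ?n * th * ka - ka*(?n * th)"
   using ge k mu(2) n th by (intro diff_mono mult_left_mono) auto
  finally show False by simp
 qed
 then obtain w where w: "w : W" "?n * th <= ka*real (card (?h w))" by blast
 let ?J = "I - ?h w"
 have cJ: "real (card ?J) = ?n - real (card (?h w))" using I(1) by (subst card_Diff_subset) (auto simp: of_nat_diff card_mono)
 have "?n*(th / ka) <= real (card (?h w))" using w(2) k by (simp add: field_simps)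
 hence Jn: "real (card ?J) <= ?n*(1 - th / ka)" using cJ by (simp add: algebra_simps)
 have tk1: "th / ka > 0" using th k by simp
 show ?case
 proof (cases "?J = {}")
  case True
  have "1*1 <= ka / th*(1+ln ?n)" using tk th n by (intro mult_mono) auto
  thus ?thesis using True w(1) by (intro exI[of _ "{w}"]) auto
 next
  case False
  have fJ: "finite ?J" using I(1) by simp
  hence J1: "real (card ?J) >= 1" using False by (metis card_gt_0_iff nat_le_real_less of_nat_0_less_iff One_nat_def Suc_leI of_nat_mono of_nat_1)
  have "?n*(th / ka) > 0" using n tk1 by (intro mult_pos_pos) auto
  hence "real (card ?J) < ?n" using Jn by (simp add: algebra_simps)
  hence "card ?J < card I" by simp
  from less.hyps[OF this fJ False] I(3)
  obtain H where H: "H <= W" "finite H" "!!i. i : ?J ==> H Int A i ~= {}" "real (card H) <= ka / th*(1+ln (card ?J))" by auto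
  have "ln (card ?J) <= ln (?n*(1 - th / ka))" using J1 Jn by (intro ln_mono) auto
  also have "... = ln ?n+ln (1 - th / ka)"
  proof (rule ln_mult_pos)
   show "0 < 1 - th / ka"
   proof (rule ccontr)
    assume "~ 0 < 1 - th / ka"
    hence "?n*(1 - th / ka) <= 0" using n by (intro mult_nonneg_nonpos) auto
    thus False using Jn J1 by linarith
   qed
   thus "0 < ?n" using n by simp
  qed
  also have "ln (1 - th / ka) <= - (th / ka)"
  proof -
   have "0 < 1 - th / ka"
   proof (rule ccontr)
    assume "~ 0 < 1 - th / ka"
    hence "?n*(1 - th / ka) <= 0" using n by (intro mult_nonneg_nonpos) auto
    thus False using Jn J1 by linarith
   qed
   thus ?thesis using ln_le_minus_one[of "1 - th / ka"] by simp
  qed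
  finally have l: "ln (card ?J) <= ln ?n - th / ka" by simp
  have "real (card (insert w H)) <= 1+real (card H)" using card_insert_le_m1[of "Suc (card H)" H w] H(2) by (simp add: card_insert_if)
  also have "real (card H) <= ka / th*(1+(ln ?n - th / ka))"
   by (rule order_trans[OF H(4)]) (use l k th in "intro mult_left_mono; simp")
  also have "1+... = ka / th*(1+ln ?n)" using k th by (simp add: field_simps)
  finally have "real (card (insert w H)) <= ka / th*(1+ln ?n)" by simp
  moreover have "insert w H Int A i ~= {}" if "i : I" for i using H(3)[of i] that by (cases "w : A i") auto
  ultimately show ?thesis using w(1) H(1,2) by (intro exI[of _ "insert w H"]) auto
 qed
qed

text \<open>One point of \<open>S\<close> is taken from each grid cell of side \<open>s\<close>
  divided by the dimension. That the number is polynomial in \<open>1/s\<close> keeps the logarithm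
  in \<open>hitting_set\<close> harmless.\<close>

lemma net_count:
 fixes S :: "(real^'n::finite) set"
 assumes S: "!!x. x : S ==> norm x <= R" and s: "0 < s" "s <= 1"
 obtains T where "finite T" "T <= S" "!!x. x : S ==> EX t:T. dist x t <= s"
  "real (card T) <= ((2*abs R*real CARD('n)+3) / s)^CARD('n)"
proof -
 let ?N = "real CARD('n)"
 define f where "f x = (%i::'n. \<lfloor>x $ i*(?N / s)\<rfloor>)" for x :: "real^'n"
 define m where "m = \<lceil>abs R*(?N / s)\<rceil>"
 have N: "?N >= 1" by (simp add: Suc_le_eq)
 have Ns: "?N / s > 0" using s N by (simp add: divide_pos_pos)
 have sub: "f ` S <= (UNIV \<rightarrow>\<^sub>E {-m..m})"
 proof
  fix g assume "g : f ` S"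
  then obtain x where x: "x : S" "g = f x" by blast
  have "g i : {-m..m}" for i
  proof -
   have "abs (x $ i) <= abs R" using component_le_norm_cart[of x i] S[OF x(1)] by linarith
   hence "abs (x $ i*(?N / s)) <= abs R*(?N / s)" unfolding abs_mult using Ns by (intro mult_mono) auto
   also have "... <= of_int m" unfolding m_def by (rule le_of_int_ceiling)
   finally have b: "abs (x $ i*(?N / s)) <= of_int m" .
   hence b': "x $ i*(?N / s) <= of_int m" "- of_int m <= x $ i*(?N / s)" unfolding abs_le_iff by linarith+
   have "- m <= g i" unfolding x(2) f_def le_floor_iff of_int_minus by (rule b'(2))
   moreover have "g i <= m" unfolding x(2) f_def using floor_mono[OF b'(1)] by simp
   ultimately show ?thesis by simp
  qed
  thus "g : (UNIV \<rightarrow>\<^sub>E {-m..m})" by auto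
 qed
 have fin: "finite (UNIV \<rightarrow>\<^sub>E {-m..m} :: ('n => int) set)" by (rule finite_PiE) auto
 have "0 <= abs R*(?N / s)" using Ns by (intro mult_nonneg_nonneg) auto
 hence "(0::real) <= of_int m" unfolding m_def by (rule order_trans) (rule le_of_int_ceiling)
 hence m0: "m >= 0" by simp
 have "card (f ` S) <= card (UNIV \<rightarrow>\<^sub>E {-m..m} :: ('n => int) set)" by (rule card_mono[OF fin sub])
 also have "... = nat (2*m+1)^CARD('n)" by (simp add: card_PiE prod_constant)
 finally have c: "card (f ` S) <= nat (2*m+1)^CARD('n)" .
 have ff: "finite (f ` S)" by (rule finite_subset[OF sub fin])
 let ?T = "inv_into S f ` (f ` S)"
 show thesis
 proof (rule that)
  show "finite ?T" using ff by simp
  show "?T <= S" by (auto intro: inv_into_into)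
  show "EX t:?T. dist x t <= s" if x: "x : S" for x
  proof
   let ?t = "inv_into S f (f x)"
   show "?t : ?T" using x by blast
   have fe: "f ?t = f x" by (rule f_inv_into_f) (use x in blast)
   have "abs ((x - ?t) $ i) <= s/?N" for i
   proof -
    have "\<lfloor>?t $ i*(?N / s)\<rfloor> = \<lfloor>x $ i*(?N / s)\<rfloor>" using fun_cong[OF fe, of i] by (simp add: f_def)
    hence "abs (x $ i*(?N / s) - ?t $ i*(?N / s)) <= 1"
    using floor_correct[of "x $ i*(?N / s)"] floor_correct[of "?t $ i*(?N / s)"] by linarith
    hence "abs ((x $ i - ?t $ i)*(?N / s)) <= 1" unfolding left_diff_distrib .
    hence "abs ((x - ?t) $ i)*(?N / s) <= 1" unfolding abs_mult vector_minus_component abs_of_pos[OF Ns] .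
    thus ?thesis using s N by (simp add: field_simps)
   qed
   hence "norm (x - ?t) <= (SUM i:(UNIV::'n set). s/?N)"
    by (intro order_trans[OF norm_le_l1_cart] sum_mono)
   thus "dist x ?t <= s" by (simp add: dist_norm)
  qed
  have "real (card ?T) <= real (card (f ` S))" using card_image_le[OF ff] by (simp add: of_nat_mono)
  also have "... <= real (nat (2*m+1))^CARD('n)" using of_nat_mono[OF c, where 'a=real] by simp
  also have "... <= ((2*abs R*?N+3) / s)^CARD('n)"
  proof (rule power_mono)
   have "of_int m <= abs R*(?N / s)+1" unfolding m_def by linarith
   hence "real (nat (2*m+1)) <= 2*(abs R*(?N / s))+3" using m0 by simp
   also have "... <= 2*(abs R*(?N / s))+3 / s" using s by (simp add: le_divide_eq)
   finally show "real (nat (2*m+1)) <= (2*abs R*?N+3) / s" by (simp add: add_divide_distrib)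
  qed simp
  finally show "real (card ?T) <= ((2*abs R*?N+3) / s)^CARD('n)" .
 qed
qed

section \<open>The reference annulus and distant interactions\<close>

context fund begin

text \<open>Dilations that scale \<open>Ga 0\<close> by powers of 2 carry this set onto all dyadic
  annuli; both boundary levels are included to make it compact.\<close>

definition K0 :: "(real^'n) set" where "K0 = {w. w ~= 0 & 1/2 <= Ga 0 w & Ga 0 w <= 1}"

lemma compact_K0: "compact K0" unfolding K0_def by (rule compact_annulus) simp

lemma K0_nonempty: "EX w. w : K0"
proof -
 have "axis i0 1 ~= (0::real^'n)" by (simp add: axis_eq_0_iff)
 then obtain t w where "w ~= 0" "Ga 0 w = 1" by (rule dilation_normalize)
 thus ?thesis by (auto simp: K0_def)
qed

text \<open>Maximum principle outside a ball: the inequality holds on the sphere of radius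
  \<open>R1\<close> by compactness, and \<open>Ga y\<close> tends to 0 at infinity.\<close>

lemma G_far_upper:
 obtains R1 C where "C > 0" "R1 > 0" "!!y. y : K0 ==> norm y < R1" "!!y x. y : K0 ==> norm x >= R1 ==> Ga y x <= C*Ga 0 x"
proof -
 obtain r where r: "!!y. y : K0 ==> norm y <= r" using compact_imp_bounded[OF compact_K0] by (auto simp: bounded_iff)
 define R1 where "R1 = abs r+1"
 have R1: "R1 > 0" "!!y. y : K0 ==> norm y < R1" using r by (force simp: R1_def)+
 have "compact (K0 \<times> sphere (0::real^'n) R1)" by (intro compact_Times compact_K0) auto
 moreover have "K0 \<times> sphere (0::real^'n) R1 <= {(x, y). x ~= y}" using R1(2) by fastforce
 ultimately have "EX B>0. ALL z:K0 \<times> sphere (0::real^'n) R1. abs (case z of (x, y) => Ga x y) <= B" by (rule G_bound_off_diag[OF _ _ G_cont2])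
 then obtain B where B0: "B > 0" "ALL z:K0 \<times> sphere (0::real^'n) R1. abs (case z of (x, y) => Ga x y) <= B" by (elim exE conjE)
 have B: "B > 0" "abs (Ga y x) <= B" if "y : K0" "norm x = R1" for y x
  using B0(1) bspec[OF B0(2), of "(y, x)"] that by auto
 obtain b where b: "b > 0" "!!y. norm y <= R1 ==> y ~= 0 ==> Ga 0 y >= b" by (rule G_lower_bound[of R1 0]) (rule that)
 let ?C = "B/b"
 have C: "?C > 0" using B0 b by simp
 show thesis
 proof (rule that[OF C R1])
  fix y x :: "real^'n" assume y: "y : K0" and x: "norm x >= R1"
  have s: "Ga y z <= ?C*Ga 0 z" if z: "norm z = R1" for z
  proof -
   have "z ~= 0" using z R1 by auto
   hence "?C*Ga 0 z >= ?C*b" using b(2)[of z] z C by (intro mult_left_mono) auto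
   thus ?thesis using B(2)[OF y z] b(1) B0(1) by simp
  qed
  show "Ga y x <= ?C*Ga 0 x"
  proof (cases "norm x = R1")
   case False
   hence xR: "norm x > R1" using x by simp
   have "Ga y x - ?C*Ga 0 x <= e" if e: "e > 0" for e
   proof -
    have "\<forall>\<^sub>F z in at_infinity. Ga y z < e" by (rule order_tendstoD(2)[OF G_0 e])
    then obtain R2 where R2: "!!z. norm z >= R2 ==> Ga y z < e" unfolding eventually_at_infinity by auto
    define R3 where "R3 = max R2 (norm x+1)"
    let ?D = "ball 0 R3 - cball (0::real^'n) R1"
    have oD: "open ?D" by (intro open_Diff) auto
    have clD: "closure ?D <= cball 0 R3 - ball 0 R1" by (rule closure_minimal) (auto intro!: closed_Diff)
    have nD: "y ~: cball 0 R3 - ball 0 R1" "0 ~: cball 0 R3 - ball (0::real^'n) R1" using R1 y by auto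
    have h: "harmonic_on L ?D (%z. 0+1*Ga y z+(- ?C)*Ga 0 z)"
    by (rule harmonic_combination[OF oD harmonic_G harmonic_G]) (use R1(1) less_imp_le[OF R1(2)[OF y]] in auto)
    have "0+1*Ga y x+(- ?C)*Ga 0 x <= e"
    proof (rule weak_max_principle[OF oD])
    show "bounded ?D" by (rule bounded_subset[of "ball 0 R3"]) auto
    show "smooth_on ?D (%z. 0+1*Ga y z+(- ?C)*Ga 0 z)" using h by (simp only: harmonic_on_def)
    show "continuous_on (closure ?D) (%z. 0+1*Ga y z+(- ?C)*Ga 0 z)"
    by (intro continuous_intros continuous_on_subset[OF G_cont]) (use clD nD in auto)
    show "0 <= L (%z. 0+1*Ga y z+(- ?C)*Ga 0 z) z" if "z : ?D" for z using h that by (simp only: harmonic_on_def order_refl)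
    show "0+1*Ga y z+(- ?C)*Ga 0 z <= e" if "z : frontier ?D" for z
    proof -
    have "z : closure ?D" "z ~: ?D" using that oD by (auto simp: frontier_def interior_open)
    then consider "norm z = R1" | "norm z >= R3" using clD by fastforce
    thus ?thesis
    proof cases
    case 1
    thus ?thesis using s[OF 1] e by simp
    next
    case 2
    hence z0: "z ~= 0" using xR R1 by (auto simp: R3_def)
    have "Ga y z < e" using 2 R2 by (simp add: R3_def)
    moreover have "?C*Ga 0 z >= 0" by (rule mult_nonneg_nonneg[OF less_imp_le[OF C] less_imp_le[OF G_pos]]) (use z0 in simp)
    ultimately show ?thesis by linarith
    qed
    qed
    show "x : ?D" using xR by (auto simp: R3_def)
    qed
    thus ?thesis by simp
   qed
   hence "Ga y x - ?C*Ga 0 x <= 0" by (rule field_le_epsilon) simp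
   thus ?thesis by simp
  qed (rule s)
 qed
qed

text \<open>Off the range \<open>1/4 < Ga 0 z < 2\<close> of the adjacent annuli, kernels with pole
  in \<open>K0\<close> are bounded. Only the pieces adjacent to a point then require the finer bound
  on potentials.\<close>

lemma G_far_bound:
 obtains C where "C > 0" "!!y z. y : K0 ==> z = 0 | Ga 0 z >= 2 | Ga 0 z <= 1/4 ==> y ~= z & Ga y z <= C"
proof -
 obtain R1 C where C: "C > 0" "R1 > 0" "!!y. y : K0 ==> norm y < R1" "!!y x. y : K0 ==> norm x >= R1 ==> Ga y x <= C*Ga 0 x"
  by (rule G_far_upper) (rule that)
 have "\<forall>\<^sub>F z in at_infinity. Ga 0 z < 1" by (rule order_tendstoD(2)[OF G_0]) simp
 then obtain R2 where R2: "!!z. norm z >= R2 ==> Ga 0 z < 1" unfolding eventually_at_infinity by auto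
 define R3 where "R3 = max R1 R2"
 let ?Z = "- {z. z ~= 0 & Ga 0 z < 2} Un {z. z ~= 0 & Ga 0 z <= 1/4}"
 have cZ: "closed ?Z" by (intro closed_Un closed_G_le) (simp add: closed_def open_G_less)
 have dZ: "z : ?Z \<longleftrightarrow> z = 0 | Ga 0 z >= 2 | Ga 0 z <= 1/4" for z by auto
 have ne: "y ~= z" if "y : K0" "z : ?Z" for y z using that unfolding dZ by (auto simp: K0_def)
 have "compact (K0 \<times> (cball 0 R3 Int ?Z))" by (intro compact_Times compact_K0 compact_Int_closed cZ) auto
 moreover have "K0 \<times> (cball 0 R3 Int ?Z) <= {(x, y). x ~= y}" using ne by blast
 ultimately have "EX B>0. ALL w:K0 \<times> (cball 0 R3 Int ?Z). abs (case w of (x, y) => Ga x y) <= B" by (rule G_bound_off_diag[OF _ _ G_cont2])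
 then obtain B where B0: "B > 0" "ALL w:K0 \<times> (cball 0 R3 Int ?Z). abs (case w of (x, y) => Ga x y) <= B" by (elim exE conjE)
 have B: "abs (Ga y z) <= B" if "y : K0" "norm z <= R3" "z : ?Z" for y z
  using bspec[OF B0(2), of "(y, z)"] that(1,2) that(3)[simplified] by auto
 show thesis
 proof (rule that[of "max B C"])
  show "max B C > 0" using B0(1) by simp
  fix y z :: "real^'n" assume y: "y : K0" and "z = 0 | Ga 0 z >= 2 | Ga 0 z <= 1/4"
  hence z: "z : ?Z" using dZ by blast
  have "Ga y z <= max B C"
  proof (cases "norm z <= R3")
   case True
   thus ?thesis using B[OF y True z] by simp
  next
   case False
   hence "Ga y z <= C*Ga 0 z" using C(4)[OF y, of z] by (simp add: R3_def)
   also have "... <= C*1" by (rule mult_left_mono[OF less_imp_le[OF R2]]) (use False C(1) in "auto simp: R3_def")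
   finally show ?thesis by simp
  qed
  thus "y ~= z & Ga y z <= max B C" using ne[OF y z] by blast
 qed
qed

text \<open>A ball is a pair of a scale and a centre, its radius depending on the scale alone. The
  condition \<open>Ga 0 (snd b) <= 2\<close> keeps the centres away from the origin, so that the
  cost relative to \<open>quasi_dist\<close> is at most a constant times
  \<open>rho (fst b) powr p\<close>.\<close>

definition cover :: "real => (real^'n) set => real => bool" where
 "cover p E c \<longleftrightarrow> (EX (B :: (nat \<times> (real^'n)) set) rho. finite B & (ALL b:B. rho (fst b) > 0 & snd b ~= 0 & Ga 0 (snd b) <= 2) &
  E <= (UN b:B. Gamma_ball Ga (snd b) (rho (fst b))) & (SUM b:B. rho (fst b) powr p) <= c)"

end

section \<open>Covering one annulus\<close>

lemma dyadic_layers: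
 fixes a b :: real
 assumes "b >= 0"
 shows "min a (b*2^I) <= b+(SUM i<=I. 2*(b*2^i)*(if a > b*2^i then 1 else 0))"
proof (induction I)
 case (Suc I)
 have "(SUM i<=I. 2*(b*2^i)*(if a > b*2^i then 1 else 0)) >= 0" using assms by (intro sum_nonneg) auto
 moreover have "b*2^Suc I >= 0" using assms by simp
 moreover have "2*(b*2^I)*(if a > b*2^I then 1 else 0) <= (SUM i<=I. 2*(b*2^i)*(if a > b*2^i then 1 else 0))"
  by (rule member_le_sum[of I "{..I}" "%i. 2*(b*2^i)*(if a > b*2^i then 1 else 0)"]) (use assms in auto)
 ultimately show ?case using Suc assms by (cases "a > b*2^I"; cases "a > b*2^Suc I") (auto simp: min_def split: if_splits)
qed (use assms in auto)

lemma half_power_powr: "(1/2^i) powr eta = (2 powr (- eta))^i" for eta :: real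
proof -
 have "(1/2^i) = (2::real) powr (- real i)" by (simp add: powr_minus powr_realpow divide_inverse)
 thus ?thesis by (simp add: powr_powr powr_power mult.commute)
qed

context fund begin

lemma cover_mono: "cover p E c ==> c <= d ==> cover p E d"
 unfolding cover_def by (meson order_trans)

text \<open>Gives all pieces one common finite cost, which disposes of large masses in the
  alternative and makes the infimum of the costs meaningful.\<close>

lemma cover_one_ball:
 obtains c where "c > 0" "!!E. E <= K0 ==> cover p E c"
proof -
 obtain x1 where x1: "x1 : K0" using K0_nonempty by blast
 obtain R where R: "!!y. y : K0 ==> norm y <= R" using compact_imp_bounded[OF compact_K0] by (auto simp: bounded_iff)
 obtain c where c: "c > 0" "!!y. norm y <= R ==> y ~= x1 ==> Ga x1 y >= c" by (rule G_lower_bound[of R x1]) (rule that)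
 show thesis
 proof (rule that)
  show "(2 / c) powr p > 0" using c by simp
  fix E assume E: "E <= K0"
  have "E <= Gamma_ball Ga x1 (2 / c)"
  proof
   fix y assume "y : E"
   hence "norm y <= R" using R E by blast
   hence "y = x1 | Ga x1 y > c/2" using c by fastforce
   thus "y : Gamma_ball Ga x1 (2 / c)" using c(1) by (simp add: Gamma_ball_eq)
  qed
  thus "cover p E ((2 / c) powr p)" unfolding cover_def
   by (intro exI[of _ "{(0, x1)}"] exI[of _ "%_. 2 / c"]) (use c x1 in "auto simp: K0_def")
 qed
qed

definition stable :: "real => real => nat => bool" where
 "stable R r0 D \<longleftrightarrow> (ALL x y y' r. norm x <= R --> norm y <= R --> norm y' <= R --> 0 < r --> r <= r0 --> dist y y' <= r^D -->
  x = y' | Ga x y' > 1/r --> x = y | Ga x y > 1/(4*r))"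

lemma stableD:
 assumes "stable R r0 D" "norm x <= R" "norm y <= R" "norm y' <= R" "0 < r" "r <= r0" "dist y y' <= r^D" "x = y' | Ga x y' > 1/r"
 shows "x = y | Ga x y > 1/(4*r)"
 using assms unfolding stable_def by blast

definition far_bound :: "real => bool" where
 "far_bound C \<longleftrightarrow> (ALL y z. y : K0 --> z = 0 | Ga 0 z >= 2 | Ga 0 z <= 1/4 --> y ~= z & Ga y z <= C)"

lemma far_boundD: "far_bound C ==> y : K0 ==> z = 0 | Ga 0 z >= 2 | Ga 0 z <= 1/4 ==> y ~= z & Ga y z <= C"
 unfolding far_bound_def by blast

text \<open>The diagonal values of the kernel are junk, hence the case distinction.\<close>

definition trunc_kernel :: "real => real^'n => real^'n => real" where
 "trunc_kernel b w e = (if w = e then b else min (Ga w e) b)"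

text \<open>Carries a bound from a net point \<open>w\<close> to an arbitrary \<open>x\<close>. If
  \<open>x\<close> lies in the ball of radius \<open>r\<close> about \<open>y\<close>, stability
  puts \<open>w\<close> into the ball of radius \<open>4*r\<close>; the choice of \<open>r\<close>
  as the smaller of \<open>r0\<close> and \<open>2 / Ga y x\<close> turns this into an inequality of
  kernels with factor 8.\<close>

lemma potential_transfer:
 assumes st: "stable R r0 D"
  and d: "0 < de" "de <= r0" and n: "norm y <= R" "norm x <= R" "norm w <= R" "dist x w <= de^D" and x: "x ~= y" "Ga y x <= 1/de"
 shows "Ga y x <= 8 * trunc_kernel (1/de) w y+1/r0"
proof (cases "Ga y x <= 1/r0")
 case True
 have "trunc_kernel (1/de) w y >= 0" using d G_pos[of w y] by (auto simp: trunc_kernel_def)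
 thus ?thesis using True by simp
next
 case False
 define a where "a = Ga y x"
 have r0: "r0 > 0" using d by simp
 hence "1/r0 > 0" by simp
 hence a: "a > 1/r0" "a <= 1/de" "a > 0" using False x unfolding a_def by linarith+
 define r where "r = min r0 (2/a)"
 have da: "de <= 1/a" using a d by (simp add: field_simps)
 have r: "0 < r" "r <= r0" "de <= r" using r0 a d da divide_right_mono[of 1 2 a] by (auto simp: r_def)
 have ar: "a > 1/r" using a r0 by (auto simp: r_def min_def field_simps)
 have ar2: "1/(4*r) >= a/8" using a r by (auto simp: r_def min_def field_simps)
 have "de^D <= r^D" using d r by (intro power_mono) auto
 hence "dist w x <= r^D" using n(4) by (simp add: dist_commute)
 hence "y = w | Ga y w > 1/(4*r)" by (rule stableD[OF st n(1) n(3) n(2) r(1,2)]) (use ar in "simp add: a_def")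
 hence "trunc_kernel (1/de) w y >= a/8"
 proof
  assume "y = w"
  thus ?thesis using a by (simp add: trunc_kernel_def)
 next
  assume *: "Ga y w > 1/(4*r)"
  show ?thesis
  proof (cases "y = w")
   case False
   thus ?thesis using * ar2 a G_sym[of y w] by (auto simp: trunc_kernel_def)
  qed (use a in "simp add: trunc_kernel_def")
 qed
 hence "Ga y x <= 8 * trunc_kernel (1/de) w y" by (simp add: a_def)
 thus ?thesis using \<open>1 / r0 > 0\<close> by linarith
qed

text \<open>Some dyadic scale must carry its share of the potential; the factor \<open>r powr eta\<close> makes the shares summable.\<close>

lemma heavy_scale:
 fixes mu :: "real^'n => real"
 assumes rs: "0 < rs" "rs <= 1" and eta: "eta > 0" and W: "finite W" and mu: "!!w. w : W ==> 0 <= mu w" "sum mu W <= rs/10"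
  and pot: "(SUM w:W. mu w * trunc_kernel (2^I/rs) w e) >= 1/5"
 shows "EX i<=I. sum mu {w:W. w = e | Ga w e > 2^i/rs} >= (1 - 2 powr (- eta))/20*(rs/2^i) powr (1+eta)"
proof (rule ccontr)
 define B where "B i = {w:W. w = e | Ga w e > 2^i/rs}" for i :: nat
 \<comment> \<open>Normalized so that the shares of all scales sum to at most 1/10; with the bottom
   layer, worth at most 1/10, the potential would stay below 1/5.\<close>
 define c where "c = (1 - 2 powr (- eta))/20"
 define q where "q = (2::real) powr (- eta)"
 assume ng: "~ ?thesis"
 have small: "sum mu (B i) < c*(rs/2^i) powr (1+eta)" if i: "i <= I" for i
 proof (rule ccontr)
  assume "~ ?thesis"
  hence "c*(rs/2^i) powr (1+eta) <= sum mu (B i)" by (simp only: not_less)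
  thus False using ng i unfolding B_def c_def by blast
 qed
 have q: "0 < q" "q < 1" using eta by (auto simp: q_def powr_less_one)
 have c: "c > 0" using q by (simp add: c_def q_def)
 have k: "trunc_kernel (2^I/rs) w e <= 1/rs+(SUM i<=I. 2*(2^i/rs)*(if w : B i then 1 else 0))" if "w : W" for w
 proof (cases "w = e")
  case True
  have "2^I/rs <= 2*(2^I/rs)*(if w : B I then 1 else (0::real))" using True that rs by (simp add: B_def divide_right_mono)
  also have "... <= (SUM i<=I. 2*(2^i/rs)*(if w : B i then 1 else 0))"
   by (rule member_le_sum[of I "{..I}" "%i. 2*(2^i/rs)*(if w : B i then 1 else 0)"]) (use rs in auto)
  also have "... <= 1/rs+..." using rs by simp
  finally show ?thesis using True by (simp add: trunc_kernel_def)
 next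
  case False
  have "trunc_kernel (2^I/rs) w e = min (Ga w e) (1/rs*2^I)" using False by (simp add: trunc_kernel_def)
  also have "... <= 1/rs+(SUM i<=I. 2*(1/rs*2^i)*(if Ga w e > 1/rs*2^i then 1 else 0))"
   by (rule dyadic_layers) (use rs in simp)
  also have "... = 1/rs+(SUM i<=I. 2*(2^i/rs)*(if w : B i then 1 else 0))"
   using False that by (simp add: B_def)
  finally show ?thesis .
 qed
 define s where "s = (SUM i<=I. 2*(2^i/rs) * sum mu (B i))"
 have "1/5 <= (SUM w:W. mu w*(1/rs+(SUM i<=I. 2*(2^i/rs)*(if w : B i then 1 else 0))))"
  by (rule order_trans[OF pot]) (intro sum_mono mult_left_mono k mu)
 also have "... = sum mu W*(1/rs)+(SUM w:W. SUM i<=I. mu w*(2*(2^i/rs)*(if w : B i then 1 else 0)))"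
  by (simp only: distrib_left sum.distrib sum_distrib_left sum_distrib_right)
 also have "(SUM w:W. SUM i<=I. mu w*(2*(2^i/rs)*(if w : B i then 1 else 0))) =
   (SUM i<=I. SUM w:W. mu w*(2*(2^i/rs)*(if w : B i then 1 else 0)))" by (rule sum.swap)
 also have "... = s" unfolding s_def
 proof (rule sum.cong[OF refl])
  fix i
  have B: "W Int {w. w : B i} = B i" by (auto simp: B_def)
  have "(SUM w:W. mu w*(2*(2^i/rs)*(if w : B i then 1 else 0))) = (SUM w:W. if w : B i then 2*(2^i/rs)*mu w else 0)"
   by (rule sum.cong) auto
  also have "... = (SUM w:B i. 2*(2^i/rs)*mu w)" by (simp only: sum.If_cases[OF W] B sum.neutral_const add_0_right)
  also have "... = 2*(2^i/rs) * sum mu (B i)" by (rule sum_distrib_left[symmetric])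
  finally show "(SUM w:W. mu w*(2*(2^i/rs)*(if w : B i then 1 else 0))) = 2*(2^i/rs) * sum mu (B i)" .
 qed
 finally have 1: "1/5 <= sum mu W*(1/rs) + s" .
 have 2: "sum mu W*(1/rs) <= 1/10" using mu(2) rs by (simp add: field_simps)
 have "s < (SUM i<=I. 2 * c*q^i)" unfolding s_def
 proof (rule sum_strict_mono)
  fix i assume "i : {..I}"
  hence "2*(2^i/rs) * sum mu (B i) < 2*(2^i/rs)*(c*(rs/2^i) powr (1+eta))"
   using small rs by (intro mult_strict_left_mono) auto
  also have "... = 2 * c*(rs/2^i) powr eta" using rs by (simp add: powr_add)
  also have "... <= 2 * c*q^i"
  proof (rule mult_left_mono)
   have "(rs/2^i) powr eta <= (1/2^i) powr eta" using rs eta by (intro powr_mono2) (auto simp: divide_right_mono)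
   thus "(rs/2^i) powr eta <= q^i" unfolding half_power_powr q_def .
  qed (use c in simp)
  finally show "2*(2^i/rs) * sum mu (B i) < 2 * c*q^i" .
 qed auto
 also have "... = 2 * c*(SUM i<=I. q^i)" by (simp add: sum_distrib_left)
 also have "... <= 2 * c*(1/(1 - q))"
 proof (rule mult_left_mono)
  have "(SUM i<=I. q^i) <= (\<Sum>i. q^i)" by (rule sum_le_suminf) (use q in "auto simp: summable_geometric")
  thus "(SUM i<=I. q^i) <= 1/(1 - q)" using q by (simp add: suminf_geometric)
 qed (use c in simp)
 also have "... = 1/10" using q by (simp add: c_def q_def[symmetric])
 finally show False using 1 2 by linarith
qed

text \<open>For a net of \<open>Y\<close>, few points of \<open>W\<close> suffice to meet the heavy
  set of each net point. Stability then puts everything near that net point into the ball of radius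
  \<open>4*r\<close> about the point chosen for it. The condition \<open>1/r > C\<close> forces the
  centres used to satisfy \<open>Ga 0 x <= 2\<close>.\<close>

lemma hit_scale:
 fixes mu :: "real^'n => real"
 assumes st: "stable R r0 D"
  and far: "far_bound C"
  and KR: "K0 <= cball 0 R" and r: "0 < r" "r <= r0" "r <= 1" "1/r > C"
  and W: "finite W" "ALL w:W. norm w <= R & 0 <= mu w" "sum mu W <= ka"
  and Y: "Y <= K0" "ALL e:Y. sum mu {w:W. w = e | Ga w e > 1/r} >= th" and th: "th > 0" and ka: "ka >= 0"
 shows "EX H. finite H & (ALL x:H. x ~= 0 & Ga 0 x <= 2) &
  (ALL e:Y. ALL z. norm z <= R --> dist z e <= r^D/2 --> (EX x:H. z : Gamma_ball Ga x (4*r))) &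
  real (card H) <= ka / th*(1+real CARD('n)*ln (2*(2*abs R*real CARD('n)+3)/r^D))" (is "EX H. ?P H")
proof -
 have R: "norm y <= R" if "y : K0" for y using KR that by auto
 define G where "G t = {w:W. w = t | Ga w t > 1/r}" for t
 let ?b = "2*(2*abs R*real CARD('n)+3)/r^D"
 have rD: "0 < r^D" "r^D <= 1" using r by (auto simp: power_le_one)
 have "?b >= 6/1" using rD by (intro frac_le) auto
 hence b: "?b >= 1" by simp
 hence lb: "ln ?b >= 0" by simp
 obtain T where T: "finite T" "T <= Y" "!!x. x : Y ==> EX t:T. dist x t <= r^D/2"
  "real (card T) <= ((2*abs R*real CARD('n)+3)/(r^D/2))^CARD('n)"
  by (rule net_count[of Y R "r^D/2"]) (use R Y rD in auto)
 show ?thesis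
 proof (cases "T = {}")
  case True
  hence "Y = {}" using T(3) by blast
  thus ?thesis using lb th ka by (intro exI[of _ "{}"]) auto
 next
  case False
  have "EX H<=W. finite H & (ALL t:T. H Int G t ~= {}) & real (card H) <= ka / th*(1+ln (card T))"
   by (rule hitting_set[OF W(1) _ W(3) th T(1) False]) (use W(2) Y(2) T(2) in "auto simp: G_def")
  then obtain H0 where H0: "H0 <= W" "finite H0" "ALL t:T. H0 Int G t ~= {}" "real (card H0) <= ka / th*(1+ln (card T))"
   by (elim exE conjE)
  define H where "H = {x:H0. EX t:T. x : G t}"
  show ?thesis
  proof (intro exI conjI ballI allI impI)
   show "finite H" using H0 by (simp add: H_def)
   have HH: "x ~= 0 & Ga 0 x <= 2" if xH: "x : H" for x
   proof -
    obtain t where t: "t : T" "x : G t" using xH by (auto simp: H_def)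
    hence tK: "t : K0" using T(2) Y(1) by blast
    show ?thesis
    proof (cases "x = t")
    case True
    thus ?thesis using tK by (auto simp: K0_def)
    next
    case False
    hence "Ga t x > C" using t(2) r(4) G_sym[of x t] by (simp add: G_def)
    thus ?thesis using far_boundD[OF far tK, of x] by linarith
    qed
   qed
   show "x ~= 0" "Ga 0 x <= 2" if "x : H" for x using HH[OF that] by auto
   show "EX x:H. z : Gamma_ball Ga x (4*r)" if zz: "e : Y" "norm z <= R" "dist z e <= r^D/2" for e z
   proof -
    obtain t where t: "t : T" "dist e t <= r^D/2" using T(3) zz(1) by blast
    obtain x where x: "x : H0" "x : G t" using H0(3) t(1) by blast
    hence xH: "x : H" using t(1) by (auto simp: H_def)
    have d: "dist z t <= r^D" using dist_triangle[of z t e] t(2) zz(3) by linarith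
    have nx: "norm x <= R" and nt: "norm t <= R" using x W(2) t T(2) Y(1) R by (auto simp: G_def)
    have "x = z | Ga x z > 1/(4*r)" by (rule stableD[OF st nx zz(2) nt r(1,2) d]) (use x(2) in "auto simp: G_def")
    hence "z : Gamma_ball Ga x (4*r)" using r(1) by (auto simp: Gamma_ball_eq)
    thus ?thesis using xH by blast
   qed
   have c1: "1 <= real (card T)" using T(1) False by (simp add: Suc_le_eq card_gt_0_iff)
   have "real (card T) <= ?b^CARD('n)" using T(4) by (simp add: field_simps)
   hence "ln (real (card T)) <= ln (?b^CARD('n))" using c1 by simp
   also have "... = real CARD('n)*ln ?b" using b by (subst ln_realpow) auto
   finally have l: "ln (real (card T)) <= real CARD('n)*ln ?b" .
   have "real (card H) <= real (card H0)" using H0(2) by (auto simp: H_def intro!: card_mono)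
   also have "... <= ka / th*(1+ln (card T))" by (rule H0(4))
   also have "... <= ka / th*(1+real CARD('n)*ln ?b)" using l ka th by (intro mult_left_mono) auto
   finally show "real (card H) <= ka / th*(1+real CARD('n)*ln ?b)" .
  qed
 qed
qed

text \<open>Every point of the net has a heavy scale, and a scale \<open>r\<close> needs about
  \<open>ka / r powr (1+eta)\<close> balls times a factor linear in its index. Since
  \<open>p = 1 + 2*eta\<close>, the costs sum to a multiple of \<open>ka\<close> with a constant
  free of \<open>I\<close>.\<close>

lemma scales_cover:
 assumes p: "p > 1" and KR: "K0 <= cball 0 R" and rs: "0 < rs" "rs <= 1" "rs <= r0" "1/rs > C"
  and st: "stable R r0 D"
  and far: "far_bound C"
 shows "EX A>0. ALL W mu Y E I ka. finite W --> (ALL w:W. norm w <= R & 0 <= mu w) --> sum mu W = ka --> ka <= rs/10 -->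
  Y <= E --> E <= K0 --> (ALL z:E. EX e:Y. dist z e <= (rs/2^I)^D/2) -->
  (ALL e:Y. (SUM w:W. mu w * trunc_kernel (2^I/rs) w e) >= 1/5) --> cover p E (A * ka)"
proof -
 define eta where "eta = (p - 1)/2"
 define c where "c = (1 - 2 powr (- eta))/20"
 define q where "q = (2::real) powr (- eta)"
 define N where "N = real CARD('n)"
 define a where "a = 2*(2*abs R*N+3)"
 define A1 where "A1 = 1+N*(ln a+real D*ln (1/rs))"
 define B1 where "B1 = N*(real D*ln 2)"
 define A where "A = 4 powr p / c*((\<Sum>i. (A1+B1*real i)*q^i)+1)"
 have eta: "eta > 0" using p by (simp add: eta_def)
 have q: "0 < q" "q < 1" using eta by (auto simp: q_def powr_less_one)
 have c: "c > 0" using q by (simp add: c_def q_def)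
 have N: "N > 0" by (simp add: N_def)
 have a: "a >= 1" using N by (simp add: a_def)
 have "ln a >= 0" using a by simp
 moreover have lrs: "ln (1/rs) >= 0" using rs by simp
 ultimately have AB: "A1 >= 0" "B1 >= 0" using N by (auto simp: A1_def B1_def)
 have sm: "summable (%i. (A1+B1*real i)*q^i)"
 proof -
  have "summable (%i. A1*q^i)" using q by (intro summable_mult summable_geometric) simp
  moreover have "summable (%i. B1*(real i*q^i))"
  proof (rule summable_mult)
   have "summable (%i. q*(real (Suc i)*q^i))" using geometric_deriv_sums[of q] q by (intro summable_mult) (auto simp: sums_iff)
   hence "summable (%i. real (Suc i)*q^Suc i)" by (simp add: algebra_simps)
   thus "summable (%i. real i*q^i)" by (subst (asm) summable_Suc_iff)
  qed
  ultimately show ?thesis by (simp add: summable_add algebra_simps)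
 qed
 have s0: "(\<Sum>i. (A1+B1*real i)*q^i) >= 0" using AB q by (intro suminf_nonneg[OF sm]) auto
 show ?thesis
 proof (intro exI[of _ A] conjI allI impI)
  show "A > 0" unfolding A_def using c s0 by (intro mult_pos_pos divide_pos_pos add_nonneg_pos) auto
  fix W mu Y E I ka
  assume W: "finite W" and Wmu: "ALL w:W. norm w <= R & 0 <= mu w" and ka: "sum mu W = ka" "ka <= rs/10"
   and Y: "Y <= E" "E <= K0" and net: "ALL z:E. EX e:Y. dist z e <= (rs/2^I)^D/2"
   and pot: "ALL e:Y. (SUM w:W. mu w * trunc_kernel (2^I/rs) w e) >= 1/5"
  have ka0: "ka >= 0" unfolding ka(1)[symmetric] using Wmu by (intro sum_nonneg) auto
  define r where "r i = rs/2^i" for i :: nat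
  define th where "th i = c*r i powr (1+eta)" for i
  define Z where "Z i = {e:Y. sum mu {w:W. w = e | Ga w e > 1/r i} >= th i}" for i
  have r: "0 < r i" "r i <= rs" for i using rs by (auto simp: r_def divide_le_eq)
  have ir: "1/r i = 2^i/rs" for i by (simp add: r_def)
  have rC: "1/r i > C" for i using rs r[of i] divide_left_mono[of "r i" rs 1] by auto
  have th: "th i > 0" for i using c r[of i] by (simp add: th_def)
  have ex: "EX H. finite H & (ALL x:H. x ~= 0 & Ga 0 x <= 2) & (ALL e:Z i. ALL z. norm z <= R --> dist z e <= r i^D/2 --> (EX x:H. z : Gamma_ball Ga x (4*r i)))
   & real (card H) <= ka / th i*(1+N*ln (a/r i^D))" for i
  proof -
   have ri: "r i <= r0" "r i <= 1" using r(2)[of i] rs by linarith+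
   have ZK: "Z i <= K0" using Y by (auto simp: Z_def)
   have Zt: "ALL e:Z i. sum mu {w:W. w = e | Ga w e > 1/r i} >= th i" by (simp add: Z_def)
   have sm: "sum mu W <= ka" using ka by simp
   show ?thesis unfolding a_def N_def by (rule hit_scale[OF st far KR r(1) ri rC W Wmu sm ZK Zt th ka0])
  qed
  obtain H where H: "ALL i. finite (H i) & (ALL x:H i. x ~= 0 & Ga 0 x <= 2) &
   (ALL e:Z i. ALL z. norm z <= R --> dist z e <= r i^D/2 --> (EX x:H i. z : Gamma_ball Ga x (4*r i)))
   & real (card (H i)) <= ka / th i*(1+N*ln (a/r i^D))" using choice[OF allI[OF ex]] ..
  show "cover p E (A * ka)" unfolding cover_def
  proof (intro exI conjI ballI)
   let ?B = "SIGMA i:{..I}. H i"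
   show "finite ?B" using H by (intro finite_SigmaI) auto
   show "4*r (fst b) > 0" if "b : ?B" for b using r(1)[of "fst b"] by simp
   show "snd b ~= 0" "Ga 0 (snd b) <= 2" if "b : ?B" for b using that H by auto
   show "E <= (UN b:?B. Gamma_ball Ga (snd b) (4*r (fst b)))"
   proof
    fix z assume z: "z : E"
    then obtain e where e: "e : Y" "dist z e <= r I^D/2" using net unfolding r_def by blast
    obtain i where i: "i <= I" "sum mu {w:W. w = e | Ga w e > 2^i/rs} >= c*(rs/2^i) powr (1+eta)"
    using heavy_scale[OF rs(1,2) eta W, of mu I e] Wmu ka pot e(1) unfolding c_def by auto
    hence eZ: "e : Z i" using e(1) by (simp add: Z_def th_def r_def)
    have "r I <= r i" using rs i(1) by (auto simp: r_def intro!: divide_left_mono power_increasing)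
    hence "r I^D <= r i^D" using r(1)[of I] by (intro power_mono) auto
    hence "dist z e <= r i^D/2" using e(2) by linarith
    moreover have "norm z <= R" using z Y KR by auto
    ultimately obtain x where "x : H i" "z : Gamma_ball Ga x (4*r i)" using H eZ by blast
    thus "z : (UN b:?B. Gamma_ball Ga (snd b) (4*r (fst b)))" using i(1) by force
   qed
   have "(SUM b:?B. (4*r (fst b)) powr p) = (SUM i<=I. SUM x:H i. (4*r i) powr p)"
    using H by (subst sum.Sigma) (auto simp: case_prod_beta)
   also have "... = (SUM i<=I. real (card (H i))*(4*r i) powr p)" by simp
   also have "... <= (SUM i<=I. ka*(4 powr p / c)*((A1+B1*real i)*q^i))"
   proof (rule sum_mono)
    fix i
    have "ln (a/r i^D) = ln a - real D*ln (r i)" using a r(1)[of i] by (simp add: ln_div ln_realpow)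
    also have "ln (r i) = ln rs - real i*ln 2" using rs by (simp add: r_def ln_div ln_realpow)
    finally have la: "ln (a/r i^D) = ln a - real D*(ln rs - real i*ln 2)" .
    have eq: "1+N*ln (a/r i^D) = A1+B1*real i" unfolding la A1_def B1_def using rs by (simp add: ln_div algebra_simps)
    have "real (card (H i)) <= ka / th i*(1+N*ln (a/r i^D))" using H by blast
    hence "real (card (H i))*(4*r i) powr p <= ka / th i*(A1+B1*real i)*(4*r i) powr p"
    unfolding eq by (rule mult_right_mono) simp
    also have "... = ka / th i*(A1+B1*real i)*(4 powr p*(r i powr (1+eta)*r i powr eta))"
    using r(1)[of i] by (simp add: powr_mult powr_add[symmetric] eta_def)
    also have "... =
    ka*(4 powr p / c)*((A1+B1*real i)*r i powr eta)"
    using r(1)[of i] c by (simp add: th_def field_simps)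
    also have "... <= ka*(4 powr p / c)*((A1+B1*real i)*q^i)"
    proof (intro mult_left_mono)
    have "r i powr eta <= (1/2^i) powr eta" unfolding r_def using rs eta by (intro powr_mono2) (auto simp: divide_right_mono)
    thus "r i powr eta <= q^i" unfolding half_power_powr q_def .
    qed (use ka0 c AB in auto)
    finally show "real (card (H i))*(4*r i) powr p <= ka*(4 powr p / c)*((A1+B1*real i)*q^i)" .
   qed
   also have "... = ka*(4 powr p / c)*(SUM i<=I. (A1+B1*real i)*q^i)" by (simp only: sum_distrib_left)
   also have "... <= ka*(4 powr p / c)*((\<Sum>i. (A1+B1*real i)*q^i)+1)"
   proof (intro mult_left_mono)
    have "(SUM i<=I. (A1+B1*real i)*q^i) <= (\<Sum>i. (A1+B1*real i)*q^i)"
    by (rule sum_le_suminf[OF sm]) (use AB q in auto)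
    thus "(SUM i<=I. (A1+B1*real i)*q^i) <= (\<Sum>i. (A1+B1*real i)*q^i)+1" by simp
   qed (use ka0 c in auto)
   also have "... = A * ka" by (simp add: A_def mult_ac)
   finally show "(SUM b:?B. (4*r (fst b)) powr p) <= A * ka" .
  qed
 qed
qed

text \<open>Both alternatives come from one game with payoff \<open>trunc_kernel\<close> between a
  net of the ball and a net of \<open>E\<close>. If \<open>ka*V > 1\<close>, the measure
  \<open>ka*mu\<close> has potential at least 1/5 on the net of \<open>E\<close>, and
  \<open>scales_cover\<close> applies. Otherwise \<open>ka*nu\<close> has potential at most 1 on the
  other net, hence at most 9 by \<open>potential_transfer\<close>. Neither \<open>C\<close> nor
  \<open>rs\<close> depends on \<open>I\<close>.\<close>

lemma dichotomy:
 assumes p: "p > 1" and KR: "K0 <= cball 0 R"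
 obtains C rs where "C > 0" "rs > 0" "ALL E ka I. E <= K0 --> ka > 0 --> ~ cover p E (C * ka) -->
  (EX Y nu. finite Y & Y <= E & (ALL y:Y. 0 <= nu y) & sum nu Y = ka &
   (ALL x. norm x <= R --> (ALL y:Y. x ~= y & Ga y x <= 2^I/rs) --> (SUM y:Y. nu y*Ga y x) <= 9))"
proof -
 have R: "norm y <= R" if "y : K0" for y using KR that by auto
 obtain x1 where "x1 : K0" using K0_nonempty by blast
 hence R0: "R >= 0" using R[of x1] norm_ge_zero[of x1] by linarith
 obtain r0 and D :: nat where r0: "r0 > 0" "r0 <= 1" "D >= 1" and
  st0: "!!x y y' r. norm x <= R ==> norm y <= R ==> norm y' <= R ==> 0 < r ==> r <= r0 ==> dist y y' <= r^D ==>
   x = y' | Ga x y' > 1/r ==> x = y | Ga x y > 1/(4*r)" by (rule G_stable[OF R0]) (rule that)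
 have st: "stable R r0 D" unfolding stable_def by (intro allI impI) (rule st0)
 obtain C0 where C0: "C0 > 0" "!!y z. y : K0 ==> z = 0 | Ga 0 z >= 2 | Ga 0 z <= 1/4 ==> y ~= z & Ga y z <= C0"
  by (rule G_far_bound) (rule that)
 have far: "far_bound C0" unfolding far_bound_def by (intro allI impI) (rule C0(2))
 define rs where "rs = min r0 (1/(C0+1))"
 have rs: "0 < rs" "rs <= 1" "rs <= r0" using r0 C0(1) by (auto simp: rs_def)
 have "1/rs >= C0+1" using rs C0(1) by (simp add: rs_def field_simps min_def)
 hence rsC: "1/rs > C0" by simp
 obtain A where A: "A > 0" "ALL W mu Y E I ka. finite W --> (ALL w:W. norm w <= R & 0 <= mu w) --> sum mu W = ka --> ka <= rs/10 -->
  Y <= E --> E <= K0 --> (ALL z:E. EX e:Y. dist z e <= (rs/2^I)^D/2) -->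
  (ALL e:Y. (SUM w:W. mu w * trunc_kernel (2^I/rs) w e) >= 1/5) --> cover p E (A * ka)"
  using scales_cover[OF p KR rs rsC st far] by (elim exE conjE)
 obtain c1 where c1: "c1 > 0" "!!E. E <= K0 ==> cover p E c1" by (rule cover_one_ball) (rule that)
 \<comment> \<open>The second term settles \<open>ka > rs/10\<close>, where a single ball is cheap
   enough.\<close>
 define C where "C = A+10 * c1/rs"
 have C: "C > 0" using A(1) c1(1) rs by (simp add: C_def add_pos_nonneg)
 show thesis
 proof (rule that[OF C rs(1)], intro allI impI)
  fix E ka and I :: nat assume E: "E <= K0" and ka: "ka > 0" and nc: "~ cover p E (C * ka)"
  have ka1: "ka <= rs/10"
  proof (rule ccontr)
   assume "~ ?thesis"
   hence "c1/(rs/10) * ka >= c1/(rs/10)*(rs/10)" using c1(1) rs by (intro mult_left_mono) auto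
   hence "c1 <= C * ka" using A(1) ka rs by (simp add: C_def distrib_right) (smt (verit) mult_pos_pos)
   thus False using nc cover_mono[OF c1(2)[OF E]] by blast
  qed
  have ncA: "~ cover p E (A * ka)"
  proof
   assume *: "cover p E (A * ka)"
   have "A * ka <= C * ka" using ka c1(1) rs by (intro mult_right_mono) (auto simp: C_def)
   thus False using cover_mono[OF *] nc by blast
  qed
  define de where "de = rs/2^I"
  have de: "0 < de" "de <= rs" "1/de = 2^I/rs" using rs by (auto simp: de_def divide_le_eq)
  have deD: "0 < de^D" "de^D <= 1" using de rs by (auto intro!: power_le_one)
  obtain W where W: "finite W" "W <= cball (0::real^'n) R" "!!x. x : cball 0 R ==> EX w:W. dist x w <= de^D"
   by (rule net_count[of "cball 0 R" R "de^D"]) (use deD in auto)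
  obtain Y where Y: "finite Y" "Y <= E" "!!x. x : E ==> EX e:Y. dist x e <= de^D/2"
   by (rule net_count[of E R "de^D/2"]) (use deD R E in auto)
  have W0: "W ~= {}" using W(3)[of 0] R0 by auto
  have Y0: "Y ~= {}"
  proof
   assume "Y = {}"
   hence "E = {}" using Y(3) by blast
   hence "cover p E (A * ka)" unfolding cover_def using A(1) ka by (intro exI[of _ "{}"] exI[of _ "%_. 1"]) simp
   thus False using ncA by blast
  qed
  let ?M = "trunc_kernel (2^I/rs)"
  have Mp: "?M w e > 0" for w e using G_pos[of w e] rs by (auto simp: trunc_kernel_def)
  obtain nu mu V where nu: "!!e. e : Y ==> 0 <= nu e" "sum nu Y = 1" and mu: "!!w. w : W ==> 0 <= mu w" "sum mu W = 1" and V: "V > 0"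
   "!!w. w : W ==> (SUM e:Y. ?M w e*nu e) <= V" "!!e. e : Y ==> (SUM w:W. mu w*?M w e) >= V/5"
   by (rule approx_minimax[of W Y ?M]) (use W(1) W0 Y(1) Y0 Mp in auto)
  have kaV: "ka*V <= 1"
  proof (rule ccontr)
   assume n: "~ ?thesis"
   have "cover p E (A * ka)"
   proof (rule A(2)[rule_format, of W "%w. ka*mu w" ka Y E I])
    show "norm w <= R & 0 <= ka*mu w" if "w : W" for w using that W(2) mu(1) ka by auto
    show "(SUM w:W. ka*mu w) = ka" using mu(2) by (simp add: sum_distrib_left[symmetric])
    show "EX e:Y. dist z e <= (rs/2^I)^D/2" if "z : E" for z using Y(3)[OF that] by (simp add: de_def)
    fix e assume "e : Y"
    hence "ka*(V/5) <= ka*(SUM w:W. mu w*?M w e)" using V(3) ka by (intro mult_left_mono) auto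
    also have "... = (SUM w:W. ka*mu w*?M w e)" by (simp add: sum_distrib_left mult.assoc)
    finally show "(SUM w:W. ka*mu w*?M w e) >= 1/5" using n by simp
   qed (use W(1) ka1 Y(2) E in auto)
   thus False using ncA by blast
  qed
  show "EX Y nu. finite Y & Y <= E & (ALL y:Y. 0 <= nu y) & sum nu Y = ka &
   (ALL x. norm x <= R --> (ALL y:Y. x ~= y & Ga y x <= 2^I/rs) --> (SUM y:Y. nu y*Ga y x) <= 9)"
  proof (intro exI conjI allI impI)
   show "finite Y" "Y <= E" by (fact Y)+
   show "ALL y:Y. 0 <= ka*nu y" using nu(1) ka by auto
   show "(SUM y:Y. ka*nu y) = ka" using nu(2) by (simp add: sum_distrib_left[symmetric])
   fix x :: "real^'n" assume x: "norm x <= R" and adm: "ALL y:Y. x ~= y & Ga y x <= 2^I/rs"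
   obtain w where w: "w : W" "dist x w <= de^D" using W(3)[of x] x by auto
   hence wR: "norm w <= R" using W(2) by auto
   have "(SUM y:Y. ka*nu y*Ga y x) <= (SUM y:Y. ka*nu y*(8*?M w y+1/r0))"
   proof (intro sum_mono mult_left_mono)
    fix y assume y: "y : Y"
    have yR: "norm y <= R" using y Y(2) E R by blast
    have "Ga y x <= 8 * trunc_kernel (1/de) w y+1/r0"
    by (rule potential_transfer[OF st de(1) _ yR x wR w(2)]) (use y adm de rs in auto)
    thus "Ga y x <= 8*?M w y+1/r0" by (simp only: de(3))
    show "0 <= ka*nu y" using nu(1) y ka by auto
   qed
   also have "... = 8*(ka*(SUM y:Y. ?M w y*nu y)) + ka/r0 * sum nu Y"
    by (simp add: algebra_simps sum.distrib sum_distrib_left sum_divide_distrib)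
   also have "ka*(SUM y:Y. ?M w y*nu y) <= ka*V" using V(2)[OF w(1)] ka by (intro mult_left_mono) auto
   also have "ka/r0 * sum nu Y <= 1/10" using nu(2) ka1 rs r0 by (simp add: field_simps)
   finally show "(SUM y:Y. ka*nu y*Ga y x) <= 9" using kaV by simp
  qed
 qed
qed

end

section \<open>Summation over all annuli\<close>

lemma p_bounded_UN:
 fixes B :: "nat => ('a::euclidean_space \<times> real) set"
 assumes B: "!!k. finite (B k)" "!!k b. b : B k ==> fst b ~= 0 & snd b > 0"
  and cov: "F <= (\<Union>k. UN b:B k. Gamma_ball Ga (fst b) (snd b))"
  and d: "!!k. (SUM b:B k. (snd b/quasi_dist Ga 0 (fst b)) powr p) <= d k" "summable d"
 shows "p_bounded Ga p F"
proof -
 let ?A = "Sigma UNIV B"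
 let ?f = "%(k::nat, b). (snd b/quasi_dist Ga 0 (fst b)) powr p"
 have cA: "countable ?A" using B(1) by (intro countable_SIGMA) (auto simp: countable_finite)
 define e where "e = from_nat_into ?A"
 define J where "J = to_nat_on ?A ` ?A"
 have e: "e (to_nat_on ?A a) = a" if "a : ?A" for a unfolding e_def by (rule from_nat_into_to_nat_on[OF cA that])
 have eJ: "e n : ?A" if nJ: "n : J" for n
 proof -
  obtain a where a: "n = to_nat_on ?A a" "a : ?A" by (rule imageE[OF nJ[unfolded J_def]])
  show ?thesis unfolding a(1) e[OF a(2)] by (rule a(2))
 qed
 have inj: "inj_on (to_nat_on ?A) ?A" by (rule inj_on_to_nat_on[OF cA])
 have "?f summable_on ?A"
 proof (rule summable_on_SigmaI)
  show "((%b. ?f (k, b)) has_sum (SUM b:B k. (snd b/quasi_dist Ga 0 (fst b)) powr p)) (B k)" for k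
   using has_sum_finite[OF B(1)[of k], of "%b. (snd b/quasi_dist Ga 0 (fst b)) powr p"] by simp
  have "summable (%k. SUM b:B k. (snd b/quasi_dist Ga 0 (fst b)) powr p)"
   by (rule summable_comparison_test'[OF d(2), of 0]) (use d(1) in "auto simp: sum_nonneg")
  hence "summable (%k. norm (SUM b:B k. (snd b/quasi_dist Ga 0 (fst b)) powr p))" by (simp add: sum_nonneg)
  thus "(%k. SUM b:B k. (snd b/quasi_dist Ga 0 (fst b)) powr p) summable_on UNIV"
   by (rule norm_summable_imp_summable_on)
 qed auto
 hence "(%a. (?f \<circ> e) (to_nat_on ?A a)) summable_on ?A" using e by (simp cong: summable_on_cong)
 hence "((?f \<circ> e) \<circ> to_nat_on ?A) summable_on ?A" by (simp add: comp_def)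
 hence "(?f \<circ> e) summable_on J" unfolding J_def using summable_on_reindex[OF inj] by blast
 hence s: "(%n. (snd (snd (e n))/quasi_dist Ga 0 (fst (snd (e n)))) powr p) summable_on J"
  by (simp add: comp_def case_prod_beta)
 show ?thesis unfolding p_bounded_def
 proof (intro exI conjI)
  show "ALL n:J. snd (snd (e n)) > 0 & fst (snd (e n)) ~= 0"
  proof
   fix n assume "n : J"
   thus "snd (snd (e n)) > 0 & fst (snd (e n)) ~= 0" using eJ[of n] B(2)[of "snd (e n)" "fst (e n)"] by auto
  qed
  show "F <= (UN n:J. Gamma_ball Ga (fst (snd (e n))) (snd (snd (e n))))"
  proof
   fix x assume "x : F"
   then obtain k b where kb: "b : B k" "x : Gamma_ball Ga (fst b) (snd b)" using cov by blast
   hence a: "(k, b) : ?A" by simp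
   hence "to_nat_on ?A (k, b) : J" unfolding J_def by (rule imageI)
   thus "x : (UN n:J. Gamma_ball Ga (fst (snd (e n))) (snd (snd (e n))))"
    by (rule UN_I) (use kb e[OF a] in simp)
  qed
 qed (rule s)
qed

text \<open>The window is open and its ends differ by the factor \<open>2^3\<close>.\<close>

lemma card_dyadic_window:
 fixes a :: real
 assumes a: "a > 0" and J: "finite J"
 shows "card {k:J. 1/4 < 2 ^ k*a & 2 ^ k*a < 2} <= 3"
proof (cases "{k:J. 1/4 < 2 ^ k*a & 2 ^ k*a < 2} = {}")
 case False
 let ?S = "{k:J. 1/4 < 2 ^ k*a & 2 ^ k*a < 2}"
 have fS: "finite ?S" using J by simp
 define k0 where "k0 = Min ?S"
 have k0: "k0 : ?S" unfolding k0_def by (rule Min_in[OF fS False])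
 have "?S <= {k0..<k0+3}"
 proof
  fix k assume k: "k : ?S"
  have le: "k0 <= k" unfolding k0_def by (rule Min_le[OF fS k])
  have "k < k0+3"
  proof (rule ccontr)
   assume "~ ?thesis"
   hence "(2::real)^(k0+3) <= 2 ^ k" by (intro power_increasing) auto
   hence "2^(k0+3)*a <= 2 ^ k*a" using a by simp
   thus False using k k0 by (simp add: power_add)
  qed
  thus "k : {k0..<k0+3}" using le by simp
 qed
 hence "card ?S <= card {k0..<k0+3}" by (intro card_mono) auto
 thus ?thesis by simp
qed (simp only: card.empty)

context fund begin

text \<open>The dilation by \<open>lam k\<close> divides \<open>Ga\<close> by exactly
  \<open>2 ^ k\<close>.\<close>

definition lam :: "nat => real" where "lam k = root (Q - 2) (2 ^ k)"

abbreviation up :: "nat => real^'n => real^'n" where "up k \<equiv> dilation sg (lam k)"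
abbreviation down :: "nat => real^'n => real^'n" where "down k \<equiv> dilation sg (1/lam k)"

lemma lam_pos: "lam k > 0" using Q3 by (simp add: lam_def)

lemma lam_power: "lam k^(Q - 2) = 2 ^ k" unfolding lam_def using Q3 by (intro real_root_pow_pos2) auto

lemma up_down [simp]: "up k (down k x) = x" "down k (up k x) = x"
 using lam_pos[of k] by (simp_all add: dilation_dilation)

lemma up_eq_iff [simp]: "up k x = up k y \<longleftrightarrow> x = y"
 using arg_cong[of "up k x" "up k y" "down k", unfolded up_down] by auto

lemma down_eq_0_iff [simp]: "down k x = 0 \<longleftrightarrow> x = 0"
 using arg_cong[of "down k x" 0 "up k", unfolded up_down] by auto

lemma G_up: "x ~= y ==> 2 ^ k*Ga (up k x) (up k y) = Ga x y"
 using G_hom[OF _ lam_pos[of k], of x y] by (simp add: lam_power)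

lemma G_down: "up k y ~= x ==> Ga y (down k x) = 2 ^ k*Ga (up k y) x"
 using G_up[of y "down k x" k] by (cases "y = down k x") simp_all

lemma lam_tendsto: "(%k. 1/lam k) \<longlonglongrightarrow> 0"
proof -
 have "(%k. root (Q - 2) ((1/2) ^ k)) \<longlonglongrightarrow> root (Q - 2) 0"
  by (intro tendsto_real_root LIMSEQ_power_zero) simp
 moreover have "root (Q - 2) (1/2 ^ k) = 1/root (Q - 2) (2 ^ k)" for k using Q3 by (subst real_root_divide) simp
 ultimately show ?thesis by (simp add: lam_def power_divide)
qed

lemma harmonic_potential:
 assumes D: "open D" and P: "!!a. a : A ==> P a ~: D" and A: "finite A"
 shows "harmonic_on L D (%x. s+(SUM a:A. c a*Ga (P a) x))"
 using A P
proof (induction A)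
 case (insert a A)
 have "harmonic_on L D (%x. 0+1*(s+(SUM a:A. c a*Ga (P a) x)) + c a*Ga (P a) x)"
  by (rule harmonic_combination[OF D insert.IH harmonic_G]) (use insert.prems in auto)
 thus ?case using insert.hyps by (simp add: algebra_simps)
qed (simp add: harmonic_const)

text \<open>Provides the thresholds: \<open>v\<close> is small in a neighbourhood of a compact piece
  of the complement, and very large values of the kernels with pole in that piece occur only
  there.\<close>

lemma G_concentration:
 assumes K: "compact K" "K <= K0" and U: "open U" "K <= U"
 obtains B where "!!y x. y : K ==> x ~= y ==> Ga y x > B ==> x : U"
proof -
 obtain R1 C where C: "C > 0" "R1 > 0" "!!y. y : K0 ==> norm y < R1" "!!y x. y : K0 ==> norm x >= R1 ==> Ga y x <= C*Ga 0 x"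
  by (rule G_far_upper) (rule that)
 have "\<forall>\<^sub>F z in at_infinity. Ga 0 z < 1" by (rule order_tendstoD(2)[OF G_0]) simp
 then obtain R2 where R2: "!!z. norm z >= R2 ==> Ga 0 z < 1" unfolding eventually_at_infinity by auto
 let ?Z = "cball 0 (max R1 R2) - U"
 have "compact (K \<times> ?Z)" by (intro compact_Times compact_diff K U) auto
 moreover have "K \<times> ?Z <= {(x, y). x ~= y}" using U by blast
 ultimately have "EX B>0. ALL w:K \<times> ?Z. abs (case w of (x, y) => Ga x y) <= B" by (rule G_bound_off_diag[OF _ _ G_cont2])
 then obtain B where B: "B > 0" "ALL w:K \<times> ?Z. abs (case w of (x, y) => Ga x y) <= B" by (elim exE conjE)
 show thesis
 proof (rule that[of "max B C"])
  fix y x assume y: "y : K" and G: "Ga y x > max B C"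
  show "x : U"
  proof (rule ccontr)
   assume xU: "x ~: U"
   show False
   proof (cases "norm x <= max R1 R2")
    case True
    thus False using bspec[OF B(2), of "(y, x)"] y xU G by auto
   next
    case False
    hence "Ga y x <= C*Ga 0 x" using C(4)[of y x] y K(2) by auto
    also have "... <= C*1" by (rule mult_left_mono[OF less_imp_le[OF R2]]) (use False C(1) in auto)
    finally show False using G by simp
   qed
  qed
 qed
qed

definition slice :: "(real^'n) set => nat => (real^'n) set" where
 "slice F k = {w:K0. up k w : F}"

lemma compact_slice:
 assumes "closed F" shows "compact (slice F k)"
proof -
 have "continuous_on UNIV (up k)" unfolding dilation_def by (intro continuous_intros)
 hence "closed (up k -` F)" using assms by (simp add: closed_vimage)
 hence "compact (K0 Int up k -` F)" by (rule compact_Int_closed[OF compact_K0])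
 thus ?thesis by (simp add: slice_def Int_def)
qed

lemma in_slice:
 assumes "x : F" "x ~= 0" "Ga 0 x <= 1"
 shows "EX k. EX w:slice F k. x = up k w"
proof -
 have g: "Ga 0 x > 0" using G_pos[of 0 x] assms(2) by simp
 obtain n where "1/Ga 0 x < 2^n" using real_arch_pow[of 2 "1/Ga 0 x"] by auto
 hence ex: "1 < 2^n*Ga 0 x" using g by (simp add: field_simps)
 define m' where "m' = (LEAST n. 1 < 2^n*Ga 0 x)"
 have m1: "1 < 2^m'*Ga 0 x" unfolding m'_def by (rule LeastI[of "%n. 1 < 2^n*Ga 0 x", OF ex])
 have "m' ~= 0" using m1 assms(3) by (cases m') auto
 then obtain k where k: "m' = Suc k" by (cases m') auto
 have "~ 1 < 2 ^ k*Ga 0 x" using not_less_Least[of k "%n. 1 < 2^n*Ga 0 x"] k unfolding m'_def[symmetric] by simp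
 moreover have "Ga 0 (down k x) = 2 ^ k*Ga 0 x" using G_down[of k 0 x] assms(2) by simp
 ultimately have "down k x : K0" using m1 k assms(2) by (simp add: K0_def)
 hence "down k x : slice F k" using assms(1) by (simp add: slice_def)
 thus ?thesis by (intro exI[of _ k] bexI[of _ "down k x"]) simp
qed

lemma down_tendsto: "(%k. down k x) \<longlonglongrightarrow> 0"
proof -
 have "filterlim (%k. 1/lam k) (at_right 0) sequentially"
  by (rule tendsto_imp_filterlim_at_right[OF lam_tendsto]) (use lam_pos in simp)
 thus ?thesis by (rule filterlim_compose[OF dilation_tendsto_0[where x=x, OF sig1]])
qed

text \<open>The factor \<open>2 ^ k\<close> cancels the scaling of \<open>Ga\<close>, so that away
  from the poles the \<open>k\<close>-th summand at \<open>x\<close> is the potential of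
  \<open>nu k\<close> on the reference annulus at \<open>down k x\<close>.\<close>

definition potential :: "(nat => (real^'n) set) => (nat => real^'n => real) => nat set => real^'n => real" where
 "potential Y nu J x = (SUM k:J. SUM y:Y k. nu k y*(2 ^ k*Ga (up k y) x))"

lemma slice_potential_le:
 assumes far: "far_bound C"
  and R: "ALL z. z ~= 0 --> Ga 0 z > 1/4 --> norm z <= R" and C: "C > 0"
  and Y: "Y <= K0" "ALL y:Y. 0 <= nu y" "sum nu Y = ka"
  and P: "ALL z. norm z <= R --> (ALL y:Y. z ~= y & Ga y z <= b) --> (SUM y:Y. nu y*Ga y z) <= 9"
  and x: "ALL y:Y. up k y ~= x & 2 ^ k*Ga (up k y) x <= b"
 shows "(SUM y:Y. nu y*(2 ^ k*Ga (up k y) x)) <= C * ka+(if x ~= 0 & 1/4 < 2 ^ k*Ga 0 x & 2 ^ k*Ga 0 x < 2 then 9 else 0)"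
proof -
 have eq: "2 ^ k*Ga (up k y) x = Ga y (down k x)" "y ~= down k x" if "y : Y" for y
  using bspec[OF x that] G_down[of k y x] by auto
 have ka: "ka >= 0" unfolding Y(3)[symmetric] by (rule sum_nonneg) (use Y(2) in blast)
 have G0: "Ga 0 (down k x) = 2 ^ k*Ga 0 x" if "x ~= 0" using G_down[of k 0 x] that by simp
 have s: "(SUM y:Y. nu y*(2 ^ k*Ga (up k y) x)) = (SUM y:Y. nu y*Ga y (down k x))" by (rule sum.cong) (simp_all add: eq)
 show ?thesis
 proof (cases "x ~= 0 & 1/4 < 2 ^ k*Ga 0 x & 2 ^ k*Ga 0 x < 2")
  case True
  hence "norm (down k x) <= R" using G0 R by simp
  moreover have "ALL y:Y. down k x ~= y & Ga y (down k x) <= b" using x eq by fastforce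
  ultimately have "(SUM y:Y. nu y*Ga y (down k x)) <= 9" using P by blast
  moreover have "C * ka >= 0" using C ka by simp
  ultimately show ?thesis using True unfolding s by simp
 next
  case False
  hence z: "down k x = 0 | Ga 0 (down k x) >= 2 | Ga 0 (down k x) <= 1/4" using G0 by (cases "x = 0") auto
  have "(SUM y:Y. nu y*Ga y (down k x)) <= (SUM y:Y. nu y*C)"
   using far_boundD[OF far _ z] Y(1,2) by (intro sum_mono mult_left_mono) auto
  also have "... = C * ka" unfolding sum_distrib_right[symmetric] Y(3) by simp
  finally show ?thesis using False unfolding s by simp
 qed
qed

text \<open>A point is near at most three annuli, each adding at most 9; beyond that every annulus
  contributes at most \<open>C\<close> times its mass. A total mass of at least 1 absorbs the
  27.\<close>

lemma potential_le:
 assumes far: "far_bound C"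
  and R: "ALL z. z ~= 0 --> Ga 0 z > 1/4 --> norm z <= R" and C: "C > 0" and J: "finite J"
  and Y: "!!k. Y k <= K0" "!!k. ALL y:Y k. 0 <= nu k y" "!!k. sum (nu k) (Y k) = ka k"
  and P: "!!k. ALL z. norm z <= R --> (ALL y:Y k. z ~= y & Ga y z <= b k) --> (SUM y:Y k. nu k y*Ga y z) <= 9"
  and x: "ALL k:J. ALL y:Y k. up k y ~= x & 2 ^ k*Ga (up k y) x <= b k" and T: "sum ka J >= 1"
 shows "potential Y nu J x <= (27+C) * sum ka J"
proof -
 let ?S = "{k:J. x ~= 0 & 1/4 < 2 ^ k*Ga 0 x & 2 ^ k*Ga 0 x < 2}"
 have "card ?S <= 3"
 proof (cases "x = 0")
  case False
  thus ?thesis using card_dyadic_window[OF G_pos[of 0 x] J] by simp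
 qed simp
 hence c: "9*real (card ?S) <= 27" by simp
 have "potential Y nu J x <= (SUM k:J. C * ka k+(if x ~= 0 & 1/4 < 2 ^ k*Ga 0 x & 2 ^ k*Ga 0 x < 2 then 9 else 0))"
  unfolding potential_def
 proof (rule sum_mono)
  fix k assume k: "k : J"
  show "(SUM y:Y k. nu k y*(2 ^ k*Ga (up k y) x)) <= C * ka k+(if x ~= 0 & 1/4 < 2 ^ k*Ga 0 x & 2 ^ k*Ga 0 x < 2 then 9 else 0)"
   by (rule slice_potential_le[OF far R C Y P bspec[OF x k]])
 qed
 also have "... = C * sum ka J+9*real (card ?S)" using J by (simp add: sum.distrib sum_distrib_left sum.If_cases Int_def)
 also have "... <= C * sum ka J+27 * sum ka J" using c T by simp
 finally show ?thesis by (simp add: algebra_simps)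
qed

text \<open>Seen from a sufficiently distant annulus, \<open>x\<close> is almost at the origin,
  where kernels with pole in \<open>K0\<close> are at least 1/2; half of that remains at
  \<open>x\<close>.\<close>

lemma potential_ge:
 assumes rho: "ALL w x. w : K0 --> norm x < rho --> x ~= w & Ga w x >= 1/2*Ga w 0"
  and Y: "!!k. Y k <= K0" "!!k. ALL y:Y k. 0 <= nu k y" "!!k. sum (nu k) (Y k) = ka k"
  and x: "ALL k:J. norm (down k x) < rho"
 shows "potential Y nu J x >= sum ka J/4"
proof -
 have "sum ka J/4 = (SUM k:J. SUM y:Y k. nu k y*(1/4))" by (simp add: Y(3)[symmetric] sum_divide_distrib)
 also have "... <= potential Y nu J x" unfolding potential_def
 proof (intro sum_mono mult_left_mono)
  fix k y assume k: "k : J" and y: "y : Y k"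
  hence yK: "y : K0" using Y by blast
  have g: "down k x ~= y" "Ga y (down k x) >= 1/2*Ga y 0" using rho yK bspec[OF x k] by auto
  have "Ga y 0 >= 1/2" using yK G_sym[of y 0] by (auto simp: K0_def)
  moreover have "up k y ~= x" using g(1) by auto
  ultimately show "1/4 <= 2 ^ k*Ga (up k y) x" using g(2) G_down[of k y x] by linarith
 qed (use Y(2) in auto)
 finally show ?thesis .
qed

text \<open>The comparison takes place on the set \<open>D\<close> below all thresholds. Near the
  inner edge, that is above half of a threshold, \<open>v\<close> is at most \<open>ep*S\<close>
  while the potential is at most \<open>M\<close>; near infinity the comparison function exceeds
  \<open>S\<close>.\<close>

lemma potential_comparison:
 assumes v: "subharmonic_on L UNIV (%x. ereal (v x))" "!!x. v x <= S" and S: "S > 0" and ep: "ep > 0"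
  and J: "finite J" and Y: "!!k. finite (Y k)" and M: "M > 0"
  and b: "!!k. b k > 0"
  and N: "!!x. ALL k:J. ALL y:Y k. up k y ~= x & 2 ^ k*Ga (up k y) x < b k ==> potential Y nu J x <= M"
  and near: "!!k y x. k : J ==> y : Y k ==> up k y ~= x ==> 2 ^ k*Ga (up k y) x > b k/2 ==> v x <= ep*S"
  and x0: "ALL k:J. ALL y:Y k. up k y ~= x0 & 2 ^ k*Ga (up k y) x0 < b k"
 shows "v x0 <= S*(1+ep - potential Y nu J x0/M)"
proof -
 define D where "D = (INT k:J. INT y:Y k. {x. x ~= up k y & Ga (up k y) x < b k/2 ^ k})"
 have D: "x : D \<longleftrightarrow> (ALL k:J. ALL y:Y k. up k y ~= x & 2 ^ k*Ga (up k y) x < b k)" for x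
  by (auto simp: D_def field_simps)
 have oD: "open D" unfolding D_def using J Y by (intro open_INT ballI open_G_less) auto
 define c where "c = (%(k, y). - (S/M)*(nu k y*2 ^ k))"
 let ?P = "%(k, y). up k y"
 define g where "g x = S*(1+ep)+(SUM a:Sigma J Y. c a*Ga (?P a) x)" for x
 have geq: "g x = S*(1+ep - potential Y nu J x/M)" for x
 proof -
  have "(SUM a:Sigma J Y. c a*Ga (?P a) x) = (SUM k:J. SUM y:Y k. c (k, y)*Ga (up k y) x)"
   using J Y by (subst sum.Sigma) (auto simp: case_prod_beta)
  also have "... = - (S/M) * potential Y nu J x" by (simp add: potential_def c_def sum_distrib_left mult_ac sum_negf)
  finally show ?thesis unfolding g_def by (simp add: algebra_simps)
 qed
 have hg: "harmonic_on L D g" unfolding g_def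
  by (rule harmonic_potential[OF oD]) (use J Y(1) in "auto simp: D")
 have lim: "(g \<longlongrightarrow> S*(1+ep)+(SUM a:Sigma J Y. c a*0)) at_infinity" unfolding g_def by (intro tendsto_intros G_0)
 have "ereal (v x0) <= ereal (g x0)"
 proof (rule comparison[OF v(1) oD subset_UNIV hg])
  show "x0 : D" using x0 unfolding D .
  fix e :: real assume "e > 0"
  have "\<forall>\<^sub>F x in at_infinity. g x > S" by (rule order_tendstoD(1)[OF lim]) (use S ep in simp)
  then obtain B where B: "!!x. norm x >= B ==> g x > S" unfolding eventually_at_infinity by auto
  define K where "K = cball 0 B Int (INT k:J. INT y:Y k. {x. x ~= up k y & Ga (up k y) x <= b k/2/2 ^ k})"
  have "compact K" unfolding K_def by (intro compact_Int_closed compact_cball closed_INT ballI closed_G_le)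
  moreover have "K <= D"
  proof
   fix x assume x: "x : K"
   have "Ga (up k y) x < b k/2 ^ k" if "k : J" "y : Y k" for k y
   proof -
    have "Ga (up k y) x <= b k/2/2 ^ k" using x that unfolding K_def by blast
    also have "... < b k/2 ^ k" using b[of k] by (simp add: field_simps)
    finally show ?thesis .
   qed
   thus "x : D" using x unfolding K_def D_def by blast
  qed
  moreover have "ereal (v x) <= ereal (g x+e)" if x: "x : D - K" for x
  proof -
   have "v x <= g x"
   proof (cases "norm x <= B")
    case True
    then obtain k y where ky: "k : J" "y : Y k" "~ (x ~= up k y & Ga (up k y) x <= b k/2/2 ^ k)" using x unfolding K_def by auto
    have ne: "up k y ~= x" using x ky unfolding D_def by blast
    hence "2 ^ k*Ga (up k y) x > b k/2" using ky(3) by (auto simp: field_simps)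
    hence v1: "v x <= ep*S" by (rule near[OF ky(1,2) ne])
    have "potential Y nu J x <= M" by (rule N) (use x D in blast)
    hence "potential Y nu J x/M <= 1" using M by simp
    hence "S*(1+ep - potential Y nu J x/M) >= S*ep" using S by (intro mult_left_mono) auto
    thus ?thesis using v1 by (simp add: geq mult.commute)
   next
    case False
    thus ?thesis using B[of x] v(2)[of x] by linarith
   qed
   thus ?thesis using \<open>e > 0\<close> by simp
  qed
  ultimately show "EX K. compact K & K <= D & (ALL x:D - K. ereal (v x) <= ereal (g x+e))" by blast
 qed
 thus ?thesis by (simp add: geq)
qed

text \<open>If the masses were not summable, for any \<open>x0\<close> there would be distant annuli
  of total mass at least 1. The upper and lower bounds for their potential differ by the fixed
  factor \<open>4*(27+C)\<close>, so \<open>v x0\<close> would stay below a fixed fraction of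
  \<open>S\<close>, against the choice of \<open>S\<close> as the supremum.\<close>

lemma kappa_summable:
 assumes O: "open Om" and v: "subharmonic_on L UNIV (%x. ereal (v x))" "!!x. x ~: Om ==> v x = 0" "!!x. v x <= S"
  and S: "S > 0" "!!c. c < S ==> EX x. v x > c" and ka: "!!k. ka k >= 0" and rs: "rs > 0"
  and R: "ALL z. z ~= 0 --> Ga 0 z > 1/4 --> norm z <= R"
  and meas: "!!k I::nat. EX Y nu. finite Y & Y <= slice (- Om) k & (ALL y:Y. 0 <= nu y) & sum nu Y = ka k &
   (ALL x. norm x <= R --> (ALL y:Y. x ~= y & Ga y x <= 2^I/rs) --> (SUM y:Y. nu y*Ga y x) <= 9)"
 shows "summable ka"
proof (rule ccontr)
 assume ns: "~ summable ka"
 obtain C where C: "C > 0" and far0: "!!y z. y : K0 ==> z = 0 | Ga 0 z >= 2 | Ga 0 z <= 1/4 ==> y ~= z & Ga y z <= C"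
  by (rule G_far_bound) (rule that)
 have far: "far_bound C" unfolding far_bound_def by (intro allI impI) (rule far0)
 have "0 ~: K0" by (simp add: K0_def)
 then obtain rho where rho: "rho > 0" "!!w x. w : K0 ==> norm x < rho ==> x ~= w & Ga w x >= 1/2*Ga w 0"
  by (rule G_unif_at_0[OF compact_K0]) (rule that)
 have rho': "ALL w x. w : K0 --> norm x < rho --> x ~= w & Ga w x >= 1/2*Ga w 0" by (intro allI impI) (rule rho(2))
 have usc: "open {x. v x < a}" for a using usc_open[OF v(1) open_UNIV, of "ereal a"] by simp
 have cu: "continuous_on UNIV (up k)" for k unfolding dilation_def by (intro continuous_intros)
 have main: "v x0 <= S*(1 - 1/(4*(27+C)))" for x0
 proof -
  have "\<forall>\<^sub>F k in sequentially. norm (down k x0) < rho" using tendstoD[OF down_tendsto[of x0] rho(1)] by simp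
  moreover have "\<forall>\<^sub>F k in sequentially. x0 = 0 | 2 ^ k*Ga 0 x0 >= 2"
  proof (cases "x0 = 0")
   case False
   hence g: "Ga 0 x0 > 0" using G_pos[of 0 x0] by simp
   obtain n where n: "2/Ga 0 x0 < 2^n" using real_arch_pow[of 2 "2/Ga 0 x0"] by auto
   have "2 ^ k*Ga 0 x0 >= 2" if "k >= n" for k
   proof -
    have "(2::real)^n <= 2 ^ k" using that by (intro power_increasing) auto
    hence "2/Ga 0 x0 <= 2 ^ k" using n by linarith
    thus ?thesis using g by (simp add: field_simps)
   qed
   thus ?thesis unfolding eventually_sequentially by blast
  qed simp
  ultimately have "\<forall>\<^sub>F k in sequentially. norm (down k x0) < rho & (x0 = 0 | 2 ^ k*Ga 0 x0 >= 2)" by (rule eventually_conj)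
  then obtain n0 where n0: "!!k. k >= n0 ==> norm (down k x0) < rho" "!!k. k >= n0 ==> x0 = 0 | 2 ^ k*Ga 0 x0 >= 2"
   unfolding eventually_sequentially by blast
  have "EX n1. sum ka {n0..<n1} >= 1"
  proof (rule ccontr)
   assume "~ ?thesis"
   hence lt: "sum ka {n0..<n} < 1" for n by (simp add: not_le)
   have "summable ka"
   proof (rule summableI_nonneg_bounded[OF ka])
    fix n
    have "sum ka {..<n} <= sum ka ({..<n0} Un {n0..<n})" by (rule sum_mono2) (use ka in auto)
    also have "... <= sum ka {..<n0} + sum ka {n0..<n}" by (subst sum.union_disjoint) auto
    finally show "sum ka {..<n} <= sum ka {..<n0}+1" using lt[of n] by linarith
   qed
   thus False using ns by blast
  qed
  then obtain n1 where n1: "sum ka {n0..<n1} >= 1" ..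
  let ?J = "{n0..<n1}"
  have *: "v x0 <= S*(1+ep - 1/(4*(27+C)))" if ep: "ep > 0" for ep
  proof -
   \<comment> \<open>The threshold depends on \<open>ep\<close> and on \<open>v\<close>; the
     measures are taken afterwards for this threshold, with the masses \<open>ka k\<close>
     unchanged.\<close>
   have "EX I::nat. C < 2^I/rs & (ALL y:slice (- Om) k. ALL z. z ~= y --> Ga y z > 2^I/rs/2 --> v (up k z) < ep*S)" for k
   proof -
    have o: "open (up k -` {x. v x < ep*S})" by (rule open_vimage[OF usc cu])
    have s: "slice (- Om) k <= up k -` {x. v x < ep*S}" using v(2) ep S(1) by (auto simp: slice_def)
    have c: "compact (slice (- Om) k)" using O by (intro compact_slice) (simp add: closed_def)
    have K: "slice (- Om) k <= K0" by (auto simp: slice_def)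
    obtain B where B: "!!y x. y : slice (- Om) k ==> x ~= y ==> Ga y x > B ==> x : up k -` {x. v x < ep*S}"
    by (rule G_concentration[OF c K o s]) (rule that)
    obtain I where I: "(max (2*B) C+1)*rs < 2^I" using real_arch_pow[of 2 "(max (2*B) C+1)*rs"] by auto
    define q where "q = 2^I/rs"
    have "max (2*B) C+1 < q" using I rs by (simp add: q_def field_simps)
    hence "C < q" "B < q/2" by linarith+
    hence "C < 2^I/rs" "B < 2^I/rs/2" unfolding q_def .
    thus ?thesis using B by (intro exI[of _ I]) auto
   qed
   note ex = this
   obtain I :: "nat => nat" where I0: "ALL k. C < 2^I k/rs & (ALL y:slice (- Om) k. ALL z. z ~= y --> Ga y z > 2^I k/rs/2 --> v (up k z) < ep*S)"
    using choice[OF allI[OF ex]] ..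
   have I: "C < 2^I k/rs" for k using I0 by blast
   have I2: "v (up k z) < ep*S" if "y : slice (- Om) k" "z ~= y" "Ga y z > 2^I k/rs/2" for k y z using I0 that by blast
   define b where "b k = 2^I k/rs" for k
   have m: "ALL k. EX Y nu. finite Y & Y <= slice (- Om) k & (ALL y:Y. 0 <= nu y) & sum nu Y = ka k &
    (ALL x. norm x <= R --> (ALL y:Y. x ~= y & Ga y x <= b k) --> (SUM y:Y. nu y*Ga y x) <= 9)" unfolding b_def by (intro allI meas)
   obtain Y where m: "ALL k. EX nu. finite (Y k) & (Y k) <= slice (- Om) k & (ALL y:(Y k). 0 <= nu y) & sum nu (Y k) = ka k &
    (ALL x. norm x <= R --> (ALL y:(Y k). x ~= y & Ga y x <= b k) --> (SUM y:(Y k). nu y*Ga y x) <= 9)" using choice[OF m] ..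
   obtain nu where m: "ALL k. finite (Y k) & (Y k) <= slice (- Om) k & (ALL y:(Y k). 0 <= nu k y) & sum (nu k) (Y k) = ka k &
    (ALL x. norm x <= R --> (ALL y:(Y k). x ~= y & Ga y x <= b k) --> (SUM y:(Y k). nu k y*Ga y x) <= 9)" using choice[OF m] ..
   have Y: "finite (Y k)" "Y k <= slice (- Om) k" "ALL y:Y k. 0 <= nu k y" "sum (nu k) (Y k) = ka k"
    "ALL z. norm z <= R --> (ALL y:Y k. z ~= y & Ga y z <= b k) --> (SUM y:Y k. nu k y*Ga y z) <= 9" for k
    using spec[OF m, of k] by - (elim conjE, assumption)+
   have YK: "Y k <= K0" for k using Y(2)[of k] by (auto simp: slice_def)
   have "v x0 <= S*(1+ep - potential Y nu ?J x0/((27+C) * sum ka ?J))"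
   proof (rule potential_comparison[where b=b, OF v(1,3) S(1) ep _ Y(1)])
    show "b k > 0" for k using rs by (simp add: b_def)
    show "(27+C) * sum ka ?J > 0" using C n1 by (intro mult_pos_pos) auto
    show "potential Y nu ?J x <= (27+C) * sum ka ?J" if "ALL k:?J. ALL y:Y k. up k y ~= x & 2 ^ k*Ga (up k y) x < b k" for x
    by (rule potential_le[where b=b, OF far R C _ YK Y(3) Y(4) Y(5) _ n1]) (use that in "auto simp: less_imp_le")
    show "v x <= ep*S" if "k : ?J" "y : Y k" "up k y ~= x" "2 ^ k*Ga (up k y) x > b k/2" for k y x
    proof -
    have "y : slice (- Om) k" using that(2) Y(2) by blast
    moreover have "down k x ~= y" using that(3) by auto
    moreover have "Ga y (down k x) > 2^I k/rs/2" using that(4) G_down[OF that(3)] by (simp add: b_def)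
    ultimately have "v (up k (down k x)) < ep*S" by (rule I2)
    thus ?thesis by simp
    qed
    show "ALL k:?J. ALL y:Y k. up k y ~= x0 & 2 ^ k*Ga (up k y) x0 < b k"
    proof (intro ballI)
    fix k y assume k: "k : ?J" and y: "y : Y k"
    have "x0 ~= 0 ==> Ga 0 (down k x0) = 2 ^ k*Ga 0 x0" using G_down[of k 0 x0] by simp
    hence "down k x0 = 0 | Ga 0 (down k x0) >= 2 | Ga 0 (down k x0) <= 1/4" using n0(2)[of k] k by auto
    hence f: "y ~= down k x0" "Ga y (down k x0) <= C" using far_boundD[OF far, of y "down k x0"] YK y by blast+
    hence "up k y ~= x0" by auto
    thus "up k y ~= x0 & 2 ^ k*Ga (up k y) x0 < b k" using f(2) I[of k] G_down[of k y x0] by (simp add: b_def)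
    qed
   qed simp
   also have "... <= S*(1+ep - 1/(4*(27+C)))"
   proof (intro mult_left_mono diff_left_mono)
    have "potential Y nu ?J x0 >= sum ka ?J/4" by (rule potential_ge[OF rho' YK Y(3) Y(4)]) (use n0(1) in auto)
    hence "(sum ka ?J/4)/((27+C) * sum ka ?J) <= potential Y nu ?J x0/((27+C) * sum ka ?J)"
    using C n1 by (intro divide_right_mono) auto
    moreover have "(sum ka ?J/4)/((27+C) * sum ka ?J) = 1/(4*(27+C))"
    using n1 C by (simp add: divide_simps)
    ultimately show "1/(4*(27+C)) <= potential Y nu ?J x0/((27+C) * sum ka ?J)" by simp
   qed (use S in simp)
   finally show ?thesis .
  qed
  show ?thesis
  proof (rule field_le_epsilon)
   fix e :: real assume "e > 0"
   hence "v x0 <= S*(1+e/S - 1/(4*(27+C)))" using S(1) by (intro *) simp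
   also have "... = S*(1 - 1/(4*(27+C)))+e" using S(1) by (simp add: algebra_simps)
   finally show "v x0 <= S*(1 - 1/(4*(27+C)))+e" .
  qed
 qed
 have "S*(1 - 1/(4*(27+C))) < S*1" using S(1) C by (intro mult_strict_left_mono) auto
 then obtain x where "v x > S*(1 - 1/(4*(27+C)))" using S(2) by force
 thus False using main[of x] by linarith
qed

text \<open>The relative radius \<open>rho / quasi_dist\<close> is invariant under dilations;
  \<open>2 powr p\<close> stems from the bound 2 for \<open>Ga 0\<close> at the centres.\<close>

lemma cover_up:
 assumes "cover p (slice F k) c" and p: "p > 1"
 shows "EX B. finite B & (ALL b:B. fst b ~= 0 & snd b > 0) & up k ` slice F k <= (UN b:B. Gamma_ball Ga (fst b) (snd b)) &
  (SUM b:B. (snd b/quasi_dist Ga 0 (fst b)) powr p) <= 2 powr p * c"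
proof -
 obtain B :: "(nat \<times> (real^'n)) set" and rho where B: "finite B" "ALL b:B. rho (fst b) > 0 & snd b ~= 0 & Ga 0 (snd b) <= 2"
  "slice F k <= (UN b:B. Gamma_ball Ga (snd b) (rho (fst b)))" "(SUM b:B. rho (fst b) powr p) <= c"
  using assms(1) unfolding cover_def by (elim exE conjE)
 let ?f = "%b. (up k (snd b), 2 ^ k*rho (fst b))"
 show ?thesis
 proof (intro exI conjI)
  show "finite (?f ` B)" using B(1) by simp
  have "up k x ~= 0" if "x ~= 0" for x using that up_eq_iff[of k x 0] by (simp del: up_eq_iff)
  thus "ALL b:?f ` B. fst b ~= 0 & snd b > 0" using B(2) by auto
  show "up k ` slice F k <= (UN b:?f ` B. Gamma_ball Ga (fst b) (snd b))"
  proof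
   fix x assume "x : up k ` slice F k"
   then obtain w where w: "w : slice F k" "x = up k w" by blast
   then obtain b where b: "b : B" "w : Gamma_ball Ga (snd b) (rho (fst b))" using B(3) by blast
   have r: "rho (fst b) > 0" using B(2) b(1) by blast
   have "x : Gamma_ball Ga (up k (snd b)) (2 ^ k*rho (fst b))"
    using b(2) r G_up[of "snd b" w k] by (cases "snd b = w") (auto simp: Gamma_ball_eq w(2) field_simps)
   thus "x : (UN b:?f ` B. Gamma_ball Ga (fst b) (snd b))" using b(1) by force
  qed
  have "(SUM b:?f ` B. (snd b/quasi_dist Ga 0 (fst b)) powr p) <= (SUM b:B. (snd (?f b)/quasi_dist Ga 0 (fst (?f b))) powr p)"
   using sum_image_le[OF B(1), of "%b. (snd b/quasi_dist Ga 0 (fst b)) powr p" ?f] by (simp add: comp_def)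
  also have "... <= (SUM b:B. 2 powr p*rho (fst b) powr p)"
  proof (rule sum_mono)
   fix b assume b: "b : B"
   hence r: "rho (fst b) > 0" "snd b ~= 0" "Ga 0 (snd b) <= 2" using B(2) by blast+
   have g: "Ga 0 (snd b) > 0" using G_pos[of 0 "snd b"] r(2) by simp
   have u: "2 ^ k*Ga 0 (up k (snd b)) = Ga 0 (snd b)" using G_up[of 0 "snd b" k] r(2) by simp
   have "up k (snd b) ~= 0" using r(2) up_eq_iff[of k "snd b" 0] by (simp del: up_eq_iff)
   hence "snd (?f b)/quasi_dist Ga 0 (fst (?f b)) = rho (fst b)*Ga 0 (snd b)" using u by (simp add: quasi_dist_def mult_ac)
   also have "... powr p <= (2*rho (fst b)) powr p" using r g p by (intro powr_mono2) (auto simp: mult.commute)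
   finally show "(snd (?f b)/quasi_dist Ga 0 (fst (?f b))) powr p <= 2 powr p*rho (fst b) powr p"
    using r(1) by (simp add: powr_mult)
  qed
  also have "... <= 2 powr p * c" using B(4) by (simp add: sum_distrib_left[symmetric] mult_left_mono)
  finally show "(SUM b:?f ` B. (snd b/quasi_dist Ga 0 (fst b)) powr p) <= 2 powr p * c" .
 qed
qed

lemma not_mps_imp_p_bounded:
 assumes O: "open Om" and n: "~ maximum_principle_set L Om" and p: "p > 1"
 shows "p_bounded Ga p (- Om)"
proof -
 obtain v S where v: "subharmonic_on L UNIV (%x. ereal (v x))" "!!x. x ~: Om ==> v x = 0"
  "!!x. 0 <= v x" "!!x. v x <= S" and S: "S > 0" "!!c. c < S ==> EX x. v x > c"
  by (rule not_mps[OF O n]) (rule that)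
 obtain R where R: "!!z. Ga 0 z >= 1/4 ==> norm z <= R" using bounded_G_ge[of "1/4" 0] by (auto simp: bounded_iff)
 have RK: "K0 <= cball 0 R" using R by (force simp: K0_def)
 obtain C rs where C: "C > 0" "rs > 0" and dich: "ALL E ka I. E <= K0 --> ka > 0 --> ~ cover p E (C * ka) -->
  (EX Y nu. finite Y & Y <= E & (ALL y:Y. 0 <= nu y) & sum nu Y = ka &
   (ALL x. norm x <= R --> (ALL y:Y. x ~= y & Ga y x <= 2^I/rs) --> (SUM y:Y. nu y*Ga y x) <= 9))"
  by (rule dichotomy[OF p RK]) (rule that)
 obtain c1 where c1: "c1 > 0" "!!E. E <= K0 ==> cover p E c1" by (rule cover_one_ball) (rule that)
 let ?E = "slice (- Om)"
 have EK: "?E k <= K0" for k by (auto simp: slice_def)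
 define c where "c k = Inf {d. cover p (?E k) d}" for k
 have ne: "{d. cover p (?E k) d} ~= {}" for k using c1(2)[OF EK[of k]] by blast
 have d0: "d >= 0" if "cover p (?E k) d" for k d
 proof -
  have "0 <= (SUM b:B. rho (fst b) powr p)" for B :: "(nat \<times> (real^'n)) set" and rho by (intro sum_nonneg) simp
  thus ?thesis using that unfolding cover_def by (meson order_trans)
 qed
 have bd: "bdd_below {d. cover p (?E k) d}" for k by (rule bdd_belowI[of _ 0]) (use d0 in blast)
 have c0: "c k >= 0" for k unfolding c_def by (rule cInf_greatest[OF ne]) (use d0 in blast)
 \<comment> \<open>Chosen so that \<open>C * ka k\<close> is half of the infimum of costs: if that
   is positive, no cover is so cheap, and \<open>dichotomy\<close> must return a measure.\<close>
 define ka where "ka k = c k/(2*C)" for k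
 have "summable ka"
 proof (rule kappa_summable[OF O v(1,2,4) S, where R=R and rs=rs])
  show "ka k >= 0" for k using c0 C by (simp add: ka_def)
  show "rs > 0" by (rule C(2))
  show "ALL z. z ~= 0 --> Ga 0 z > 1/4 --> norm z <= R" by (auto intro: R)
  fix k I :: nat
  show "EX Y nu. finite Y & Y <= slice (- Om) k & (ALL y:Y. 0 <= nu y) & sum nu Y = ka k &
   (ALL x. norm x <= R --> (ALL y:Y. x ~= y & Ga y x <= 2^I/rs) --> (SUM y:Y. nu y*Ga y x) <= 9)"
  proof (cases "c k = 0")
   case True
   thus ?thesis by (intro exI[of _ "{}"] exI[of _ "%_. 0"]) (simp add: ka_def)
  next
   case False
   hence ck: "c k > 0" using c0[of k] by simp
   hence "ka k > 0" using C by (simp add: ka_def)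
   moreover have "~ cover p (?E k) (C * ka k)"
   proof
    assume "cover p (?E k) (C * ka k)"
    hence "c k <= C * ka k" unfolding c_def by (intro cInf_lower bd) simp
    thus False using ck C by (simp add: ka_def)
   qed
   ultimately show ?thesis by (rule dich[rule_format, OF EK])
  qed
 qed
 hence "summable (%k. 2*C * ka k)" by (rule summable_mult)
 hence sc: "summable c" using C by (simp add: ka_def)
 \<comment> \<open>The infimum need not be attained; \<open>(1/2) ^ k\<close> is a summable excess,
   and \<open>2 powr p\<close> is the factor of \<open>cover_up\<close>.\<close>
 define d where "d k = 2 powr p*(c k+(1/2) ^ k)" for k
 have sd: "summable d" unfolding d_def by (intro summable_mult summable_add sc summable_geometric) simp
 have "EX B. finite B & (ALL b:B. fst b ~= 0 & snd b > 0) & up k ` ?E k <= (UN b:B. Gamma_ball Ga (fst b) (snd b)) &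
  (SUM b:B. (snd b/quasi_dist Ga 0 (fst b)) powr p) <= d k" for k
 proof -
  have "c k < c k+(1/2) ^ k" by simp
  then obtain e where e: "cover p (?E k) e" "e < c k+(1/2) ^ k" unfolding c_def using cInf_lessD[OF ne] by blast
  hence "cover p (?E k) (c k+(1/2) ^ k)" by (intro cover_mono[OF e(1)]) simp
  thus ?thesis unfolding d_def by (rule cover_up[OF _ p])
 qed
 note ex = this
 obtain B where B0: "ALL k. finite (B k) & (ALL b:B k. fst b ~= 0 & snd b > 0) & up k ` ?E k <= (UN b:B k. Gamma_ball Ga (fst b) (snd b)) &
  (SUM b:B k. (snd b/quasi_dist Ga 0 (fst b)) powr p) <= d k" using choice[OF allI[OF ex]] ..
 have B: "finite (B k)" "ALL b:B k. fst b ~= 0 & snd b > 0" "up k ` ?E k <= (UN b:B k. Gamma_ball Ga (fst b) (snd b))"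
  "(SUM b:B k. (snd b/quasi_dist Ga 0 (fst b)) powr p) <= d k" for k using spec[OF B0, of k] by - (elim conjE, assumption)+
 obtain x1 where x1: "x1 : K0" using K0_nonempty by blast
 obtain R1 where R1: "!!z. Ga 0 z >= 1 ==> norm z <= R1" using bounded_G_ge[of 1 0] by (auto simp: bounded_iff)
 obtain l where l: "l > 0" "!!y. norm y <= abs R1 ==> y ~= x1 ==> Ga x1 y >= l" by (rule G_lower_bound[of "abs R1" x1]) (rule that)
 \<comment> \<open>One more ball, at index 0, covers the origin and the points with
   \<open>Ga 0 x > 1\<close>, which no annulus reaches.\<close>
 define B' where "B' k = (case k of 0 => {(x1, 2/l)} | Suc k => B k)" for k
 define d' where "d' k = (case k of 0 => (2/l/quasi_dist Ga 0 x1) powr p | Suc k => d k)" for k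
 show ?thesis
 proof (rule p_bounded_UN[where B=B' and d=d'])
  show "finite (B' k)" for k using B(1) by (cases k) (auto simp: B'_def)
  show "fst b ~= 0 & snd b > 0" if "b : B' k" for k b using that bspec[OF B(2)] x1 l(1) by (cases k) (auto simp: B'_def K0_def)
  show "(SUM b:B' k. (snd b/quasi_dist Ga 0 (fst b)) powr p) <= d' k" for k using B(4) by (cases k) (auto simp: B'_def d'_def)
  have "summable (%k. d' (Suc k))" using sd by (simp add: d'_def)
  thus "summable d'" by (subst (asm) summable_Suc_iff)
  show "- Om <= (\<Union>k. UN b:B' k. Gamma_ball Ga (fst b) (snd b))"
  proof
   fix x assume x: "x : - Om"
   show "x : (\<Union>k. UN b:B' k. Gamma_ball Ga (fst b) (snd b))"
   proof (cases "x ~= 0 & Ga 0 x <= 1")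
    case True
    then obtain k w where "w : ?E k" "x = up k w" using in_slice[OF x] by blast
    hence "x : (UN b:B' (Suc k). Gamma_ball Ga (fst b) (snd b))" using B(3)[of k] by (auto simp: B'_def)
    thus ?thesis by blast
   next
    case False
    hence "norm x <= abs R1" using R1[of x] by (cases "x = 0") auto
    hence "x = x1 | Ga x1 x > l/2" using l by fastforce
    hence "x : Gamma_ball Ga x1 (2/l)" using l(1) by (simp add: Gamma_ball_eq)
    hence "x : (UN b:B' 0. Gamma_ball Ga (fst b) (snd b))" by (simp add: B'_def)
    thus ?thesis by blast
   qed
  qed
 qed
qed

end

theorem theorem5p8:
  fixes X :: "nat \<Rightarrow> real^'n::{finite,linorder} \<Rightarrow> real^'n::{finite,linorder}"
    and m :: nat
    and \<sigma> :: "'n \<Rightarrow> nat"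
    and \<Gamma> :: "real^'n::{finite,linorder} \<Rightarrow> real^'n::{finite,linorder} \<Rightarrow> real"
  assumes "CARD('n) \<ge> 3"
    and "\<And>j. j \<in> {1..m} \<Longrightarrow> smooth_on UNIV (X j)"
    and "vf_independent m X"
    and "dilation_exponents \<sigma>"
    and "\<And>j. j \<in> {1..m} \<Longrightarrow> vf_homogeneous_1 \<sigma> (X j)"
    and "hormander_condition m X"
    and "fundamental_solution \<sigma> (sum_of_squares m X) \<Gamma>"
  shows "(\<forall>\<Omega>. open \<Omega> \<longrightarrow> (maximum_principle_set (sum_of_squares m X) \<Omega> \<longleftrightarrow>
        large_at_infinity (sum_of_squares m X) (- \<Omega>)))
    \<and> (\<forall>\<Omega>. open \<Omega> \<longrightarrow> (\<exists>p>1. \<not> p_bounded \<Gamma> p (- \<Omega>)) \<longrightarrow>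
        maximum_principle_set (sum_of_squares m X) \<Omega>)
    \<and> (\<forall>\<Omega>. open \<Omega> \<longrightarrow> (\<exists>K. K \<subseteq> - \<Omega> \<and> Gamma_cone \<Gamma> K) \<longrightarrow>
        maximum_principle_set (sum_of_squares m X) \<Omega>)"
proof -
  have mono: "mono \<sigma>" and min1: "\<sigma> (Min UNIV) = 1" using assms(4) by (auto simp: dilation_exponents_def)
  have "\<sigma> (Min UNIV) \<le> \<sigma> i" for i by (rule monoD[OF mono]) simp
  then have ge1: "\<sigma> i \<ge> 1" for i using min1 by simp
  interpret fund X m \<sigma> "Min UNIV" \<Gamma>
    by unfold_locales (use assms ge1 min1 in auto)
  show ?thesis
  proof (intro conjI allI impI)
    show "maximum_principle_set (sum_of_squares m X) \<Omega> \<longleftrightarrow> large_at_infinity (sum_of_squares m X) (- \<Omega>)" if "open \<Omega>" for \<Omega>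
      by (rule mps_iff[OF that])
    show "maximum_principle_set (sum_of_squares m X) \<Omega>" if "open \<Omega>" "\<exists>p>1. \<not> p_bounded \<Gamma> p (- \<Omega>)" for \<Omega>
      using not_mps_imp_p_bounded[OF that(1)] that(2) by blast
    show "maximum_principle_set (sum_of_squares m X) \<Omega>" if "open \<Omega>" "\<exists>K. K \<subseteq> - \<Omega> \<and> Gamma_cone \<Gamma> K" for \<Omega>
      using cone_mps[OF that(1)] that(2) by blast
  qed
qed

end
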